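(* Let $K$ be an algebraically closed field, let $Q$ be one of the Dynkin quivers listed below, and let $\Lambda = KQ/J^2$ be the radical square zero algebra of $Q$ (where $J$ is the arrow ideal of the path algebra $KQ$). Let $\Gamma=\operatorname{End}_\Lambda(M)$ be the Auslander algebra of $\Lambda$, where $M$ is an additive generator of $\operatorname{mod}\Lambda$. Then: (1) if $Q$ is of type $A_m$ ($m\ge 1$), the number of (isomorphism classes of basic) tilting right $\Gamma$-modules is $2^{m-1}$; (2) if $Q$ is of type $D_m$ with $m\geq 4$, or of type $E_m$ with $m\in\{6,7,8\}$, the number of (isomorphism classes of basic) tilting right $\Gamma$-modules is $2^{m-3}\times 14$. The quivers are: $A_m$: $1\to 2\to\cdots\to m-1\to m$. $D_m$ ($m\ge4$): arrows $1\to 3$, $2\to 3$, $3\to 4\to 5\to\cdots\to m-1\to m$. $E_6$: arrows $1\to 2\to 4\to 5\to 6$ and $3\to 4$. $E_7$: arrows $1\to 2\to 4\to 5\to 6\to 7$ and $3\to 4$. $E_8$: arrows $1\to 2\to 4\to 5\to 6\to 7\to 8$ and $3\to 4$.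
   Context: All algebras are finite-dimensional basic algebras over $K$ and modules are finitely generated right modules. The radical square zero algebra $KQ/J^2$ of a Dynkin quiver is representation-finite, so its Auslander algebra $\Gamma=\operatorname{End}_\Lambda(M)$ (with $M$ an additive generator of $\operatorname{mod}\Lambda$, i.e. the direct sum of one copy of each indecomposable module) is defined; it is determined up to Morita equivalence. A (classical) tilting module $T$ over an algebra $A$ is a module with projective dimension at most $1$, $\operatorname{Ext}^i_A(T,T)=0$ for all $i\ge1$, and the number of pairwise non-isomorphic indecomposable direct summands of $T$ equal to that of $A$. Tilting modules are counted up to isomorphism, taking basic modules. *)

theory Defs
  imports "Jordan_Normal_Form.Matrix" "HOL-Computational_Algebra.Polynomial"
begin

text \<open>A module is a pair (n, rho): its underlying space is K^n (column vectors) and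
  rho g is the n x n matrix by which the generator / algebra element g acts.
  The set I of relevant indices is passed explicitly; a homomorphism X -> Y is a
  matrix H (dim Y x dim X) commuting with the actions of all g in I.\<close>

type_synonym ('i,'k) md = "nat \<times> ('i \<Rightarrow> 'k mat)"

definition hom :: "'i set \<Rightarrow> ('i,'k::field) md \<Rightarrow> ('i,'k) md \<Rightarrow> 'k mat \<Rightarrow> bool" where
  "hom I X Y H \<longleftrightarrow> H \<in> carrier_mat (fst Y) (fst X) \<and> (\<forall>g\<in>I. H * snd X g = snd Y g * H)"

definition iso :: "'i set \<Rightarrow> ('i,'k::field) md \<Rightarrow> ('i,'k) md \<Rightarrow> bool" where
  "iso I X Y \<longleftrightarrow> (\<exists>H G. hom I X Y H \<and> hom I Y X G \<and>
      G * H = 1\<^sub>m (fst X) \<and> H * G = 1\<^sub>m (fst Y))"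

definition dsum :: "('i,'k::field) md \<Rightarrow> ('i,'k) md \<Rightarrow> ('i,'k) md" where
  "dsum X Y = (fst X + fst Y, \<lambda>g. four_block_mat (snd X g) (0\<^sub>m (fst X) (fst Y))
                                      (0\<^sub>m (fst Y) (fst X)) (snd Y g))"

definition zmod :: "('i,'k::field) md" where
  "zmod = (0, \<lambda>g. 0\<^sub>m 0 0)"

primrec dpow :: "('i,'k::field) md \<Rightarrow> nat \<Rightarrow> ('i,'k) md" where
  "dpow X 0 = zmod"
| "dpow X (Suc k) = dsum X (dpow X k)"

definition summand :: "('i,'k::field) md set \<Rightarrow> 'i set \<Rightarrow> ('i,'k) md \<Rightarrow> ('i,'k) md \<Rightarrow> bool" where
  "summand mods I X Y \<longleftrightarrow> (\<exists>Z\<in>mods. iso I Y (dsum X Z))"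

definition indec :: "('i,'k::field) md set \<Rightarrow> 'i set \<Rightarrow> ('i,'k) md \<Rightarrow> bool" where
  "indec mods I X \<longleftrightarrow> X \<in> mods \<and> fst X > 0 \<and>
     \<not> (\<exists>Y\<in>mods. \<exists>Z\<in>mods. fst Y > 0 \<and> fst Z > 0 \<and> iso I X (dsum Y Z))"

definition basic :: "('i,'k::field) md set \<Rightarrow> 'i set \<Rightarrow> ('i,'k) md \<Rightarrow> bool" where
  "basic mods I X \<longleftrightarrow> \<not> (\<exists>Y Z. indec mods I Y \<and> Z \<in> mods \<and> iso I X (dsum Y (dsum Y Z)))"

definition isorel :: "('i,'k::field) md set \<Rightarrow> 'i set \<Rightarrow> (('i,'k) md \<times> ('i,'k) md) set" where
  "isorel mods I = {(X,Y). X \<in> mods \<and> Y \<in> mods \<and> iso I X Y}"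

definition nind :: "('i,'k::field) md set \<Rightarrow> 'i set \<Rightarrow> ('i,'k) md \<Rightarrow> nat" where
  "nind mods I X = card ({Y. indec mods I Y \<and> summand mods I Y X} // isorel mods I)"

definition surjm :: "nat \<Rightarrow> nat \<Rightarrow> 'k::field mat \<Rightarrow> bool" where
  "surjm nA nB f \<longleftrightarrow> (\<forall>v\<in>carrier_vec nB. \<exists>u\<in>carrier_vec nA. f *\<^sub>v u = v)"

definition injm :: "nat \<Rightarrow> nat \<Rightarrow> 'k::field mat \<Rightarrow> bool" where
  "injm nA nB f \<longleftrightarrow> (\<forall>u\<in>carrier_vec nA. f *\<^sub>v u = 0\<^sub>v nB \<longrightarrow> u = 0\<^sub>v nA)"

definition exact_at :: "nat \<Rightarrow> nat \<Rightarrow> nat \<Rightarrow> 'k::field mat \<Rightarrow> 'k mat \<Rightarrow> bool" where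
  "exact_at nA nB nC f g \<longleftrightarrow>
     (\<forall>v\<in>carrier_vec nB. g *\<^sub>v v = 0\<^sub>v nC \<longleftrightarrow> (\<exists>u\<in>carrier_vec nA. f *\<^sub>v u = v))"

definition projective :: "('i,'k::field) md set \<Rightarrow> 'i set \<Rightarrow> ('i,'k) md \<Rightarrow> bool" where
  "projective mods I P \<longleftrightarrow> P \<in> mods \<and>
     (\<forall>X\<in>mods. \<forall>Y\<in>mods. \<forall>g f. hom I X Y g \<and> surjm (fst X) (fst Y) g \<and> hom I P Y f
         \<longrightarrow> (\<exists>h. hom I P X h \<and> g * h = f))"

definition proj_res :: "('i,'k::field) md set \<Rightarrow> 'i set \<Rightarrow> ('i,'k) md \<Rightarrow>
    (nat \<Rightarrow> ('i,'k) md) \<Rightarrow> (nat \<Rightarrow> 'k mat) \<Rightarrow> 'k mat \<Rightarrow> bool" where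
  "proj_res mods I X P dd eps \<longleftrightarrow>
     (\<forall>k. projective mods I (P k)) \<and> hom I (P 0) X eps \<and> surjm (fst (P 0)) (fst X) eps \<and>
     (\<forall>k. hom I (P (Suc k)) (P k) (dd k)) \<and>
     exact_at (fst (P 1)) (fst (P 0)) (fst X) (dd 0) eps \<and>
     (\<forall>k. exact_at (fst (P (Suc (Suc k)))) (fst (P (Suc k))) (fst (P k)) (dd (Suc k)) (dd k))"

text \<open>Ext^i(X,Y) = 0 (for i \<ge> 1), computed as the i-th cohomology of Hom(P_*,Y)
  for a projective resolution P_* of X (independent of the resolution).\<close>
definition ext_vanish :: "('i,'k::field) md set \<Rightarrow> 'i set \<Rightarrow> nat \<Rightarrow> ('i,'k) md \<Rightarrow> ('i,'k) md \<Rightarrow> bool" where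
  "ext_vanish mods I i X Y \<longleftrightarrow> (\<exists>P dd eps. proj_res mods I X P dd eps \<and>
     (\<forall>\<phi>. hom I (P i) Y \<phi> \<and> \<phi> * dd i = 0\<^sub>m (fst Y) (fst (P (Suc i)))
          \<longrightarrow> (\<exists>\<psi>. hom I (P (i - 1)) Y \<psi> \<and> \<phi> = \<psi> * dd (i - 1))))"

definition pd_le1 :: "('i,'k::field) md set \<Rightarrow> 'i set \<Rightarrow> ('i,'k) md \<Rightarrow> bool" where
  "pd_le1 mods I T \<longleftrightarrow> (\<exists>P0 P1 f g. projective mods I P0 \<and> projective mods I P1 \<and>
     hom I P1 P0 f \<and> hom I P0 T g \<and> injm (fst P1) (fst P0) f \<and> surjm (fst P0) (fst T) g \<and>
     exact_at (fst P1) (fst P0) (fst T) f g)"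

text \<open>Right S-module on column vectors: v.a = rho a *v v, so rho (a*b) = rho b * rho a.\<close>
definition rmods :: "'k::field mat set \<Rightarrow> nat \<Rightarrow> ('k mat,'k) md set" where
  "rmods S d = {X. (\<forall>a\<in>S. snd X a \<in> carrier_mat (fst X) (fst X)) \<and>
      snd X (1\<^sub>m d) = 1\<^sub>m (fst X) \<and>
      (\<forall>a\<in>S. \<forall>b\<in>S. snd X (a + b) = snd X a + snd X b \<and> snd X (a * b) = snd X b * snd X a) \<and>
      (\<forall>c. \<forall>a\<in>S. snd X (c \<cdot>\<^sub>m a) = c \<cdot>\<^sub>m snd X a)}"

text \<open>F is isomorphic to the regular module S_S (via a \<mapsto> v.a)\<close>
definition regular :: "'k::field mat set \<Rightarrow> nat \<Rightarrow> ('k mat,'k) md \<Rightarrow> bool" where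
  "regular S d F \<longleftrightarrow> F \<in> rmods S d \<and>
     (\<exists>v\<in>carrier_vec (fst F). bij_betw (\<lambda>a. snd F a *\<^sub>v v) S (carrier_vec (fst F)))"

definition tilting :: "'k::field mat set \<Rightarrow> nat \<Rightarrow> ('k mat,'k) md \<Rightarrow> bool" where
  "tilting S d T \<longleftrightarrow> T \<in> rmods S d \<and> pd_le1 (rmods S d) S T \<and>
     (\<forall>i\<ge>1. ext_vanish (rmods S d) S i T T) \<and>
     (\<forall>F. regular S d F \<longrightarrow> nind (rmods S d) S T = nind (rmods S d) S F)"

definition num_tilting :: "'k::field mat set \<Rightarrow> nat \<Rightarrow> nat" where
  "num_tilting S d = card ({T. tilting S d T \<and> basic (rmods S d) S T} // isorel (rmods S d) S)"

text \<open>Quiver with vertices 1..m and arrow set Ar (pairs (i,j) for an arrow i -> j).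
  A right KQ/J^2-module is a representation of Q (ASS convention, mod KQ/I = rep(Q,I)):
  rho (Inl i) are the complete orthogonal idempotents e_i, rho (Inr (i,j)) the arrow
  action, mapping the e_i-part to the e_j-part, and all products of two arrows vanish.\<close>

definition gensL :: "nat \<Rightarrow> (nat \<times> nat) set \<Rightarrow> (nat + nat \<times> nat) set" where
  "gensL m Ar = Inl ` {1..m} \<union> Inr ` Ar"

definition lmods :: "nat \<Rightarrow> (nat \<times> nat) set \<Rightarrow> (nat + nat \<times> nat, 'k::field) md set" where
  "lmods m Ar = {X. let n = fst X; \<rho> = snd X in
      (\<forall>i\<in>{1..m}. \<rho> (Inl i) \<in> carrier_mat n n \<and>
          (\<forall>j\<in>{1..m}. \<rho> (Inl i) * \<rho> (Inl j) = (if i = j then \<rho> (Inl i) else 0\<^sub>m n n))) \<and>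
      foldr (+) (map (\<lambda>i. \<rho> (Inl i)) [1..<Suc m]) (0\<^sub>m n n) = 1\<^sub>m n \<and>
      (\<forall>(i,j)\<in>Ar. \<rho> (Inr (i,j)) \<in> carrier_mat n n \<and>
          \<rho> (Inr (i,j)) = \<rho> (Inl j) * \<rho> (Inr (i,j)) * \<rho> (Inl i)) \<and>
      (\<forall>a\<in>Ar. \<forall>b\<in>Ar. \<rho> (Inr b) * \<rho> (Inr a) = 0\<^sub>m n n)}"

definition add_gen :: "nat \<Rightarrow> (nat \<times> nat) set \<Rightarrow> (nat + nat \<times> nat, 'k::field) md \<Rightarrow> bool" where
  "add_gen m Ar M \<longleftrightarrow> M \<in> lmods m Ar \<and>
     (\<forall>X\<in>lmods m Ar. \<exists>k. summand (lmods m Ar) (gensL m Ar) X (dpow M k))"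

text \<open>End_Lambda(M) as a matrix algebra; product = matrix product = composition.\<close>
definition End_alg :: "nat \<Rightarrow> (nat \<times> nat) set \<Rightarrow> (nat + nat \<times> nat, 'k::field) md \<Rightarrow> 'k mat set" where
  "End_alg m Ar M = {F. hom (gensL m Ar) M M F}"

definition quiver_A :: "nat \<Rightarrow> (nat \<times> nat) set" where
  "quiver_A m = {(i, i + 1) | i. 1 \<le> i \<and> i < m}"

definition quiver_D :: "nat \<Rightarrow> (nat \<times> nat) set" where
  "quiver_D m = {(1,3), (2,3)} \<union> {(i, i + 1) | i. 3 \<le> i \<and> i < m}"

definition quiver_E :: "nat \<Rightarrow> (nat \<times> nat) set" where
  "quiver_E m = {(1,2), (2,4), (3,4)} \<union> {(i, i + 1) | i. 4 \<le> i \<and> i < m}"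

definition alg_closed :: "'k::field itself \<Rightarrow> bool" where
  "alg_closed TYPE('k) \<longleftrightarrow> (\<forall>p :: 'k poly. degree p \<ge> 1 \<longrightarrow> (\<exists>x. poly p x = 0))"

end

theory Submission
  imports Defs "Jordan_Normal_Form.Determinant" "HOL-Library.Function_Algebras"
begin

text \<open>The indecomposable \<open>\<Lambda>\<close>-modules are the simple modules, the modules of length two with simple top
  given by the arrows, and one module of length three for the vertex with two incoming arrows (if any). All
  homomorphism spaces between them are at most one-dimensional, so \<open>\<Gamma>\<close> has a multiplicative basis, and
  a set of labels closed in a suitable sense supports a \<open>thin\<close> \<open>\<Gamma>\<close>-module, whose homomorphisms can be
  computed coordinatewise. Projective dimension at most one forces some structure maps of a module to be
  injective, and this suffices to split off thin summands one by one. Hence the modules of projective dimension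
  at most one are the direct sums of an explicit finite list of thin modules, each with an explicit projective
  presentation, from which \<open>Ext\<^sup>1\<close> between them is read off. This list falls into blocks, one for every
  vertex of the quiver, without extensions between different blocks. A tilting module consists of a largest
  \<open>Ext\<close>-orthogonal set from each block, and there are \<open>1\<close>, \<open>2\<close> or \<open>14\<close> of these, according as the vertex has
  no, one or two incoming arrows.\<close>

section \<open>Linear maps between coordinate spaces\<close>

text \<open>A right \<Gamma>-module is a contravariant functor on the indecomposable
  \<Lambda>-modules, the projective ones being \<open>Hom(-, Y)\<close>. Left exactness of
  \<open>Hom(-, Y)\<close> on \<open>0 \<rightarrow> Sv v \<rightarrow> Pa u v \<rightarrow> Sv u
  \<rightarrow> 0\<close> and, for two arrows into \<open>v\<close>, on \<open>0 \<rightarrow> Sv v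
  \<rightarrow> Pa u v \<oplus> Pa u' v \<rightarrow> Dv v \<rightarrow> 0\<close> passes, by a
  diagram chase, to cokernels of injective maps between projectives: this is where the injectivity
  comes from. Splitting off a thin summand needs a compatible family of vectors and a dual family of
  functionals; the thin modules are tried in such an order that each failure removes an obstruction
  to the next. An additive generator may repeat summands, so \<Gamma> need not be basic; hence
  points (summands of \<open>M\<close>) are kept apart from labels (isomorphism classes). A block
  with one incoming arrow has 3 modules, one with two has 10; in both, one module is orthogonal to
  all others. The remaining 2 exclude each other; the remaining 9 behave like the diagonals of a
  hexagon, and 14 is the number of its triangulations.\<close>

definition lin :: "nat \<Rightarrow> nat \<Rightarrow> ('k::field vec \<Rightarrow> 'k vec) \<Rightarrow> bool" where
  "lin n m f \<longleftrightarrow> (\<forall>v\<in>carrier_vec n. f v \<in> carrier_vec m) \<and>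
     (\<forall>v\<in>carrier_vec n. \<forall>w\<in>carrier_vec n. f (v + w) = f v + f w) \<and>
     (\<forall>a. \<forall>v\<in>carrier_vec n. f (a \<cdot>\<^sub>v v) = a \<cdot>\<^sub>v f v)"

text \<open>Vectors of all lengths share one type, so the neutral element of a sum depends on the
  length; \<open>n\<close> fixes it, also for the empty sum.\<close>

definition vsum :: "nat \<Rightarrow> ('a \<Rightarrow> 'k::field vec) \<Rightarrow> 'a set \<Rightarrow> 'k vec" where
  "vsum n F A = vec n (\<lambda>i. \<Sum>a\<in>A. F a $ i)"

definition mof :: "nat \<Rightarrow> nat \<Rightarrow> ('k::field vec \<Rightarrow> 'k vec) \<Rightarrow> 'k mat" where
  "mof n m f = mat m n (\<lambda>(i,j). f (unit_vec n j) $ i)"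

definition linf :: "nat \<Rightarrow> ('k::field vec \<Rightarrow> 'k) \<Rightarrow> bool" where
  "linf n f \<longleftrightarrow> (\<forall>v\<in>carrier_vec n. \<forall>w\<in>carrier_vec n. f (v + w) = f v + f w) \<and>
     (\<forall>a. \<forall>v\<in>carrier_vec n. f (a \<cdot>\<^sub>v v) = a * f v)"

definition subsp :: "nat \<Rightarrow> 'k::field vec set \<Rightarrow> bool" where
  "subsp n W \<longleftrightarrow> W \<subseteq> carrier_vec n \<and> 0\<^sub>v n \<in> W \<and> (\<forall>v\<in>W. \<forall>w\<in>W. v + w \<in> W) \<and> (\<forall>a. \<forall>v\<in>W. a \<cdot>\<^sub>v v \<in> W)"

lemma lin_closed: "lin n m f \<Longrightarrow> v \<in> carrier_vec n \<Longrightarrow> f v \<in> carrier_vec m"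
  and lin_add: "lin n m f \<Longrightarrow> v \<in> carrier_vec n \<Longrightarrow> w \<in> carrier_vec n \<Longrightarrow> f (v + w) = f v + f w"
  and lin_smult: "lin n m f \<Longrightarrow> v \<in> carrier_vec n \<Longrightarrow> f (a \<cdot>\<^sub>v v) = a \<cdot>\<^sub>v f v"
  by (auto simp: lin_def)

lemma linI: "(\<And>v. v \<in> carrier_vec n \<Longrightarrow> f v \<in> carrier_vec m) \<Longrightarrow>
   (\<And>v w. v \<in> carrier_vec n \<Longrightarrow> w \<in> carrier_vec n \<Longrightarrow> f (v + w) = f v + f w) \<Longrightarrow>
   (\<And>a v. v \<in> carrier_vec n \<Longrightarrow> f (a \<cdot>\<^sub>v v) = a \<cdot>\<^sub>v f v) \<Longrightarrow> lin n m f"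
  by (auto simp: lin_def)

lemma zero_smult_vec: "v \<in> carrier_vec n \<Longrightarrow> (0::'k::field) \<cdot>\<^sub>v v = 0\<^sub>v n"
  by (intro eq_vecI) auto

lemma smult_zero_vec [simp]: "a \<cdot>\<^sub>v 0\<^sub>v n = (0\<^sub>v n :: 'k::field vec)"
  by (intro eq_vecI) auto

lemma vec_diff_zero: "v \<in> carrier_vec n \<Longrightarrow> w \<in> carrier_vec n \<Longrightarrow> v - w = 0\<^sub>v n \<Longrightarrow> v = (w :: 'k::field vec)"
proof (intro eq_vecI)
  fix i assume h: "v \<in> carrier_vec n" "w \<in> carrier_vec n" "v - w = 0\<^sub>v n" "i < dim_vec w"
  have "v $ i - w $ i = (v - w) $ i" using h(1,2,4) by simp
  also have "\<dots> = 0" using h(2,4) by (simp only: h(3)) simp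
  finally show "v $ i = w $ i" by simp
qed auto

lemma vec_nonzero_coord:
  assumes "v \<in> carrier_vec n" "v \<noteq> 0\<^sub>v n" obtains i where "i < n" "v $ i \<noteq> (0::'k::field)"
proof -
  have "\<exists>i<n. v $ i \<noteq> 0"
  proof (rule ccontr)
    assume "\<not> ?thesis"
    then have "v = 0\<^sub>v n" using assms(1) by (intro eq_vecI) auto
    then show False using assms by simp
  qed
  then show ?thesis using that by blast
qed

lemma diff_as_add: "v \<in> carrier_vec n \<Longrightarrow> w \<in> carrier_vec n \<Longrightarrow> v - w = v + (-1) \<cdot>\<^sub>v (w :: 'k::field vec)"
  by (intro eq_vecI) auto

lemma lin_zero: "lin n m f \<Longrightarrow> f (0\<^sub>v n) = 0\<^sub>v m"
  using lin_smult[of n m f "0\<^sub>v n" 0] lin_closed[of n m f "0\<^sub>v n"] by (simp add: zero_smult_vec[of _ n] zero_smult_vec[of _ m])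

lemma lin_minus: "lin n m f \<Longrightarrow> v \<in> carrier_vec n \<Longrightarrow> w \<in> carrier_vec n \<Longrightarrow> f (v - w) = f v - f w"
  by (simp add: diff_as_add[of _ n] diff_as_add[of _ m] lin_closed lin_add lin_smult)

lemma lin_cong: "lin n m f \<Longrightarrow> (\<And>v. v \<in> carrier_vec n \<Longrightarrow> f v = g v) \<Longrightarrow> lin n m g"
  unfolding lin_def by auto

lemma lin_comp: "lin n m f \<Longrightarrow> lin m p g \<Longrightarrow> lin n p (\<lambda>v. g (f v))"
  by (intro linI) (simp_all add: lin_closed lin_add lin_smult)

lemma lin_mat: "A \<in> carrier_mat m n \<Longrightarrow> lin n m (\<lambda>v. A *\<^sub>v v)"
  by (intro linI) (auto simp: mult_add_distrib_mat_vec mult_mat_vec)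

lemma lin_id: "lin n n (\<lambda>v. v)" by (intro linI) auto

lemma lin_const0: "lin n m (\<lambda>v. 0\<^sub>v m)" by (intro linI) (auto)

lemma lin_plus:
  fixes f g :: "'k::field vec \<Rightarrow> 'k vec"
  assumes f: "lin n m f" and g: "lin n m g" shows "lin n m (\<lambda>v. f v + g v)"
proof (intro linI)
  fix v w :: "'k vec" assume h: "v \<in> carrier_vec n" "w \<in> carrier_vec n"
  show "f (v + w) + g (v + w) = f v + g v + (f w + g w)"
    using lin_closed[OF f h(1)] lin_closed[OF f h(2)] lin_closed[OF g h(1)] lin_closed[OF g h(2)]
    by (intro eq_vecI) (auto simp: lin_add[OF f h] lin_add[OF g h])
next
  fix a and v :: "'k vec" assume h: "v \<in> carrier_vec n"
  show "f (a \<cdot>\<^sub>v v) + g (a \<cdot>\<^sub>v v) = a \<cdot>\<^sub>v (f v + g v)"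
    using lin_closed[OF f h] lin_closed[OF g h]
    by (simp add: lin_smult[OF f h] lin_smult[OF g h] smult_add_distrib_vec)
qed (use f g in \<open>auto simp: lin_closed\<close>)

lemma lin_scale: "lin n m f \<Longrightarrow> lin n m (\<lambda>v. (a::'k::field) \<cdot>\<^sub>v f v)"
  by (intro linI)
     (auto simp: lin_closed lin_add lin_smult smult_add_distrib_vec[of _ m] smult_smult_assoc mult.commute)

lemma lin_diff: "lin n m f \<Longrightarrow> lin n m g \<Longrightarrow> lin n m (\<lambda>v. f v - g v)"
  by (rule lin_cong[OF lin_plus[OF _ lin_scale[of _ _ _ "-1"]]]) (auto simp: diff_as_add[of _ m] lin_closed)

lemma vsum_carrier [simp]: "vsum n F A \<in> carrier_vec n" by (simp add: vsum_def)

lemma vsum_index [simp]: "i < n \<Longrightarrow> vsum n F A $ i = (\<Sum>a\<in>A. F a $ i)" by (simp add: vsum_def)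

lemma vsum_empty [simp]: "vsum n F {} = 0\<^sub>v n" by (intro eq_vecI) (auto simp: vsum_def)

lemma vsum_insert: "finite A \<Longrightarrow> a \<notin> A \<Longrightarrow> F a \<in> carrier_vec n \<Longrightarrow> vsum n F (insert a A) = F a + vsum n F A"
  by (intro eq_vecI) (auto simp: vsum_def)

lemma vsum_cong: "(\<And>a. a \<in> A \<Longrightarrow> F a = G a) \<Longrightarrow> vsum n F A = vsum n G A"
  by (simp add: vsum_def)

lemma lin_vsum:
  assumes "lin n m f" "finite A" "\<And>a. a \<in> A \<Longrightarrow> F a \<in> carrier_vec n"
  shows "f (vsum n F A) = vsum m (\<lambda>a. f (F a)) A"
  using assms(2,3)
proof (induction A)
  case empty then show ?case using lin_zero[OF assms(1)] by simp
next
  case (insert a A)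
  then show ?case using assms(1) by (simp add: vsum_insert lin_add lin_closed)
qed

lemma vsum_single:
  assumes "finite A" "a \<in> A" "F a \<in> carrier_vec n" "\<And>b. b \<in> A \<Longrightarrow> b \<noteq> a \<Longrightarrow> F b = 0\<^sub>v n"
  shows "vsum n F A = F a"
proof (intro eq_vecI)
  fix i assume "i < dim_vec (F a)"
  then have i: "i < n" using assms(3) by simp
  have "(\<Sum>b\<in>A. F b $ i) = (\<Sum>b\<in>A. if b = a then F a $ i else 0)"
    using assms(4) i by (intro sum.cong) auto
  then show "vsum n F A $ i = F a $ i" using i assms(1,2) by simp
qed (use assms in auto)

lemma unit_expand: "v \<in> carrier_vec n \<Longrightarrow> vsum n (\<lambda>j. v $ j \<cdot>\<^sub>v unit_vec n j) {..<n} = v"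
proof (intro eq_vecI)
  fix i assume v: "v \<in> carrier_vec n" and "i < dim_vec v"
  then have i: "i < n" by simp
  have "(\<Sum>j<n. (v $ j \<cdot>\<^sub>v unit_vec n j) $ i) = (\<Sum>j<n. if j = i then v $ i else 0)"
    using i by (intro sum.cong) auto
  then show "vsum n (\<lambda>j. v $ j \<cdot>\<^sub>v unit_vec n j) {..<n} $ i = v $ i" using i by simp
qed (auto simp: vsum_def)

lemma mof_carrier [simp]: "mof n m f \<in> carrier_mat m n" by (simp add: mof_def)

lemma mof_mult:
  assumes "lin n m f" "v \<in> carrier_vec n"
  shows "mof n m f *\<^sub>v v = f v"
proof -
  have "f v = f (vsum n (\<lambda>j. v $ j \<cdot>\<^sub>v unit_vec n j) {..<n})" using assms by (simp add: unit_expand)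
  also have "\<dots> = vsum m (\<lambda>j. v $ j \<cdot>\<^sub>v f (unit_vec n j)) {..<n}"
    using assms(1) by (subst lin_vsum) (auto simp: lin_smult)
  finally have fv: "f v = vsum m (\<lambda>j. v $ j \<cdot>\<^sub>v f (unit_vec n j)) {..<n}" .
  have c: "f (unit_vec n j) \<in> carrier_vec m" for j using assms(1) by (simp add: lin_closed)
  have d: "dim_vec (f (unit_vec n j)) = m" for j using c[of j] by auto
  show ?thesis unfolding fv
    by (intro eq_vecI)
       (use assms d in \<open>auto simp: mof_def scalar_prod_def vsum_def mult.commute intro!: sum.cong\<close>)
qed

lemma mat_eq_vecI:
  assumes "A \<in> carrier_mat m n" "B \<in> carrier_mat m n" "\<And>v. v \<in> carrier_vec n \<Longrightarrow> A *\<^sub>v v = B *\<^sub>v v"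
  shows "A = (B :: 'k::field mat)"
proof (intro eq_matI)
  fix i j assume ij: "i < dim_row B" "j < dim_col B"
  have "(A *\<^sub>v unit_vec n j) $ i = (B *\<^sub>v unit_vec n j) $ i" using assms(3) by simp
  then show "A $$ (i,j) = B $$ (i,j)" using ij assms(1,2) by simp
qed (use assms in auto)

section \<open>Linear functionals and subspaces\<close>

lemma linf_add: "linf n f \<Longrightarrow> v \<in> carrier_vec n \<Longrightarrow> w \<in> carrier_vec n \<Longrightarrow> f (v + w) = f v + f w"
  and linf_smult: "linf n f \<Longrightarrow> v \<in> carrier_vec n \<Longrightarrow> f (a \<cdot>\<^sub>v v) = a * f v"
  by (auto simp: linf_def)

lemma linf_zero: "linf n f \<Longrightarrow> f (0\<^sub>v n) = 0"
  using linf_smult[of n f "0\<^sub>v n" 0] by (simp add: zero_smult_vec[of _ n])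

lemma linf_comp: "linf m f \<Longrightarrow> lin n m g \<Longrightarrow> linf n (\<lambda>v. f (g v))"
  by (auto simp: linf_def lin_closed lin_add lin_smult)

lemma linf_index: "i < n \<Longrightarrow> linf n (\<lambda>v. v $ i)"
  by (auto simp: linf_def)

lemma linf_scale: "linf n f \<Longrightarrow> linf n (\<lambda>v. a * f v)"
  by (auto simp: linf_def algebra_simps)

lemma linf_separate0:
  assumes "t \<in> carrier_vec n" "t \<noteq> 0\<^sub>v n"
  shows "\<exists>\<phi>. linf n \<phi> \<and> \<phi> t = (1::'k::field)"
proof -
  obtain i where i: "i < n" "t $ i \<noteq> 0" using vec_nonzero_coord[OF assms] .
  then show ?thesis
    by (intro exI[of _ "\<lambda>v. inverse (t $ i) * v $ i"] conjI linf_scale linf_index) auto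
qed

lemma vector_space_fun: "vector_space (\<lambda>(a::'k::field) (f::nat \<Rightarrow> 'k) i. a * f i)"
  by unfold_locales (auto simp: algebra_simps fun_eq_iff plus_fun_def)

lemma vector_space_pair_fun: "vector_space_pair (\<lambda>(a::'k::field) (f::nat \<Rightarrow> 'k) i. a * f i) (*)"
  by (intro vector_space_pair.intro vector_space_fun) (unfold_locales, auto simp: algebra_simps)

text \<open>Coordinates embed \<open>carrier_vec n\<close> by \<open>E\<close> into the vector space
  of functions \<open>nat \<Rightarrow> 'k\<close>. There a basis of the image of \<open>W\<close>,
  enlarged by the image of \<open>t\<close>, is still independent, and a linear map can be
  prescribed on it.\<close>

lemma linf_separate:
  assumes W: "subsp n W" and t: "t \<in> carrier_vec n" "t \<notin> W"
  shows "\<exists>\<phi>. linf n \<phi> \<and> (\<forall>w\<in>W. \<phi> w = 0) \<and> \<phi> t = (1::'k::field)"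
proof -
  interpret vector_space_pair "\<lambda>(a::'k) (f::nat \<Rightarrow> 'k) i. a * f i" "(*) :: 'k \<Rightarrow> 'k \<Rightarrow> 'k"
    by (rule vector_space_pair_fun)
  define E where "E v = (\<lambda>i. if i < n then v $ i else (0::'k))" for v
  have Eadd: "E (v + w) = (\<lambda>i. E v i + E w i)" if "v \<in> carrier_vec n" "w \<in> carrier_vec n" for v w
    using that by (auto simp: E_def fun_eq_iff)
  have Esm: "E (a \<cdot>\<^sub>v v) = (\<lambda>i. a * E v i)" if "v \<in> carrier_vec n" for a v
    using that by (auto simp: E_def fun_eq_iff)
  have Einj: "v = w" if "v \<in> carrier_vec n" "w \<in> carrier_vec n" "E v = E w" for v w
    using that by (intro eq_vecI) (auto simp: E_def fun_eq_iff, metis)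
  have sub: "vs1.subspace (E ` W)"
  proof (rule vs1.subspaceI)
    have "E (0\<^sub>v n) = 0" by (auto simp: E_def fun_eq_iff zero_fun_def)
    then show "0 \<in> E ` W" using W by (metis imageI subsp_def)
  next
    fix x y assume "x \<in> E ` W" "y \<in> E ` W"
    then obtain v w where vw: "v \<in> W" "w \<in> W" "x = E v" "y = E w" by auto
    have c: "v \<in> carrier_vec n" "w \<in> carrier_vec n" using vw W by (auto simp: subsp_def)
    have "E (v + w) = x + y" using Eadd[OF c] vw by (simp add: fun_eq_iff plus_fun_def)
    then show "x + y \<in> E ` W" using W vw unfolding subsp_def by (metis imageI)
  next
    fix a x assume "x \<in> E ` W"
    then obtain v where v: "v \<in> W" "x = E v" by auto
    have "E (a \<cdot>\<^sub>v v) = (\<lambda>i. a * x i)" using v W by (subst Esm) (auto simp: subsp_def)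
    then show "(\<lambda>i. a * x i) \<in> E ` W" using W v unfolding subsp_def by (metis imageI)
  qed
  have tn: "E t \<notin> E ` W" using Einj t W unfolding subsp_def by (metis imageE subsetD)
  obtain B where B: "B \<subseteq> E ` W" "vs1.independent B" "E ` W \<subseteq> vs1.span B"
    using vs1.maximal_independent_subset[of "E ` W"] by blast
  have spB: "vs1.span B = E ` W"
    using B sub by (metis subset_antisym vs1.span_minimal)
  then have "vs1.independent (insert (E t) B)" using B tn vs1.independent_insert by auto
  then obtain g where g: "Vector_Spaces.linear (\<lambda>a f i. a * f i) (*) g" "\<forall>x\<in>insert (E t) B. g x = (if x = E t then 1 else 0)"
    using linear_independent_extend[of "insert (E t) B" "\<lambda>x. if x = E t then 1 else 0"] by blast
  interpret g: Vector_Spaces.linear "\<lambda>(a::'k) (f::nat\<Rightarrow>'k) i. a * f i" "(*) :: 'k \<Rightarrow> 'k \<Rightarrow> 'k" g by (rule g(1))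
  have gB: "g x = 0" if "x \<in> B" for x using g(2) that B(1) tn by auto
  have gW: "g x = 0" if "x \<in> E ` W" for x
    using linear_eq_0_on_span[OF g(1) gB] that spB by blast
  have 1: "linf n (\<lambda>v. g (E v))"
    unfolding linf_def
  proof (intro conjI ballI allI)
    fix v w :: "'k vec" assume "v \<in> carrier_vec n" "w \<in> carrier_vec n"
    then have "E (v + w) = E v + E w" by (simp add: Eadd fun_eq_iff plus_fun_def)
    then show "g (E (v + w)) = g (E v) + g (E w)" by (simp add: g.add)
  next
    fix a and v :: "'k vec" assume "v \<in> carrier_vec n"
    then show "g (E (a \<cdot>\<^sub>v v)) = a * g (E v)" by (simp add: Esm g.scale)
  qed
  show ?thesis using 1 gW g(2) by (intro exI[of _ "\<lambda>v. g (E v)"]) auto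
qed

lemma subsp_image:
  assumes "lin n m f" "subsp n W" shows "subsp m (f ` W)"
  unfolding subsp_def
proof (intro conjI ballI allI)
  have c: "\<And>v. v \<in> W \<Longrightarrow> v \<in> carrier_vec n" using assms by (auto simp: subsp_def)
  show "f ` W \<subseteq> carrier_vec m" using assms c by (auto simp: lin_closed)
  show "0\<^sub>v m \<in> f ` W" using assms lin_zero[OF assms(1)] by (metis imageI subsp_def)
  fix x assume x: "x \<in> f ` W"
  then obtain v where v: "v \<in> W" "x = f v" by auto
  { fix y assume "y \<in> f ` W"
    then obtain w where w: "w \<in> W" "y = f w" by auto
    have "x + y = f (v + w)" using v w c assms by (simp add: lin_add)
    then show "x + y \<in> f ` W" using v w assms unfolding subsp_def by (metis imageI) }
  fix a have "a \<cdot>\<^sub>v x = f (a \<cdot>\<^sub>v v)" using v c assms by (simp add: lin_smult)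
  then show "a \<cdot>\<^sub>v x \<in> f ` W" using v assms unfolding subsp_def by (metis imageI)
qed

lemma subsp_all: "subsp n (carrier_vec n)" by (auto simp: subsp_def)

lemma subsp_kernel: "linf n \<phi> \<Longrightarrow> subsp n W \<Longrightarrow> subsp n {v\<in>W. \<phi> v = 0}"
  unfolding subsp_def by (auto simp: linf_zero linf_add linf_smult subset_iff)

section \<open>Comparison of dimensions and splitting of idempotents\<close>

lemma lin_left_inverse_dim:
  assumes f: "lin k n f" and g: "lin n k g" and gf: "\<And>v. v \<in> carrier_vec k \<Longrightarrow> g (f v) = v"
  shows "k \<le> n"
proof (rule ccontr)
  assume "\<not> k \<le> n"
  then have nk: "n < k" by simp
  define F where "F = mof k n f" define G where "G = mof n k g"
  \<comment> \<open>Padding with zeros makes both matrices square of size \<open>k\<close>. Their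
    product stays the identity, so the reversed product is the identity as well, although row
    \<open>n\<close> of \<open>F'\<close> is zero.\<close>
  define F' where "F' = mat k k (\<lambda>(i,j). if i < n then F $$ (i,j) else 0)"
  define G' where "G' = mat k k (\<lambda>(i,j). if j < n then G $$ (i,j) else 0)"
  have FG: "F \<in> carrier_mat n k" "G \<in> carrier_mat k n" by (auto simp: F_def G_def)
  have GF: "G * F = 1\<^sub>m k"
  proof (rule mat_eq_vecI[OF mult_carrier_mat[OF FG(2,1)] one_carrier_mat])
    fix v :: "'a vec" assume v: "v \<in> carrier_vec k"
    show "(G * F) *\<^sub>v v = 1\<^sub>m k *\<^sub>v v"
      using v f g by (simp add: assoc_mult_mat_vec[OF FG(2,1) v]) (simp add: F_def G_def mof_mult lin_closed gf)
  qed
  have "G' * F' = G * F"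
  proof (intro eq_matI)
    fix i j assume "i < dim_row (G * F)" "j < dim_col (G * F)"
    then have ij: "i < k" "j < k" using FG by auto
    have "(\<Sum>l = 0..<k. (if l < n then G $$ (i, l) else 0) * (if l < n then F $$ (l, j) else 0))
        = (\<Sum>l = 0..<n. G $$ (i, l) * F $$ (l, j))"
      using nk by (intro sum.mono_neutral_cong_right) auto
    then show "(G' * F') $$ (i,j) = (G * F) $$ (i,j)"
      using ij nk FG by (simp add: G'_def F'_def scalar_prod_def)
  qed (use FG in \<open>auto simp: G'_def F'_def\<close>)
  then have 1: "G' * F' = 1\<^sub>m k" using GF by simp
  have "F' * G' = 1\<^sub>m k"
    by (rule mat_mult_left_right_inverse[OF _ _ 1]) (auto simp: F'_def G'_def)
  then have "(F' * G') $$ (n,n) = 1" using nk by simp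
  moreover have "(F' * G') $$ (n,n) = 0" using nk by (simp add: G'_def F'_def scalar_prod_def)
  ultimately show False by simp
qed

text \<open>The image of an idempotent is coordinatized by treating the images of the unit vectors
  one at a time, enlarging a partial splitting by each image that is not yet covered.\<close>

lemma idem_split:
  assumes e: "lin n n e" and ee: "\<And>v. v \<in> carrier_vec n \<Longrightarrow> e (e v) = (e v :: 'k::field vec)"
  shows "\<exists>r f g. lin r n f \<and> lin n r g \<and> (\<forall>u\<in>carrier_vec r. g (f u) = u) \<and> (\<forall>v\<in>carrier_vec n. f (g v) = e v)"
proof -
  have "\<exists>r f g. lin r n f \<and> lin n r g \<and> (\<forall>u\<in>carrier_vec r. g (f u) = u) \<and> (\<forall>u\<in>carrier_vec r. e (f u) = f u)
     \<and> (\<forall>v\<in>carrier_vec n. g (e v) = g v) \<and> (\<forall>j<i. f (g (unit_vec n j)) = e (unit_vec n j))" if "i \<le> n" for i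
    using that
  proof (induction i)
    case 0
    show ?case
      by (intro exI[of _ 0] exI[of _ "\<lambda>_. 0\<^sub>v n"] exI[of _ "\<lambda>_. 0\<^sub>v 0"] conjI lin_const0)
         (use lin_zero[OF e] in \<open>auto\<close>)
  next
    case (Suc i)
    then obtain r f g where f: "lin r n f" and g: "lin n r g" and gf: "\<And>u. u \<in> carrier_vec r \<Longrightarrow> g (f u) = u"
      and ef: "\<And>u. u \<in> carrier_vec r \<Longrightarrow> e (f u) = f u" and ge: "\<And>v. v \<in> carrier_vec n \<Longrightarrow> g (e v) = g v"
      and old: "\<And>j. j < i \<Longrightarrow> f (g (unit_vec n j)) = e (unit_vec n j)" by auto
    note cl = lin_closed[OF f] lin_closed[OF g] lin_closed[OF e]
    \<comment> \<open>\<open>w\<close> is the part of the next image that the splitting so far does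
      not reach: it is fixed by \<open>e\<close> and killed by \<open>g\<close>, so it can serve as
      one new basis vector.\<close>
    define w where "w = e (unit_vec n i) - f (g (unit_vec n i))"
    have wc: "w \<in> carrier_vec n" by (simp add: w_def cl)
    show ?case
    proof (cases "w = 0\<^sub>v n")
      case True
      then have "f (g (unit_vec n i)) = e (unit_vec n i)"
        using vec_diff_zero[of "e (unit_vec n i)" n "f (g (unit_vec n i))"] by (simp add: w_def cl)
      then show ?thesis using f g gf ef ge old
        by (intro exI[of _ r] exI[of _ f] exI[of _ g]) (auto simp: less_Suc_eq)
    next
      case False
      have ew: "e w = w" by (simp add: w_def lin_minus[OF e] cl ee ef)
      have gw: "g w = 0\<^sub>v r" by (simp add: w_def lin_minus[OF g] cl ge gf minus_cancel_vec[of _ r])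
      obtain \<phi>0 where p0: "linf n \<phi>0" "\<phi>0 w = 1" using linf_separate0[OF wc False] by auto
      \<comment> \<open>This functional is 1 on \<open>w\<close>, vanishes on the range of
        \<open>f\<close> and takes the same value on \<open>v\<close> and \<open>e v\<close>; it
        becomes the new coordinate.\<close>
      define \<phi> where "\<phi> v = \<phi>0 (e v - f (g v))" for v
      have lp: "linf n \<phi>" unfolding \<phi>_def
        by (rule linf_comp[OF p0(1)]) (intro lin_diff e lin_comp[OF g f])
      have pw: "\<phi> w = 1" by (simp add: \<phi>_def ew gw lin_zero[OF f] minus_zero_vec[OF wc] p0)
      have pf: "\<phi> (f u) = 0" if "u \<in> carrier_vec r" for u
        by (simp add: \<phi>_def ef gf that minus_cancel_vec[of _ n] cl linf_zero[OF p0(1)])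
      have pe: "\<phi> (e v) = \<phi> v" if "v \<in> carrier_vec n" for v
        by (simp add: \<phi>_def ee ge that)
      define F where "F u = f (vec r (\<lambda>i. u $ i)) + u $ r \<cdot>\<^sub>v w" for u
      define G where "G v = vec (Suc r) (\<lambda>i. if i < r then g v $ i else \<phi> v)" for v
      have lt: "lin (Suc r) r (\<lambda>u. vec r (\<lambda>i. u $ i))" by (intro linI) auto
      have lF: "lin (Suc r) n F"
      proof -
        have "lin (Suc r) n (\<lambda>u. u $ r \<cdot>\<^sub>v w)"
          by (intro linI) (auto simp: wc add_smult_distrib_vec smult_smult_assoc)
        then show ?thesis unfolding F_def by (intro lin_plus lin_comp[OF lt f])
      qed
      have dg: "v \<in> carrier_vec n \<Longrightarrow> dim_vec (g v) = r" for v using cl(2) by auto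
      have lG: "lin n (Suc r) G"
        by (intro linI)
          (auto simp: G_def lin_add[OF g] lin_smult[OF g] linf_add[OF lp] linf_smult[OF lp] dg)
          have GF: "G (F u) = u" if "u \<in> carrier_vec (Suc r)" for u
      proof -
        have 1: "g (F u) = vec r (\<lambda>i. u $ i)"
          by (simp add: F_def lin_add[OF g] cl wc lin_smult[OF g] gw gf)
        have 2: "\<phi> (F u) = u $ r"
          by (simp add: F_def linf_add[OF lp] cl wc linf_smult[OF lp] pw pf)
        show ?thesis using that by (intro eq_vecI) (auto simp: G_def 1 2 less_Suc_eq)
      qed
      have eF: "e (F u) = F u" for u
        by (simp add: F_def lin_add[OF e] cl wc lin_smult[OF e] ew ef)
      have Ge: "G (e v) = G v" if "v \<in> carrier_vec n" for v
        unfolding G_def by (simp only: ge[OF that] pe[OF that])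
      have FG: "F (G v) = f (g v) + \<phi> v \<cdot>\<^sub>v w" if "v \<in> carrier_vec n" for v
      proof -
        have "vec r (\<lambda>i. G v $ i) = g v" using dg[OF that] by (intro eq_vecI) (auto simp: G_def)
        then show ?thesis by (simp add: F_def) (simp add: G_def)
      qed
      have new: "F (G (unit_vec n j)) = e (unit_vec n j)" if "j < Suc i" for j
      proof (cases "j = i")
        case True
        have "\<phi> (unit_vec n i) = 1" using p0 by (simp add: \<phi>_def w_def[symmetric])
        then have "F (G (unit_vec n i)) = f (g (unit_vec n i)) + w" by (simp add: FG)
        also have "\<dots> = e (unit_vec n i)"
          using cl(1)[OF cl(2), of "unit_vec n i"] cl(3)[of "unit_vec n i"]
          by (intro eq_vecI) (auto simp: w_def)
        finally show ?thesis using True by simp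
      next
        case False
        then have j: "j < i" using that by simp
        have "\<phi> (unit_vec n j) = 0"
          by (simp add: \<phi>_def old[OF j] minus_cancel_vec[of _ n] cl linf_zero[OF p0(1)])
        then show ?thesis using old[OF j] by (simp add: FG zero_smult_vec[OF wc] cl)
      qed
      show ?thesis using lF lG GF eF Ge new by (intro exI[of _ "Suc r"] exI[of _ F] exI[of _ G]) auto
    qed
  qed
  from this[of n] obtain r f g where f: "lin r n f" and g: "lin n r g" and gf: "\<And>u. u \<in> carrier_vec r \<Longrightarrow> g (f u) = u"
      and old: "\<And>j. j < n \<Longrightarrow> f (g (unit_vec n j)) = e (unit_vec n j)" by auto
  have "f (g v) = e v" if v: "v \<in> carrier_vec n" for v
  proof -
    have l: "h v = vsum n (\<lambda>j. v $ j \<cdot>\<^sub>v h (unit_vec n j)) {..<n}" if "lin n n h" for h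
      using lin_vsum[OF that, of "{..<n}" "\<lambda>j. v $ j \<cdot>\<^sub>v unit_vec n j"] unit_expand[OF v] that
      by (simp add: lin_smult)
    show ?thesis using l[OF lin_comp[OF g f]] l[OF e] old by (simp add: vsum_def)
  qed
  then show ?thesis using f g gf by blast
qed

section \<open>Homomorphisms as linear functions\<close>

abbreviation vs :: "('i,'k::field) md \<Rightarrow> 'k vec set" where "vs X \<equiv> carrier_vec (fst X)"

definition wfm :: "'i set \<Rightarrow> ('i,'k::field) md \<Rightarrow> bool" where
  "wfm I X \<longleftrightarrow> (\<forall>g\<in>I. snd X g \<in> carrier_mat (fst X) (fst X))"

text \<open>Homomorphisms are kept as functions constrained only on the underlying space, so that
  composites and inverses are those of functions; \<open>hom_lh\<close> and \<open>lh_hom\<close>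
  translate from and to the matrices of the given definitions.\<close>

definition lh :: "'i set \<Rightarrow> ('i,'k::field) md \<Rightarrow> ('i,'k) md \<Rightarrow> ('k vec \<Rightarrow> 'k vec) \<Rightarrow> bool" where
  "lh I X Y f \<longleftrightarrow> lin (fst X) (fst Y) f \<and> (\<forall>g\<in>I. \<forall>v\<in>vs X. f (snd X g *\<^sub>v v) = snd Y g *\<^sub>v f v)"

definition eqv :: "'i set \<Rightarrow> ('i,'k::field) md \<Rightarrow> ('i,'k) md \<Rightarrow> bool" where
  "eqv I X Y \<longleftrightarrow> (\<exists>f g. lh I X Y f \<and> lh I Y X g \<and> (\<forall>v\<in>vs X. g (f v) = v) \<and> (\<forall>v\<in>vs Y. f (g v) = v))"

text \<open>Up to isomorphism the retracts are the direct summands, by \<open>ret_split\<close>.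
  Unlike a decomposition, a retraction names no complement and composes directly.\<close>

definition ret :: "'i set \<Rightarrow> ('i,'k::field) md \<Rightarrow> ('i,'k) md \<Rightarrow> bool" where
  "ret I X Y \<longleftrightarrow> (\<exists>f g. lh I X Y f \<and> lh I Y X g \<and> (\<forall>v\<in>vs X. g (f v) = v))"

lemma wfm_carrier: "wfm I X \<Longrightarrow> g \<in> I \<Longrightarrow> snd X g \<in> carrier_mat (fst X) (fst X)"
  by (simp add: wfm_def)

lemma wfm_act: "wfm I X \<Longrightarrow> g \<in> I \<Longrightarrow> v \<in> vs X \<Longrightarrow> snd X g *\<^sub>v v \<in> vs X"
  by (meson mult_mat_vec_carrier wfm_carrier)

lemma wfm_lin: "wfm I X \<Longrightarrow> g \<in> I \<Longrightarrow> lin (fst X) (fst X) (\<lambda>v. snd X g *\<^sub>v v)"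
  by (intro lin_mat wfm_carrier)

lemma lh_lin: "lh I X Y f \<Longrightarrow> lin (fst X) (fst Y) f"
  and lh_act: "lh I X Y f \<Longrightarrow> g \<in> I \<Longrightarrow> v \<in> vs X \<Longrightarrow> f (snd X g *\<^sub>v v) = snd Y g *\<^sub>v f v"
  by (auto simp: lh_def)

lemma lh_closed: "lh I X Y f \<Longrightarrow> v \<in> vs X \<Longrightarrow> f v \<in> vs Y"
  by (meson lin_closed lh_lin)

lemmas lh_add = lin_add[OF lh_lin]
lemmas lh_smult = lin_smult[OF lh_lin]
lemmas lh_zero = lin_zero[OF lh_lin]
lemmas lh_minus = lin_minus[OF lh_lin]

lemma lh_comp: "lh I X Y f \<Longrightarrow> lh I Y Z g \<Longrightarrow> lh I X Z (\<lambda>v. g (f v))"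
  by (auto simp: lh_def intro: lin_comp) (metis lin_closed)

lemma lh_id: "lh I X X (\<lambda>v. v)" by (auto simp: lh_def lin_id)

lemma mat_zero_vec: "A \<in> carrier_mat m n \<Longrightarrow> A *\<^sub>v 0\<^sub>v n = (0\<^sub>v m :: 'k::field vec)"
  using lin_zero[OF lin_mat] by blast

lemma lh_const0: "wfm I Y \<Longrightarrow> lh I X Y (\<lambda>v. 0\<^sub>v (fst Y))"
  using mat_zero_vec[OF wfm_carrier] by (fastforce simp: lh_def lin_const0)

lemma lh_plus: "wfm I Y \<Longrightarrow> lh I X Y f \<Longrightarrow> lh I X Y g \<Longrightarrow> lh I X Y (\<lambda>v. f v + g v)"
  unfolding lh_def by (auto simp: lin_plus lin_closed wfm_def mult_add_distrib_mat_vec)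

lemma lh_scale: "wfm I Y \<Longrightarrow> lh I X Y f \<Longrightarrow> lh I X Y (\<lambda>v. a \<cdot>\<^sub>v f v)"
  unfolding lh_def wfm_def by (auto simp: lin_scale lin_closed mult_mat_vec)

lemma lh_diff: "wfm I Y \<Longrightarrow> lh I X Y f \<Longrightarrow> lh I X Y g \<Longrightarrow> lh I X Y (\<lambda>v. f v - g v)"
  unfolding lh_def by (auto simp: lin_diff lin_closed wfm_def mult_minus_distrib_mat_vec)

lemma lh_cong: "wfm I X \<Longrightarrow> lh I X Y f \<Longrightarrow> (\<And>v. v \<in> vs X \<Longrightarrow> f v = g v) \<Longrightarrow> lh I X Y g"
  using lin_cong[of "fst X" "fst Y" f g] by (auto simp: lh_def wfm_act)

lemma hom_lh:
  assumes "wfm I X" "wfm I Y" "hom I X Y H" shows "lh I X Y (\<lambda>v. H *\<^sub>v v)"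
  unfolding lh_def
proof (intro conjI ballI)
  have H: "H \<in> carrier_mat (fst Y) (fst X)" using assms by (simp add: hom_def)
  show "lin (fst X) (fst Y) (\<lambda>v. H *\<^sub>v v)" using H by (rule lin_mat)
  fix g v assume gv: "g \<in> I" "v \<in> vs X"
  have X: "snd X g \<in> carrier_mat (fst X) (fst X)" and Y: "snd Y g \<in> carrier_mat (fst Y) (fst Y)"
    using assms gv by (auto simp: wfm_def)
  have "H * snd X g = snd Y g * H" using assms gv by (simp add: hom_def)
  then show "H *\<^sub>v (snd X g *\<^sub>v v) = snd Y g *\<^sub>v (H *\<^sub>v v)"
    by (metis H X Y assoc_mult_mat_vec gv(2))
qed

lemma lh_hom:
  assumes "wfm I X" "wfm I Y" "lh I X Y f" shows "hom I X Y (mof (fst X) (fst Y) f)"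
  unfolding hom_def
proof (intro conjI ballI)
  fix g assume g: "g \<in> I"
  have X: "snd X g \<in> carrier_mat (fst X) (fst X)" and Y: "snd Y g \<in> carrier_mat (fst Y) (fst Y)"
    using assms g by (auto simp: wfm_def)
  let ?F = "mof (fst X) (fst Y) f"
  have F: "?F \<in> carrier_mat (fst Y) (fst X)" by simp
  note l = lh_lin[OF assms(3)]
  show "?F * snd X g = snd Y g * ?F"
  proof (rule mat_eq_vecI[OF mult_carrier_mat[OF F X] mult_carrier_mat[OF Y F]])
    fix v assume v: "v \<in> vs X"
    have "(?F * snd X g) *\<^sub>v v = f (snd X g *\<^sub>v v)"
      by (simp add: assoc_mult_mat_vec[OF F X v] mof_mult[OF l wfm_act[OF assms(1) g v]])
    also have "\<dots> = snd Y g *\<^sub>v f v" by (rule lh_act[OF assms(3) g v])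
    also have "\<dots> = (snd Y g * ?F) *\<^sub>v v"
      by (simp add: assoc_mult_mat_vec[OF Y F v] mof_mult[OF l v])
    finally show "(?F * snd X g) *\<^sub>v v = (snd Y g * ?F) *\<^sub>v v" .
  qed
qed simp

lemma mof_comp:
  assumes "lin n m f" "lin m p g"
  shows "mof m p g * mof n m f = mof n p (\<lambda>v. g (f v))"
proof (rule mat_eq_vecI)
  show "mof m p g * mof n m f \<in> carrier_mat p n" by (rule mult_carrier_mat[OF mof_carrier mof_carrier])
  fix v :: "'a vec" assume v: "v \<in> carrier_vec n"
  show "(mof m p g * mof n m f) *\<^sub>v v = mof n p (\<lambda>v. g (f v)) *\<^sub>v v"
    by (simp add: assoc_mult_mat_vec[OF mof_carrier mof_carrier v] mof_mult[OF assms(1) v]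
       mof_mult[OF assms(2) lin_closed[OF assms(1) v]] mof_mult[OF lin_comp[OF assms] v])
qed simp

lemma mof_eqI: "A \<in> carrier_mat m n \<Longrightarrow> lin n m f \<Longrightarrow> (\<And>v. v \<in> carrier_vec n \<Longrightarrow> f v = A *\<^sub>v v) \<Longrightarrow> mof n m f = A"
  by (rule mat_eq_vecI[of _ m n]) (auto simp: mof_mult)

lemma iso_iff_eqv:
  assumes X: "wfm I X" and Y: "wfm I Y" shows "iso I X Y \<longleftrightarrow> eqv I X Y"
proof
  assume "iso I X Y"
  then obtain H G where h: "hom I X Y H" "hom I Y X G" "G * H = 1\<^sub>m (fst X)" "H * G = 1\<^sub>m (fst Y)"
    by (auto simp: iso_def)
  have c: "H \<in> carrier_mat (fst Y) (fst X)" "G \<in> carrier_mat (fst X) (fst Y)" using h by (auto simp: hom_def)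
  have "G *\<^sub>v (H *\<^sub>v v) = v" if "v \<in> vs X" for v
    using assoc_mult_mat_vec[OF c(2,1) that] h(3) that by simp
  moreover have "H *\<^sub>v (G *\<^sub>v v) = v" if "v \<in> vs Y" for v
    using assoc_mult_mat_vec[OF c(1,2) that] h(4) that by simp
  ultimately show "eqv I X Y" unfolding eqv_def using hom_lh[OF X Y h(1)] hom_lh[OF Y X h(2)] by blast
next
  assume "eqv I X Y"
  then obtain f g where h: "lh I X Y f" "lh I Y X g" "\<forall>v\<in>vs X. g (f v) = v" "\<forall>v\<in>vs Y. f (g v) = v"
    by (auto simp: eqv_def)
  note l = lh_lin[OF h(1)] lh_lin[OF h(2)]
  show "iso I X Y" unfolding iso_def
  proof (intro exI conjI)
    show "hom I X Y (mof (fst X) (fst Y) f)" "hom I Y X (mof (fst Y) (fst X) g)"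
      by (rule lh_hom[OF X Y h(1)], rule lh_hom[OF Y X h(2)])
    show "mof (fst Y) (fst X) g * mof (fst X) (fst Y) f = 1\<^sub>m (fst X)"
      unfolding mof_comp[OF l] by (rule mof_eqI) (use h lin_comp[OF l] in auto)
    show "mof (fst X) (fst Y) f * mof (fst Y) (fst X) g = 1\<^sub>m (fst Y)"
      unfolding mof_comp[OF l(2,1)] by (rule mof_eqI) (use h lin_comp[OF l(2,1)] in auto)
  qed
qed

lemma eqvI: "lh I X Y f \<Longrightarrow> lh I Y X g \<Longrightarrow> (\<And>v. v \<in> vs X \<Longrightarrow> g (f v) = v) \<Longrightarrow> (\<And>v. v \<in> vs Y \<Longrightarrow> f (g v) = v) \<Longrightarrow> eqv I X Y"
  by (auto simp: eqv_def)

lemma eqvE: assumes "eqv I X Y"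
  obtains f g where "lh I X Y f" "lh I Y X g" "\<And>v. v \<in> vs X \<Longrightarrow> g (f v) = v" "\<And>v. v \<in> vs Y \<Longrightarrow> f (g v) = v"
  using assms by (auto simp: eqv_def)

lemma eqv_refl: "eqv I X X" by (rule eqvI[OF lh_id lh_id]) auto

lemma eqv_sym: "eqv I X Y \<Longrightarrow> eqv I Y X" by (auto simp: eqv_def)

lemma eqv_trans: assumes "eqv I X Y" "eqv I Y Z" shows "eqv I X Z"
proof -
  obtain f g where a: "lh I X Y f" "lh I Y X g" "\<And>v. v \<in> vs X \<Longrightarrow> g (f v) = v" "\<And>v. v \<in> vs Y \<Longrightarrow> f (g v) = v"
    using assms(1) by (rule eqvE) blast
  obtain f' g' where b: "lh I Y Z f'" "lh I Z Y g'" "\<And>v. v \<in> vs Y \<Longrightarrow> g' (f' v) = v" "\<And>v. v \<in> vs Z \<Longrightarrow> f' (g' v) = v"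
    using assms(2) by (rule eqvE) blast
  show ?thesis
    by (rule eqvI[OF lh_comp[OF a(1) b(1)] lh_comp[OF b(2) a(2)]]) (use a b in \<open>auto simp: lh_closed\<close>)
qed

lemma retI: "lh I X Y f \<Longrightarrow> lh I Y X g \<Longrightarrow> (\<And>v. v \<in> vs X \<Longrightarrow> g (f v) = v) \<Longrightarrow> ret I X Y"
  by (auto simp: ret_def)

lemma retE: assumes "ret I X Y"
  obtains f g where "lh I X Y f" "lh I Y X g" "\<And>v. v \<in> vs X \<Longrightarrow> g (f v) = v"
  using assms by (auto simp: ret_def)

lemma eqv_ret: "eqv I X Y \<Longrightarrow> ret I X Y" by (auto simp: eqv_def ret_def)

lemma ret_trans: assumes "ret I X Y" "ret I Y Z" shows "ret I X Z"
proof -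
  obtain f g where a: "lh I X Y f" "lh I Y X g" "\<And>v. v \<in> vs X \<Longrightarrow> g (f v) = v"
    using assms(1) by (rule retE) blast
  obtain f' g' where b: "lh I Y Z f'" "lh I Z Y g'" "\<And>v. v \<in> vs Y \<Longrightarrow> g' (f' v) = v"
    using assms(2) by (rule retE) blast
  show ?thesis
    by (rule retI[OF lh_comp[OF a(1) b(1)] lh_comp[OF b(2) a(2)]]) (use a b in \<open>auto simp: lh_closed\<close>)
qed

lemma ret_dim: "ret I X Y \<Longrightarrow> fst X \<le> fst Y"
  by (elim retE) (meson lin_left_inverse_dim lh_lin)

lemma eqv_dim: "eqv I X Y \<Longrightarrow> fst X = fst Y"
  by (meson antisym eqv_ret eqv_sym ret_dim)

section \<open>Direct sums\<close>

definition i1 :: "('i,'k::field) md \<Rightarrow> ('i,'k) md \<Rightarrow> 'k vec \<Rightarrow> 'k vec" where "i1 X Y v = v @\<^sub>v 0\<^sub>v (fst Y)"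
definition i2 :: "('i,'k::field) md \<Rightarrow> ('i,'k) md \<Rightarrow> 'k vec \<Rightarrow> 'k vec" where "i2 X Y v = 0\<^sub>v (fst X) @\<^sub>v v"
definition p1 :: "('i,'k::field) md \<Rightarrow> ('i,'k) md \<Rightarrow> 'k vec \<Rightarrow> 'k vec" where "p1 X Y v = vec (fst X) (\<lambda>i. v $ i)"
definition p2 :: "('i,'k::field) md \<Rightarrow> ('i,'k) md \<Rightarrow> 'k vec \<Rightarrow> 'k vec" where "p2 X Y v = vec (fst Y) (\<lambda>i. v $ (fst X + i))"

lemma fst_dsum [simp]: "fst (dsum X Y) = fst X + fst Y" by (simp add: dsum_def)

lemma wfm_dsum: "wfm I X \<Longrightarrow> wfm I Y \<Longrightarrow> wfm I (dsum X Y)"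
  by (simp add: wfm_def dsum_def)

lemma wfm_zmod: "wfm I zmod" by (auto simp: wfm_def zmod_def)

lemma fst_zmod [simp]: "fst zmod = 0" by (simp add: zmod_def)

lemma vec_split: "v \<in> vs (dsum X Y) \<Longrightarrow> v = p1 X Y v @\<^sub>v p2 X Y v"
  by (intro eq_vecI) (auto simp: p1_def p2_def)

lemma p12_carrier [simp]: "p1 X Y v \<in> vs X" "p2 X Y v \<in> vs Y" by (auto simp: p1_def p2_def)

lemma p12_dsum_carrier [simp]:
  "p1 (dsum X Y) Z v \<in> carrier_vec (fst X + fst Y)" "p2 Z (dsum X Y) v \<in> carrier_vec (fst X + fst Y)"
  by (auto simp: p1_def p2_def)

lemma p1_append [simp]: "a \<in> vs X \<Longrightarrow> p1 X Y (a @\<^sub>v b) = a"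
  and p2_append [simp]: "a \<in> vs X \<Longrightarrow> b \<in> vs Y \<Longrightarrow> p2 X Y (a @\<^sub>v b) = b"
  by (auto simp: p1_def p2_def intro!: eq_vecI)

lemma dsum_act:
  assumes "wfm I X" "wfm I Y" "g \<in> I" "a \<in> vs X" "b \<in> vs Y"
  shows "snd (dsum X Y) g *\<^sub>v (a @\<^sub>v b) = (snd X g *\<^sub>v a) @\<^sub>v (snd Y g *\<^sub>v b)"
proof -
  have "snd X g \<in> carrier_mat (fst X) (fst X)" "snd Y g \<in> carrier_mat (fst Y) (fst Y)" using assms by (auto simp: wfm_def)
  then show ?thesis using assms(4,5) by (simp add: dsum_def mult_mat_vec_split)
qed

lemma i_carrier [simp]: "a \<in> vs X \<Longrightarrow> i1 X Y a \<in> carrier_vec (fst X + fst Y)" "b \<in> vs Y \<Longrightarrow> i2 X Y b \<in> carrier_vec (fst X + fst Y)"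
  by (auto simp: i1_def i2_def)

lemma p_i [simp]:
  "a \<in> vs X \<Longrightarrow> p1 X Y (i1 X Y a) = a" "a \<in> vs X \<Longrightarrow> p2 X Y (i1 X Y a) = 0\<^sub>v (fst Y)"
  "b \<in> vs Y \<Longrightarrow> p1 X Y (i2 X Y b) = 0\<^sub>v (fst X)" "b \<in> vs Y \<Longrightarrow> p2 X Y (i2 X Y b) = b"
  by (auto simp: i1_def i2_def)

lemma i_p: "v \<in> vs (dsum X Y) \<Longrightarrow> i1 X Y (p1 X Y v) + i2 X Y (p2 X Y v) = v"
  by (intro eq_vecI) (auto simp: i1_def i2_def p1_def p2_def)

lemma dsum_eqI: "v \<in> vs (dsum X Y) \<Longrightarrow> w \<in> vs (dsum X Y) \<Longrightarrow> p1 X Y v = p1 X Y w \<Longrightarrow> p2 X Y v = p2 X Y w \<Longrightarrow> v = w"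
  by (metis i_p)

lemma lh_p1: assumes "wfm I X" "wfm I Y" shows "lh I (dsum X Y) X (p1 X Y)"
  unfolding lh_def
proof (intro conjI ballI)
  show "lin (fst (dsum X Y)) (fst X) (p1 X Y)" by (intro linI) (auto simp: p1_def)
  fix g v assume g: "g \<in> I" and v: "v \<in> vs (dsum X Y)"
  show "p1 X Y (snd (dsum X Y) g *\<^sub>v v) = snd X g *\<^sub>v p1 X Y v"
    by (subst vec_split[OF v]) (simp add: dsum_act[OF assms g] wfm_act[OF assms(1) g])
qed

lemma lh_p2: assumes "wfm I X" "wfm I Y" shows "lh I (dsum X Y) Y (p2 X Y)"
  unfolding lh_def
proof (intro conjI ballI)
  show "lin (fst (dsum X Y)) (fst Y) (p2 X Y)" by (intro linI) (auto simp: p2_def)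
  fix g v assume g: "g \<in> I" and v: "v \<in> vs (dsum X Y)"
  show "p2 X Y (snd (dsum X Y) g *\<^sub>v v) = snd Y g *\<^sub>v p2 X Y v"
    by (subst vec_split[OF v]) (simp add: dsum_act[OF assms g] wfm_act[OF assms(1) g] wfm_act[OF assms(2) g])
qed

lemma lh_i1: assumes "wfm I X" "wfm I Y" shows "lh I X (dsum X Y) (i1 X Y)"
  unfolding lh_def
proof (intro conjI ballI)
  show "lin (fst X) (fst (dsum X Y)) (i1 X Y)"
    by (intro linI) (auto simp: i1_def intro!: eq_vecI)
  fix g v assume g: "g \<in> I" and v: "v \<in> vs X"
  show "i1 X Y (snd X g *\<^sub>v v) = snd (dsum X Y) g *\<^sub>v i1 X Y v"
    using v by (simp add: i1_def dsum_act[OF assms g] mat_zero_vec[OF wfm_carrier[OF assms(2) g]])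
qed

lemma lh_i2: assumes "wfm I X" "wfm I Y" shows "lh I Y (dsum X Y) (i2 X Y)"
  unfolding lh_def
proof (intro conjI ballI)
  show "lin (fst Y) (fst (dsum X Y)) (i2 X Y)"
    by (intro linI) (auto simp: i2_def intro!: eq_vecI)
  fix g v assume g: "g \<in> I" and v: "v \<in> vs Y"
  show "i2 X Y (snd Y g *\<^sub>v v) = snd (dsum X Y) g *\<^sub>v i2 X Y v"
    using v by (simp add: i2_def dsum_act[OF assms g] mat_zero_vec[OF wfm_carrier[OF assms(1) g]])
qed

definition cop :: "('i,'k::field) md \<Rightarrow> ('i,'k) md \<Rightarrow> ('k vec \<Rightarrow> 'k vec) \<Rightarrow> ('k vec \<Rightarrow> 'k vec) \<Rightarrow> 'k vec \<Rightarrow> 'k vec" where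
  "cop X Y f g v = f (p1 X Y v) + g (p2 X Y v)"

definition prd :: "('i,'k::field) md \<Rightarrow> ('i,'k) md \<Rightarrow> ('k vec \<Rightarrow> 'k vec) \<Rightarrow> ('k vec \<Rightarrow> 'k vec) \<Rightarrow> 'k vec \<Rightarrow> 'k vec" where
  "prd X Y f g v = i1 X Y (f v) + i2 X Y (g v)"

lemma lh_cop: "wfm I X \<Longrightarrow> wfm I Y \<Longrightarrow> wfm I Z \<Longrightarrow> lh I X Z f \<Longrightarrow> lh I Y Z g \<Longrightarrow> lh I (dsum X Y) Z (cop X Y f g)"
  unfolding cop_def by (intro lh_plus lh_comp[OF lh_p1] lh_comp[OF lh_p2])

lemma lh_prd: "wfm I X \<Longrightarrow> wfm I Y \<Longrightarrow> lh I Z X f \<Longrightarrow> lh I Z Y g \<Longrightarrow> lh I Z (dsum X Y) (prd X Y f g)"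
  unfolding prd_def by (intro lh_plus lh_comp[OF _ lh_i1] lh_comp[OF _ lh_i2] wfm_dsum)

lemma p_prd [simp]:
  assumes "f v \<in> vs X" "g v \<in> vs Y" shows "p1 X Y (prd X Y f g v) = f v" "p2 X Y (prd X Y f g v) = g v"
proof -
  have "prd X Y f g v = f v @\<^sub>v g v"
    using assms by (auto simp: prd_def i1_def i2_def intro!: eq_vecI)
  then show "p1 X Y (prd X Y f g v) = f v" "p2 X Y (prd X Y f g v) = g v" using assms by simp_all
qed

lemma prd_carrier: "f v \<in> vs X \<Longrightarrow> g v \<in> vs Y \<Longrightarrow> prd X Y f g v \<in> vs (dsum X Y)"
  by (simp add: prd_def)

lemma dsum_map:
  assumes w: "wfm I X" "wfm I Y" "wfm I X'" "wfm I Y'" and f: "lh I X X' f" and g: "lh I Y Y' g"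
  defines "h \<equiv> prd X' Y' (\<lambda>v. f (p1 X Y v)) (\<lambda>v. g (p2 X Y v))"
  shows "lh I (dsum X Y) (dsum X' Y') h"
    and "\<And>v. p1 X' Y' (h v) = f (p1 X Y v)" and "\<And>v. p2 X' Y' (h v) = g (p2 X Y v)"
  unfolding h_def using w by (auto intro!: lh_prd lh_comp[OF lh_p1 f] lh_comp[OF lh_p2 g] simp: lh_closed[OF f] lh_closed[OF g])

lemma ret_dsum_cong:
  assumes w: "wfm I X" "wfm I Y" "wfm I X'" "wfm I Y'" and "ret I X X'" "ret I Y Y'"
  shows "ret I (dsum X Y) (dsum X' Y')"
proof -
  obtain f g where a: "lh I X X' f" "lh I X' X g" "\<And>v. v \<in> vs X \<Longrightarrow> g (f v) = v"
    using assms(5) by (rule retE) blast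
  obtain f' g' where b: "lh I Y Y' f'" "lh I Y' Y g'" "\<And>v. v \<in> vs Y \<Longrightarrow> g' (f' v) = v"
    using assms(6) by (rule retE) blast
  note m = dsum_map[OF w a(1) b(1)] and n = dsum_map[OF w(3,4,1,2) a(2) b(2)]
  show ?thesis
  proof (rule retI[OF m(1) n(1)])
    fix v assume v: "v \<in> vs (dsum X Y)"
    note c = lh_closed[OF n(1) lh_closed[OF m(1) v]]
    show "prd X Y (\<lambda>v. g (p1 X' Y' v)) (\<lambda>v. g' (p2 X' Y' v)) (prd X' Y' (\<lambda>v. f (p1 X Y v)) (\<lambda>v. f' (p2 X Y v)) v) = v"
      by (rule dsum_eqI[OF c v]) (simp_all add: m n a b)
  qed
qed

lemma eqv_dsum_cong:
  assumes w: "wfm I X" "wfm I Y" "wfm I X'" "wfm I Y'" and "eqv I X X'" "eqv I Y Y'"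
  shows "eqv I (dsum X Y) (dsum X' Y')"
proof -
  obtain f g where a: "lh I X X' f" "lh I X' X g" "\<And>v. v \<in> vs X \<Longrightarrow> g (f v) = v" "\<And>v. v \<in> vs X' \<Longrightarrow> f (g v) = v"
    using assms(5) by (rule eqvE) blast
  obtain f' g' where b: "lh I Y Y' f'" "lh I Y' Y g'" "\<And>v. v \<in> vs Y \<Longrightarrow> g' (f' v) = v" "\<And>v. v \<in> vs Y' \<Longrightarrow> f' (g' v) = v"
    using assms(6) by (rule eqvE) blast
  note m = dsum_map[OF w a(1) b(1)] and n = dsum_map[OF w(3,4,1,2) a(2) b(2)]
  show ?thesis
  proof (rule eqvI[OF m(1) n(1)])
    fix v assume v: "v \<in> vs (dsum X Y)"
    note c = lh_closed[OF n(1) lh_closed[OF m(1) v]]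
    show "prd X Y (\<lambda>v. g (p1 X' Y' v)) (\<lambda>v. g' (p2 X' Y' v)) (prd X' Y' (\<lambda>v. f (p1 X Y v)) (\<lambda>v. f' (p2 X Y v)) v) = v"
      by (rule dsum_eqI[OF c v]) (simp_all add: m n a b)
  next
    fix v assume v: "v \<in> vs (dsum X' Y')"
    note c = lh_closed[OF m(1) lh_closed[OF n(1) v]]
    show "prd X' Y' (\<lambda>v. f (p1 X Y v)) (\<lambda>v. f' (p2 X Y v)) (prd X Y (\<lambda>v. g (p1 X' Y' v)) (\<lambda>v. g' (p2 X' Y' v)) v) = v"
      by (rule dsum_eqI[OF c v]) (simp_all add: m n a b)
  qed
qed

lemma eqv_dsum_comm: assumes "wfm I X" "wfm I Y" shows "eqv I (dsum X Y) (dsum Y X)"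
proof (rule eqvI)
  show l: "lh I (dsum X Y) (dsum Y X) (prd Y X (p2 X Y) (p1 X Y))" "lh I (dsum Y X) (dsum X Y) (prd X Y (p2 Y X) (p1 Y X))"
    using assms by (auto intro!: lh_prd lh_p1 lh_p2)
  show "prd X Y (p2 Y X) (p1 Y X) (prd Y X (p2 X Y) (p1 X Y) v) = v" if "v \<in> vs (dsum X Y)" for v
    by (rule dsum_eqI[OF lh_closed[OF l(2) lh_closed[OF l(1) that]] that]) simp_all
  show "prd Y X (p2 X Y) (p1 X Y) (prd X Y (p2 Y X) (p1 Y X) v) = v" if "v \<in> vs (dsum Y X)" for v
    by (rule dsum_eqI[OF lh_closed[OF l(1) lh_closed[OF l(2) that]] that]) simp_all
qed

lemma eqv_dsum_assoc: assumes w: "wfm I X" "wfm I Y" "wfm I Z" shows "eqv I (dsum (dsum X Y) Z) (dsum X (dsum Y Z))"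
proof (rule eqvI)
  let ?XY = "dsum X Y" and ?YZ = "dsum Y Z"
  let ?f2 = "prd Y Z (\<lambda>v. p2 X Y (p1 ?XY Z v)) (p2 ?XY Z)"
  let ?f = "prd X ?YZ (\<lambda>v. p1 X Y (p1 ?XY Z v)) ?f2"
  let ?g1 = "prd X Y (p1 X ?YZ) (\<lambda>v. p1 Y Z (p2 X ?YZ v))"
  let ?g = "prd ?XY Z ?g1 (\<lambda>v. p2 Y Z (p2 X ?YZ v))"
  note w' = wfm_dsum[OF w(1,2)] wfm_dsum[OF w(2,3)]
  show l: "lh I (dsum ?XY Z) (dsum X ?YZ) ?f" "lh I (dsum X ?YZ) (dsum ?XY Z) ?g"
    using w w' by (auto intro!: lh_prd lh_comp[OF lh_p1 lh_p1] lh_comp[OF lh_p1 lh_p2] lh_comp[OF lh_p2 lh_p1]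
      lh_comp[OF lh_p2 lh_p2] lh_p1 lh_p2)
  have F: "p1 X ?YZ (?f v) = p1 X Y (p1 ?XY Z v)" "p2 X ?YZ (?f v) = ?f2 v" for v
    by (rule p_prd; simp add: prd_carrier[simplified])+
  have G: "p1 ?XY Z (?g v) = ?g1 v" "p2 ?XY Z (?g v) = p2 Y Z (p2 X ?YZ v)" for v
    by (rule p_prd; simp add: prd_carrier[simplified])+
  show "?g (?f v) = v" if v: "v \<in> vs (dsum ?XY Z)" for v
  proof (rule dsum_eqI[OF lh_closed[OF l(2) lh_closed[OF l(1) that]] that])
    show "p2 ?XY Z (?g (?f v)) = p2 ?XY Z v" unfolding G F by simp
    show "p1 ?XY Z (?g (?f v)) = p1 ?XY Z v" unfolding G
      by (rule dsum_eqI[of _ X Y]) (simp_all add: F prd_carrier[simplified])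
  qed
  show "?f (?g v) = v" if v: "v \<in> vs (dsum X ?YZ)" for v
  proof (rule dsum_eqI[OF lh_closed[OF l(1) lh_closed[OF l(2) that]] that])
    show "p1 X ?YZ (?f (?g v)) = p1 X ?YZ v" unfolding G F by simp
    show "p2 X ?YZ (?f (?g v)) = p2 X ?YZ v" unfolding F
      by (rule dsum_eqI[of _ Y Z]) (simp_all add: G prd_carrier[simplified])
  qed
qed

lemma vec0_eq: "v \<in> carrier_vec 0 \<Longrightarrow> w \<in> carrier_vec 0 \<Longrightarrow> v = w" by auto

lemma eqv_dsum_zero: assumes "wfm I X" "wfm I Z" "fst Z = 0" shows "eqv I (dsum X Z) X"
proof (rule eqvI[OF lh_p1 lh_i1])
  show "i1 X Z (p1 X Z v) = v" if v: "v \<in> vs (dsum X Z)" for v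
  proof (rule dsum_eqI[OF _ v])
    show "p2 X Z (i1 X Z (p1 X Z v)) = p2 X Z v"
      using p12_carrier(2)[of X Z "i1 X Z (p1 X Z v)"] p12_carrier(2)[of X Z v] unfolding assms(3) by (rule vec0_eq)
  qed simp_all
qed (use assms in auto)

lemma ret_dsum1: "wfm I X \<Longrightarrow> wfm I Y \<Longrightarrow> ret I X (dsum X Y)"
  by (rule retI[OF lh_i1 lh_p1]) auto

lemma ret_dsum2: "wfm I X \<Longrightarrow> wfm I Y \<Longrightarrow> ret I Y (dsum X Y)"
  by (rule retI[OF lh_i2 lh_p2]) auto

text \<open>The complement is the image of the idempotent \<open>e = id - f g\<close>, which
  commutes with the action; \<open>idem_split\<close> identifies this image with a coordinate
  space.\<close>

lemma ret_split:
  assumes U: "wfm I U" and X: "wfm I X" and r: "ret I U X"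
  shows "\<exists>Z. wfm I Z \<and> eqv I X (dsum U Z)"
proof -
  obtain f g where f: "lh I U X f" and g: "lh I X U g" and gf: "\<And>v. v \<in> vs U \<Longrightarrow> g (f v) = v"
    using r by (rule retE) blast
  define e where "e v = v - f (g v)" for v
  have le: "lh I X X e" unfolding e_def by (intro lh_diff X lh_id lh_comp[OF g f])
  have ge: "g (e v) = 0\<^sub>v (fst U)" if "v \<in> vs X" for v
    using that by (simp add: e_def lh_minus[OF g] lh_closed[OF f] lh_closed[OF g] gf minus_cancel_vec[of _ "fst U"])
  have ee: "e (e v) = e v" if "v \<in> vs X" for v
    using ge[OF that] lh_closed[OF le that] by (simp add: e_def[of "e v"] lh_zero[OF f] minus_zero_vec[of _ "fst X"])
  have ef: "e (f u) = 0\<^sub>v (fst X)" if "u \<in> vs U" for u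
    using that by (simp add: e_def gf lh_closed[OF f] minus_cancel_vec[of _ "fst X"])
  from idem_split[OF lh_lin[OF le] ee]
  obtain r a b where a: "lin r (fst X) a" and b: "lin (fst X) r b" and ba: "\<And>u. u \<in> carrier_vec r \<Longrightarrow> b (a u) = u"
    and ab: "\<And>v. v \<in> vs X \<Longrightarrow> a (b v) = e v" by auto
  have ea: "e (a u) = a u" if "u \<in> carrier_vec r" for u
    using ab[of "a u"] ba[OF that] lin_closed[OF a that] by simp
  \<comment> \<open>The action is carried over to the coordinate space along \<open>a\<close> and
    \<open>b\<close>.\<close>
  define Z :: "('a,'b) md" where "Z = (r, \<lambda>h. mof r r (\<lambda>u. b (snd X h *\<^sub>v a u)))"
  have Zr: "fst Z = r" by (simp add: Z_def)
  have lZ: "lin r r (\<lambda>u. b (snd X h *\<^sub>v a u))" if "h \<in> I" for h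
    using lin_comp[OF lin_comp[OF a wfm_lin[OF X that]] b] .
  have actZ: "snd Z h *\<^sub>v u = b (snd X h *\<^sub>v a u)" if "h \<in> I" "u \<in> carrier_vec r" for h u
    using mof_mult[OF lZ that(2)] that by (simp add: Z_def)
  have wZ: "wfm I Z" by (auto simp: wfm_def Z_def)
  have be: "b (e v) = b v" if "v \<in> vs X" for v
    using ba[of "b v"] ab[OF that] lin_closed[OF b that] by simp
  have la: "lh I Z X a" unfolding lh_def Zr
    using a by (auto simp: actZ ab wfm_act[OF X] lin_closed[OF a] lh_act[OF le] ea)
  have lb: "lh I X Z b" unfolding lh_def Zr
    using b by (auto simp: actZ ab lin_closed[OF b] lh_act[OF le, symmetric] be wfm_act[OF X])
  have "eqv I X (dsum U Z)"
  proof (rule eqvI[OF lh_prd[OF U wZ g lb] lh_cop[OF U wZ X f la]])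
    fix v assume v: "v \<in> vs X"
    have "cop U Z f a (prd U Z g b v) = f (g v) + e v"
      using v by (simp add: cop_def lh_closed[OF g] lh_closed[OF lb] ab)
    also have "\<dots> = v" using v lh_closed[OF f lh_closed[OF g v]] by (auto simp: e_def intro!: eq_vecI)
    finally show "cop U Z f a (prd U Z g b v) = v" .
  next
    fix v assume v: "v \<in> vs (dsum U Z)"
    define x where "x = p1 U Z v" define y where "y = p2 U Z v"
    have xy: "x \<in> vs U" "y \<in> vs Z" by (auto simp: x_def y_def)
    have y': "y \<in> carrier_vec r" using xy Zr by simp
    have c: "cop U Z f a v = f x + a y" by (simp add: cop_def x_def y_def)
    have cc: "f x + a y \<in> vs X" using lh_closed[OF f xy(1)] lh_closed[OF la xy(2)] by simp
    have "g (a y) = 0\<^sub>v (fst U)" using ge[of "a y"] ea[OF y'] lin_closed[OF a y'] by simp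
    then have 1: "g (f x + a y) = x"
      using xy lh_closed[OF f xy(1)] lh_closed[OF la xy(2)] by (simp add: lh_add[OF g] gf right_zero_vec[of _ "fst U"])
    have "b (f x) = 0\<^sub>v r" using be[OF lh_closed[OF f xy(1)]] ef[OF xy(1)] lin_zero[OF b] by simp
    then have 2: "b (f x + a y) = y"
      using y' lh_closed[OF f xy(1)] lh_closed[OF la xy(2)] by (simp add: lin_add[OF b] ba left_zero_vec[of _ r])
    show "prd U Z g b (cop U Z f a v) = v"
      by (rule dsum_eqI[OF _ v])
        (use lh_closed[OF g cc] lh_closed[OF lb cc] 1 2 in \<open>simp_all add: c prd_carrier[simplified] x_def y_def\<close>)
  qed
  then show ?thesis using wZ by blast
qed

section \<open>Bricks\<close>

definition brick :: "'i set \<Rightarrow> ('i,'k::field) md \<Rightarrow> bool" where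
  "brick I U \<longleftrightarrow> wfm I U \<and> fst U > 0 \<and> (\<forall>f. lh I U U f \<longrightarrow> (\<exists>k. \<forall>v\<in>vs U. f v = k \<cdot>\<^sub>v v))"

lemma brickE:
  assumes "brick I U" "lh I U U f" obtains k where "\<And>v. v \<in> vs U \<Longrightarrow> f v = k \<cdot>\<^sub>v v"
  using assms by (auto simp: brick_def)

lemma pos_dim_vec: "n > 0 \<Longrightarrow> \<exists>v\<in>carrier_vec n. v $ 0 = (1::'k::field)"
  by (rule bexI[of _ "unit_vec n 0"]) auto

lemma smult_cancel0:
  assumes "n > 0" "\<And>v. v \<in> carrier_vec n \<Longrightarrow> (a::'k::field) \<cdot>\<^sub>v v = b \<cdot>\<^sub>v v" shows "a = b"
proof -
  obtain v :: "'k vec" where v: "v \<in> carrier_vec n" "v $ 0 = 1" using pos_dim_vec[OF assms(1)] by blast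
  have "(a \<cdot>\<^sub>v v) $ 0 = (b \<cdot>\<^sub>v v) $ 0" using assms(2)[OF v(1)] by simp
  then show ?thesis using v assms(1) by simp
qed

lemma scalar_ret:
  assumes f: "lh I U X f" and g: "lh I X U g" and U: "wfm I U" and k: "\<And>v. v \<in> vs U \<Longrightarrow> g (f v) = k \<cdot>\<^sub>v v" "k \<noteq> 0"
  shows "ret I U X"
  by (rule retI[OF f lh_scale[OF U g, of "inverse k"]]) (use k in \<open>simp add: smult_smult_assoc\<close>)

text \<open>The composites \<open>U \<rightarrow> X \<rightarrow> U\<close> and
  \<open>U \<rightarrow> Y \<rightarrow> U\<close> are scalars with sum 1, so one of them is
  invertible. This stands in for the local endomorphism ring in the Krull-Schmidt theorem.\<close>

lemma brick_prime:
  assumes b: "brick I U" and X: "wfm I X" and Y: "wfm I Y" and r: "ret I U (dsum X Y)"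
  shows "ret I U X \<or> ret I U Y"
proof -
  have U: "wfm I U" "fst U > 0" using b by (auto simp: brick_def)
  obtain f g where f: "lh I U (dsum X Y) f" and g: "lh I (dsum X Y) U g" and gf: "\<And>v. v \<in> vs U \<Longrightarrow> g (f v) = v"
    using r by (rule retE) blast
  note f1 = lh_comp[OF f lh_p1[OF X Y]] and f2 = lh_comp[OF f lh_p2[OF X Y]]
  note g1 = lh_comp[OF lh_i1[OF X Y] g] and g2 = lh_comp[OF lh_i2[OF X Y] g]
  obtain k1 where k1: "\<And>v. v \<in> vs U \<Longrightarrow> g (i1 X Y (p1 X Y (f v))) = k1 \<cdot>\<^sub>v v" using brickE[OF b lh_comp[OF f1 g1]] by blast
  obtain k2 where k2: "\<And>v. v \<in> vs U \<Longrightarrow> g (i2 X Y (p2 X Y (f v))) = k2 \<cdot>\<^sub>v v" using brickE[OF b lh_comp[OF f2 g2]] by blast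
  have "k1 + k2 = 1"
  proof (rule smult_cancel0[OF U(2)])
    fix v assume v: "v \<in> vs U"
    have "v = g (i1 X Y (p1 X Y (f v)) + i2 X Y (p2 X Y (f v)))" using gf[OF v] i_p[OF lh_closed[OF f v]] by simp
    also have "\<dots> = k1 \<cdot>\<^sub>v v + k2 \<cdot>\<^sub>v v" using v by (subst lh_add[OF g]) (auto simp: k1 k2)
    finally show "(k1 + k2) \<cdot>\<^sub>v v = 1 \<cdot>\<^sub>v v" by (simp add: add_smult_distrib_vec)
  qed
  then have "k1 \<noteq> 0 \<or> k2 \<noteq> 0" by auto
  then show ?thesis using scalar_ret[OF f1 g1 U(1) k1] scalar_ret[OF f2 g2 U(1) k2] by blast
qed

text \<open>If \<open>U\<close> were not a retract of \<open>R\<close>, all composites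
  \<open>U \<rightarrow> R \<rightarrow> U\<close> would vanish, and the identity of
  \<open>U \<oplus> U\<close> would be given by a 2 by 2 matrix of scalars \<open>y_i x_j\<close>,
  which has rank at most one.\<close>

lemma brick_double:
  assumes b: "brick I U" and R: "wfm I R" and r: "ret I (dsum U U) (dsum U R)"
  shows "ret I U R"
proof (rule ccontr)
  assume no: "\<not> ret I U R"
  have U: "wfm I U" "fst U > 0" using b by (auto simp: brick_def)
  obtain f g where f: "lh I (dsum U U) (dsum U R) f" and g: "lh I (dsum U R) (dsum U U) g"
    and gf: "\<And>v. v \<in> vs (dsum U U) \<Longrightarrow> g (f v) = v"
    using r by (rule retE) blast
  \<comment> \<open>A composite \<open>U \<rightarrow> U \<oplus> R \<rightarrow> U\<close> is the
    product of the two scalars seen at the summand \<open>U\<close>, since its part through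
    \<open>R\<close> is zero.\<close>
  have comp: "\<exists>y. \<forall>f'. lh I U (dsum U R) f' \<longrightarrow> (\<forall>x. (\<forall>v\<in>vs U. p1 U R (f' v) = x \<cdot>\<^sub>v v) \<longrightarrow> (\<forall>v\<in>vs U. g' (f' v) = (y * x) \<cdot>\<^sub>v v))"
    if g': "lh I (dsum U R) U g'" for g'
  proof -
    obtain y where y: "\<And>v. v \<in> vs U \<Longrightarrow> g' (i1 U R v) = y \<cdot>\<^sub>v v" using brickE[OF b lh_comp[OF lh_i1[OF U(1) R] g']] by blast
    have "g' (f' v) = (y * x) \<cdot>\<^sub>v v"
      if f': "lh I U (dsum U R) f'" and x: "\<forall>v\<in>vs U. p1 U R (f' v) = x \<cdot>\<^sub>v v" and v: "v \<in> vs U" for f' x v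
    proof -
      note f2 = lh_comp[OF f' lh_p2[OF U(1) R]] and g2 = lh_comp[OF lh_i2[OF U(1) R] g']
      obtain z where z: "\<And>v. v \<in> vs U \<Longrightarrow> g' (i2 U R (p2 U R (f' v))) = z \<cdot>\<^sub>v v" using brickE[OF b lh_comp[OF f2 g2]] by blast
      have z0: "z = 0" using scalar_ret[OF f2 g2 U(1) z] no by blast
      have "g' (f' v) = g' (i1 U R (p1 U R (f' v)) + i2 U R (p2 U R (f' v)))" using i_p[OF lh_closed[OF f' v]] by simp
      also have "\<dots> = y \<cdot>\<^sub>v (x \<cdot>\<^sub>v v) + z \<cdot>\<^sub>v v" using v x by (subst lh_add[OF g']) (auto simp: y z)
      finally show ?thesis using v z0 by (simp add: smult_smult_assoc zero_smult_vec[OF v] right_zero_vec[of _ "fst U"])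
    qed
    then show ?thesis by blast
  qed
  note j1 = lh_i1[OF U(1) U(1)] and j2 = lh_i2[OF U(1) U(1)] and q1 = lh_p1[OF U(1) U(1)] and q2 = lh_p2[OF U(1) U(1)]
  note fa = lh_comp[OF j1 f] and fb = lh_comp[OF j2 f]
  obtain x1 where x1: "\<And>v. v \<in> vs U \<Longrightarrow> p1 U R (f (i1 U U v)) = x1 \<cdot>\<^sub>v v" using brickE[OF b lh_comp[OF fa lh_p1[OF U(1) R]]] by blast
  obtain x2 where x2: "\<And>v. v \<in> vs U \<Longrightarrow> p1 U R (f (i2 U U v)) = x2 \<cdot>\<^sub>v v" using brickE[OF b lh_comp[OF fb lh_p1[OF U(1) R]]] by blast
  obtain y1 where y1: "\<And>f' x v. lh I U (dsum U R) f' \<Longrightarrow> \<forall>v\<in>vs U. p1 U R (f' v) = x \<cdot>\<^sub>v v \<Longrightarrow> v \<in> vs U \<Longrightarrow> p1 U U (g (f' v)) = (y1 * x) \<cdot>\<^sub>v v"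
    using comp[OF lh_comp[OF g q1]] by blast
  obtain y2 where y2: "\<And>f' x v. lh I U (dsum U R) f' \<Longrightarrow> \<forall>v\<in>vs U. p1 U R (f' v) = x \<cdot>\<^sub>v v \<Longrightarrow> v \<in> vs U \<Longrightarrow> p2 U U (g (f' v)) = (y2 * x) \<cdot>\<^sub>v v"
    using comp[OF lh_comp[OF g q2]] by blast
  have "1 = y1 * x1"
    by (rule smult_cancel0[OF U(2)]) (use y1[OF fa, of x1] x1 gf in auto)
  moreover have "1 = y2 * x2"
    by (rule smult_cancel0[OF U(2)]) (use y2[OF fb, of x2] x2 gf in auto)
  moreover have "0 = y1 * x2"
    by (rule smult_cancel0[OF U(2)]) (use y1[OF fb, of x2] x2 gf in \<open>auto simp: zero_smult_vec\<close>)
  ultimately show False by auto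
qed

section \<open>Categories of modules given by matrices\<close>

text \<open>Instantiated for the representations of the quiver and for the right modules over the
  endomorphism algebra. By \<open>mods_ret\<close> the complement of a summand is again in the
  category, so decompositions can be continued.\<close>

locale modcat =
  fixes I :: "'i set" and mods :: "('i,'k::field) md set"
  assumes mods_wfm: "X \<in> mods \<Longrightarrow> wfm I X"
    and mods_zmod: "zmod \<in> mods"
    and mods_dsum: "X \<in> mods \<Longrightarrow> Y \<in> mods \<Longrightarrow> dsum X Y \<in> mods"
    and mods_ret: "X \<in> mods \<Longrightarrow> wfm I Z \<Longrightarrow> ret I Z X \<Longrightarrow> Z \<in> mods"
begin

lemma mods_iso: "X \<in> mods \<Longrightarrow> Y \<in> mods \<Longrightarrow> iso I X Y \<longleftrightarrow> eqv I X Y"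
  by (intro iso_iff_eqv mods_wfm)

lemma ret_split_mods:
  assumes "U \<in> mods" "X \<in> mods" "ret I U X" obtains Z where "Z \<in> mods" "eqv I X (dsum U Z)"
proof -
  obtain Z where Z: "wfm I Z" "eqv I X (dsum U Z)" using ret_split[OF mods_wfm mods_wfm] assms by blast
  have "ret I Z X"
    by (rule ret_trans[OF ret_dsum2[OF mods_wfm[OF assms(1)] Z(1)] eqv_ret[OF eqv_sym[OF Z(2)]]])
  then show ?thesis using that Z mods_ret[OF assms(2)] by blast
qed

lemma summand_iff:
  assumes "X \<in> mods" "Y \<in> mods" shows "summand mods I X Y \<longleftrightarrow> ret I X Y"
proof
  assume "summand mods I X Y"
  then obtain Z where Z: "Z \<in> mods" "eqv I Y (dsum X Z)" using assms mods_iso mods_dsum by (auto simp: summand_def)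
  show "ret I X Y"
    by (rule ret_trans[OF ret_dsum1 eqv_ret[OF eqv_sym[OF Z(2)]]]) (use assms Z mods_wfm in auto)
next
  assume "ret I X Y"
  then obtain Z where "Z \<in> mods" "eqv I Y (dsum X Z)" using ret_split_mods assms by blast
  then show "summand mods I X Y" using assms mods_iso mods_dsum by (auto simp: summand_def)
qed

lemma indec_ret:
  assumes X: "indec mods I X" and U: "U \<in> mods" "ret I U X" "fst U > 0" shows "eqv I X U"
proof -
  have Xm: "X \<in> mods" using X by (simp add: indec_def)
  obtain Z where Z: "Z \<in> mods" "eqv I X (dsum U Z)" using ret_split_mods[OF U(1) Xm U(2)] .
  then have "iso I X (dsum U Z)" using mods_iso mods_dsum Xm U by blast
  then have "fst Z = 0" using X U Z by (auto simp: indec_def)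
  then show ?thesis using eqv_trans[OF Z(2) eqv_dsum_zero] mods_wfm Z U by blast
qed

text \<open>For a decomposition into \<open>Y\<close> and \<open>Z\<close>, the projection onto
  \<open>Y\<close> is an endomorphism of \<open>U\<close>, hence a scalar; it would have to be 1
  because of \<open>Y\<close> and 0 because of \<open>Z\<close>.\<close>

lemma brick_indec:
  assumes b: "brick I U" and U: "U \<in> mods" shows "indec mods I U"
  unfolding indec_def
proof (intro conjI notI)
  show "fst U > 0" "U \<in> mods" using b U by (auto simp: brick_def)
  assume "\<exists>Y\<in>mods. \<exists>Z\<in>mods. 0 < fst Y \<and> 0 < fst Z \<and> iso I U (dsum Y Z)"
  then obtain Y Z where YZ: "Y \<in> mods" "Z \<in> mods" "0 < fst Y" "0 < fst Z" "iso I U (dsum Y Z)" by blast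
  have w: "wfm I Y" "wfm I Z" using YZ mods_wfm by auto
  have "eqv I U (dsum Y Z)" using YZ U mods_iso mods_dsum by blast
  then obtain f g where f: "lh I U (dsum Y Z) f" and g: "lh I (dsum Y Z) U g" and gf: "\<And>v. v \<in> vs U \<Longrightarrow> g (f v) = v"
    and fg: "\<And>v. v \<in> vs (dsum Y Z) \<Longrightarrow> f (g v) = v"
    by (rule eqvE) blast
  have "lh I U U (\<lambda>v. g (i1 Y Z (p1 Y Z (f v))))"
    by (rule lh_comp[OF lh_comp[OF lh_comp[OF f lh_p1[OF w]] lh_i1[OF w]] g])
  then obtain k where k: "\<And>v. v \<in> vs U \<Longrightarrow> g (i1 Y Z (p1 Y Z (f v))) = k \<cdot>\<^sub>v v" using brickE[OF b] by blast
  have k1: "k = 1"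
  proof (rule smult_cancel0[OF YZ(3)])
    fix y assume y: "y \<in> vs Y"
    have iy: "i1 Y Z y \<in> vs (dsum Y Z)" using y by simp
    have "g (i1 Y Z y) = k \<cdot>\<^sub>v g (i1 Y Z y)" using k[OF lh_closed[OF g iy]] fg[OF iy] y by simp
    then have "f (g (i1 Y Z y)) = k \<cdot>\<^sub>v f (g (i1 Y Z y))" using lh_smult[OF f lh_closed[OF g iy]] by metis
    then have "i1 Y Z y = k \<cdot>\<^sub>v i1 Y Z y" using fg[OF iy] by simp
    then have "p1 Y Z (i1 Y Z y) = k \<cdot>\<^sub>v p1 Y Z (i1 Y Z y)" using lh_smult[OF lh_p1[OF w] iy] by metis
    then show "k \<cdot>\<^sub>v y = 1 \<cdot>\<^sub>v y" using y by simp
  qed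
  have k0: "k = 0"
  proof (rule smult_cancel0[OF YZ(4)])
    fix y assume y: "y \<in> vs Z"
    have iy: "i2 Y Z y \<in> vs (dsum Y Z)" using y by simp
    have "0\<^sub>v (fst U) = k \<cdot>\<^sub>v g (i2 Y Z y)"
      using k[OF lh_closed[OF g iy]] fg[OF iy] y lh_zero[OF lh_comp[OF lh_i1[OF w] g]] by simp
    then have "f (0\<^sub>v (fst U)) = k \<cdot>\<^sub>v f (g (i2 Y Z y))" using lh_smult[OF f lh_closed[OF g iy]] by metis
    then have "0\<^sub>v (fst (dsum Y Z)) = k \<cdot>\<^sub>v i2 Y Z y" using fg[OF iy] lh_zero[OF f] by simp
    then have "p2 Y Z (0\<^sub>v (fst (dsum Y Z))) = k \<cdot>\<^sub>v p2 Y Z (i2 Y Z y)" using lh_smult[OF lh_p2[OF w] iy] by metis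
    then show "k \<cdot>\<^sub>v y = 0 \<cdot>\<^sub>v y" using y lh_zero[OF lh_p2[OF w]] by (simp add: zero_smult_vec[OF y])
  qed
  show False using k1 k0 by simp
qed

lemma proj_mods: "projective mods I P \<Longrightarrow> P \<in> mods" by (simp add: projective_def)

lemma proj_lift:
  assumes P: "projective mods I P" and XY: "X \<in> mods" "Y \<in> mods" and g: "lh I X Y g"
    and s: "\<And>v. v \<in> vs Y \<Longrightarrow> \<exists>u\<in>vs X. g u = v" and f: "lh I P Y f"
  obtains h where "lh I P X h" "\<And>v. v \<in> vs P \<Longrightarrow> g (h v) = f v"
proof -
  have Pm: "P \<in> mods" using P by (rule proj_mods)
  note w = mods_wfm[OF XY(1)] mods_wfm[OF XY(2)] mods_wfm[OF Pm]
  have "hom I X Y (mof (fst X) (fst Y) g)" "hom I P Y (mof (fst P) (fst Y) f)" using lh_hom w g f by blast+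
  moreover have "surjm (fst X) (fst Y) (mof (fst X) (fst Y) g)"
    using s unfolding surjm_def by (metis mof_mult[OF lh_lin[OF g]])
  ultimately obtain h where h: "hom I P X h" "mof (fst X) (fst Y) g * h = mof (fst P) (fst Y) f"
    using P XY unfolding projective_def by blast
  have hc: "h \<in> carrier_mat (fst X) (fst P)" using h by (simp add: hom_def)
  show ?thesis
  proof (rule that[OF hom_lh[OF w(3,1) h(1)]])
    fix v assume v: "v \<in> vs P"
    have "g (h *\<^sub>v v) = mof (fst X) (fst Y) g *\<^sub>v (h *\<^sub>v v)"
      using mof_mult[OF lh_lin[OF g]] hc v by simp
    also have "\<dots> = f v" using assoc_mult_mat_vec[OF mof_carrier hc v] h(2) mof_mult[OF lh_lin[OF f] v] by metis
    finally show "g (h *\<^sub>v v) = f v" .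
  qed
qed

lemma projI:
  assumes Pm: "P \<in> mods"
    and l: "\<And>X Y g f. X \<in> mods \<Longrightarrow> Y \<in> mods \<Longrightarrow> lh I X Y g \<Longrightarrow> (\<And>v. v \<in> vs Y \<Longrightarrow> \<exists>u\<in>vs X. g u = v) \<Longrightarrow> lh I P Y f
      \<Longrightarrow> \<exists>h. lh I P X h \<and> (\<forall>v\<in>vs P. g (h v) = f v)"
  shows "projective mods I P"
  unfolding projective_def
proof (intro conjI ballI allI impI Pm)
  fix X Y g f assume X: "X \<in> mods" and Y: "Y \<in> mods" and "hom I X Y g \<and> surjm (fst X) (fst Y) g \<and> hom I P Y f"
  then have h: "hom I X Y g" "surjm (fst X) (fst Y) g" "hom I P Y f" by auto
  note w = mods_wfm[OF X] mods_wfm[OF Y] mods_wfm[OF Pm]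
  have c: "g \<in> carrier_mat (fst Y) (fst X)" "f \<in> carrier_mat (fst Y) (fst P)" using h by (auto simp: hom_def)
  obtain k where k: "lh I P X k" "\<forall>v\<in>vs P. g *\<^sub>v (k v) = f *\<^sub>v v"
    using l[OF X Y hom_lh[OF w(1,2) h(1)] _ hom_lh[OF w(3,2) h(3)]] h(2) by (auto simp: surjm_def)
  show "\<exists>h. hom I P X h \<and> g * h = f"
  proof (intro exI conjI)
    show "hom I P X (mof (fst P) (fst X) k)" by (rule lh_hom[OF w(3,1) k(1)])
    show "g * mof (fst P) (fst X) k = f"
    proof (rule mat_eq_vecI[OF mult_carrier_mat[OF c(1) mof_carrier] c(2)])
      fix v assume v: "v \<in> vs P"
      show "(g * mof (fst P) (fst X) k) *\<^sub>v v = f *\<^sub>v v"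
        using assoc_mult_mat_vec[OF c(1) mof_carrier v] mof_mult[OF lh_lin[OF k(1)] v] k(2) v by metis
    qed
  qed
qed

lemma proj_ret:
  assumes P: "projective mods I P" and Q: "Q \<in> mods" "ret I Q P" shows "projective mods I Q"
proof (rule projI[OF Q(1)])
  fix X Y g f assume h: "X \<in> mods" "Y \<in> mods" "lh I X Y g" "\<And>v. v \<in> vs Y \<Longrightarrow> \<exists>u\<in>vs X. g u = v" "lh I Q Y f"
  obtain a b where ab: "lh I Q P a" "lh I P Q b" "\<And>v. v \<in> vs Q \<Longrightarrow> b (a v) = v" using Q(2) by (rule retE) blast
  obtain k where k: "lh I P X k" "\<And>v. v \<in> vs P \<Longrightarrow> g (k v) = f (b v)"
    using proj_lift[OF P h(1-4) lh_comp[OF ab(2) h(5)]] by blast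
  show "\<exists>h. lh I Q X h \<and> (\<forall>v\<in>vs Q. g (h v) = f v)"
    using lh_comp[OF ab(1) k(1)] k(2)[OF lh_closed[OF ab(1)]] ab(3) by auto
qed

lemma proj_dsum:
  assumes P: "projective mods I P" and Q: "projective mods I Q" shows "projective mods I (dsum P Q)"
proof (rule projI)
  have m: "P \<in> mods" "Q \<in> mods" using P Q proj_mods by auto
  note w = mods_wfm[OF m(1)] mods_wfm[OF m(2)]
  show "dsum P Q \<in> mods" using m by (rule mods_dsum)
  fix X Y g f assume h: "X \<in> mods" "Y \<in> mods" "lh I X Y g" "\<And>v. v \<in> vs Y \<Longrightarrow> \<exists>u\<in>vs X. g u = v" "lh I (dsum P Q) Y f"
  obtain a where a: "lh I P X a" "\<And>v. v \<in> vs P \<Longrightarrow> g (a v) = f (i1 P Q v)"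
    using proj_lift[OF P h(1-4) lh_comp[OF lh_i1[OF w] h(5)]] by blast
  obtain b where b: "lh I Q X b" "\<And>v. v \<in> vs Q \<Longrightarrow> g (b v) = f (i2 P Q v)"
    using proj_lift[OF Q h(1-4) lh_comp[OF lh_i2[OF w] h(5)]] by blast
  have "g (cop P Q a b v) = f v" if v: "v \<in> vs (dsum P Q)" for v
  proof -
    have "g (cop P Q a b v) = f (i1 P Q (p1 P Q v)) + f (i2 P Q (p2 P Q v))"
      by (simp add: cop_def lh_add[OF h(3)] lh_closed[OF a(1)] lh_closed[OF b(1)] a(2) b(2))
    also have "\<dots> = f (i1 P Q (p1 P Q v) + i2 P Q (p2 P Q v))" by (subst lh_add[OF h(5)]) auto
    finally show ?thesis by (simp only: i_p[OF v])
  qed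
  then show "\<exists>k. lh I (dsum P Q) X k \<and> (\<forall>v\<in>vs (dsum P Q). g (k v) = f v)"
    using lh_cop[OF w mods_wfm[OF h(1)] a(1) b(1)] by blast
qed

lemma proj_zmod: "projective mods I zmod"
proof (rule projI[OF mods_zmod])
  fix X Y g f assume h: "X \<in> mods" "Y \<in> mods" "lh I X Y g" "lh I zmod Y f"
  have "g (0\<^sub>v (fst X)) = f v" if "v \<in> vs zmod" for v :: "'k vec"
  proof -
    have "v = 0\<^sub>v 0" using that by (intro vec0_eq) auto
    then show ?thesis using lh_zero[OF h(3)] lh_zero[OF h(4)] by simp
  qed
  then show "\<exists>k. lh I zmod X k \<and> (\<forall>v\<in>vs zmod. g (k v) = f v)" using lh_const0[OF mods_wfm[OF h(1)]] by blast
qed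

end

section \<open>Thin modules\<close>

text \<open>The algebra acting has a basis \<open>ix c c'\<close> indexed by pairs of points of \<open>C\<close> whose labels are
  related by \<open>RL\<close>, and the product of \<open>ix c c'\<close> and \<open>ix c' c''\<close> is \<open>ix c c''\<close> or zero. Points with
  the same label are interchangeable; \<open>rp\<close> picks one point for each label. A set \<open>A\<close> of labels gives
  the thin module \<open>th A\<close>, one-dimensional at each point whose label lies in \<open>A\<close>.\<close>

locale thin0 =
  fixes C :: "nat set" and lab :: "nat \<Rightarrow> 'l" and J :: "'l set" and RL :: "'l \<Rightarrow> 'l \<Rightarrow> bool"
    and rp :: "'l \<Rightarrow> nat" and co :: "'i \<Rightarrow> nat \<Rightarrow> nat \<Rightarrow> 'k::field"
  assumes finC: "finite C" and lab: "c \<in> C \<Longrightarrow> lab c \<in> J"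
    and rp: "j \<in> J \<Longrightarrow> rp j \<in> C" "j \<in> J \<Longrightarrow> lab (rp j) = j"
    and RL_refl: "j \<in> J \<Longrightarrow> RL j j"
    and RL_assoc: "x \<in> J \<Longrightarrow> i \<in> J \<Longrightarrow> j \<in> J \<Longrightarrow> k \<in> J \<Longrightarrow> RL x i \<Longrightarrow> RL i j \<Longrightarrow> RL j k \<Longrightarrow> RL x k \<Longrightarrow> RL x j \<longleftrightarrow> RL i k"
begin

definition sc where "sc A = {c\<in>C. lab c \<in> A}"
definition en where "en A = sorted_list_of_set (sc A)"
text \<open>The coefficients enter transposed: in a right module, \<open>ix c c'\<close> carries the
  coordinate at \<open>c\<close> to the coordinate at \<open>c'\<close>.\<close>

definition th :: "'l set \<Rightarrow> ('i,'k) md" where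
  "th A = (card (sc A), \<lambda>g. mat (card (sc A)) (card (sc A)) (\<lambda>(i,k). co g (en A ! k) (en A ! i)))"
definition ps where "ps A c = (SOME i. i < card (sc A) \<and> en A ! i = c)"
definition cd :: "'l set \<Rightarrow> nat \<Rightarrow> 'k vec \<Rightarrow> 'k" where "cd A c v = v $ ps A c"
definition mk :: "'l set \<Rightarrow> (nat \<Rightarrow> 'k) \<Rightarrow> 'k vec" where "mk A F = vec (card (sc A)) (\<lambda>i. F (en A ! i))"
definition bs :: "'l set \<Rightarrow> nat \<Rightarrow> 'k vec" where "bs A c = mk A (\<lambda>c'. if c' = c then 1 else 0)"
definition R where "R c c' \<longleftrightarrow> c \<in> C \<and> c' \<in> C \<and> RL (lab c) (lab c')"
text \<open>In \<open>th A\<close> the structure map between two related labels of \<open>A\<close>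
  is the identity. A composite through \<open>j\<close> is therefore non-zero iff \<open>j\<close>
  lies in \<open>A\<close>, while the corresponding product in the algebra is non-zero iff
  \<open>RL i k\<close>; these two have to agree for \<open>th A\<close> to be a module.\<close>

definition tconv where "tconv A \<longleftrightarrow> (\<forall>i\<in>A. \<forall>k\<in>A. \<forall>j\<in>J. RL i j \<and> RL j k \<longrightarrow> (j \<in> A \<longleftrightarrow> RL i k))"
text \<open>The scalars of an endomorphism of \<open>th A\<close> agree at related labels. A label
  related to all others therefore makes the endomorphism a single scalar, so that
  \<open>th A\<close> is a brick.\<close>

definition star where "star A \<longleftrightarrow> (\<exists>j0\<in>A. \<forall>j\<in>A. RL j0 j \<or> RL j j0)"
definition good where "good A \<longleftrightarrow> A \<subseteq> J \<and> tconv A \<and> star A"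
text \<open>The support of the indecomposable projective right module at \<open>x\<close>: the
  labels \<open>j\<close> for which the algebra has a basis element from \<open>x\<close> to
  \<open>j\<close>.\<close>

definition PP where "PP x = {j\<in>J. RL x j}"

lemma finsc [simp]: "finite (sc A)" by (simp add: sc_def finC)

lemma en_props: "length (en A) = card (sc A)" "set (en A) = sc A" "distinct (en A)"
  by (simp_all add: en_def)

lemma ps: assumes "c \<in> sc A" shows "ps A c < card (sc A)" "en A ! ps A c = c"
proof -
  have "\<exists>i. i < card (sc A) \<and> en A ! i = c" using assms en_props(1,2)[of A] by (metis in_set_conv_nth)
  then show "ps A c < card (sc A)" "en A ! ps A c = c" unfolding ps_def by (metis (mono_tags, lifting) someI_ex)+
qed

lemma ps_en: "i < card (sc A) \<Longrightarrow> ps A (en A ! i) = i \<and> en A ! i \<in> sc A"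
  using ps[of "en A ! i" A] en_props[of A] by (metis nth_eq_iff_index_eq nth_mem)

lemma fst_th [simp]: "fst (th A) = card (sc A)" by (simp add: th_def)

lemma mk_carrier [simp]: "mk A F \<in> carrier_vec (card (sc A))" by (simp add: mk_def)
lemma bs_carrier [simp]: "bs A c \<in> carrier_vec (card (sc A))" by (simp add: bs_def)

lemma cd_mk [simp]: "c \<in> sc A \<Longrightarrow> cd A c (mk A F) = F c"
  using ps[of c A] by (simp add: cd_def mk_def)

lemma cd_bs [simp]: "c \<in> sc A \<Longrightarrow> cd A c (bs A c') = (if c = c' then 1 else 0)"
  by (simp add: bs_def)

lemma cd_eqI: "v \<in> carrier_vec (card (sc A)) \<Longrightarrow> w \<in> carrier_vec (card (sc A)) \<Longrightarrow> (\<And>c. c \<in> sc A \<Longrightarrow> cd A c v = cd A c w) \<Longrightarrow> v = w"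
  by (rule eq_vecI) (auto simp: cd_def, metis ps_en)

lemma cd_linf: "c \<in> sc A \<Longrightarrow> linf (card (sc A)) (cd A c)"
  using ps[of c A] unfolding cd_def by (intro linf_index) auto

lemmas cd_add = linf_add[OF cd_linf]
lemmas cd_smult = linf_smult[OF cd_linf]
lemmas cd_zero = linf_zero[OF cd_linf]

lemma cd_vsum:
  "c \<in> sc A \<Longrightarrow> cd A c (vsum (card (sc A)) F B) = (\<Sum>b\<in>B. cd A c (F b))"
  using ps[of c A] by (simp add: cd_def)

lemma sum_en: "(\<Sum>i = 0..<card (sc A). f (en A ! i)) = (\<Sum>c\<in>sc A. f c)"
proof -
  have "(\<Sum>c\<in>sc A. f c) = sum_list (map f (en A))"
    using en_props[of A] by (metis sum_list_distinct_conv_sum_set)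
  also have "\<dots> = (\<Sum>i = 0..<card (sc A). f (en A ! i))"
    by (simp add: sum_list_sum_nth en_props)
  finally show ?thesis by simp
qed

lemma cd_act:
  assumes "c \<in> sc A" "v \<in> carrier_vec (card (sc A))"
  shows "cd A c (snd (th A) g *\<^sub>v v) = (\<Sum>c'\<in>sc A. co g c' c * cd A c' v)"
proof -
  have "cd A c (snd (th A) g *\<^sub>v v) = (\<Sum>i = 0..<card (sc A). co g (en A ! i) c * v $ i)"
    using assms(2) ps[OF assms(1)] by (simp add: cd_def th_def scalar_prod_def)
  also have "\<dots> = (\<Sum>i = 0..<card (sc A). co g (en A ! i) c * cd A (en A ! i) v)"
    by (intro sum.cong) (auto simp: cd_def ps_en)
  finally show ?thesis using sum_en[where f="\<lambda>c'. co g c' c * cd A c' v"] by simp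
qed

lemma th_wfm: "wfm I (th A)" by (simp add: wfm_def th_def)

lemma sc_iff: "c \<in> sc A \<longleftrightarrow> c \<in> C \<and> lab c \<in> A" by (simp add: sc_def)

lemma rp_sc [simp]: "j \<in> J \<Longrightarrow> rp j \<in> sc A \<longleftrightarrow> j \<in> A" by (simp add: sc_def rp)

lemma R_rp [simp]: "i \<in> J \<Longrightarrow> j \<in> J \<Longrightarrow> R (rp i) (rp j) \<longleftrightarrow> RL i j" by (simp add: R_def rp)

lemma bs_expand: "v \<in> carrier_vec (card (sc A)) \<Longrightarrow> vsum (card (sc A)) (\<lambda>c. cd A c v \<cdot>\<^sub>v bs A c) (sc A) = v"
proof (rule cd_eqI)
  fix c assume v: "v \<in> carrier_vec (card (sc A))" and c: "c \<in> sc A"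
  have "(\<Sum>b\<in>sc A. cd A c (cd A b v \<cdot>\<^sub>v bs A b)) = (\<Sum>b\<in>sc A. if b = c then cd A c v else 0)"
    by (intro sum.cong) (auto simp: cd_smult[OF c] c)
  then show "cd A c (vsum (card (sc A)) (\<lambda>c. cd A c v \<cdot>\<^sub>v bs A c) (sc A)) = cd A c v"
    using c by (simp add: cd_vsum)
qed auto

text \<open>The condition \<open>tconv\<close> for this set is \<open>RL_assoc\<close> with
  \<open>x\<close> in the first place, and \<open>x\<close> itself is the centre.\<close>

lemma PP_good: assumes "x \<in> J" shows "good (PP x)"
proof -
  have "tconv (PP x)"
    unfolding tconv_def
  proof (intro ballI impI)
    fix i k j assume "i \<in> PP x" "k \<in> PP x" "j \<in> J" "RL i j \<and> RL j k"
    then show "(j \<in> PP x) = RL i k" using RL_assoc[of x i j k] assms by (simp add: PP_def)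
  qed
  moreover have "star (PP x)" unfolding star_def PP_def using assms RL_refl by auto
  ultimately show ?thesis unfolding good_def PP_def by blast
qed

lemma good_nonempty: "good A \<Longrightarrow> A \<noteq> {}" by (auto simp: good_def star_def)

end

text \<open>Over \<Lambda> only idempotents and arrows act, over \<Gamma> the whole algebra; the
  axioms are what both share. \<open>mod_faith\<close> expresses that modules are unital, and
  \<open>lh_ext\<close> that commuting with the elements \<open>ix c c'\<close> suffices for a
  homomorphism. In \<open>mod_mul\<close> the left factor of a product acts before the right one, as
  in a right module.\<close>

locale thincat = thin0 C lab J RL rp co + modcat I mods
  for C :: "nat set" and lab :: "nat \<Rightarrow> 'l" and J RL rp and co :: "'i \<Rightarrow> nat \<Rightarrow> nat \<Rightarrow> 'k::field" and I mods +
  fixes ix :: "nat \<Rightarrow> nat \<Rightarrow> 'i"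
  assumes ixI: "R c c' \<Longrightarrow> ix c c' \<in> I"
    and co_ix: "R x y \<Longrightarrow> c \<in> C \<Longrightarrow> c' \<in> C \<Longrightarrow> co (ix x y) c c' = (if c = x \<and> c' = y then 1 else 0)"
    and mod_mul: "X \<in> mods \<Longrightarrow> R c c' \<Longrightarrow> R c' c'' \<Longrightarrow> v \<in> vs X \<Longrightarrow>
       snd X (ix c' c'') *\<^sub>v (snd X (ix c c') *\<^sub>v v) = (if R c c'' then snd X (ix c c'') *\<^sub>v v else 0\<^sub>v (fst X))"
    and mod_orth: "X \<in> mods \<Longrightarrow> R a b \<Longrightarrow> R c d \<Longrightarrow> b \<noteq> c \<Longrightarrow> v \<in> vs X \<Longrightarrow>
       snd X (ix c d) *\<^sub>v (snd X (ix a b) *\<^sub>v v) = 0\<^sub>v (fst X)"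
    and mod_faith: "X \<in> mods \<Longrightarrow> v \<in> vs X \<Longrightarrow> (\<And>c. c \<in> C \<Longrightarrow> snd X (ix c c) *\<^sub>v v = 0\<^sub>v (fst X)) \<Longrightarrow> v = 0\<^sub>v (fst X)"
    and lh_ext: "X \<in> mods \<Longrightarrow> Y \<in> mods \<Longrightarrow> lin (fst X) (fst Y) f \<Longrightarrow>
       (\<And>c c' v. R c c' \<Longrightarrow> v \<in> vs X \<Longrightarrow> f (snd X (ix c c') *\<^sub>v v) = snd Y (ix c c') *\<^sub>v f v) \<Longrightarrow> lh I X Y f"
    and th_mods: "A \<subseteq> J \<Longrightarrow> tconv A \<Longrightarrow> th A \<in> mods"
begin

section \<open>Spaces at a label and structure maps\<close>

abbreviation ac :: "('i,'k) md \<Rightarrow> nat \<Rightarrow> nat \<Rightarrow> 'k vec \<Rightarrow> 'k vec" where "ac X c c' v \<equiv> snd X (ix c c') *\<^sub>v v"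

text \<open>The part of \<open>X\<close> at the chosen point of label \<open>j\<close>, cut out by
  an idempotent. Points with the same label carry isomorphic parts, so one point for each label is
  enough.\<close>

definition Tv :: "('i,'k) md \<Rightarrow> 'l \<Rightarrow> 'k vec set" where "Tv X j = {v\<in>vs X. ac X (rp j) (rp j) v = v}"
definition al :: "('i,'k) md \<Rightarrow> 'l \<Rightarrow> 'l \<Rightarrow> 'k vec \<Rightarrow> 'k vec" where "al X i j v = ac X (rp i) (rp j) v"

lemma R_refl: "c \<in> C \<Longrightarrow> R c c" by (simp add: R_def RL_refl lab)

lemma ac_lin: "X \<in> mods \<Longrightarrow> R c c' \<Longrightarrow> lin (fst X) (fst X) (ac X c c')"
  by (intro wfm_lin[OF mods_wfm] ixI)

lemma ac_closed: "X \<in> mods \<Longrightarrow> R c c' \<Longrightarrow> v \<in> vs X \<Longrightarrow> ac X c c' v \<in> vs X"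
  by (intro wfm_act[OF mods_wfm] ixI)

lemma ac_zero: "X \<in> mods \<Longrightarrow> R c c' \<Longrightarrow> ac X c c' (0\<^sub>v (fst X)) = 0\<^sub>v (fst X)"
  using lin_zero[OF ac_lin] .

lemma lh_ac: "lh I X Y f \<Longrightarrow> R c c' \<Longrightarrow> v \<in> vs X \<Longrightarrow> f (ac X c c' v) = ac Y c c' (f v)"
  by (rule lh_act[OF _ ixI])

lemma al_lin: "X \<in> mods \<Longrightarrow> i \<in> J \<Longrightarrow> j \<in> J \<Longrightarrow> RL i j \<Longrightarrow> lin (fst X) (fst X) (al X i j)"
  unfolding al_def[abs_def] by (intro ac_lin) auto

lemma al_zero: "X \<in> mods \<Longrightarrow> i \<in> J \<Longrightarrow> j \<in> J \<Longrightarrow> RL i j \<Longrightarrow> al X i j (0\<^sub>v (fst X)) = 0\<^sub>v (fst X)"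
  using lin_zero[OF al_lin] .

lemma al_closed: "X \<in> mods \<Longrightarrow> i \<in> J \<Longrightarrow> j \<in> J \<Longrightarrow> RL i j \<Longrightarrow> v \<in> vs X \<Longrightarrow> al X i j v \<in> vs X"
  using lin_closed[OF al_lin] .

lemma Tv_vs: "v \<in> Tv X j \<Longrightarrow> v \<in> vs X" by (simp add: Tv_def)

lemma al_id: "v \<in> Tv X j \<Longrightarrow> al X j j v = v" by (simp add: Tv_def al_def)

lemma al_comp: "X \<in> mods \<Longrightarrow> i \<in> J \<Longrightarrow> j \<in> J \<Longrightarrow> k \<in> J \<Longrightarrow> RL i j \<Longrightarrow> RL j k \<Longrightarrow> v \<in> vs X \<Longrightarrow>
   al X j k (al X i j v) = (if RL i k then al X i k v else 0\<^sub>v (fst X))"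
  unfolding al_def using mod_mul[of X "rp i" "rp j" "rp k" v] by simp

lemma al_Tv: "X \<in> mods \<Longrightarrow> i \<in> J \<Longrightarrow> j \<in> J \<Longrightarrow> RL i j \<Longrightarrow> v \<in> vs X \<Longrightarrow> al X i j v \<in> Tv X j"
  using al_comp[of X i j j v] by (simp add: Tv_def al_closed RL_refl) (simp add: al_def)

lemma ac_Tv: "X \<in> mods \<Longrightarrow> j \<in> J \<Longrightarrow> R c (rp j) \<Longrightarrow> v \<in> vs X \<Longrightarrow> ac X c (rp j) v \<in> Tv X j"
  using mod_mul[of X c "rp j" "rp j" v] by (simp add: Tv_def ac_closed RL_refl)

lemma Tv_zero: "X \<in> mods \<Longrightarrow> j \<in> J \<Longrightarrow> 0\<^sub>v (fst X) \<in> Tv X j"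
  using al_zero[of X j j] by (simp add: Tv_def al_def RL_refl)

lemma Tv_subsp: assumes "X \<in> mods" "j \<in> J" shows "subsp (fst X) (Tv X j)"
proof -
  have l: "lin (fst X) (fst X) (ac X (rp j) (rp j))" using assms RL_refl by (intro ac_lin) auto
  show ?thesis unfolding subsp_def using Tv_zero[OF assms]
    by (auto simp: Tv_def lin_add[OF l] lin_smult[OF l])
qed

lemma lh_al: "lh I X Y f \<Longrightarrow> i \<in> J \<Longrightarrow> j \<in> J \<Longrightarrow> RL i j \<Longrightarrow> v \<in> vs X \<Longrightarrow> f (al X i j v) = al Y i j (f v)"
  unfolding al_def by (intro lh_ac) auto

lemma lh_Tv: "lh I X Y f \<Longrightarrow> j \<in> J \<Longrightarrow> v \<in> Tv X j \<Longrightarrow> f v \<in> Tv Y j"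
  unfolding Tv_def using lh_ac[of X Y f "rp j" "rp j" v] by (auto simp: lh_closed RL_refl)

text \<open>At any point \<open>c\<close> the idempotent factors through the chosen point with the
  same label, so it acts by zero if the space there is zero; \<open>mod_faith\<close>
  concludes.\<close>

lemma Tv_trivial:
  assumes X: "X \<in> mods" and z: "\<And>j v. j \<in> J \<Longrightarrow> v \<in> Tv X j \<Longrightarrow> v = 0\<^sub>v (fst X)" shows "fst X = 0"
proof (rule ccontr)
  assume n: "fst X \<noteq> 0"
  have "v = 0\<^sub>v (fst X)" if v: "v \<in> vs X" for v
  proof (rule mod_faith[OF X v])
    fix c assume c: "c \<in> C"
    let ?j = "lab c"
    have j: "?j \<in> J" using c by (rule lab)
    have r: "R c (rp ?j)" "R (rp ?j) c" "R c c" using c j by (auto simp: R_def rp RL_refl)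
    have "ac X c c v = ac X (rp ?j) c (ac X c (rp ?j) v)" using mod_mul[OF X r(1,2) v] r by simp
    also have "ac X c (rp ?j) v = 0\<^sub>v (fst X)" using z[OF j ac_Tv[OF X j r(1) v]] .
    finally show "ac X c c v = 0\<^sub>v (fst X)" using ac_zero[OF X r(2)] by simp
  qed
  from this[of "unit_vec (fst X) 0"] have "(unit_vec (fst X) 0 :: 'k vec) $ 0 = 0" using n by simp
  then show False using n by simp
qed

lemma th_ac:
  assumes r: "R x y" and v: "v \<in> vs (th A)" and c: "c \<in> sc A"
  shows "cd A c (ac (th A) x y v) = (if c = y \<and> x \<in> sc A then cd A x v else 0)"
proof -
  have "cd A c (ac (th A) x y v) = (\<Sum>c'\<in>sc A. co (ix x y) c' c * cd A c' v)"
    using v c by (subst cd_act) auto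
  also have "\<dots> = (\<Sum>c'\<in>sc A. if c' = x then (if c = y then cd A x v else 0) else 0)"
    using c by (intro sum.cong) (auto simp: co_ix[OF r] sc_iff)
  finally show ?thesis by simp
qed

lemma th_ac_bs:
  assumes r: "R x y" and "x \<in> sc A" shows "ac (th A) x y (bs A x) = (if y \<in> sc A then bs A y else 0\<^sub>v (card (sc A)))"
  by (rule cd_eqI[where A=A])
     (use assms in \<open>auto simp: th_ac cd_zero wfm_act[OF th_wfm ixI[OF r], of _ A, simplified]\<close>)

section \<open>Maps out of and into thin modules\<close>

definition outm :: "'l set \<Rightarrow> ('i,'k) md \<Rightarrow> ('l \<Rightarrow> 'k vec) \<Rightarrow> 'k vec \<Rightarrow> 'k vec" where
  "outm A X t v = vsum (fst X) (\<lambda>c. cd A c v \<cdot>\<^sub>v ac X (rp (lab c)) c (t (lab c))) (sc A)"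

definition inm :: "'l set \<Rightarrow> ('i,'k) md \<Rightarrow> ('l \<Rightarrow> 'k vec \<Rightarrow> 'k) \<Rightarrow> 'k vec \<Rightarrow> 'k vec" where
  "inm A X \<phi> v = mk A (\<lambda>c. \<phi> (lab c) (ac X c (rp (lab c)) v))"

lemma R_lab: "c \<in> C \<Longrightarrow> R c (rp (lab c))" "c \<in> C \<Longrightarrow> R (rp (lab c)) c"
  by (auto simp: R_def rp lab RL_refl)

lemma outm_term:
  assumes "X \<in> mods" "\<And>j. j \<in> A \<Longrightarrow> t j \<in> Tv X j" "c \<in> sc A" shows "ac X (rp (lab c)) c (t (lab c)) \<in> vs X"
  using assms by (intro ac_closed R_lab) (auto simp: sc_iff Tv_def)

text \<open>\<open>outm A X t\<close> sends the basis vector at \<open>c\<close> to the copy at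
  \<open>c\<close> of \<open>t (lab c)\<close>. By \<open>lh_ext\<close> only basis elements of the
  algebra are tested, and moving to representatives reduces these tests to \<open>tt\<close>:
  structure maps carry the family into itself, or to zero on leaving \<open>A\<close>.\<close>

lemma lh_outm:
  assumes A: "A \<subseteq> J" "tconv A" and X: "X \<in> mods" and t: "\<And>j. j \<in> A \<Longrightarrow> t j \<in> Tv X j"
    and tt: "\<And>i j. i \<in> A \<Longrightarrow> j \<in> J \<Longrightarrow> RL i j \<Longrightarrow> al X i j (t i) = (if j \<in> A then t j else 0\<^sub>v (fst X))"
  shows "lh I (th A) X (outm A X t)"
proof (rule lh_ext[OF th_mods[OF A] X])
  have oc: "\<And>c. c \<in> sc A \<Longrightarrow> ac X (rp (lab c)) c (t (lab c)) \<in> vs X" using outm_term[of X A t] X t by blast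
  show "lin (fst (th A)) (fst X) (outm A X t)"
  proof (rule linI)
    fix v w :: "'k vec" assume vw: "v \<in> vs (th A)" "w \<in> vs (th A)"
    have d: "\<And>c. c \<in> sc A \<Longrightarrow> dim_vec (ac X (rp (lab c)) c (t (lab c))) = fst X" using carrier_vecD[OF oc] by blast
    show "outm A X t (v + w) = outm A X t v + outm A X t w"
    proof (intro eq_vecI)
      fix i assume "i < dim_vec (outm A X t v + outm A X t w)"
      then have i: "i < fst X" by (simp add: outm_def vsum_def)
      show "outm A X t (v + w) $ i = (outm A X t v + outm A X t w) $ i"
        using i vw by (simp add: outm_def vsum_def sum.distrib[symmetric])
          (intro sum.cong, auto simp: cd_add algebra_simps d[simplified])
    qed (simp add: outm_def vsum_def)
  next
    fix a and v :: "'k vec" assume v: "v \<in> vs (th A)"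
    have d: "\<And>c. c \<in> sc A \<Longrightarrow> dim_vec (ac X (rp (lab c)) c (t (lab c))) = fst X" using carrier_vecD[OF oc] by blast
    show "outm A X t (a \<cdot>\<^sub>v v) = a \<cdot>\<^sub>v outm A X t v"
    proof (intro eq_vecI)
      fix i assume "i < dim_vec (a \<cdot>\<^sub>v outm A X t v)"
      then have i: "i < fst X" by (simp add: outm_def vsum_def)
      show "outm A X t (a \<cdot>\<^sub>v v) $ i = (a \<cdot>\<^sub>v outm A X t v) $ i"
        using i v by (simp add: outm_def vsum_def sum_distrib_left)
          (intro sum.cong, auto simp: cd_smult algebra_simps d[simplified])
    qed (simp add: outm_def vsum_def)
  qed (simp add: outm_def)
next
  have oc: "\<And>c. c \<in> sc A \<Longrightarrow> ac X (rp (lab c)) c (t (lab c)) \<in> vs X" using outm_term[of X A t] X t by blast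
  fix x y v assume r: "R x y" and v: "v \<in> vs (th A)"
  have xy: "x \<in> C" "y \<in> C" using r by (auto simp: R_def)
  have lhs: "outm A X t (ac (th A) x y v) = (if x \<in> sc A \<and> y \<in> sc A then cd A x v \<cdot>\<^sub>v ac X (rp (lab y)) y (t (lab y)) else 0\<^sub>v (fst X))"
  proof -
    have e: "outm A X t (ac (th A) x y v) = vsum (fst X) (\<lambda>c. if c = y \<and> x \<in> sc A then cd A x v \<cdot>\<^sub>v ac X (rp (lab c)) c (t (lab c)) else 0\<^sub>v (fst X)) (sc A)"
      unfolding outm_def
      by (rule vsum_cong) (auto simp: th_ac[OF r v] zero_smult_vec[OF oc])
    show ?thesis
    proof (cases "y \<in> sc A")
      case True
      show ?thesis unfolding e
        by (subst vsum_single[where a=y]) (use True oc in auto)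
    next
      case False
      have "vsum (fst X) (\<lambda>c. if c = y \<and> x \<in> sc A then cd A x v \<cdot>\<^sub>v ac X (rp (lab c)) c (t (lab c)) else 0\<^sub>v (fst X)) (sc A)
          = vsum (fst X) (\<lambda>c. 0\<^sub>v (fst X)) (sc A)"
        by (rule vsum_cong) (use False in auto)
      then show ?thesis unfolding e using False by (auto simp: vsum_def intro!: eq_vecI)
    qed
  qed
  have "ac X x y (outm A X t v) = vsum (fst X) (\<lambda>c. ac X x y (cd A c v \<cdot>\<^sub>v ac X (rp (lab c)) c (t (lab c)))) (sc A)"
    unfolding outm_def by (rule lin_vsum[OF ac_lin[OF X r]]) (use oc in auto)
  also have "\<dots> = vsum (fst X) (\<lambda>c. if c = x then cd A x v \<cdot>\<^sub>v ac X (rp (lab x)) y (t (lab x)) else 0\<^sub>v (fst X)) (sc A)"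
  proof (rule vsum_cong)
    fix c assume c: "c \<in> sc A"
    have tc: "t (lab c) \<in> vs X" using t[of "lab c"] c by (simp add: sc_iff Tv_def)
    have cC: "c \<in> C" using c by (simp add: sc_iff)
    have "ac X x y (cd A c v \<cdot>\<^sub>v ac X (rp (lab c)) c (t (lab c))) = cd A c v \<cdot>\<^sub>v ac X x y (ac X (rp (lab c)) c (t (lab c)))"
      by (rule lin_smult[OF ac_lin[OF X r] oc[OF c]])
    moreover have "R (rp (lab x)) y" using r by (simp add: R_def rp lab)
    ultimately show "ac X x y (cd A c v \<cdot>\<^sub>v ac X (rp (lab c)) c (t (lab c))) = (if c = x then cd A x v \<cdot>\<^sub>v ac X (rp (lab x)) y (t (lab x)) else 0\<^sub>v (fst X))"
      using mod_orth[OF X R_lab(2)[OF cC] r _ tc] mod_mul[OF X R_lab(2)[OF xy(1)] r] tc by auto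
  qed
  also have "\<dots> = (if x \<in> sc A then cd A x v \<cdot>\<^sub>v ac X (rp (lab x)) y (t (lab x)) else 0\<^sub>v (fst X))"
  proof (cases "x \<in> sc A")
    case True
    have "ac X (rp (lab x)) y (t (lab x)) \<in> vs X"
      using True t[of "lab x"] r by (intro ac_closed[OF X]) (auto simp: sc_iff Tv_def R_def rp lab)
    then show ?thesis by (subst vsum_single[where a=x]) (use True in auto)
  next
    case False
    have "vsum (fst X) (\<lambda>c. if c = x then cd A x v \<cdot>\<^sub>v ac X (rp (lab x)) y (t (lab x)) else 0\<^sub>v (fst X)) (sc A)
        = vsum (fst X) (\<lambda>c. 0\<^sub>v (fst X)) (sc A)"
      by (rule vsum_cong) (use False in auto)
    then show ?thesis using False by (auto simp: vsum_def intro!: eq_vecI)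
  qed
  also have "\<dots> = outm A X t (ac (th A) x y v)"
  proof (cases "x \<in> sc A")
    case True
    let ?i = "lab x" and ?j = "lab y"
    have ij: "?i \<in> A" "?i \<in> J" "?j \<in> J" "RL ?i ?j" using True r lab by (auto simp: sc_iff R_def)
    have ti: "t ?i \<in> vs X" using t[OF ij(1)] by (simp add: Tv_def)
    have rr: "R (rp ?i) (rp ?j)" "R (rp ?i) y" using ij r by (auto simp: R_def rp)
    have "ac X (rp ?i) y (t ?i) = ac X (rp ?j) y (al X ?i ?j (t ?i))"
      unfolding al_def using mod_mul[OF X rr(1) R_lab(2)[OF xy(2)] ti] rr by simp
    also have "\<dots> = (if y \<in> sc A then ac X (rp ?j) y (t ?j) else 0\<^sub>v (fst X))"
      using tt[OF ij(1,3,4)] xy ac_zero[OF X R_lab(2)[OF xy(2)]] by (auto simp: sc_iff)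
    finally show ?thesis unfolding lhs using True by auto
  qed (simp add: lhs)
  finally show "outm A X t (ac (th A) x y v) = ac X x y (outm A X t v)" by simp
qed

lemma outm_bs:
  assumes X: "X \<in> mods" and t: "\<And>j. j \<in> A \<Longrightarrow> t j \<in> Tv X j" and c: "c \<in> sc A"
  shows "outm A X t (bs A c) = ac X (rp (lab c)) c (t (lab c))"
  unfolding outm_def using c outm_term[of X A t] X t
  by (subst vsum_single[where a=c]) (auto simp: zero_smult_vec)

text \<open>Dual to \<open>lh_outm\<close>: the coordinate at \<open>c\<close> is a functional
  applied to the component at \<open>c\<close> moved to its representative. By \<open>pp\<close> the
  functionals pull back to one another along structure maps within \<open>A\<close>, and to zero
  along those entering \<open>A\<close> from outside.\<close>

lemma lh_inm:
  assumes A: "A \<subseteq> J" "tconv A" and X: "X \<in> mods" and p: "\<And>j. j \<in> A \<Longrightarrow> linf (fst X) (\<phi> j)"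
    and pp: "\<And>i j s. i \<in> J \<Longrightarrow> j \<in> A \<Longrightarrow> RL i j \<Longrightarrow> s \<in> Tv X i \<Longrightarrow> \<phi> j (al X i j s) = (if i \<in> A then \<phi> i s else 0)"
  shows "lh I X (th A) (inm A X \<phi>)"
proof (rule lh_ext[OF X th_mods[OF A]])
  have c: "inm A X \<phi> v \<in> vs (th A)" for v by (simp add: inm_def)
  have l: "linf (fst X) (\<lambda>v. \<phi> (lab c) (ac X c (rp (lab c)) v))" if "c \<in> sc A" for c
    using that by (intro linf_comp[OF p ac_lin[OF X]] R_lab) (auto simp: sc_iff)
  show "lin (fst X) (fst (th A)) (inm A X \<phi>)"
  proof (rule linI)
    fix v w assume v: "v \<in> vs X" "w \<in> vs X"
    show "inm A X \<phi> (v + w) = inm A X \<phi> v + inm A X \<phi> w"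
      by (rule cd_eqI[where A=A]) (use v in \<open>auto simp: inm_def cd_add linf_add[OF l]\<close>)
  next
    fix a v assume v: "v \<in> vs X"
    show "inm A X \<phi> (a \<cdot>\<^sub>v v) = a \<cdot>\<^sub>v inm A X \<phi> v"
      by (rule cd_eqI[where A=A]) (use v in \<open>auto simp: inm_def cd_smult linf_smult[OF l]\<close>)
  qed (simp add: inm_def)
  fix x y v assume r: "R x y" and v: "v \<in> vs X"
  have xy: "x \<in> C" "y \<in> C" using r by (auto simp: R_def)
  show "inm A X \<phi> (ac X x y v) = ac (th A) x y (inm A X \<phi> v)"
  proof (rule cd_eqI[where A=A])
    show "ac (th A) x y (inm A X \<phi> v) \<in> carrier_vec (card (sc A))"
      using wfm_act[OF th_wfm ixI[OF r], of _ A] by (simp add: inm_def)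
    fix c assume cs: "c \<in> sc A"
    have cC: "c \<in> C" using cs by (simp add: sc_iff)
    have rhs: "cd A c (ac (th A) x y (inm A X \<phi> v)) = (if c = y \<and> x \<in> sc A then \<phi> (lab x) (ac X x (rp (lab x)) v) else 0)"
      using th_ac[OF r c cs] by (simp add: inm_def)
    have "cd A c (inm A X \<phi> (ac X x y v)) = \<phi> (lab c) (ac X c (rp (lab c)) (ac X x y v))" using cs by (simp add: inm_def)
    also have "\<dots> = (if c = y \<and> x \<in> sc A then \<phi> (lab x) (ac X x (rp (lab x)) v) else 0)"
    proof (cases "c = y")
      case False
      then show ?thesis using mod_orth[OF X r R_lab(1)[OF cC] _ v] linf_zero[OF p] cs by (auto simp: sc_iff)
    next
      case True
      let ?i = "lab x" and ?j = "lab y"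
      have ij: "?i \<in> J" "?j \<in> A" "?j \<in> J" "RL ?i ?j" using cs True r lab by (auto simp: sc_iff R_def)
      have rr: "R x (rp ?j)" "R (rp ?i) (rp ?j)" using ij r by (auto simp: R_def rp)
      have "ac X y (rp ?j) (ac X x y v) = al X ?i ?j (ac X x (rp ?i) v)"
        unfolding al_def using mod_mul[OF X r R_lab(1)[OF xy(2)] v] mod_mul[OF X R_lab(1)[OF xy(1)] rr(2) v] rr by simp
      then have "\<phi> ?j (ac X y (rp ?j) (ac X x y v)) = (if ?i \<in> A then \<phi> ?i (ac X x (rp ?i) v) else 0)"
        using pp[OF ij(1,2,4) ac_Tv[OF X ij(1) R_lab(1)[OF xy(1)] v]] by simp
      then show ?thesis using True xy by (simp add: sc_iff)
    qed
    finally show "cd A c (inm A X \<phi> (ac X x y v)) = cd A c (ac (th A) x y (inm A X \<phi> v))" using rhs by simp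
  qed (simp add: inm_def)
qed

text \<open>The vectors give a map from \<open>th A\<close> to \<open>X\<close>, the functionals a
  map back, and the pairing 1 at each label makes the composite the identity. Every summand found
  later is produced by this criterion.\<close>

theorem split_family:
  assumes A: "A \<subseteq> J" "tconv A" and X: "X \<in> mods" and t: "\<And>j. j \<in> A \<Longrightarrow> t j \<in> Tv X j"
    and tt: "\<And>i j. i \<in> A \<Longrightarrow> j \<in> J \<Longrightarrow> RL i j \<Longrightarrow> al X i j (t i) = (if j \<in> A then t j else 0\<^sub>v (fst X))"
    and p: "\<And>j. j \<in> A \<Longrightarrow> linf (fst X) (\<phi> j)"
    and pp: "\<And>i j s. i \<in> J \<Longrightarrow> j \<in> A \<Longrightarrow> RL i j \<Longrightarrow> s \<in> Tv X i \<Longrightarrow> \<phi> j (al X i j s) = (if i \<in> A then \<phi> i s else 0)"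
    and pt: "\<And>j. j \<in> A \<Longrightarrow> \<phi> j (t j) = 1"
  shows "ret I (th A) X"
proof (rule retI[OF lh_outm[OF A X t tt] lh_inm[OF A X p pp]])
  fix v assume v: "v \<in> vs (th A)"
  have oc: "\<And>c. c \<in> sc A \<Longrightarrow> ac X (rp (lab c)) c (t (lab c)) \<in> vs X" using outm_term[of X A t] X t by blast
  show "inm A X \<phi> (outm A X t v) = v"
  proof (rule cd_eqI[where A=A])
    fix c assume cs: "c \<in> sc A"
    then have cC: "c \<in> C" "lab c \<in> A" by (auto simp: sc_iff)
    note r = R_lab(1)[OF cC(1)]
    have tc: "t (lab c) \<in> Tv X (lab c)" using t cC by simp
    have "ac X c (rp (lab c)) (outm A X t v) = vsum (fst X) (\<lambda>c'. ac X c (rp (lab c)) (cd A c' v \<cdot>\<^sub>v ac X (rp (lab c')) c' (t (lab c')))) (sc A)"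
      unfolding outm_def by (rule lin_vsum[OF ac_lin[OF X r]]) (use oc in auto)
    also have "\<dots> = vsum (fst X) (\<lambda>c'. if c' = c then cd A c v \<cdot>\<^sub>v t (lab c) else 0\<^sub>v (fst X)) (sc A)"
    proof (rule vsum_cong)
      fix c' assume c': "c' \<in> sc A"
      then have c'C: "c' \<in> C" "lab c' \<in> A" by (auto simp: sc_iff)
      have tc': "t (lab c') \<in> vs X" using t[OF c'C(2)] by (simp add: Tv_def)
      have j: "lab c \<in> J" using cC lab by blast
      have "ac X c (rp (lab c)) (ac X (rp (lab c)) c (t (lab c))) = t (lab c)"
        using mod_mul[OF X R_lab(2)[OF cC(1)] r] tc by (simp add: Tv_def j RL_refl)
      then show "ac X c (rp (lab c)) (cd A c' v \<cdot>\<^sub>v ac X (rp (lab c')) c' (t (lab c'))) = (if c' = c then cd A c v \<cdot>\<^sub>v t (lab c) else 0\<^sub>v (fst X))"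
        using lin_smult[OF ac_lin[OF X r] oc[OF c']] mod_orth[OF X R_lab(2)[OF c'C(1)] r _ tc'] by auto
    qed
    also have "\<dots> = cd A c v \<cdot>\<^sub>v t (lab c)"
      by (subst vsum_single[where a=c]) (use cs Tv_vs[OF tc] in auto)
    finally show "cd A c (inm A X \<phi> (outm A X t v)) = cd A c v"
      using cs linf_smult[OF p[OF cC(2)] Tv_vs[OF tc]] pt[OF cC(2)] by (simp add: inm_def)
  qed (use v in \<open>auto simp: inm_def\<close>)
qed

end

section \<open>Homomorphisms between thin modules\<close>

context thincat
begin

lemma lh_th_eq:
  assumes f: "lh I (th A) X f" and g: "lh I (th A) X g" and e: "\<And>c. c \<in> sc A \<Longrightarrow> f (bs A c) = g (bs A c)" and v: "v \<in> vs (th A)"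
  shows "f v = g v"
proof -
  have *: "h v = vsum (fst X) (\<lambda>c. cd A c v \<cdot>\<^sub>v h (bs A c)) (sc A)" if h: "lh I (th A) X h" for h
  proof -
    have "h v = h (vsum (card (sc A)) (\<lambda>c. cd A c v \<cdot>\<^sub>v bs A c) (sc A))" using v by (simp add: bs_expand)
    also have "\<dots> = vsum (fst X) (\<lambda>c. h (cd A c v \<cdot>\<^sub>v bs A c)) (sc A)"
      by (rule lin_vsum[of "card (sc A)", OF lh_lin[OF h, simplified]]) auto
    finally show ?thesis using lh_smult[OF h] by simp
  qed
  show ?thesis unfolding *[OF f] *[OF g] by (rule vsum_cong) (simp add: e)
qed

lemma al_bs: "i \<in> J \<Longrightarrow> j \<in> J \<Longrightarrow> RL i j \<Longrightarrow> i \<in> A \<Longrightarrow> al (th A) i j (bs A (rp i)) = (if j \<in> A then bs A (rp j) else 0\<^sub>v (card (sc A)))"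
  unfolding al_def using th_ac_bs[of "rp i" "rp j" A] by simp

lemma cd_al: "i \<in> J \<Longrightarrow> j \<in> J \<Longrightarrow> RL i j \<Longrightarrow> j \<in> A \<Longrightarrow> v \<in> vs (th A) \<Longrightarrow>
   cd A (rp j) (al (th A) i j v) = (if i \<in> A then cd A (rp i) v else 0)"
  unfolding al_def using th_ac[of "rp i" "rp j" v A "rp j"] by simp

lemma Tv_th:
  assumes j: "j \<in> J" and s: "s \<in> Tv (th A) j"
  shows "s = (if j \<in> A then cd A (rp j) s \<cdot>\<^sub>v bs A (rp j) else 0\<^sub>v (card (sc A)))"
proof -
  have v: "s \<in> vs (th A)" using Tv_vs[OF s] .
  have e: "s = ac (th A) (rp j) (rp j) s" using s by (simp add: Tv_def)
  have r: "R (rp j) (rp j)" using j by (simp add: RL_refl)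
  show ?thesis
  proof (rule cd_eqI[where A=A])
    fix c assume c: "c \<in> sc A"
    have "cd A c s = (if c = rp j \<and> rp j \<in> sc A then cd A (rp j) s else 0)"
      using th_ac[OF r v c] e by simp
    then show "cd A c s = cd A c (if j \<in> A then cd A (rp j) s \<cdot>\<^sub>v bs A (rp j) else 0\<^sub>v (card (sc A)))"
      using c j by (auto simp: cd_smult cd_zero)
  qed (use v in auto)
qed

lemma Tv_th_eqI:
  assumes "j \<in> J" "s \<in> Tv (th A) j" "s' \<in> Tv (th A) j" "j \<in> A \<Longrightarrow> cd A (rp j) s = cd A (rp j) s'" shows "s = s'"
  using Tv_th[OF assms(1,2)] Tv_th[OF assms(1,3)] assms(4) by (cases "j \<in> A") auto

lemma bs_Tv: "j \<in> J \<Longrightarrow> j \<in> A \<Longrightarrow> bs A (rp j) \<in> Tv (th A) j"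
  using al_bs[of j j A] by (simp add: Tv_def al_def RL_refl)

text \<open>A homomorphism respects the spaces at the points, which are at most one-dimensional, so
  it is given by one scalar per point; moving to representatives shows that it depends on the label
  only. The second conclusion is commutation with the structure maps.\<close>

lemma thin_hom:
  assumes A: "A \<subseteq> J" and B: "B \<subseteq> J" and f: "lh I (th A) (th B) f"
  obtains l where "\<And>c v. c \<in> sc B \<Longrightarrow> v \<in> vs (th A) \<Longrightarrow> cd B c (f v) = (if lab c \<in> A then l (lab c) * cd A c v else 0)"
    and "\<And>i j. i \<in> A \<Longrightarrow> j \<in> B \<Longrightarrow> RL i j \<Longrightarrow> (if j \<in> A then l j else 0) = (if i \<in> B then l i else 0)"
proof
  let ?l = "\<lambda>j. cd B (rp j) (f (bs A (rp j)))"
  fix c v assume c: "c \<in> sc B" and v: "v \<in> vs (th A)"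
  let ?j = "lab c"
  have cC: "c \<in> C" "?j \<in> B" "?j \<in> J" using c lab by (auto simp: sc_iff)
  note r = R_lab(1)[OF cC(1)]
  have w: "ac (th A) c (rp ?j) v = (if ?j \<in> A then cd A c v \<cdot>\<^sub>v bs A (rp ?j) else 0\<^sub>v (card (sc A)))"
  proof (rule cd_eqI[where A=A])
    show "ac (th A) c (rp ?j) v \<in> carrier_vec (card (sc A))" using wfm_act[OF th_wfm ixI[OF r] v] by simp
    fix c' assume "c' \<in> sc A"
    then show "cd A c' (ac (th A) c (rp ?j) v) = cd A c' (if ?j \<in> A then cd A c v \<cdot>\<^sub>v bs A (rp ?j) else 0\<^sub>v (card (sc A)))"
      using th_ac[OF r v] cC by (auto simp: cd_smult cd_zero sc_iff)
  qed simp
  have "cd B (rp ?j) (f (ac (th A) c (rp ?j) v)) = cd B c (f v)"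
    using lh_ac[OF f r v] th_ac[OF r lh_closed[OF f v], of "rp ?j"] cC c by simp
  then show "cd B c (f v) = (if ?j \<in> A then ?l ?j * cd A c v else 0)"
    unfolding w using cC lh_zero[OF f] lh_smult[OF f] lh_closed[OF f, of "bs A (rp ?j)"] by (auto simp: cd_smult cd_zero mult.commute split: if_splits)
next
  let ?l = "\<lambda>j. cd B (rp j) (f (bs A (rp j)))"
  fix i j assume ij: "i \<in> A" "j \<in> B" "RL i j"
  have J: "i \<in> J" "j \<in> J" using ij A B by auto
  have b: "bs A (rp i) \<in> vs (th A)" by simp
  have "f (al (th A) i j (bs A (rp i))) = al (th B) i j (f (bs A (rp i)))" by (rule lh_al[OF f J ij(3) b])
  then have "cd B (rp j) (f (if j \<in> A then bs A (rp j) else 0\<^sub>v (card (sc A)))) = (if i \<in> B then ?l i else 0)"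
    using al_bs[OF J ij(3,1)] cd_al[OF J ij(3,2) lh_closed[OF f b]] by simp
  then show "(if j \<in> A then ?l j else 0) = (if i \<in> B then ?l i else 0)"
    using lh_zero[OF f] J ij by (auto simp: cd_zero split: if_splits)
qed

lemma good_J: "good A \<Longrightarrow> A \<subseteq> J" and good_tconv: "good A \<Longrightarrow> tconv A" by (auto simp: good_def)

lemma good_mods: "good A \<Longrightarrow> th A \<in> mods" by (intro th_mods good_J good_tconv)

lemma brick_th: assumes g: "good A" shows "brick I (th A)"
  unfolding brick_def
proof (intro conjI allI impI)
  show "wfm I (th A)" by (rule th_wfm)
  obtain j0 where j0: "j0 \<in> A" "\<And>j. j \<in> A \<Longrightarrow> RL j0 j \<or> RL j j0" using g by (auto simp: good_def star_def)
  have "rp j0 \<in> sc A" using j0(1) good_J[OF g] by auto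
  then show "0 < fst (th A)" using card_gt_0_iff[of "sc A"] by auto
  fix f assume f: "lh I (th A) (th A) f"
  obtain l where l: "\<And>c v. c \<in> sc A \<Longrightarrow> v \<in> vs (th A) \<Longrightarrow> cd A c (f v) = (if lab c \<in> A then l (lab c) * cd A c v else 0)"
    "\<And>i j. i \<in> A \<Longrightarrow> j \<in> A \<Longrightarrow> RL i j \<Longrightarrow> (if j \<in> A then l j else 0) = (if i \<in> A then l i else 0)"
    using thin_hom[OF good_J[OF g] good_J[OF g] f] by blast
  have lc: "l j = l j0" if "j \<in> A" for j using j0(2)[OF that] l(2)[of j j0] l(2)[of j0 j] that j0(1) by auto
  show "\<exists>k. \<forall>v\<in>vs (th A). f v = k \<cdot>\<^sub>v v"
  proof (intro exI ballI)
    fix v assume v: "v \<in> vs (th A)"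
    show "f v = l j0 \<cdot>\<^sub>v v"
      by (rule cd_eqI[where A=A]) (use v lh_closed[OF f v] lc in \<open>auto simp: l cd_smult sc_iff\<close>)
  qed
qed

text \<open>Since the composite is the identity, both maps have non-zero scalars on all of
  \<open>A\<close>, so \<open>A\<close> lies in \<open>B\<close>; the centre of \<open>B\<close>
  then ties every label of \<open>B\<close> to \<open>A\<close>.\<close>

lemma ret_th_eq:
  assumes A: "good A" and B: "good B" and r: "ret I (th A) (th B)" shows "A = B"
proof -
  obtain f g where f: "lh I (th A) (th B) f" and g: "lh I (th B) (th A) g" and gf: "\<And>v. v \<in> vs (th A) \<Longrightarrow> g (f v) = v"
    using r by (rule retE) blast
  note AB = good_J[OF A] good_J[OF B]
  obtain l where l: "\<And>c v. c \<in> sc B \<Longrightarrow> v \<in> vs (th A) \<Longrightarrow> cd B c (f v) = (if lab c \<in> A then l (lab c) * cd A c v else 0)"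
    "\<And>i j. i \<in> A \<Longrightarrow> j \<in> B \<Longrightarrow> RL i j \<Longrightarrow> (if j \<in> A then l j else 0) = (if i \<in> B then l i else 0)"
    using thin_hom[OF AB f] by blast
  obtain m where m: "\<And>c v. c \<in> sc A \<Longrightarrow> v \<in> vs (th B) \<Longrightarrow> cd A c (g v) = (if lab c \<in> B then m (lab c) * cd B c v else 0)"
    "\<And>i j. i \<in> B \<Longrightarrow> j \<in> A \<Longrightarrow> RL i j \<Longrightarrow> (if j \<in> B then m j else 0) = (if i \<in> A then m i else 0)"
    using thin_hom[OF AB(2,1) g] by blast
  have key: "j \<in> B \<and> l j \<noteq> 0 \<and> m j \<noteq> 0" if j: "j \<in> A" for j
  proof -
    have jJ: "j \<in> J" using j AB by auto
    have s: "rp j \<in> sc A" "rp j \<in> sc B \<longleftrightarrow> j \<in> B" using j jJ by auto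
    have b: "bs A (rp j) \<in> vs (th A)" by simp
    have "1 = cd A (rp j) (g (f (bs A (rp j))))" using gf[OF b] s(1) by simp
    also have "\<dots> = (if j \<in> B then m j * (l j * 1) else 0)"
      using m(1)[OF s(1) lh_closed[OF f b]] l(1)[OF _ b, of "rp j"] s jJ j by (simp add: rp)
    finally show ?thesis by (auto split: if_splits)
  qed
  have sub: "A \<subseteq> B" using key by auto
  obtain j0 where j0: "j0 \<in> B" "\<And>j. j \<in> B \<Longrightarrow> RL j0 j \<or> RL j j0" using B by (auto simp: good_def star_def)
  obtain a where a: "a \<in> A" using good_nonempty[OF A] by auto
  \<comment> \<open>If the centre of \<open>B\<close> were missing in \<open>A\<close>,
    compatibility between the centre and some \<open>a\<close> in \<open>A\<close> would force one
    of the non-zero scalars at \<open>a\<close> to vanish.\<close>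
  have j0A: "j0 \<in> A"
  proof (rule ccontr)
    assume n: "j0 \<notin> A"
    have "a \<in> B" using a sub by auto
    from j0(2)[OF this] show False
    proof
      assume "RL j0 a" then show False using m(2)[OF j0(1) a] key[OF a] n by auto
    next
      assume "RL a j0" then show False using l(2)[OF a j0(1)] key[OF a] n by auto
    qed
  qed
  have "j \<in> A" if j: "j \<in> B" for j
  proof (rule ccontr)
    assume n: "j \<notin> A"
    from j0(2)[OF j] show False
    proof
      assume "RL j0 j" then show False using l(2)[OF j0A j] key[OF j0A] n j0 by auto
    next
      assume "RL j j0" then show False using m(2)[OF j j0A] key[OF j0A] n j0 by auto
    qed
  qed
  then show ?thesis using sub by auto
qed

lemma fst_th_pos: "good A \<Longrightarrow> fst (th A) > 0" using brick_th by (simp add: brick_def)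

lemma indec_th: "good A \<Longrightarrow> indec mods I (th A)" by (intro brick_indec brick_th good_mods)

section \<open>Projective thin modules\<close>

abbreviation P where "P x \<equiv> th (PP x)"

lemma P_mods: "x \<in> J \<Longrightarrow> P x \<in> mods" by (intro good_mods PP_good)

lemma PP_self: "x \<in> J \<Longrightarrow> x \<in> PP x" by (simp add: PP_def RL_refl)

lemma bsP_Tv: "x \<in> J \<Longrightarrow> bs (PP x) (rp x) \<in> Tv (P x) x" by (simp add: bs_Tv PP_self)

text \<open>The images of \<open>t\<close> under the structure maps starting at \<open>x\<close>
  form a family to which \<open>lh_outm\<close> applies. Together with \<open>yoneda_unique\<close>,
  homomorphisms from \<open>P x\<close> to \<open>X\<close> are the vectors of
  \<open>Tv X x\<close>.\<close>

lemma yoneda: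
  assumes X: "X \<in> mods" and x: "x \<in> J" and t: "t \<in> Tv X x"
  obtains f where "lh I (P x) X f" "f (bs (PP x) (rp x)) = t"
proof
  let ?t = "\<lambda>j. al X x j t"
  have tv: "t \<in> vs X" using Tv_vs[OF t] .
  have PJ: "PP x \<subseteq> J" "tconv (PP x)" using PP_good[OF x] by (auto simp: good_def)
  have tT: "?t j \<in> Tv X j" if "j \<in> PP x" for j using that x tv by (auto simp: PP_def al_Tv[OF X])
  show "lh I (P x) X (outm (PP x) X ?t)"
  proof (rule lh_outm[OF PJ X tT])
    fix i j assume "i \<in> PP x" "j \<in> J" "RL i j"
    then show "al X i j (?t i) = (if j \<in> PP x then ?t j else 0\<^sub>v (fst X))"
      using al_comp[OF X x, of i j t] tv by (auto simp: PP_def)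
  qed
  have s: "rp x \<in> sc (PP x)" using x PP_self by auto
  show "outm (PP x) X ?t (bs (PP x) (rp x)) = t"
    using outm_bs[OF X tT s] al_id[OF t] x t by (simp add: rp) (simp add: Tv_def)
qed

lemma bs_gen:
  assumes x: "x \<in> J" and c: "c \<in> sc (PP x)"
  shows "bs (PP x) c = ac (P x) (rp x) c (bs (PP x) (rp x))" "R (rp x) c"
proof -
  show r: "R (rp x) c" using c x by (auto simp: R_def rp sc_iff PP_def)
  have "rp x \<in> sc (PP x)" using x PP_self by auto
  then show "bs (PP x) c = ac (P x) (rp x) c (bs (PP x) (rp x))" using th_ac_bs[OF r] c by simp
qed

lemma yoneda_unique:
  assumes x: "x \<in> J" and f: "lh I (P x) X f" and g: "lh I (P x) X g"
    and e: "f (bs (PP x) (rp x)) = g (bs (PP x) (rp x))" and v: "v \<in> vs (P x)"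
  shows "f v = g v"
proof (rule lh_th_eq[OF f g _ v])
  fix c assume c: "c \<in> sc (PP x)"
  show "f (bs (PP x) c) = g (bs (PP x) c)"
    unfolding bs_gen(1)[OF x c] using bs_gen(2)[OF x c] e lh_ac[OF f] lh_ac[OF g] by simp
qed

lemma Tv_lift:
  assumes g: "lh I X Y g" and X: "X \<in> mods" and j: "j \<in> J" and t: "t \<in> Tv Y j" and u: "u \<in> vs X" "g u = t"
  obtains s where "s \<in> Tv X j" "g s = t"
proof
  show "al X j j u \<in> Tv X j" using al_Tv[OF X j j RL_refl[OF j] u(1)] .
  show "g (al X j j u) = t" using lh_al[OF g j j RL_refl[OF j] u(1)] u(2) al_id[OF t] by simp
qed

lemma P_proj: assumes x: "x \<in> J" shows "projective mods I (P x)"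
proof (rule projI[OF P_mods[OF x]])
  fix X Y g f assume h: "X \<in> mods" "Y \<in> mods" "lh I X Y g" "\<And>v. v \<in> vs Y \<Longrightarrow> \<exists>u\<in>vs X. g u = v" "lh I (P x) Y f"
  let ?b = "bs (PP x) (rp x)"
  have fb: "f ?b \<in> Tv Y x" by (rule lh_Tv[OF h(5) x bsP_Tv[OF x]])
  obtain u where "u \<in> vs X" "g u = f ?b" using h(4) Tv_vs[OF fb] by blast
  then obtain s where s: "s \<in> Tv X x" "g s = f ?b" using Tv_lift[OF h(3,1) x fb] by blast
  obtain k where k: "lh I (P x) X k" "k ?b = s" using yoneda[OF h(1) x s(1)] by blast
  have "g (k v) = f v" if "v \<in> vs (P x)" for v
    by (rule yoneda_unique[OF x lh_comp[OF k(1) h(3)] h(5) _ that]) (simp add: k s)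
  then show "\<exists>k. lh I (P x) X k \<and> (\<forall>v\<in>vs (P x). g (k v) = f v)" using k by blast
qed

section \<open>Sums of thin modules\<close>

definition dsl :: "'l set list \<Rightarrow> ('i,'k) md" where "dsl As = foldr (\<lambda>A X. dsum (th A) X) As zmod"

lemma dsl_simps [simp]: "dsl [] = zmod" "dsl (A # As) = dsum (th A) (dsl As)" by (simp_all add: dsl_def)

lemma dsl_mods: "(\<And>A. A \<in> set As \<Longrightarrow> good A) \<Longrightarrow> dsl As \<in> mods"
  by (induction As) (auto intro: mods_zmod mods_dsum good_mods)

lemma dsl_wfm: "wfm I (dsl As)"
  by (induction As) (auto intro: wfm_dsum th_wfm wfm_zmod)

lemma dsl_swap: "eqv I (dsl (A # B # As)) (dsl (B # A # As))"
proof -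
  have 2: "eqv I (dsum (dsum (th A) (th B)) (dsl As)) (dsum (dsum (th B) (th A)) (dsl As))"
    by (intro eqv_dsum_cong eqv_dsum_comm eqv_refl wfm_dsum th_wfm dsl_wfm)
  have 3: "eqv I (dsum (dsum (th B) (th A)) (dsl As)) (dsum (th B) (dsum (th A) (dsl As)))"
    by (intro eqv_dsum_assoc th_wfm dsl_wfm)
  show ?thesis unfolding dsl_simps
    by (rule eqv_trans[OF eqv_sym[OF eqv_dsum_assoc] eqv_trans[OF 2 3]]) (intro th_wfm dsl_wfm)+
qed

lemma dsl_Cons_cong: "eqv I (dsl As) (dsl Bs) \<Longrightarrow> eqv I (dsl (A # As)) (dsl (A # Bs))"
  unfolding dsl_simps by (intro eqv_dsum_cong eqv_refl th_wfm dsl_wfm)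

lemma dsl_move: "eqv I (dsl (As @ A # Bs)) (dsl (A # As @ Bs))"
proof (induction As)
  case (Cons B As)
  show ?case using eqv_trans[OF dsl_Cons_cong[OF Cons, of B] dsl_swap] by simp
qed (simp add: eqv_refl)

lemma dsl_perm: "mset As = mset Bs \<Longrightarrow> eqv I (dsl As) (dsl Bs)"
proof (induction As arbitrary: Bs)
  case (Cons A As)
  then obtain B1 B2 where B: "Bs = B1 @ A # B2" by (metis list.set_intros(1) mset_eq_setD split_list)
  then have "mset As = mset (B1 @ B2)" using Cons.prems by simp
  then have "eqv I (dsl (A # As)) (dsl (A # B1 @ B2))" by (intro dsl_Cons_cong Cons.IH)
  then show ?case unfolding B using eqv_trans eqv_sym[OF dsl_move] by blast
qed (simp add: eqv_refl)

text \<open>One half of the Krull-Schmidt theorem: a brick that is a summand of a sum is a summand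
  of one term by \<open>brick_prime\<close>, and thin modules with different supports are not
  retracts of one another.\<close>

lemma ret_dsl:
  assumes A: "good A" and As: "\<And>B. B \<in> set As \<Longrightarrow> good B" and r: "ret I (th A) (dsl As)" shows "A \<in> set As"
  using As r
proof (induction As)
  case Nil
  then show ?case using ret_dim[of I "th A" "dsl []"] fst_th_pos[OF A] by simp
next
  case (Cons B As)
  then have "ret I (th A) (th B) \<or> ret I (th A) (dsl As)"
    using brick_prime[OF brick_th[OF A] th_wfm dsl_wfm] by simp
  then show ?case using Cons ret_th_eq[OF A] by auto
qed

lemma dsl_ret: "A \<in> set As \<Longrightarrow> ret I (th A) (dsl As)"
proof (induction As)
  case (Cons B As)
  show ?case
  proof (cases "A = B")
    case True then show ?thesis using ret_dsum1[OF th_wfm dsl_wfm] by simp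
  next
    case False
    then have "ret I (th A) (dsl As)" using Cons by auto
    then show ?thesis using ret_trans[OF _ ret_dsum2[OF th_wfm dsl_wfm]] by simp
  qed
qed simp

text \<open>Induction on the dimension. The property \<open>\<Phi>\<close> has to pass to retracts,
  so that the complement of each summand split off is again subject to \<open>s\<close>.\<close>

theorem decompose:
  assumes cl: "\<And>X Z. X \<in> mods \<Longrightarrow> \<Phi> X \<Longrightarrow> Z \<in> mods \<Longrightarrow> ret I Z X \<Longrightarrow> \<Phi> Z"
    and F: "\<And>A. A \<in> F \<Longrightarrow> good A"
    and s: "\<And>X. X \<in> mods \<Longrightarrow> \<Phi> X \<Longrightarrow> fst X > 0 \<Longrightarrow> \<exists>A\<in>F. ret I (th A) X"
    and X: "X \<in> mods" "\<Phi> X"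
  shows "\<exists>As. set As \<subseteq> F \<and> eqv I X (dsl As)"
  using X
proof (induction "fst X" arbitrary: X rule: less_induct)
  case less
  show ?case
  proof (cases "fst X = 0")
    case True
    have l: "lh I X zmod (\<lambda>v. 0\<^sub>v 0)" using lh_const0[OF wfm_zmod, of I X] by simp
    have l': "lh I zmod X (\<lambda>v. 0\<^sub>v (fst X))" by (rule lh_const0[OF mods_wfm[OF less(2)]])
    have "eqv I X zmod"
      by (rule eqvI[OF l l']) (use True in auto)
    then show ?thesis by (intro exI[of _ "[]"]) simp
  next
    case False
    then obtain A where A: "A \<in> F" "ret I (th A) X" using s less by blast
    obtain Z where Z: "Z \<in> mods" "eqv I X (dsum (th A) Z)" using ret_split_mods[OF good_mods[OF F[OF A(1)]] less(2) A(2)] .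
    have "ret I Z X" using ret_trans[OF ret_dsum2[OF th_wfm mods_wfm[OF Z(1)]] eqv_ret[OF eqv_sym[OF Z(2)]]] .
    then have "\<Phi> Z" using cl less Z by blast
    moreover have "fst Z < fst X" using eqv_dim[OF Z(2)] fst_th_pos[OF F[OF A(1)]] by simp
    ultimately obtain As where As: "set As \<subseteq> F" "eqv I Z (dsl As)" using less Z by blast
    have "eqv I (dsum (th A) Z) (dsl (A # As))"
      unfolding dsl_simps by (intro eqv_dsum_cong eqv_refl th_wfm dsl_wfm mods_wfm Z As)
    then show ?thesis using eqv_trans[OF Z(2)] As A by (intro exI[of _ "A # As"]) auto
  qed
qed

text \<open>With \<open>A\<close> moved to the front, \<open>brick_double\<close> cancels one copy
  of it against the only occurrence in \<open>As\<close>; the second copy would have to occur among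
  the rest.\<close>

lemma not_distinct_ret:
  assumes A: "good A" and As: "\<And>B. B \<in> set As \<Longrightarrow> good B" and d: "distinct As"
    and r: "ret I (dsum (th A) (th A)) (dsl As)"
  shows False
proof -
  have "A \<in> set As" by (rule ret_dsl[OF A As ret_trans[OF ret_dsum1[OF th_wfm th_wfm] r]])
  then obtain B1 B2 where B: "As = B1 @ A # B2" by (metis split_list)
  have n: "A \<notin> set (B1 @ B2)" using d B by auto
  have "ret I (dsum (th A) (th A)) (dsum (th A) (dsl (B1 @ B2)))"
    using ret_trans[OF r eqv_ret[OF dsl_move[of B1 A B2, folded B]]] by simp
  then have "ret I (th A) (dsl (B1 @ B2))" by (rule brick_double[OF brick_th[OF A] dsl_wfm])
  then have "A \<in> set (B1 @ B2)" by (rule ret_dsl[OF A, rotated]) (use As B in auto)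
  then show False using n by simp
qed

section \<open>Free covers\<close>

lemma vsum_subsp:
  assumes W: "subsp n W" and "finite A" "\<And>a. a \<in> A \<Longrightarrow> F a \<in> W" shows "vsum n F A \<in> W"
  using assms(2,3)
proof (induction A rule: finite_induct)
  case (insert a A)
  then have "F a \<in> carrier_vec n" using W by (auto simp: subsp_def)
  then show ?case using insert W by (simp add: vsum_insert) (simp add: subsp_def)
qed (use W in \<open>simp add: subsp_def\<close>)

text \<open>The difference of the two sides is killed by the idempotent of every point, so
  \<open>mod_faith\<close> applies.\<close>

lemma unital:
  assumes X: "X \<in> mods" and v: "v \<in> vs X" shows "v = vsum (fst X) (\<lambda>c. ac X c c v) C"
proof -
  let ?w = "vsum (fst X) (\<lambda>c. ac X c c v) C"
  have c: "ac X c c v \<in> vs X" if "c \<in> C" for c using ac_closed[OF X R_refl[OF that] v] .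
  have "v - ?w = 0\<^sub>v (fst X)"
  proof (rule mod_faith[OF X])
    fix d assume d: "d \<in> C"
    note r = R_refl[OF d]
    have "ac X d d ?w = vsum (fst X) (\<lambda>c. ac X d d (ac X c c v)) C"
      by (rule lin_vsum[OF ac_lin[OF X r] finC c])
    also have "\<dots> = ac X d d v"
      by (subst vsum_single[where a=d])
        (use d finC c mod_mul[OF X r r v] mod_orth[OF X R_refl r _ v] r in auto)
    finally show "ac X d d (v - ?w) = 0\<^sub>v (fst X)"
      using lin_minus[OF ac_lin[OF X r] v, of ?w] c[OF d] by (simp add: minus_cancel_vec[of _ "fst X"])
  qed (use v in simp)
  then show ?thesis by (intro vec_diff_zero[OF v]) auto
qed

lemma cover_list:
  assumes X: "X \<in> mods" and qs: "\<forall>(j,t)\<in>set qs. j \<in> J \<and> t \<in> Tv X j"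
  shows "\<exists>g. lh I (dsl (map (\<lambda>q. PP (fst q)) qs)) X g \<and> (\<forall>(j,t)\<in>set qs. t \<in> g ` vs (dsl (map (\<lambda>q. PP (fst q)) qs)))"
  using qs
proof (induction qs)
  case Nil
  have "lh I (dsl (map (\<lambda>q. PP (fst q)) [])) X (\<lambda>v. 0\<^sub>v (fst X))" by (rule lh_const0[OF mods_wfm[OF X]])
  then show ?case by auto
next
  case (Cons a qs)
  obtain j t where a: "a = (j,t)" by (cases a)
  then have j: "j \<in> J" "t \<in> Tv X j" using Cons.prems by auto
  let ?D = "dsl (map (\<lambda>q. PP (fst q)) qs)"
  have "\<forall>(j,t)\<in>set qs. j \<in> J \<and> t \<in> Tv X j" using Cons.prems by auto
  from Cons.IH[OF this] obtain g where g: "lh I ?D X g" "\<forall>(j,t)\<in>set qs. t \<in> g ` vs ?D" by blast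
  obtain f where f: "lh I (P j) X f" "f (bs (PP j) (rp j)) = t" using yoneda[OF X j] by blast
  note w = th_wfm[where A="PP j"] dsl_wfm[of "map (\<lambda>q. PP (fst q)) qs"]
  let ?h = "cop (P j) ?D f g"
  have 1: "lh I (dsum (P j) ?D) X ?h" by (rule lh_cop[OF w mods_wfm[OF X] f(1) g(1)])
  have 2: "f u \<in> ?h ` vs (dsum (P j) ?D)" if u: "u \<in> vs (P j)" for u
  proof (rule image_eqI)
    show "f u = ?h (i1 (P j) ?D u)" using p_i(1,2)[OF u] lh_zero[OF g(1)] lh_closed[OF f(1) u] by (simp add: cop_def)
    show "i1 (P j) ?D u \<in> vs (dsum (P j) ?D)" using i_carrier(1)[OF u, of ?D] by simp
  qed
  have 3: "g u \<in> ?h ` vs (dsum (P j) ?D)" if u: "u \<in> vs ?D" for u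
  proof (rule image_eqI)
    show "g u = ?h (i2 (P j) ?D u)" using p_i(3,4)[OF u] lh_zero[OF f(1)] lh_closed[OF g(1) u] by (simp add: cop_def)
    show "i2 (P j) ?D u \<in> vs (dsum (P j) ?D)" using i_carrier(2)[OF u, of "P j"] by simp
  qed
  have "\<forall>(j',t')\<in>set (a # qs). t' \<in> ?h ` vs (dsum (P j) ?D)"
  proof (clarify)
    fix j' t' assume "(j',t') \<in> set (a # qs)"
    then consider "t' = t" | "(j',t') \<in> set qs" using a by auto
    then show "t' \<in> ?h ` vs (dsum (P j) ?D)"
    proof cases
      case 1 then show ?thesis using 2[of "bs (PP j) (rp j)"] f(2) by simp
    next
      case 2
      then obtain u where "u \<in> vs ?D" "t' = g u" using g(2) by auto
      then show ?thesis using 3 by simp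
    qed
  qed
  then show ?case using 1 a by (intro exI[of _ ?h]) simp
qed

text \<open>The image of the cover is a subspace stable under the basis of the algebra. It contains
  all components of the unit vectors and hence, by \<open>unital\<close>, the unit vectors
  themselves.\<close>

lemma free_cover:
  assumes X: "X \<in> mods"
  obtains js g where "set js \<subseteq> J" "lh I (dsl (map PP js)) X g" "\<And>v. v \<in> vs X \<Longrightarrow> \<exists>u\<in>vs (dsl (map PP js)). g u = v"
proof -
  \<comment> \<open>Generators: the component of each unit vector at each point, moved to the
    representative of the label.\<close>
  let ?K = "(\<lambda>(c,i). (lab c, ac X c (rp (lab c)) (unit_vec (fst X) i))) ` (C \<times> {..<fst X})"
  have fK: "finite ?K" by (intro finite_imageI finite_cartesian_product finC finite_lessThan)
  obtain qs where qs: "set qs = ?K" using finite_list[OF fK] ..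
  have p: "\<forall>(j,t)\<in>set qs. j \<in> J \<and> t \<in> Tv X j"
  proof (clarify)
    fix j t assume "(j,t) \<in> set qs"
    then obtain c i where c: "c \<in> C" "j = lab c" "t = ac X c (rp (lab c)) (unit_vec (fst X) i)" unfolding qs by auto
    show "j \<in> J \<and> t \<in> Tv X j" unfolding c(2,3)
      by (intro conjI lab c(1) ac_Tv[OF X lab[OF c(1)] R_lab(1)[OF c(1)]]) simp
  qed
  let ?D = "dsl (map (\<lambda>q. PP (fst q)) qs)"
  obtain g where g: "lh I ?D X g" "\<forall>(j,t)\<in>set qs. t \<in> g ` vs ?D" using cover_list[OF X p] by blast
  define W where "W = g ` vs ?D"
  have sW: "subsp (fst X) W" unfolding W_def by (rule subsp_image[OF lh_lin[OF g(1)] subsp_all])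
  have aW: "ac X c c' w \<in> W" if "R c c'" "w \<in> W" for c c' w
  proof -
    obtain u where u: "u \<in> vs ?D" "w = g u" using \<open>w \<in> W\<close> by (auto simp: W_def)
    have "ac X c c' w = g (ac ?D c c' u)" using lh_ac[OF g(1) \<open>R c c'\<close> u(1)] u by simp
    then show ?thesis using wfm_act[OF dsl_wfm ixI[OF \<open>R c c'\<close>] u(1)] by (auto simp: W_def)
  qed
  have eW: "unit_vec (fst X) i \<in> W" if i: "i < fst X" for i
  proof -
    have u: "ac X c c (unit_vec (fst X) i) \<in> W" if c: "c \<in> C" for c
    proof -
      have "ac X c (rp (lab c)) (unit_vec (fst X) i) \<in> W" using g(2) c i unfolding W_def qs by fastforce
      then have "ac X (rp (lab c)) c (ac X c (rp (lab c)) (unit_vec (fst X) i)) \<in> W" using aW R_lab(2)[OF c] by blast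
      then show ?thesis using mod_mul[OF X R_lab[OF c]] R_refl[OF c] by simp
    qed
    have "vsum (fst X) (\<lambda>c. ac X c c (unit_vec (fst X) i)) C \<in> W" by (rule vsum_subsp[OF sW finC u])
    then show ?thesis by (simp only: unital[OF X unit_vec_carrier, symmetric])
  qed
  have "v \<in> W" if v: "v \<in> vs X" for v
  proof -
    have "vsum (fst X) (\<lambda>j. v $ j \<cdot>\<^sub>v unit_vec (fst X) j) {..<fst X} \<in> W"
      by (rule vsum_subsp[OF sW]) (use eW sW in \<open>auto simp: subsp_def\<close>)
    then show ?thesis using unit_expand[OF v] by simp
  qed
  then have sur: "\<exists>u\<in>vs ?D. g u = v" if "v \<in> vs X" for v using that by (auto simp: W_def)
  have e: "map PP (map fst qs) = map (\<lambda>q. PP (fst q)) qs" by simp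
  show ?thesis
  proof (rule that[of "map fst qs" g, unfolded e])
    show "set (map fst qs) \<subseteq> J" using p by auto
  qed (rule g(1), rule sur)
qed

text \<open>The identity of \<open>Q\<close> lifts along its cover by projective thin
  modules.\<close>

lemma proj_ret_free:
  assumes Q: "projective mods I Q" obtains js where "set js \<subseteq> J" "ret I Q (dsl (map PP js))"
proof -
  have Qm: "Q \<in> mods" using Q by (rule proj_mods)
  obtain js g where js: "set js \<subseteq> J" and g: "lh I (dsl (map PP js)) Q g" and s: "\<And>v. v \<in> vs Q \<Longrightarrow> \<exists>u\<in>vs (dsl (map PP js)). g u = v"
    using free_cover[OF Qm] by blast
  have D: "dsl (map PP js) \<in> mods" using js PP_good by (intro dsl_mods) auto
  obtain h where "lh I Q (dsl (map PP js)) h" "\<And>v. v \<in> vs Q \<Longrightarrow> g (h v) = v" using proj_lift[OF Q D Qm g s lh_id] by blast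
  then show ?thesis using that[OF js] retI[OF _ g] by blast
qed

end

section \<open>Presentations and extension groups\<close>

context modcat
begin

text \<open>A projective resolution \<open>0 \<rightarrow> P1 \<rightarrow> P0 \<rightarrow> X
  \<rightarrow> 0\<close>.\<close>

definition spr :: "('i,'k) md \<Rightarrow> ('i,'k) md \<Rightarrow> ('k vec \<Rightarrow> 'k vec) \<Rightarrow> ('k vec \<Rightarrow> 'k vec) \<Rightarrow> ('i,'k) md \<Rightarrow> bool" where
  "spr P0 P1 f g X \<longleftrightarrow> projective mods I P0 \<and> projective mods I P1 \<and> lh I P1 P0 f \<and> lh I P0 X g \<and>
     (\<forall>u\<in>vs P1. f u = 0\<^sub>v (fst P0) \<longrightarrow> u = 0\<^sub>v (fst P1)) \<and> (\<forall>v\<in>vs X. \<exists>u\<in>vs P0. g u = v) \<and>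
     (\<forall>v\<in>vs P0. g v = 0\<^sub>v (fst X) \<longleftrightarrow> (\<exists>u\<in>vs P1. f u = v))"

text \<open>Combines projective dimension at most one for \<open>X\<close> with the vanishing of the
  first extension group of \<open>X\<close> by \<open>Y\<close>, both witnessed by the same
  resolution. In this form the two conditions pass together to direct sums in the first
  argument.\<close>

definition prs :: "('i,'k) md \<Rightarrow> ('i,'k) md \<Rightarrow> bool" where
  "prs X Y \<longleftrightarrow> (\<exists>P0 P1 f g. spr P0 P1 f g X \<and>
     (\<forall>\<eta>. lh I P1 Y \<eta> \<longrightarrow> (\<exists>\<psi>. lh I P0 Y \<psi> \<and> (\<forall>u\<in>vs P1. \<eta> u = \<psi> (f u)))))"

lemma sprD:
  assumes "spr P0 P1 f g X"
  shows "projective mods I P0" "projective mods I P1" "lh I P1 P0 f" "lh I P0 X g"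
     "\<And>u. u\<in>vs P1 \<Longrightarrow> f u = 0\<^sub>v (fst P0) \<Longrightarrow> u = 0\<^sub>v (fst P1)" "\<And>v. v\<in>vs X \<Longrightarrow> \<exists>u\<in>vs P0. g u = v"
     "\<And>v. v\<in>vs P0 \<Longrightarrow> g v = 0\<^sub>v (fst X) \<longleftrightarrow> (\<exists>u\<in>vs P1. f u = v)"
  using assms by (simp_all add: spr_def)

lemma sprI: "(projective mods I P0) \<Longrightarrow> (projective mods I P1) \<Longrightarrow> (lh I P1 P0 f) \<Longrightarrow> (lh I P0 X g) \<Longrightarrow>
     (\<And>u. u\<in>vs P1 \<Longrightarrow> f u = 0\<^sub>v (fst P0) \<Longrightarrow> u = 0\<^sub>v (fst P1)) \<Longrightarrow> (\<And>v. v\<in>vs X \<Longrightarrow> \<exists>u\<in>vs P0. g u = v) \<Longrightarrow>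
     (\<And>v. v\<in>vs P0 \<Longrightarrow> g v = 0\<^sub>v (fst X) \<longleftrightarrow> (\<exists>u\<in>vs P1. f u = v)) \<Longrightarrow> spr P0 P1 f g X"
  by (simp add: spr_def)

lemma prsI:
  assumes "spr P0 P1 f g X" "\<And>\<eta>. lh I P1 Y \<eta> \<Longrightarrow> \<exists>\<psi>. lh I P0 Y \<psi> \<and> (\<forall>u\<in>vs P1. \<eta> u = \<psi> (f u))"
  shows "prs X Y"
  using assms unfolding prs_def by blast

text \<open>The preimages are chosen pointwise; since they are unique, the choice is automatically
  linear and compatible with the action.\<close>

lemma lift_inj:
  assumes w: "P1 \<in> mods" "P0 \<in> mods" "Q \<in> mods" and f: "lh I P1 P0 f" and h: "lh I Q P0 h"
    and inj: "\<And>u. u \<in> vs P1 \<Longrightarrow> f u = 0\<^sub>v (fst P0) \<Longrightarrow> u = 0\<^sub>v (fst P1)"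
    and im: "\<And>v. v \<in> vs Q \<Longrightarrow> \<exists>u\<in>vs P1. f u = h v"
  obtains k where "lh I Q P1 k" "\<And>v. v \<in> vs Q \<Longrightarrow> f (k v) = h v"
proof -
  have inj': "u = u'" if u: "u \<in> vs P1" "u' \<in> vs P1" and e: "f u = f u'" for u u'
  proof (rule vec_diff_zero[OF u inj])
    show "f (u - u') = 0\<^sub>v (fst P0)" using lh_minus[OF f u] e minus_cancel_vec[OF lh_closed[OF f u(2)]] by simp
  qed (use u in simp)
  obtain k where k: "\<And>v. v \<in> vs Q \<Longrightarrow> k v \<in> vs P1 \<and> f (k v) = h v" using im by metis
  have "lh I Q P1 k"
    unfolding lh_def
  proof (intro conjI ballI linI)
    fix v assume v: "v \<in> vs Q"
    show "k v \<in> vs P1" using k v by simp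
    { fix w assume w: "w \<in> vs Q"
      show "k (v + w) = k v + k w"
        by (rule inj') (use v w k in \<open>auto simp: lh_add[OF f] lh_add[OF h]\<close>) }
    { fix a show "k (a \<cdot>\<^sub>v v) = a \<cdot>\<^sub>v k v"
        by (rule inj') (use v k in \<open>auto simp: lh_smult[OF f] lh_smult[OF h]\<close>) }
    fix g assume g: "g \<in> I"
    have qv: "snd Q g *\<^sub>v v \<in> vs Q" by (rule wfm_act[OF mods_wfm[OF w(3)] g v])
    show "k (snd Q g *\<^sub>v v) = snd P1 g *\<^sub>v k v"
      by (rule inj') (use k[OF v] k[OF qv] wfm_act[OF mods_wfm[OF w(1)] g] lh_act[OF f g] lh_act[OF h g v] in auto)
  qed
  then show ?thesis using that k by blast
qed

lemma zmod_vec: "v \<in> vs zmod \<Longrightarrow> v = 0\<^sub>v 0" by (intro vec0_eq) auto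

lemma prs_zmod: "prs zmod Y"
proof -
  have z: "v = 0\<^sub>v 0" if "v \<in> carrier_vec 0" for v :: "'k vec" using that by (intro vec0_eq) auto
  have l: "lh I zmod zmod (\<lambda>v. v :: 'k vec)" by (rule lh_id)
  have "spr zmod zmod (\<lambda>v. v) (\<lambda>v. v) zmod" by (rule sprI[OF proj_zmod proj_zmod l l]) (use z in auto)
  then show ?thesis by (rule prsI) auto
qed

lemma prs_proj: assumes P: "projective mods I Q" and Y: "Y \<in> mods" shows "prs Q Y"
proof -
  have Q: "Q \<in> mods" using P by (rule proj_mods)
  have e: "\<exists>\<psi>. lh I Q Y \<psi> \<and> (\<forall>u\<in>vs zmod. \<eta> u = \<psi> (0\<^sub>v (fst Q)))" if "lh I zmod Y \<eta>" for \<eta>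
  proof (intro exI conjI ballI)
    show l: "lh I Q Y (\<lambda>v. 0\<^sub>v (fst Y))" by (rule lh_const0[OF mods_wfm[OF Y]])
    fix u :: "'k vec" assume "u \<in> vs zmod"
    then have "u = 0\<^sub>v (fst zmod)" using zmod_vec by simp
    then show "\<eta> u = 0\<^sub>v (fst Y)" using lh_zero[OF that] by simp
  qed
  have "spr Q zmod (\<lambda>v. 0\<^sub>v (fst Q)) (\<lambda>v. v) Q"
  proof (rule sprI[OF P proj_zmod lh_const0[OF mods_wfm[OF Q]] lh_id])
    show "u = 0\<^sub>v (fst zmod)" if "u \<in> vs zmod" for u :: "'k vec" using zmod_vec[OF that] by simp
    show "v = 0\<^sub>v (fst Q) \<longleftrightarrow> (\<exists>u\<in>vs zmod. 0\<^sub>v (fst Q) = v)" if "v \<in> vs Q" for v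
      by (auto intro!: exI[of _ "0\<^sub>v 0"])
  qed auto
  then show ?thesis by (rule prsI) (use e in auto)
qed

lemma prs_eqv: assumes e: "eqv I X X'" and p: "prs X Y" shows "prs X' Y"
proof -
  obtain a b where a: "lh I X X' a" and b: "lh I X' X b" and ba: "\<And>v. v \<in> vs X \<Longrightarrow> b (a v) = v" and ab: "\<And>v. v \<in> vs X' \<Longrightarrow> a (b v) = v"
    using e by (rule eqvE) blast
  obtain P0 P1 f g where p': "spr P0 P1 f g X"
    and p8: "\<forall>\<eta>. lh I P1 Y \<eta> \<longrightarrow> (\<exists>\<psi>. lh I P0 Y \<psi> \<and> (\<forall>u\<in>vs P1. \<eta> u = \<psi> (f u)))"
    using p unfolding prs_def by blast
  note p = sprD[OF p'] p8[rule_format]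
  have "spr P0 P1 f (\<lambda>v. a (g v)) X'"
  proof (rule sprI[OF p(1-3) lh_comp[OF p(4) a]])
    show "\<exists>u\<in>vs P0. a (g u) = v" if "v \<in> vs X'" for v
      using p(6)[OF lh_closed[OF b that]] ab[OF that] by metis
    show "a (g v) = 0\<^sub>v (fst X') \<longleftrightarrow> (\<exists>u\<in>vs P1. f u = v)" if "v \<in> vs P0" for v
      using p(7)[OF that] ba[OF lh_closed[OF p(4) that]] lh_zero[OF a] lh_zero[OF b] by metis
  qed (use p(5) in auto)
  then show ?thesis by (rule prsI) (rule p(8))
qed

lemma prs_dsum:
  assumes X: "X \<in> mods" and X': "X' \<in> mods" and Y: "Y \<in> mods" and "prs X Y" "prs X' Y" shows "prs (dsum X X') Y"
proof -
  obtain P0 P1 f g where p': "spr P0 P1 f g X"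
    and p8: "\<forall>\<eta>. lh I P1 Y \<eta> \<longrightarrow> (\<exists>\<psi>. lh I P0 Y \<psi> \<and> (\<forall>u\<in>vs P1. \<eta> u = \<psi> (f u)))"
    using assms(4) unfolding prs_def by blast
  note p = sprD[OF p'] p8[rule_format]
  obtain Q0 Q1 f' g' where q': "spr Q0 Q1 f' g' X'"
    and q8: "\<forall>\<eta>. lh I Q1 Y \<eta> \<longrightarrow> (\<exists>\<psi>. lh I Q0 Y \<psi> \<and> (\<forall>u\<in>vs Q1. \<eta> u = \<psi> (f' u)))"
    using assms(5) unfolding prs_def by blast
  note q = sprD[OF q'] q8[rule_format]
  have w: "wfm I P0" "wfm I P1" "wfm I Q0" "wfm I Q1" "wfm I X" "wfm I X'" "wfm I Y"
    using p(1,2) q(1,2) X X' Y by (auto intro!: mods_wfm proj_mods)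
  let ?F = "prd P0 Q0 (\<lambda>v. f (p1 P1 Q1 v)) (\<lambda>v. f' (p2 P1 Q1 v))"
  let ?G = "prd X X' (\<lambda>v. g (p1 P0 Q0 v)) (\<lambda>v. g' (p2 P0 Q0 v))"
  note F = dsum_map[OF w(2,4,1,3) p(3) q(3)] and G = dsum_map[OF w(1,3,5,6) p(4) q(4)]
  note zp = lh_zero[OF lh_p1[OF w(1,3)]] lh_zero[OF lh_p2[OF w(1,3)]] lh_zero[OF lh_p1[OF w(5,6)]] lh_zero[OF lh_p2[OF w(5,6)]]
    lh_zero[OF lh_p1[OF w(2,4)]] lh_zero[OF lh_p2[OF w(2,4)]]
  have "spr (dsum P0 Q0) (dsum P1 Q1) ?F ?G (dsum X X')"
  proof (rule sprI[OF proj_dsum[OF p(1) q(1)] proj_dsum[OF p(2) q(2)] F(1) G(1)])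
    show "u = 0\<^sub>v (fst (dsum P1 Q1))" if u: "u \<in> vs (dsum P1 Q1)" and z: "?F u = 0\<^sub>v (fst (dsum P0 Q0))" for u
    proof -
      have "f (p1 P1 Q1 u) = 0\<^sub>v (fst P0)" "f' (p2 P1 Q1 u) = 0\<^sub>v (fst Q0)"
        using F(2)[of u] F(3)[of u] unfolding z zp by simp_all
      then have "p1 P1 Q1 u = 0\<^sub>v (fst P1)" "p2 P1 Q1 u = 0\<^sub>v (fst Q1)" using p(5) q(5) by auto
      then show ?thesis using zp by (intro dsum_eqI[OF u]) auto
    qed
    show "\<exists>u\<in>vs (dsum P0 Q0). ?G u = v" if v: "v \<in> vs (dsum X X')" for v
    proof -
      obtain a b where ab: "a \<in> vs P0" "g a = p1 X X' v" "b \<in> vs Q0" "g' b = p2 X X' v"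
        using p(6)[of "p1 X X' v"] q(6)[of "p2 X X' v"] by auto
      have m: "a @\<^sub>v b \<in> vs (dsum P0 Q0)" using ab by simp
      have "?G (a @\<^sub>v b) = v"
        by (rule dsum_eqI[OF lh_closed[OF G(1) m] v]) (use ab in \<open>simp_all add: G\<close>)
      then show ?thesis using m by blast
    qed
    show "?G v = 0\<^sub>v (fst (dsum X X')) \<longleftrightarrow> (\<exists>u\<in>vs (dsum P1 Q1). ?F u = v)" if v: "v \<in> vs (dsum P0 Q0)" for v
    proof
      assume z: "?G v = 0\<^sub>v (fst (dsum X X'))"
      have "g (p1 P0 Q0 v) = 0\<^sub>v (fst X)" "g' (p2 P0 Q0 v) = 0\<^sub>v (fst X')"
        using G(2)[of v] G(3)[of v] unfolding z zp by simp_all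
      then obtain a b where ab: "a \<in> vs P1" "f a = p1 P0 Q0 v" "b \<in> vs Q1" "f' b = p2 P0 Q0 v"
        using p(7)[of "p1 P0 Q0 v"] q(7)[of "p2 P0 Q0 v"] by auto
      have m: "a @\<^sub>v b \<in> vs (dsum P1 Q1)" using ab by simp
      have "?F (a @\<^sub>v b) = v"
        by (rule dsum_eqI[OF lh_closed[OF F(1) m] v]) (use ab in \<open>simp_all add: F\<close>)
      then show "\<exists>u\<in>vs (dsum P1 Q1). ?F u = v" using m by blast
    next
      assume "\<exists>u\<in>vs (dsum P1 Q1). ?F u = v"
      then obtain u where u: "u \<in> vs (dsum P1 Q1)" "?F u = v" by blast
      have "g (f (p1 P1 Q1 u)) = 0\<^sub>v (fst X)" using p(7)[OF lh_closed[OF p(3)], of "p1 P1 Q1 u"] by auto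
      moreover have "g' (f' (p2 P1 Q1 u)) = 0\<^sub>v (fst X')" using q(7)[OF lh_closed[OF q(3)], of "p2 P1 Q1 u"] by auto
      ultimately show "?G v = 0\<^sub>v (fst (dsum X X'))"
        unfolding u(2)[symmetric] using zp
        by (intro dsum_eqI[OF lh_closed[OF G(1) lh_closed[OF F(1) u(1)]]]) (simp_all add: F G)
    qed
  qed
  then show ?thesis
  proof (rule prsI)
    show "\<exists>\<psi>. lh I (dsum P0 Q0) Y \<psi> \<and> (\<forall>u\<in>vs (dsum P1 Q1). \<eta> u = \<psi> (?F u))" if e: "lh I (dsum P1 Q1) Y \<eta>" for \<eta>
    proof -
      obtain a where a: "lh I P0 Y a" "\<And>u. u \<in> vs P1 \<Longrightarrow> \<eta> (i1 P1 Q1 u) = a (f u)"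
        using p(8)[OF lh_comp[OF lh_i1[OF w(2,4)] e]] by blast
      obtain b where b: "lh I Q0 Y b" "\<And>u. u \<in> vs Q1 \<Longrightarrow> \<eta> (i2 P1 Q1 u) = b (f' u)"
        using q(8)[OF lh_comp[OF lh_i2[OF w(2,4)] e]] by blast
      have "\<eta> u = cop P0 Q0 a b (?F u)" if u: "u \<in> vs (dsum P1 Q1)" for u
      proof -
        have "\<eta> u = \<eta> (i1 P1 Q1 (p1 P1 Q1 u) + i2 P1 Q1 (p2 P1 Q1 u))" by (simp only: i_p[OF u])
        also have "\<dots> = \<eta> (i1 P1 Q1 (p1 P1 Q1 u)) + \<eta> (i2 P1 Q1 (p2 P1 Q1 u))" by (rule lh_add[OF e]) auto
        also have "\<dots> = cop P0 Q0 a b (?F u)" by (simp add: cop_def F a b)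
        finally show ?thesis .
      qed
      then show ?thesis using lh_cop[OF w(1,3,7) a(1) b(1)] by blast
    qed
  qed
qed

lemma pd_le1_lh:
  assumes "pd_le1 mods I T" and T: "T \<in> mods"
  obtains P0 P1 f g where "spr P0 P1 f g T"
proof -
  obtain P0 P1 f g where h: "projective mods I P0" "projective mods I P1" "hom I P1 P0 f" "hom I P0 T g"
    "injm (fst P1) (fst P0) f" "surjm (fst P0) (fst T) g" "exact_at (fst P1) (fst P0) (fst T) f g"
    using assms unfolding pd_le1_def by blast
  note w = mods_wfm[OF proj_mods[OF h(1)]] mods_wfm[OF proj_mods[OF h(2)]] mods_wfm[OF T]
  have "spr P0 P1 (\<lambda>v. f *\<^sub>v v) (\<lambda>v. g *\<^sub>v v) T"
    by (rule sprI[OF h(1,2) hom_lh[OF w(2,1) h(3)] hom_lh[OF w(1,3) h(4)]])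
      (use h(5-7) in \<open>auto simp: injm_def surjm_def exact_at_def\<close>)
  then show ?thesis by (rule that)
qed

lemma prs_pd_le1:
  assumes "prs T Y" and T: "T \<in> mods" shows "pd_le1 mods I T"
proof -
  obtain P0 P1 f g where p': "spr P0 P1 f g T"
    and p8: "\<forall>\<eta>. lh I P1 Y \<eta> \<longrightarrow> (\<exists>\<psi>. lh I P0 Y \<psi> \<and> (\<forall>u\<in>vs P1. \<eta> u = \<psi> (f u)))"
    using assms(1) unfolding prs_def by blast
  note p = sprD[OF p'] p8[rule_format]
  note w = mods_wfm[OF proj_mods[OF p(1)]] mods_wfm[OF proj_mods[OF p(2)]] mods_wfm[OF T]
  let ?F = "mof (fst P1) (fst P0) f" and ?G = "mof (fst P0) (fst T) g"
  note m = mof_mult[OF lh_lin[OF p(3)]] mof_mult[OF lh_lin[OF p(4)]]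
  show ?thesis unfolding pd_le1_def
  proof (intro exI conjI)
    show "hom I P1 P0 ?F" "hom I P0 T ?G" by (rule lh_hom[OF w(2,1) p(3)], rule lh_hom[OF w(1,3) p(4)])
    show "injm (fst P1) (fst P0) ?F" using p(5) m(1) by (simp add: injm_def)
    show "surjm (fst P0) (fst T) ?G" using p(6) m(2) by (simp add: surjm_def)
    show "exact_at (fst P1) (fst P0) (fst T) ?F ?G" using p(7) m by (simp add: exact_at_def)
  qed (rule p)+
qed

text \<open>The short resolution continued by zero modules is a resolution in the required sense.
  Degree 1 is the factorization contained in \<open>prs\<close>; from degree 2 on the modules of the
  resolution are zero.\<close>

lemma prs_ext_vanish:
  assumes "prs T Y" and T: "T \<in> mods" and Y: "Y \<in> mods" and i: "i \<ge> 1" shows "ext_vanish mods I i T Y"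
proof -
  obtain P0 P1 f g where p': "spr P0 P1 f g T"
    and p8: "\<forall>\<eta>. lh I P1 Y \<eta> \<longrightarrow> (\<exists>\<psi>. lh I P0 Y \<psi> \<and> (\<forall>u\<in>vs P1. \<eta> u = \<psi> (f u)))"
    using assms(1) unfolding prs_def by blast
  note p = sprD[OF p'] p8[rule_format]
  note w = mods_wfm[OF proj_mods[OF p(1)]] mods_wfm[OF proj_mods[OF p(2)]] mods_wfm[OF T] mods_wfm[OF Y]
  let ?F = "mof (fst P1) (fst P0) f" and ?G = "mof (fst P0) (fst T) g"
  note m = mof_mult[OF lh_lin[OF p(3)]] mof_mult[OF lh_lin[OF p(4)]]
  define Q where "Q = (\<lambda>n. if n = 0 then P0 else if n = Suc 0 then P1 else zmod)"
  define dd where "dd = (\<lambda>n. if n = 0 then ?F else 0\<^sub>m (fst (Q n)) 0 :: 'k mat)"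
  have Qs: "Q 0 = P0" "Q (Suc 0) = P1" "\<And>n. Q (Suc (Suc n)) = zmod" by (auto simp: Q_def)
  have ds: "dd 0 = ?F" "\<And>n. dd (Suc n) = 0\<^sub>m (fst (Q (Suc n))) 0" by (auto simp: dd_def)
  have hF: "hom I P1 P0 ?F" by (rule lh_hom[OF w(2,1) p(3)])
  have z0: "0\<^sub>m n 0 *\<^sub>v u = 0\<^sub>v n" if "u \<in> carrier_vec 0" for n and u :: "'k vec"
    using that by (intro eq_vecI) (auto simp: scalar_prod_def)
  have b0: "(\<exists>u\<in>carrier_vec 0. 0\<^sub>m n 0 *\<^sub>v u = v) \<longleftrightarrow> v = 0\<^sub>v n" for n and v :: "'k vec"
    using z0[of "0\<^sub>v 0" n] z0[of _ n] by (metis zero_carrier_vec)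
  have pres: "proj_res mods I T Q dd ?G"
    unfolding proj_res_def
  proof (intro conjI allI)
    show "projective mods I (Q k)" for k using p(1,2) proj_zmod by (auto simp: Q_def)
    show "hom I (Q 0) T ?G" unfolding Qs by (rule lh_hom[OF w(1,3) p(4)])
    show "surjm (fst (Q 0)) (fst T) ?G" unfolding Qs surjm_def using p(6) m by simp
    show "hom I (Q (Suc k)) (Q k) (dd k)" for k
    proof (cases k)
      case (Suc j)
      have wQ: "wfm I (Q k)" using w wfm_zmod by (auto simp: Q_def)
      show ?thesis
        unfolding Suc Qs ds hom_def
      proof (intro conjI ballI)
        show "0\<^sub>m (fst (Q (Suc j))) 0 \<in> carrier_mat (fst (Q (Suc j))) (fst zmod)" by simp
        fix g assume g: "g \<in> I"
        have c: "snd (Q (Suc j)) g \<in> carrier_mat (fst (Q (Suc j))) (fst (Q (Suc j)))" using wQ g Suc by (simp add: wfm_def)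
        have c': "snd zmod g \<in> carrier_mat 0 0" by (simp add: zmod_def)
        show "0\<^sub>m (fst (Q (Suc j))) 0 * snd zmod g = snd (Q (Suc j)) g * 0\<^sub>m (fst (Q (Suc j))) 0"
          using c c' by (intro eq_matI) auto
      qed
    qed (simp add: Qs ds hF)
    show "exact_at (fst (Q 1)) (fst (Q 0)) (fst T) (dd 0) ?G"
      using p(7) m by (simp add: Qs ds exact_at_def)
    show "exact_at (fst (Q (Suc (Suc k)))) (fst (Q (Suc k))) (fst (Q k)) (dd (Suc k)) (dd k)" for k
    proof (cases k)
      case 0
      have "f v = 0\<^sub>v (fst P0) \<longleftrightarrow> v = 0\<^sub>v (fst P1)" if "v \<in> vs P1" for v
        using p(5)[OF that] lh_zero[OF p(3)] by auto
      then show ?thesis unfolding 0 Qs ds exact_at_def fst_zmod b0 using m(1) by simp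
    next
      case (Suc j)
      have "v = 0\<^sub>v 0" if "v \<in> carrier_vec 0" for v :: "'k vec" using that by (intro vec0_eq) auto
      then show ?thesis unfolding Suc Qs ds exact_at_def fst_zmod b0 using z0 by simp
    qed
  qed
  have "\<exists>\<psi>. hom I (Q (i - 1)) Y \<psi> \<and> \<phi> = \<psi> * dd (i - 1)" if h: "hom I (Q i) Y \<phi>" for \<phi>
  proof (cases "i = 1")
    case True
    then have h1: "hom I P1 Y \<phi>" using h by (simp add: Qs)
    have c: "\<phi> \<in> carrier_mat (fst Y) (fst P1)" using h1 by (simp add: hom_def)
    obtain \<psi> where q: "lh I P0 Y \<psi>" "\<forall>u\<in>vs P1. \<phi> *\<^sub>v u = \<psi> (f u)" using p(8)[OF hom_lh[OF w(2,4) h1]] by blast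
    have "\<phi> = mof (fst P0) (fst Y) \<psi> * ?F"
    proof (rule mat_eq_vecI[OF c mult_carrier_mat[OF mof_carrier mof_carrier]])
      fix v assume v: "v \<in> vs P1"
      show "\<phi> *\<^sub>v v = (mof (fst P0) (fst Y) \<psi> * ?F) *\<^sub>v v"
        using assoc_mult_mat_vec[OF mof_carrier mof_carrier v] q(2) v m(1)[OF v] mof_mult[OF lh_lin[OF q(1)] lh_closed[OF p(3) v]] by metis
    qed
    then show ?thesis using True lh_hom[OF w(1,4) q(1)] by (auto simp: Qs ds)
  next
    case False
    define j where "j = i - 2"
    have j: "i = Suc (Suc j)" using i False by (simp add: j_def)
    have c: "\<phi> \<in> carrier_mat (fst Y) 0" using h by (simp add: j Qs hom_def)
    have wQ: "wfm I (Q (Suc j))" using w wfm_zmod by (auto simp: Q_def)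
    let ?Z = "mof (fst (Q (Suc j))) (fst Y) (\<lambda>v. 0\<^sub>v (fst Y))"
    have "hom I (Q (Suc j)) Y ?Z" by (rule lh_hom[OF wQ w(4) lh_const0[OF w(4)]])
    moreover have "\<phi> = ?Z * dd (Suc j)" using c by (intro eq_matI) (auto simp: ds mof_def)
    ultimately show ?thesis using j by auto
  qed
  then show ?thesis unfolding ext_vanish_def using pres by blast
qed

end

context thincat
begin

text \<open>Vanishing of the first extension group is stated with some projective resolution of \<open>X\<close>; a
  comparison with the presentation of a direct summand \<open>U\<close> of \<open>X\<close> transfers it to that presentation.\<close>

lemma ext_vanish_presentation:
  assumes X: "X \<in> mods" and Y: "Y \<in> mods" and U: "U \<in> mods" and r: "ret I U X" and ext: "ext_vanish mods I 1 X Y"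
    and x: "x \<in> J" and P0: "projective mods I P0" and f: "lh I (P x) P0 f" and g: "lh I P0 U g"
    and inj: "\<And>u. u \<in> vs (P x) \<Longrightarrow> f u = 0\<^sub>v (fst P0) \<Longrightarrow> u = 0\<^sub>v (fst (P x))"
    and surj: "\<And>v. v \<in> vs U \<Longrightarrow> \<exists>u\<in>vs P0. g u = v"
    and ex: "\<And>v. v \<in> vs P0 \<Longrightarrow> g v = 0\<^sub>v (fst U) \<longleftrightarrow> (\<exists>u\<in>vs (P x). f u = v)"
    and \<eta>: "lh I (P x) Y \<eta>"
  obtains \<psi> where "lh I P0 Y \<psi>" "\<And>u. u \<in> vs (P x) \<Longrightarrow> \<eta> u = \<psi> (f u)"
proof -
  obtain a b where a: "lh I U X a" and b: "lh I X U b" and ba: "\<And>v. v \<in> vs U \<Longrightarrow> b (a v) = v" using r by (rule retE) blast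
  obtain Q D E where res: "proj_res mods I X Q D E"
    and van: "\<And>\<phi>. hom I (Q 1) Y \<phi> \<Longrightarrow> \<phi> * D 1 = 0\<^sub>m (fst Y) (fst (Q (Suc 1))) \<Longrightarrow> \<exists>\<psi>. hom I (Q 0) Y \<psi> \<and> \<phi> = \<psi> * D 0"
    using ext unfolding ext_vanish_def by auto
  have Qp: "\<And>k. projective mods I (Q k)" using res by (simp add: proj_res_def)
  have Qm: "\<And>k. Q k \<in> mods" using proj_mods[OF Qp] .
  have Qw: "\<And>k. wfm I (Q k)" using mods_wfm[OF Qm] .
  note Xw = mods_wfm[OF X] and Yw = mods_wfm[OF Y] and Pm = P_mods[OF x] and P0m = proj_mods[OF P0]
  define e where "e = (\<lambda>v. E *\<^sub>v v)" define d0 where "d0 = (\<lambda>v. D 0 *\<^sub>v v)" define d1 where "d1 = (\<lambda>v. D 1 *\<^sub>v v)"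
  have hD: "hom I (Q 1) (Q 0) (D 0)" "hom I (Q (Suc 1)) (Q 1) (D 1)" using res unfolding proj_res_def by auto
  have e: "lh I (Q 0) X e" unfolding e_def using res by (intro hom_lh Qw Xw) (simp add: proj_res_def)
  have d0: "lh I (Q 1) (Q 0) d0" unfolding d0_def using hD by (intro hom_lh Qw)
  have d1: "lh I (Q (Suc 1)) (Q 1) d1" unfolding d1_def using hD by (intro hom_lh Qw)
  have se: "\<exists>u\<in>vs (Q 0). e u = v" if "v \<in> vs X" for v
    using res that unfolding proj_res_def surjm_def e_def by blast
  have ex0: "e v = 0\<^sub>v (fst X) \<longleftrightarrow> (\<exists>u\<in>vs (Q 1). d0 u = v)" if "v \<in> vs (Q 0)" for v
    using res that unfolding proj_res_def exact_at_def e_def d0_def by blast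
  have "exact_at (fst (Q (Suc (Suc 0)))) (fst (Q (Suc 0))) (fst (Q 0)) (D (Suc 0)) (D 0)"
    using res unfolding proj_res_def by blast
  then have dd: "d0 (d1 v) = 0\<^sub>v (fst (Q 0))" if "v \<in> vs (Q (Suc 1))" for v
    using that lh_closed[OF d1 that] unfolding exact_at_def d0_def d1_def One_nat_def by blast
  \<comment> \<open>\<open>l0\<close> and \<open>l1\<close> form a chain map from the presentation
    of \<open>U\<close> to the resolution of \<open>X\<close>, lying over \<open>a\<close>;
    \<open>m0\<close> and \<open>m1\<close> form one in the other direction, lying over
    \<open>b\<close>.\<close>
  obtain l0 where l0: "lh I P0 (Q 0) l0" "\<And>v. v \<in> vs P0 \<Longrightarrow> e (l0 v) = a (g v)"
    using proj_lift[OF P0 Qm X e se lh_comp[OF g a]] by blast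
  let ?b = "bs (PP x) (rp x)"
  have bT: "?b \<in> Tv (P x) x" by (rule bsP_Tv[OF x])
  have bv: "?b \<in> vs (P x)" by simp
  have gf: "g (f u) = 0\<^sub>v (fst U)" if "u \<in> vs (P x)" for u using ex[OF lh_closed[OF f that]] that by blast
  have sT: "l0 (f ?b) \<in> Tv (Q 0) x" by (intro lh_Tv[OF l0(1) x] lh_Tv[OF f x] bT)
  have "e (l0 (f ?b)) = 0\<^sub>v (fst X)" using l0(2)[OF lh_closed[OF f bv]] gf[OF bv] lh_zero[OF a] by simp
  then obtain q where "q \<in> vs (Q 1)" "d0 q = l0 (f ?b)" using ex0[OF Tv_vs[OF sT]] by blast
  then obtain q' where q': "q' \<in> Tv (Q 1) x" "d0 q' = l0 (f ?b)" using Tv_lift[OF d0 Qm x sT] by blast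
  obtain l1 where l1: "lh I (P x) (Q 1) l1" "l1 ?b = q'" using yoneda[OF Qm x q'(1)] by blast
  have dl: "d0 (l1 u) = l0 (f u)" if "u \<in> vs (P x)" for u
    by (rule yoneda_unique[OF x lh_comp[OF l1(1) d0] lh_comp[OF f l0(1)] _ that]) (simp add: l1 q')
  obtain m0 where m0: "lh I (Q 0) P0 m0" "\<And>w. w \<in> vs (Q 0) \<Longrightarrow> g (m0 w) = b (e w)"
    using proj_lift[OF Qp P0m U g surj lh_comp[OF e b]] by blast
  have im1: "\<exists>u\<in>vs (P x). f u = m0 (d0 w)" if w: "w \<in> vs (Q 1)" for w
  proof -
    have "e (d0 w) = 0\<^sub>v (fst X)" using ex0[OF lh_closed[OF d0 w]] w by blast
    then have "g (m0 (d0 w)) = 0\<^sub>v (fst U)" using m0(2)[OF lh_closed[OF d0 w]] lh_zero[OF b] by simp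
    then show ?thesis using ex[OF lh_closed[OF m0(1) lh_closed[OF d0 w]]] by blast
  qed
  obtain m1 where m1: "lh I (Q 1) (P x) m1" "\<And>w. w \<in> vs (Q 1) \<Longrightarrow> f (m1 w) = m0 (d0 w)"
    using lift_inj[OF Pm P0m Qm f lh_comp[OF d0 m0(1)] inj im1] by blast
  have m1d: "m1 (d1 w) = 0\<^sub>v (fst (P x))" if w: "w \<in> vs (Q (Suc 1))" for w
    by (rule inj[OF lh_closed[OF m1(1) lh_closed[OF d1 w]]]) (simp add: m1(2)[OF lh_closed[OF d1 w]] dd[OF w] lh_zero[OF m0(1)])
  note em = lh_comp[OF m1(1) \<eta>]
  \<comment> \<open>\<open>\<eta>\<close> composed with \<open>m1\<close> is a cocycle because
    \<open>m1\<close> kills the image of \<open>d1\<close>; the assumed vanishing turns it into a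
    coboundary \<open>H d0\<close>.\<close>
  have "mof (fst (Q 1)) (fst Y) (\<lambda>w. \<eta> (m1 w)) * D 1 = 0\<^sub>m (fst Y) (fst (Q (Suc 1)))"
  proof (rule mat_eq_vecI)
    have Dc: "D 1 \<in> carrier_mat (fst (Q 1)) (fst (Q (Suc 1)))" using hD(2) unfolding hom_def by blast
    show "mof (fst (Q 1)) (fst Y) (\<lambda>w. \<eta> (m1 w)) * D 1 \<in> carrier_mat (fst Y) (fst (Q (Suc 1)))" by (rule mult_carrier_mat[OF mof_carrier Dc])
    fix v :: "'k vec" assume v: "v \<in> vs (Q (Suc 1))"
    have "(mof (fst (Q 1)) (fst Y) (\<lambda>w. \<eta> (m1 w)) * D 1) *\<^sub>v v = \<eta> (m1 (d1 v))"
      using assoc_mult_mat_vec[OF mof_carrier Dc v] mof_mult[OF lh_lin[OF em] lh_closed[OF d1 v]] unfolding d1_def by metis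
    also have "\<dots> = 0\<^sub>m (fst Y) (fst (Q (Suc 1))) *\<^sub>v v" using m1d[OF v] lh_zero[OF \<eta>] v by (intro eq_vecI) auto
    finally show "(mof (fst (Q 1)) (fst Y) (\<lambda>w. \<eta> (m1 w)) * D 1) *\<^sub>v v = 0\<^sub>m (fst Y) (fst (Q (Suc 1))) *\<^sub>v v" .
  qed simp
  from van[OF lh_hom[OF Qw Yw em] this] obtain H where H: "hom I (Q 0) Y H" "mof (fst (Q 1)) (fst Y) (\<lambda>w. \<eta> (m1 w)) = H * D 0" by blast
  have pl: "lh I (Q 0) Y (\<lambda>v. H *\<^sub>v v)" by (rule hom_lh[OF Qw Yw H(1)])
  have pd: "\<eta> (m1 w) = H *\<^sub>v (d0 w)" if w: "w \<in> vs (Q 1)" for w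
  proof -
    have c: "H \<in> carrier_mat (fst Y) (fst (Q 0))" "D 0 \<in> carrier_mat (fst (Q 0)) (fst (Q 1))" using H(1) hD(1) unfolding hom_def by blast+
    show ?thesis using assoc_mult_mat_vec[OF c w] mof_mult[OF lh_lin[OF em] w] H(2) unfolding d0_def by metis
  qed
  have imS: "\<exists>u\<in>vs (P x). f u = m0 (l0 v) - v" if v: "v \<in> vs P0" for v
  proof -
    note c = lh_closed[OF m0(1) lh_closed[OF l0(1) v]]
    have "g (m0 (l0 v)) = g v" using m0(2)[OF lh_closed[OF l0(1) v]] l0(2)[OF v] ba[OF lh_closed[OF g v]] by simp
    then have "g (m0 (l0 v) - v) = 0\<^sub>v (fst U)" using lh_minus[OF g c v] minus_cancel_vec[OF lh_closed[OF g v]] by simp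
    then show ?thesis using ex[of "m0 (l0 v) - v"] c v by auto
  qed
  \<comment> \<open>Since \<open>b (a v) = v\<close>, the composite of the two chain maps differs
    from the identity by a homotopy, which is \<open>s\<close>.\<close>
  obtain s where s: "lh I P0 (P x) s" "\<And>v. v \<in> vs P0 \<Longrightarrow> f (s v) = m0 (l0 v) - v"
    using lift_inj[OF Pm P0m P0m f lh_diff[OF mods_wfm[OF P0m] lh_comp[OF l0(1) m0(1)] lh_id] inj imS] by blast
  have ml: "m1 (l1 u) - s (f u) = u" if u: "u \<in> vs (P x)" for u
  proof -
    note fu = lh_closed[OF f u]
    note c1 = lh_closed[OF m1(1) lh_closed[OF l1(1) u]] and c2 = lh_closed[OF s(1) fu] and c3 = lh_closed[OF m0(1) lh_closed[OF l0(1) fu]]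
    have c12: "m1 (l1 u) - s (f u) \<in> vs (P x)" using c1 c2 by simp
    have "f (m1 (l1 u) - s (f u) - u) = f (m1 (l1 u)) - f (s (f u)) - f u"
      by (simp only: lh_minus[OF f c12 u] lh_minus[OF f c1 c2])
    also have "\<dots> = m0 (l0 (f u)) - (m0 (l0 (f u)) - f u) - f u"
      by (simp only: m1(2)[OF lh_closed[OF l1(1) u]] dl[OF u] s(2)[OF fu])
    also have "\<dots> = 0\<^sub>v (fst P0)" using c3 fu by (intro eq_vecI) auto
    finally have "m1 (l1 u) - s (f u) - u = 0\<^sub>v (fst (P x))" using c12 u by (intro inj) auto
    then show ?thesis by (rule vec_diff_zero[OF c12 u])
  qed
  show ?thesis
  proof (rule that)
    \<comment> \<open>The coboundary only factors \<open>\<eta>\<close> composed with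
      \<open>m1 l1\<close>; subtracting \<open>\<eta> s\<close> corrects this to a factorization of
      \<open>\<eta>\<close> itself.\<close>
    show "lh I P0 Y (\<lambda>v. H *\<^sub>v (l0 v) - \<eta> (s v))" by (intro lh_diff Yw lh_comp[OF l0(1) pl] lh_comp[OF s(1) \<eta>])
    fix u assume u: "u \<in> vs (P x)"
    note c1 = lh_closed[OF m1(1) lh_closed[OF l1(1) u]] and c2 = lh_closed[OF s(1) lh_closed[OF f u]]
    have "\<eta> u = \<eta> (m1 (l1 u)) - \<eta> (s (f u))" using ml[OF u] lh_minus[OF \<eta> c1 c2] by simp
    then show "\<eta> u = H *\<^sub>v (l0 (f u)) - \<eta> (s (f u))" using pd[OF lh_closed[OF l1(1) u]] dl[OF u] by simp
  qed
qed

end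

section \<open>Representations of the quiver\<close>

text \<open>Out-degree at most one makes the indecomposable projective \<Lambda>-modules uniserial
  of length at most two; in-degree at most two bounds the length of the indecomposable injective
  ones by three. Arrows increase the vertex number, which excludes cycles.\<close>

locale quiver =
  fixes m :: nat and Ar :: "(nat \<times> nat) set" and K :: "'k::field itself"
  assumes Ar_bounds: "(u,v) \<in> Ar \<Longrightarrow> 1 \<le> u \<and> u < v \<and> v \<le> m"
    and Ar_fun: "(u,v) \<in> Ar \<Longrightarrow> (u,v') \<in> Ar \<Longrightarrow> v = v'"
    and Ar_indeg: "(a,v) \<in> Ar \<Longrightarrow> (b,v) \<in> Ar \<Longrightarrow> (c,v) \<in> Ar \<Longrightarrow> a = b \<or> b = c \<or> a = c"
begin

definition V :: "nat set" where "V = {1..m}"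
definition rl :: "nat \<Rightarrow> nat \<Rightarrow> bool" where "rl x y \<longleftrightarrow> x = y \<or> (x,y) \<in> Ar"
definition ixL :: "nat \<Rightarrow> nat \<Rightarrow> nat + nat \<times> nat" where "ixL x y = (if x = y then Inl x else Inr (x,y))"
definition coL :: "nat + nat \<times> nat \<Rightarrow> nat \<Rightarrow> nat \<Rightarrow> 'k" where
  "coL g c c' = (case g of Inl i \<Rightarrow> if c = i \<and> c' = i then 1 else 0 | Inr a \<Rightarrow> if (c,c') = a then 1 else 0)"

abbreviation IL where "IL \<equiv> gensL m Ar"
abbreviation LM :: "(nat + nat \<times> nat, 'k) md set" where "LM \<equiv> lmods m Ar"

lemma Ar_V: "(u,v) \<in> Ar \<Longrightarrow> u \<in> V" "(u,v) \<in> Ar \<Longrightarrow> v \<in> V" "(u,v) \<in> Ar \<Longrightarrow> u < v"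
  using Ar_bounds by (force simp: V_def)+

lemma finite_V [simp]: "finite V" by (simp add: V_def)

lemma Ar_irrefl: "(u,u) \<notin> Ar" using Ar_V(3) by blast

lemma Ar_no_short: "(u,v) \<in> Ar \<Longrightarrow> (v,w) \<in> Ar \<Longrightarrow> (u,w) \<notin> Ar"
  using Ar_fun Ar_irrefl by blast

lemma in_IL [simp]: "Inl i \<in> IL \<longleftrightarrow> i \<in> V" "Inr a \<in> IL \<longleftrightarrow> a \<in> Ar"
  by (auto simp: gensL_def V_def)

lemma foldr_mat:
  fixes A :: "nat \<Rightarrow> 'k mat"
  assumes "\<And>i. i \<in> set xs \<Longrightarrow> A i \<in> carrier_mat n n" "distinct xs"
  shows "foldr (+) (map A xs) (0\<^sub>m n n) \<in> carrier_mat n n \<and>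
    (\<forall>v\<in>carrier_vec n. foldr (+) (map A xs) (0\<^sub>m n n) *\<^sub>v v = vsum n (\<lambda>i. A i *\<^sub>v v) (set xs))"
  using assms
proof (induction xs)
  case Nil
  show ?case by (auto intro!: eq_vecI)
next
  case (Cons a xs)
  let ?S = "foldr (+) (map A xs) (0\<^sub>m n n)"
  have a: "A a \<in> carrier_mat n n" using Cons by simp
  have IH: "?S \<in> carrier_mat n n" "\<And>v. v\<in>carrier_vec n \<Longrightarrow> ?S *\<^sub>v v = vsum n (\<lambda>i. A i *\<^sub>v v) (set xs)"
    using Cons by auto
  have "(A a + ?S) *\<^sub>v v = vsum n (\<lambda>i. A i *\<^sub>v v) (set (a # xs))" if v: "v \<in> carrier_vec n" for v
    using add_mult_distrib_mat_vec[OF a IH(1) v] IH(2)[OF v] a v Cons.prems(2) by (simp add: vsum_insert)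
  then show ?case using a IH(1) by simp
qed

text \<open>Identities between matrices become identities on vectors. In this form they pass to
  direct sums through the two projections, and to retracts through the injective map into the larger
  module.\<close>

lemma LM_iff: "X \<in> LM \<longleftrightarrow> wfm IL X \<and>
   (\<forall>i\<in>V. \<forall>j\<in>V. \<forall>v\<in>vs X. snd X (Inl i) *\<^sub>v (snd X (Inl j) *\<^sub>v v) = (if i = j then snd X (Inl i) *\<^sub>v v else 0\<^sub>v (fst X))) \<and>
   (\<forall>v\<in>vs X. vsum (fst X) (\<lambda>i. snd X (Inl i) *\<^sub>v v) V = v) \<and>
   (\<forall>i j. (i,j) \<in> Ar \<longrightarrow> (\<forall>v\<in>vs X. snd X (Inr (i,j)) *\<^sub>v v = snd X (Inl j) *\<^sub>v (snd X (Inr (i,j)) *\<^sub>v (snd X (Inl i) *\<^sub>v v)))) \<and>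
   (\<forall>a\<in>Ar. \<forall>b\<in>Ar. \<forall>v\<in>vs X. snd X (Inr b) *\<^sub>v (snd X (Inr a) *\<^sub>v v) = 0\<^sub>v (fst X))" (is "_ \<longleftrightarrow> ?W \<and> ?E \<and> ?S \<and> ?A \<and> ?Z")
proof (cases ?W)
  case W: True
  let ?n = "fst X" and ?r = "snd X"
  have ci: "?r (Inl i) \<in> carrier_mat ?n ?n" if "i \<in> V" for i using W that by (auto simp: wfm_def)
  have ca: "?r (Inr a) \<in> carrier_mat ?n ?n" if "a \<in> Ar" for a using W that by (auto simp: wfm_def)
  note mc = mult_carrier_mat[of _ ?n ?n _ ?n]
  have eqv: "A = B \<longleftrightarrow> (\<forall>v\<in>vs X. A *\<^sub>v v = B *\<^sub>v v)" if "A \<in> carrier_mat ?n ?n" "B \<in> carrier_mat ?n ?n" for A B :: "'k mat"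
    using mat_eq_vecI[OF that] by blast
  have am: "(A * B) *\<^sub>v v = A *\<^sub>v (B *\<^sub>v v)" if "A \<in> carrier_mat ?n ?n" "B \<in> carrier_mat ?n ?n" "v \<in> vs X" for A B :: "'k mat" and v
    by (rule assoc_mult_mat_vec[OF that])
  have z: "0\<^sub>m ?n ?n *\<^sub>v v = 0\<^sub>v ?n" if "v \<in> vs X" for v :: "'k vec" using that by (intro eq_vecI) auto
  have E: "(\<forall>i\<in>V. \<forall>j\<in>V. ?r (Inl i) * ?r (Inl j) = (if i = j then ?r (Inl i) else 0\<^sub>m ?n ?n)) \<longleftrightarrow> ?E"
  proof (intro ball_cong refl)
    fix i j assume ij: "i \<in> V" "j \<in> V"
    have "(if i = j then ?r (Inl i) else 0\<^sub>m ?n ?n) \<in> carrier_mat ?n ?n" using ci[OF ij(1)] by (cases "i = j") auto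
    from eqv[OF mc[OF ci[OF ij(1)] ci[OF ij(2)]] this]
    show "(?r (Inl i) * ?r (Inl j) = (if i = j then ?r (Inl i) else 0\<^sub>m ?n ?n)) \<longleftrightarrow>
      (\<forall>v\<in>vs X. ?r (Inl i) *\<^sub>v (?r (Inl j) *\<^sub>v v) = (if i = j then ?r (Inl i) *\<^sub>v v else 0\<^sub>v ?n))"
      using am[OF ci[OF ij(1)] ci[OF ij(2)]] z by auto
  qed
  have s: "set [1..<Suc m] = V" by (auto simp: V_def)
  have fm: "foldr (+) (map (\<lambda>i. ?r (Inl i)) [1..<Suc m]) (0\<^sub>m ?n ?n) \<in> carrier_mat ?n ?n"
    "\<And>v. v \<in> vs X \<Longrightarrow> foldr (+) (map (\<lambda>i. ?r (Inl i)) [1..<Suc m]) (0\<^sub>m ?n ?n) *\<^sub>v v = vsum ?n (\<lambda>i. ?r (Inl i) *\<^sub>v v) V"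
    using foldr_mat[of "[1..<Suc m]" "\<lambda>i. ?r (Inl i)" ?n] ci unfolding s by auto
  have S: "foldr (+) (map (\<lambda>i. ?r (Inl i)) [1..<Suc m]) (0\<^sub>m ?n ?n) = 1\<^sub>m ?n \<longleftrightarrow> ?S"
    using eqv[OF fm(1) one_carrier_mat] fm(2) by simp
  have A: "(\<forall>(i,j)\<in>Ar. ?r (Inr (i,j)) = ?r (Inl j) * ?r (Inr (i,j)) * ?r (Inl i)) \<longleftrightarrow> ?A"
  proof -
    have "?r (Inr (i,j)) = ?r (Inl j) * ?r (Inr (i,j)) * ?r (Inl i) \<longleftrightarrow>
       (\<forall>v\<in>vs X. ?r (Inr (i,j)) *\<^sub>v v = ?r (Inl j) *\<^sub>v (?r (Inr (i,j)) *\<^sub>v (?r (Inl i) *\<^sub>v v)))" if ij: "(i,j) \<in> Ar" for i j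
    proof -
      note c1 = ci[OF Ar_V(1)[OF ij]] and c2 = ci[OF Ar_V(2)[OF ij]] and c3 = ca[OF ij]
      show ?thesis using eqv[OF c3 mc[OF mc[OF c2 c3] c1]] am[OF mc[OF c2 c3] c1] am[OF c2 c3 mult_mat_vec_carrier[OF c1]] by simp
    qed
    then show ?thesis by blast
  qed
  have Z: "(\<forall>a\<in>Ar. \<forall>b\<in>Ar. ?r (Inr b) * ?r (Inr a) = 0\<^sub>m ?n ?n) \<longleftrightarrow> ?Z"
    using eqv[OF mc[OF ca ca] zero_carrier_mat] am[OF ca ca] z by simp
  show ?thesis unfolding lmods_def Let_def mem_Collect_eq V_def[symmetric] E[symmetric] S[symmetric] A[symmetric] Z[symmetric]
    using W ci ca by auto
next
  case False
  then show ?thesis unfolding lmods_def Let_def wfm_def gensL_def by auto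
qed

lemma LM_modcat: "modcat IL LM"
proof
  fix X assume "X \<in> LM" then show "wfm IL X" by (simp add: LM_iff)
next
  have e: "v = w" if "v \<in> carrier_vec 0" "w \<in> carrier_vec 0" for v w :: "'k vec" using that by (rule vec0_eq)
  have c: "snd zmod g *\<^sub>v v \<in> carrier_vec 0" for g :: "nat + nat \<times> nat" and v :: "'k vec" by (rule carrier_vecI) (simp add: zmod_def)
  let ?Z = "zmod :: (nat + nat \<times> nat, 'k) md"
  show "zmod \<in> LM" unfolding LM_iff fst_zmod
  proof (intro conjI ballI allI impI wfm_zmod)
    show "snd ?Z (Inl i) *\<^sub>v (snd ?Z (Inl j) *\<^sub>v v) = (if i = j then snd ?Z (Inl i) *\<^sub>v v else 0\<^sub>v 0)" for i j and v :: "'k vec"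
      by (rule e[OF c]) (cases "i = j", simp_all add: c)
    show "vsum 0 (\<lambda>i. snd ?Z (Inl i) *\<^sub>v v) V = v" if "v \<in> carrier_vec 0" for v :: "'k vec"
      by (rule e[OF vsum_carrier that])
    show "snd ?Z (Inr (i,j)) *\<^sub>v v = snd ?Z (Inl j) *\<^sub>v (snd ?Z (Inr (i,j)) *\<^sub>v (snd ?Z (Inl i) *\<^sub>v v))" for i j and v :: "'k vec"
      by (rule e[OF c c])
    show "snd ?Z (Inr b) *\<^sub>v (snd ?Z (Inr a) *\<^sub>v v) = 0\<^sub>v 0" for a b and v :: "'k vec"
      by (rule e[OF c zero_carrier_vec])
  qed
next
  fix X Y assume X: "X \<in> LM" and Y: "Y \<in> LM"
  have w: "wfm IL X" "wfm IL Y" using X Y by (auto simp: LM_iff)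
  note wd = wfm_dsum[OF w]
  let ?D = "dsum X Y"
  have c: "snd ?D g *\<^sub>v v \<in> vs ?D" if "g \<in> IL" "v \<in> vs ?D" for g v using wfm_act[OF wd that] .
  have q1: "p1 X Y (snd ?D g *\<^sub>v v) = snd X g *\<^sub>v p1 X Y v" if "g \<in> IL" "v \<in> vs ?D" for g v using lh_act[OF lh_p1[OF w] that] .
  have q2: "p2 X Y (snd ?D g *\<^sub>v v) = snd Y g *\<^sub>v p2 X Y v" if "g \<in> IL" "v \<in> vs ?D" for g v using lh_act[OF lh_p2[OF w] that] .
  note z = lh_zero[OF lh_p1[OF w]] lh_zero[OF lh_p2[OF w]] lh_zero[OF lh_p1[OF w], simplified] lh_zero[OF lh_p2[OF w], simplified]
  have i: "Inl i \<in> IL" if "i \<in> V" for i using that by simp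
  have a: "Inr a \<in> IL" if "a \<in> Ar" for a using that by simp
  show "?D \<in> LM" unfolding LM_iff
  proof (intro conjI wd ballI allI impI)
    fix i j v assume h: "i \<in> V" "j \<in> V" "v \<in> vs ?D"
    show "snd ?D (Inl i) *\<^sub>v (snd ?D (Inl j) *\<^sub>v v) = (if i = j then snd ?D (Inl i) *\<^sub>v v else 0\<^sub>v (fst ?D))"
      by (rule dsum_eqI[of _ X Y])
        (use X Y h in \<open>auto simp: c[OF i] q1[OF i] q2[OF i] z LM_iff c[OF i, simplified]\<close>)
  next
    fix v assume v: "v \<in> vs ?D"
    show "vsum (fst ?D) (\<lambda>i. snd ?D (Inl i) *\<^sub>v v) V = v"
    proof (rule dsum_eqI[of _ X Y])
      show "p1 X Y (vsum (fst ?D) (\<lambda>i. snd ?D (Inl i) *\<^sub>v v) V) = p1 X Y v"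
        using X v by (subst lin_vsum[OF lh_lin[OF lh_p1[OF w]]]) (auto simp: c[OF i] c[OF i, simplified] q1[OF i] LM_iff cong: vsum_cong)
      show "p2 X Y (vsum (fst ?D) (\<lambda>i. snd ?D (Inl i) *\<^sub>v v) V) = p2 X Y v"
        using Y v by (subst lin_vsum[OF lh_lin[OF lh_p2[OF w]]]) (auto simp: c[OF i] c[OF i, simplified] q2[OF i] LM_iff cong: vsum_cong)
    qed (use v in auto)
  next
    fix i j v assume h: "(i,j) \<in> Ar" and v: "v \<in> vs ?D"
    note ii = i[OF Ar_V(1)[OF h]] and jj = i[OF Ar_V(2)[OF h]] and aa = a[OF h]
    note v1 = c[OF ii v] note v2 = c[OF aa v1] note v3 = c[OF jj v2]
    have X': "snd X (Inr (i,j)) *\<^sub>v x = snd X (Inl j) *\<^sub>v (snd X (Inr (i,j)) *\<^sub>v (snd X (Inl i) *\<^sub>v x))" if "x \<in> vs X" for x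
      using X h that by (simp add: LM_iff)
    have Y': "snd Y (Inr (i,j)) *\<^sub>v x = snd Y (Inl j) *\<^sub>v (snd Y (Inr (i,j)) *\<^sub>v (snd Y (Inl i) *\<^sub>v x))" if "x \<in> vs Y" for x
      using Y h that by (simp add: LM_iff)
    show "snd ?D (Inr (i,j)) *\<^sub>v v = snd ?D (Inl j) *\<^sub>v (snd ?D (Inr (i,j)) *\<^sub>v (snd ?D (Inl i) *\<^sub>v v))"
    proof (rule dsum_eqI[OF c[OF aa v] v3])
      show "p1 X Y (snd ?D (Inr (i,j)) *\<^sub>v v) = p1 X Y (snd ?D (Inl j) *\<^sub>v (snd ?D (Inr (i,j)) *\<^sub>v (snd ?D (Inl i) *\<^sub>v v)))"
        unfolding q1[OF aa v] q1[OF jj v2] q1[OF aa v1] q1[OF ii v] by (rule X') simp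
      show "p2 X Y (snd ?D (Inr (i,j)) *\<^sub>v v) = p2 X Y (snd ?D (Inl j) *\<^sub>v (snd ?D (Inr (i,j)) *\<^sub>v (snd ?D (Inl i) *\<^sub>v v)))"
        unfolding q2[OF aa v] q2[OF jj v2] q2[OF aa v1] q2[OF ii v] by (rule Y') simp
    qed
  next
    fix x y v assume h: "x \<in> Ar" "y \<in> Ar" and v: "v \<in> vs ?D"
    note v1 = c[OF a[OF h(1)] v] note v2 = c[OF a[OF h(2)] v1]
    show "snd ?D (Inr y) *\<^sub>v (snd ?D (Inr x) *\<^sub>v v) = 0\<^sub>v (fst ?D)"
      by (rule dsum_eqI[OF v2])
        (use X Y h in \<open>auto simp: q1[OF a[OF h(2)] v1] q2[OF a[OF h(2)] v1] q1[OF a[OF h(1)] v] q2[OF a[OF h(1)] v] z[simplified] LM_iff\<close>)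
  qed
next
  fix X Z assume X: "X \<in> LM" and wZ: "wfm IL Z" and r: "ret IL Z X"
  obtain f g where f: "lh IL Z X f" and g: "lh IL X Z g" and gf: "\<And>v. v \<in> vs Z \<Longrightarrow> g (f v) = v" using r by (rule retE) blast
  have c: "snd Z h *\<^sub>v v \<in> vs Z" if "h \<in> IL" "v \<in> vs Z" for h v using wfm_act[OF wZ that] .
  have i: "Inl i \<in> IL" if "i \<in> V" for i using that by simp
  have a: "Inr a \<in> IL" if "a \<in> Ar" for a using that by simp
  have inj: "v = w" if "v \<in> vs Z" "w \<in> vs Z" "f v = f w" for v w using gf that by metis
  have fc: "f (snd Z h *\<^sub>v v) = snd X h *\<^sub>v f v" if "h \<in> IL" "v \<in> vs Z" for h v using lh_act[OF f that] .
  note fz = lh_zero[OF f] and fv = lh_closed[OF f]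
  show "Z \<in> LM" unfolding LM_iff
  proof (intro conjI wZ ballI allI impI)
    fix i' j v assume h: "i' \<in> V" "j \<in> V" "v \<in> vs Z"
    show "snd Z (Inl i') *\<^sub>v (snd Z (Inl j) *\<^sub>v v) = (if i' = j then snd Z (Inl i') *\<^sub>v v else 0\<^sub>v (fst Z))"
      by (rule inj) (use X h in \<open>auto simp: c[OF i] fc[OF i] fz LM_iff fv\<close>)
  next
    fix v assume v: "v \<in> vs Z"
    show "vsum (fst Z) (\<lambda>i. snd Z (Inl i) *\<^sub>v v) V = v"
    proof (rule inj)
      show "f (vsum (fst Z) (\<lambda>i. snd Z (Inl i) *\<^sub>v v) V) = f v"
        using X v by (subst lin_vsum[OF lh_lin[OF f]]) (auto simp: c[OF i] fc[OF i] fv LM_iff cong: vsum_cong)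
    qed (use v in auto)
  next
    fix i' j v assume h: "(i',j) \<in> Ar" and v: "v \<in> vs Z"
    note ii = i[OF Ar_V(1)[OF h]] and jj = i[OF Ar_V(2)[OF h]] and aa = a[OF h]
    note v1 = c[OF ii v] note v2 = c[OF aa v1] note v3 = c[OF jj v2]
    have X': "snd X (Inr (i',j)) *\<^sub>v x = snd X (Inl j) *\<^sub>v (snd X (Inr (i',j)) *\<^sub>v (snd X (Inl i') *\<^sub>v x))" if "x \<in> vs X" for x
      using X h that by (simp add: LM_iff)
    show "snd Z (Inr (i',j)) *\<^sub>v v = snd Z (Inl j) *\<^sub>v (snd Z (Inr (i',j)) *\<^sub>v (snd Z (Inl i') *\<^sub>v v))"
      by (rule inj[OF c[OF aa v] v3]) (unfold fc[OF jj v2] fc[OF aa v1] fc[OF ii v] fc[OF aa v], rule X'[OF fv[OF v]])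
  next
    fix x y v assume h: "x \<in> Ar" "y \<in> Ar" and v: "v \<in> vs Z"
    note v1 = c[OF a[OF h(1)] v] note v2 = c[OF a[OF h(2)] v1]
    show "snd Z (Inr y) *\<^sub>v (snd Z (Inr x) *\<^sub>v v) = 0\<^sub>v (fst Z)"
      by (rule inj[OF v2]) (use X h fv[OF v] in \<open>auto simp: fc[OF a[OF h(2)] v1] fc[OF a[OF h(1)] v] fz LM_iff\<close>)
  qed
qed

section \<open>Thin representations of the quiver\<close>

lemma rl_less: "rl x y \<Longrightarrow> x = y \<or> x < y" by (auto simp: rl_def dest: Ar_V(3))

lemma rl_assoc: "rl x i \<Longrightarrow> rl i j \<Longrightarrow> rl j k \<Longrightarrow> rl x k \<Longrightarrow> rl x j \<longleftrightarrow> rl i k"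
  using rl_less[of x i] rl_less[of i j] rl_less[of j k] Ar_fun unfolding rl_def by auto

text \<open>Over \<Lambda> the points are the vertices, and each vertex is its own label.\<close>

sublocale L: thin0 "V" "\<lambda>x. x" "V" rl "\<lambda>x. x" coL
proof
  show "\<And>x i j k. x \<in> V \<Longrightarrow> i \<in> V \<Longrightarrow> j \<in> V \<Longrightarrow> k \<in> V \<Longrightarrow> rl x i \<Longrightarrow> rl i j \<Longrightarrow> rl j k \<Longrightarrow> rl x k \<Longrightarrow> rl x j = rl i k"
    using rl_assoc by blast
qed (auto simp: rl_def V_def)

lemma L_Inl:
  assumes "v \<in> vs (L.th A)" "c \<in> L.sc A"
  shows "L.cd A c (snd (L.th A) (Inl i) *\<^sub>v v) = (if c = i then L.cd A c v else 0)"
proof -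
  have "(\<Sum>c'\<in>L.sc A. coL (Inl i) c' c * L.cd A c' v) = (\<Sum>c'\<in>L.sc A. if c' = i then (if c = i then L.cd A c v else 0) else 0)"
    by (intro sum.cong) (auto simp: coL_def)
  then show ?thesis using assms L.cd_act[of c A v "Inl i"] by auto
qed

lemma L_Inr:
  assumes "v \<in> vs (L.th A)" "c \<in> L.sc A"
  shows "L.cd A c (snd (L.th A) (Inr (i,j)) *\<^sub>v v) = (if c = j \<and> i \<in> L.sc A then L.cd A i v else 0)"
proof -
  have "(\<Sum>c'\<in>L.sc A. coL (Inr (i,j)) c' c * L.cd A c' v) = (\<Sum>c'\<in>L.sc A. if c' = i then (if c = j then L.cd A i v else 0) else 0)"
    by (intro sum.cong) (auto simp: coL_def)
  then show ?thesis using assms L.cd_act[of c A v "Inr (i,j)"] by auto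
qed

text \<open>The one relation that is not immediate is that two consecutive arrows act by zero. If
  all three vertices lay in \<open>A\<close>, then \<open>tconv\<close> would relate the first to
  the last, which out-degree one and the numbering of the vertices exclude.\<close>

lemma L_th_LM: assumes A: "A \<subseteq> V" "L.tconv A" shows "L.th A \<in> LM"
proof -
  let ?T = "L.th A"
  have w: "wfm IL ?T" by (rule L.th_wfm)
  have c: "snd ?T h *\<^sub>v v \<in> carrier_vec (card (L.sc A))" if "v \<in> carrier_vec (card (L.sc A))" for h v
    using wfm_act[OF L.th_wfm[of UNIV], of h v A] that by simp
  have sc: "x \<in> L.sc A \<longleftrightarrow> x \<in> A" for x using A by (auto simp: L.sc_iff)
  note ev = L.cd_eqI[where A=A]
  show ?thesis unfolding LM_iff L.fst_th
  proof (intro conjI w ballI allI impI)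
    fix i j and v :: "'k vec" assume "v \<in> carrier_vec (card (L.sc A))"
    then show "snd ?T (Inl i) *\<^sub>v (snd ?T (Inl j) *\<^sub>v v) = (if i = j then snd ?T (Inl i) *\<^sub>v v else 0\<^sub>v (card (L.sc A)))"
      by (intro ev) (auto simp: L_Inl c L.cd_zero)
  next
    fix v :: "'k vec" assume v: "v \<in> carrier_vec (card (L.sc A))"
    show "vsum (card (L.sc A)) (\<lambda>i. snd ?T (Inl i) *\<^sub>v v) V = v"
      by (rule ev) (use v in \<open>auto simp: L_Inl L.cd_vsum L.sc_iff\<close>)
  next
    fix i j and v :: "'k vec" assume "v \<in> carrier_vec (card (L.sc A))"
    then show "snd ?T (Inr (i,j)) *\<^sub>v v = snd ?T (Inl j) *\<^sub>v (snd ?T (Inr (i,j)) *\<^sub>v (snd ?T (Inl i) *\<^sub>v v))"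
      by (intro ev) (auto simp: L_Inl L_Inr c)
  next
    fix a b and v :: "'k vec" assume ab: "a \<in> Ar" "b \<in> Ar" and v: "v \<in> carrier_vec (card (L.sc A))"
    obtain x y x' y' where xy: "a = (x,y)" "b = (x',y')" by (cases a; cases b) auto
    have "\<not> (y = x' \<and> x \<in> A \<and> y \<in> A \<and> y' \<in> A)"
    proof
      assume h: "y = x' \<and> x \<in> A \<and> y \<in> A \<and> y' \<in> A"
      have "rl x y \<and> rl y y'" "y \<in> V" using ab xy h Ar_V by (auto simp: rl_def)
      then have "rl x y'" using A(2) h unfolding L.tconv_def by blast
      then show False using ab xy h Ar_no_short Ar_V(3) unfolding rl_def by (metis less_asym)
    qed
    then show "snd ?T (Inr b) *\<^sub>v (snd ?T (Inr a) *\<^sub>v v) = 0\<^sub>v (card (L.sc A))"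
      unfolding xy using v by (intro ev) (auto simp: L_Inr c L.cd_zero sc)
  qed
qed

lemma LM_act:
  assumes X: "X \<in> LM" and v: "v \<in> vs X"
  shows "i \<in> V \<Longrightarrow> j \<in> V \<Longrightarrow> snd X (Inl i) *\<^sub>v (snd X (Inl j) *\<^sub>v v) = (if i = j then snd X (Inl i) *\<^sub>v v else 0\<^sub>v (fst X))"
    and "(i,j) \<in> Ar \<Longrightarrow> c \<in> V \<Longrightarrow> snd X (Inr (i,j)) *\<^sub>v (snd X (Inl c) *\<^sub>v v) = (if c = i then snd X (Inr (i,j)) *\<^sub>v v else 0\<^sub>v (fst X))"
    and "(i,j) \<in> Ar \<Longrightarrow> c \<in> V \<Longrightarrow> snd X (Inl c) *\<^sub>v (snd X (Inr (i,j)) *\<^sub>v v) = (if c = j then snd X (Inr (i,j)) *\<^sub>v v else 0\<^sub>v (fst X))"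
    and "a \<in> Ar \<Longrightarrow> b \<in> Ar \<Longrightarrow> snd X (Inr b) *\<^sub>v (snd X (Inr a) *\<^sub>v v) = 0\<^sub>v (fst X)"
proof -
  have w: "wfm IL X" using X by (simp add: LM_iff)
  have E: "snd X (Inl i) *\<^sub>v (snd X (Inl j) *\<^sub>v v) = (if i = j then snd X (Inl i) *\<^sub>v v else 0\<^sub>v (fst X))" if "i \<in> V" "j \<in> V" "v \<in> vs X" for i j v
    using X that by (simp add: LM_iff)
  have D: "snd X (Inr (i,j)) *\<^sub>v v = snd X (Inl j) *\<^sub>v (snd X (Inr (i,j)) *\<^sub>v (snd X (Inl i) *\<^sub>v v))" if "(i,j) \<in> Ar" "v \<in> vs X" for i j v
    using X that by (simp add: LM_iff)
  have c: "snd X (Inl i) *\<^sub>v v \<in> vs X" if "i \<in> V" "v \<in> vs X" for i v using wfm_act[OF w _ that(2)] that by simp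
  have ca: "snd X (Inr a) *\<^sub>v v \<in> vs X" if "a \<in> Ar" "v \<in> vs X" for a v using wfm_act[OF w _ that(2)] that by simp
  have z: "snd X (Inl i) *\<^sub>v 0\<^sub>v (fst X) = 0\<^sub>v (fst X)" if "i \<in> V" for i by (rule mat_zero_vec[OF wfm_carrier[OF w]]) (use that in simp)
  have za: "snd X (Inr a) *\<^sub>v 0\<^sub>v (fst X) = 0\<^sub>v (fst X)" if "a \<in> Ar" for a by (rule mat_zero_vec[OF wfm_carrier[OF w]]) (use that in simp)
  show "i \<in> V \<Longrightarrow> j \<in> V \<Longrightarrow> snd X (Inl i) *\<^sub>v (snd X (Inl j) *\<^sub>v v) = (if i = j then snd X (Inl i) *\<^sub>v v else 0\<^sub>v (fst X))"
    using E v by blast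
  show "snd X (Inr (i,j)) *\<^sub>v (snd X (Inl c) *\<^sub>v v) = (if c = i then snd X (Inr (i,j)) *\<^sub>v v else 0\<^sub>v (fst X))" if h: "(i,j) \<in> Ar" "c \<in> V"
  proof -
    have e: "snd X (Inl i) *\<^sub>v (snd X (Inl c) *\<^sub>v v) = (if i = c then snd X (Inl i) *\<^sub>v v else 0\<^sub>v (fst X))"
      by (rule E[OF Ar_V(1)[OF h(1)] h(2) v])
    have d: "snd X (Inr (i,j)) *\<^sub>v (snd X (Inl c) *\<^sub>v v) = snd X (Inl j) *\<^sub>v (snd X (Inr (i,j)) *\<^sub>v (snd X (Inl i) *\<^sub>v (snd X (Inl c) *\<^sub>v v)))"
      by (rule D[OF h(1) c[OF h(2) v]])
    show ?thesis
    proof (cases "c = i")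
      case True
      then have "(if i = c then snd X (Inl i) *\<^sub>v v else 0\<^sub>v (fst X)) = snd X (Inl i) *\<^sub>v v" by simp
      note d2 = d[unfolded e this]
      show ?thesis unfolding if_P[OF True] by (rule trans[OF d2 D[OF h(1) v, symmetric]])
    next
      case False
      then show ?thesis unfolding d e using za[OF h(1)] z[OF Ar_V(2)[OF h(1)]] by auto
    qed
  qed
  show "snd X (Inl c) *\<^sub>v (snd X (Inr (i,j)) *\<^sub>v v) = (if c = j then snd X (Inr (i,j)) *\<^sub>v v else 0\<^sub>v (fst X))" if h: "(i,j) \<in> Ar" "c \<in> V"
  proof -
    let ?w = "snd X (Inr (i,j)) *\<^sub>v (snd X (Inl i) *\<^sub>v v)"
    have wc: "?w \<in> vs X" by (intro ca h c Ar_V(1)[OF h(1)] v)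
    have "snd X (Inr (i,j)) *\<^sub>v v = snd X (Inl j) *\<^sub>v ?w" by (rule D[OF h(1) v])
    then show ?thesis using E[OF h(2) Ar_V(2)[OF h(1)] wc] by auto
  qed
  show "a \<in> Ar \<Longrightarrow> b \<in> Ar \<Longrightarrow> snd X (Inr b) *\<^sub>v (snd X (Inr a) *\<^sub>v v) = 0\<^sub>v (fst X)"
    using X v by (simp add: LM_iff)
qed

sublocale L: thincat "V" "\<lambda>x. x" "V" rl "\<lambda>x. x" coL IL LM ixL
proof (intro thincat.intro L.thin0_axioms LM_modcat thincat_axioms.intro)
  have R: "L.R c c' \<longleftrightarrow> c \<in> V \<and> c' \<in> V \<and> (c = c' \<or> (c,c') \<in> Ar)" for c c' by (simp add: L.R_def rl_def)
  show "ixL c c' \<in> IL" if "L.R c c'" for c c' using that by (auto simp: ixL_def R)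
  show "coL (ixL x y) c c' = (if c = x \<and> c' = y then 1 else 0)" if "L.R x y" "c \<in> V" "c' \<in> V" for x y c c'
    by (auto simp: coL_def ixL_def)
  show "snd X (ixL c' c'') *\<^sub>v (snd X (ixL c c') *\<^sub>v v) = (if L.R c c'' then snd X (ixL c c'') *\<^sub>v v else 0\<^sub>v (fst X))"
    if "X \<in> LM" "L.R c c'" "L.R c' c''" "v \<in> vs X" for X c c' c'' v
    using that LM_act[OF that(1,4)] Ar_no_short[of c c' c''] Ar_V(3)[of c c'] Ar_V(3)[of c' c''] by (auto simp: R ixL_def)
  show "snd X (ixL c d) *\<^sub>v (snd X (ixL a b) *\<^sub>v v) = 0\<^sub>v (fst X)"
    if "X \<in> LM" "L.R a b" "L.R c d" "b \<noteq> c" "v \<in> vs X" for X a b c d v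
    using that LM_act[OF that(1,5)] by (auto simp: R ixL_def)
  show "v = 0\<^sub>v (fst X)" if "X \<in> LM" "v \<in> vs X" "\<And>c. c \<in> V \<Longrightarrow> snd X (ixL c c) *\<^sub>v v = 0\<^sub>v (fst X)" for X v
  proof -
    have "v = vsum (fst X) (\<lambda>i. snd X (Inl i) *\<^sub>v v) V" using that(1,2) by (simp add: LM_iff)
    also have "\<dots> = vsum (fst X) (\<lambda>i. 0\<^sub>v (fst X)) V" by (rule vsum_cong) (use that(3) in \<open>simp add: ixL_def\<close>)
    also have "\<dots> = 0\<^sub>v (fst X)" by (intro eq_vecI) auto
    finally show ?thesis .
  qed
  show "lh IL X Y f" if "X \<in> LM" "Y \<in> LM" "lin (fst X) (fst Y) f"
    "\<And>c c' v. L.R c c' \<Longrightarrow> v \<in> vs X \<Longrightarrow> f (snd X (ixL c c') *\<^sub>v v) = snd Y (ixL c c') *\<^sub>v f v" for X Y f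
    unfolding lh_def
  proof (intro conjI ballI that(3))
    fix g v assume g: "g \<in> IL" and v: "v \<in> vs X"
    show "f (snd X g *\<^sub>v v) = snd Y g *\<^sub>v f v"
    proof (cases g)
      case (Inl i)
      then show ?thesis using that(4)[of i i v] g v by (simp add: R ixL_def)
    next
      case (Inr a)
      obtain x y where a: "a = (x,y)" by (cases a)
      have "(x,y) \<in> Ar" using g Inr a by simp
      then show ?thesis using that(4)[of x y v] v Ar_V[of x y] Inr a by (simp add: R ixL_def)
    qed
  qed
  show "L.th A \<in> LM" if "A \<subseteq> V" "L.tconv A" for A by (rule L_th_LM[OF that])
qed

end

section \<open>Indecomposable representations\<close>

text \<open>\<open>Sv v\<close> is the simple module at \<open>v\<close>, \<open>Pa u v\<close> the module of length two with top \<open>u\<close> and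
  socle \<open>v\<close>, and \<open>Dv v\<close> the module with socle \<open>v\<close> and a top of two simple modules. The relation \<open>RG i j\<close>
  says that there is a non-zero homomorphism from the module \<open>j\<close> to the module \<open>i\<close>.\<close>

datatype label = Sv nat | Pa nat nat | Dv nat

context quiver
begin

definition fk where "fk v \<longleftrightarrow> (\<exists>u u'. u \<noteq> u' \<and> (u,v) \<in> Ar \<and> (u',v) \<in> Ar)"
definition JG where "JG = Sv ` V \<union> {Pa u v | u v. (u,v) \<in> Ar} \<union> Dv ` {v. fk v}"

fun sp :: "label \<Rightarrow> nat set" where
  "sp (Sv v) = {v}" | "sp (Pa u v) = {u,v}" | "sp (Dv v) = insert v {u. (u,v) \<in> Ar}"

fun RG :: "label \<Rightarrow> label \<Rightarrow> bool" where
  "RG (Sv x) (Sv y) \<longleftrightarrow> x = y"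
| "RG (Sv x) (Pa u v) \<longleftrightarrow> x = u"
| "RG (Sv x) (Dv w) \<longleftrightarrow> (x,w) \<in> Ar"
| "RG (Pa u v) (Sv y) \<longleftrightarrow> y = v"
| "RG (Pa u v) (Pa u' v') \<longleftrightarrow> u = u' \<or> v = u'"
| "RG (Pa u v) (Dv w) \<longleftrightarrow> (v,w) \<in> Ar"
| "RG (Dv v) (Sv y) \<longleftrightarrow> y = v"
| "RG (Dv v) (Pa u' v') \<longleftrightarrow> v' = v \<or> u' = v"
| "RG (Dv v) (Dv w) \<longleftrightarrow> w = v \<or> (v,w) \<in> Ar"

text \<open>The overlap of the two supports is non-empty, closed under arrows inside
  \<open>sp i\<close> and under predecessors inside \<open>sp j\<close>. It is then a submodule of
  the module \<open>i\<close> and a quotient of the module \<open>j\<close>, that is, the image of a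
  non-zero homomorphism from \<open>j\<close> to \<open>i\<close>.\<close>

definition HC where "HC i j \<longleftrightarrow> sp i \<inter> sp j \<noteq> {} \<and>
   (\<forall>x y. (x,y) \<in> Ar \<and> x \<in> sp i \<inter> sp j \<and> y \<in> sp i \<longrightarrow> y \<in> sp j) \<and>
   (\<forall>x y. (x,y) \<in> Ar \<and> y \<in> sp i \<inter> sp j \<and> x \<in> sp j \<longrightarrow> x \<in> sp i)"

lemma JG_simps [simp]: "Sv v \<in> JG \<longleftrightarrow> v \<in> V" "Pa u v \<in> JG \<longleftrightarrow> (u,v) \<in> Ar" "Dv v \<in> JG \<longleftrightarrow> fk v"
  by (auto simp: JG_def)

lemma fk_V: "fk v \<Longrightarrow> v \<in> V" using Ar_V(2) by (auto simp: fk_def)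

lemma sp_V: "j \<in> JG \<Longrightarrow> sp j \<subseteq> V"
  using Ar_V fk_V by (cases j) auto

lemma RG_HC: assumes "i \<in> JG" "j \<in> JG" shows "RG i j \<longleftrightarrow> HC i j"
  using assms
  by (cases i; cases j; simp add: HC_def) (use Ar_fun Ar_irrefl Ar_V(3) in \<open>auto simp: fk_def; (metis less_asym | fastforce)?\<close>)+

text \<open>If the outer modules are related, no vertex of their overlap is lost in the middle one;
  hence the composite of two canonical maps is again the canonical map, as \<open>hm_comp\<close>
  needs.\<close>

lemma RG_mid: "i \<in> JG \<Longrightarrow> j \<in> JG \<Longrightarrow> k \<in> JG \<Longrightarrow> RG i j \<Longrightarrow> RG j k \<Longrightarrow> RG i k \<Longrightarrow> sp i \<inter> sp k \<subseteq> sp j"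
  by (cases i; cases j; cases k; simp) (use Ar_fun Ar_irrefl Ar_V(3) in \<open>(auto; metis less_asym)\<close>)+

text \<open>Associativity of composition expressed in labels: the two sides decide whether the
  threefold composite survives, according to which pair is composed beforehand. With
  \<open>RG\<close> explicit this is a finite distinction of constructors.\<close>

lemma RG_assoc: "x \<in> JG \<Longrightarrow> i \<in> JG \<Longrightarrow> j \<in> JG \<Longrightarrow> k \<in> JG \<Longrightarrow> RG x i \<Longrightarrow> RG i j \<Longrightarrow> RG j k \<Longrightarrow> RG x k \<Longrightarrow> RG x j \<longleftrightarrow> RG i k"
  by (cases x; cases i; cases j; cases k; simp) (use Ar_fun Ar_irrefl Ar_V(3) in \<open>(auto; metis less_asym)\<close>)+

lemma sp_inj: "i \<in> JG \<Longrightarrow> j \<in> JG \<Longrightarrow> sp i = sp j \<Longrightarrow> i = j"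
proof -
  have two: "sp (Pa u v) \<noteq> sp (Dv w)" if h: "(u,v) \<in> Ar" "fk w" for u v w
  proof
    assume e: "sp (Pa u v) = sp (Dv w)"
    obtain a b where ab: "a \<noteq> b" "(a,w) \<in> Ar" "(b,w) \<in> Ar" using h(2) by (auto simp: fk_def)
    then have "{w,a,b} \<subseteq> {u,v}" using e by auto
    then show False using ab Ar_irrefl by auto
  qed
  have pa: "u = u' \<and> v = v'" if "(u,v) \<in> Ar" "(u',v') \<in> Ar" "{u,v} = {u',v'}" for u v u' v'
    using that Ar_V(3)[of u v] Ar_V(3)[of u' v'] by (auto simp: doubleton_eq_iff)
  have sd: "{x} \<noteq> sp (Dv w)" if h: "fk w" for x w
  proof
    assume e: "{x} = sp (Dv w)"
    obtain a b where ab: "a \<noteq> b" "(a,w) \<in> Ar" "(b,w) \<in> Ar" using h by (auto simp: fk_def)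
    then have "{w,a,b} \<subseteq> {x}" using e by auto
    then show False using ab by auto
  qed
  have dd: "w = w'" if "fk w" "fk w'" "sp (Dv w) = sp (Dv w')" for w w'
  proof (rule ccontr)
    assume n: "w \<noteq> w'"
    have "(w,w') \<in> Ar" "(w',w) \<in> Ar" using that(3) n by auto
    then show False using Ar_V(3) less_asym by blast
  qed
  show "i \<in> JG \<Longrightarrow> j \<in> JG \<Longrightarrow> sp i = sp j \<Longrightarrow> i = j"
    using two pa sd dd by (cases i; cases j; simp) (auto dest: Ar_V(3), metis+)?
qed

lemma L_good_sp: assumes "j \<in> JG" shows "L.good (sp j)"
  unfolding L.good_def
proof (intro conjI sp_V assms)
  show "L.tconv (sp j)" unfolding L.tconv_def
  proof (intro ballI impI)
    fix i k l assume h: "i \<in> sp j" "k \<in> sp j" "l \<in> V" "rl i l \<and> rl l k"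
    show "(l \<in> sp j) = rl i k"
    proof (cases "i = l \<or> l = k")
      case True then show ?thesis using h by (auto simp: rl_def)
    next
      case False
      then have a: "(i,l) \<in> Ar" "(l,k) \<in> Ar" using h by (auto simp: rl_def)
      have o: "i < l" "l < k" "(i,k) \<notin> Ar" using a Ar_V(3) Ar_no_short by blast+
      \<comment> \<open>A support consists of a top layer and a socle layer, so it cannot contain
        both ends of a path of length two.\<close>
      have "False"
      proof (cases j)
        case (Pa x y)
        then show ?thesis using h(1,2) o assms Ar_V(3)[of x y] by auto
      next
        case (Dv w)
        have "i = w \<or> (i,w) \<in> Ar" "k = w \<or> (k,w) \<in> Ar" using h(1,2) Dv by auto
        then show ?thesis using o a Ar_V(3)[of k w] Ar_fun[OF a(1), of w] by auto
      qed (use h(1,2) o in auto)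
      then show ?thesis ..
    qed
  qed
  show "L.star (sp j)" unfolding L.star_def
    using assms by (cases j) (auto simp: rl_def)
qed

section \<open>Homomorphisms between the indecomposable representations\<close>

lemma sp_connected: "j \<in> JG \<Longrightarrow> x \<in> sp j \<Longrightarrow> y \<in> sp j \<Longrightarrow>
   x = y \<or> (x,y) \<in> Ar \<or> (y,x) \<in> Ar \<or> (\<exists>z\<in>sp j. (x,z) \<in> Ar \<and> (y,z) \<in> Ar)"
  by (cases j) auto

definition hm :: "label \<Rightarrow> label \<Rightarrow> 'k vec \<Rightarrow> 'k vec" where
  "hm i j v = L.mk (sp i) (\<lambda>x. if x \<in> sp j then L.cd (sp j) x v else 0)"

lemma sc_sp: "j \<in> JG \<Longrightarrow> x \<in> L.sc (sp j) \<longleftrightarrow> x \<in> sp j" using sp_V[of j] by (auto simp: L.sc_iff)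

lemma hm_carrier [simp]: "hm i j v \<in> carrier_vec (card (L.sc (sp i)))" by (simp add: hm_def)

lemma cd_hm: "i \<in> JG \<Longrightarrow> x \<in> sp i \<Longrightarrow> L.cd (sp i) x (hm i j v) = (if x \<in> sp j then L.cd (sp j) x v else 0)"
  by (simp add: hm_def sc_sp)

text \<open>The scalars of \<open>f\<close> are constant along arrows of the overlap, and the
  overlap is connected. If \<open>RG\<close> fails, one of the clauses of \<open>HC\<close> fails,
  and unless the overlap is empty the corresponding compatibility equation reads
  \<open>k = 0\<close>.\<close>

lemma hm_hom_scalar:
  assumes i: "i \<in> JG" and j: "j \<in> JG" and f: "lh IL (L.th (sp j)) (L.th (sp i)) f"
  obtains k where "\<And>v. v \<in> vs (L.th (sp j)) \<Longrightarrow> f v = k \<cdot>\<^sub>v hm i j v" "\<not> RG i j \<Longrightarrow> k = 0"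
proof -
  obtain l where l: "\<And>c v. c \<in> L.sc (sp i) \<Longrightarrow> v \<in> vs (L.th (sp j)) \<Longrightarrow> L.cd (sp i) c (f v) = (if c \<in> sp j then l c * L.cd (sp j) c v else 0)"
    and lc: "\<And>x y. x \<in> sp j \<Longrightarrow> y \<in> sp i \<Longrightarrow> rl x y \<Longrightarrow> (if y \<in> sp j then l y else 0) = (if x \<in> sp i then l x else 0)"
    using L.thin_hom[OF sp_V[OF j] sp_V[OF i] f] by blast
  have ar: "l x = l y" if "(x,y) \<in> Ar" "x \<in> sp i \<inter> sp j" "y \<in> sp i \<inter> sp j" for x y
    using lc[of x y] that by (auto simp: rl_def)
  have conn: "l x = l y" if xy: "x \<in> sp i \<inter> sp j" "y \<in> sp i \<inter> sp j" for x y
  proof -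
    \<comment> \<open>If \<open>x\<close> and \<open>y\<close> are joined through a common successor
      in each of the two supports, the successors coincide by out-degree one, so the overlap itself
      is connected.\<close>
    have "x = y \<or> (x,y) \<in> Ar \<or> (y,x) \<in> Ar \<or> (\<exists>z. z \<in> sp i \<inter> sp j \<and> (x,z) \<in> Ar \<and> (y,z) \<in> Ar)"
      using sp_connected[OF i, of x y] sp_connected[OF j, of x y] xy Ar_fun by blast
    then show ?thesis using ar[of x y] ar[of y x] ar[of x] ar[of y] xy by metis
  qed
  obtain k where k: "\<And>x. x \<in> sp i \<inter> sp j \<Longrightarrow> l x = k" and k0: "sp i \<inter> sp j = {} \<Longrightarrow> k = 0"
  proof (cases "sp i \<inter> sp j = {}")
    case True then show ?thesis using that[of 0] by auto
  next
    case False
    then obtain x where "x \<in> sp i \<inter> sp j" by blast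
    then show ?thesis using that[of "l x"] conn False by blast
  qed
  show ?thesis
  proof (rule that[of k])
    fix v assume v: "v \<in> vs (L.th (sp j))"
    show "f v = k \<cdot>\<^sub>v hm i j v"
    proof (rule L.cd_eqI[where A="sp i"])
      fix c assume c: "c \<in> L.sc (sp i)"
      then show "L.cd (sp i) c (f v) = L.cd (sp i) c (k \<cdot>\<^sub>v hm i j v)"
        using l[OF c v] k[of c] by (simp add: L.cd_smult sc_sp[OF i] cd_hm[OF i])
    qed (use lh_closed[OF f v] in auto)
  next
    assume "\<not> RG i j"
    then have "\<not> HC i j" using RG_HC[OF i j] by simp
    then consider "sp i \<inter> sp j = {}" | x y where "(x,y) \<in> Ar" "x \<in> sp i \<inter> sp j" "y \<in> sp i" "y \<notin> sp j"
      | x y where "(x,y) \<in> Ar" "y \<in> sp i \<inter> sp j" "x \<in> sp j" "x \<notin> sp i" unfolding HC_def by blast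
    then show "k = 0"
    proof cases
      case 1 then show ?thesis by (rule k0)
    next
      case 2 then show ?thesis using lc[of x y] k[of x] by (auto simp: rl_def)
    next
      case 3 then show ?thesis using lc[of x y] k[of y] by (auto simp: rl_def)
    qed
  qed
qed

lemma lin_hm: assumes i: "i \<in> JG" and j: "j \<in> JG" shows "lin (card (L.sc (sp j))) (card (L.sc (sp i))) (hm i j)"
proof (rule linI)
  fix v w :: "'k vec" assume v: "v \<in> carrier_vec (card (L.sc (sp j)))" "w \<in> carrier_vec (card (L.sc (sp j)))"
  show "hm i j (v + w) = hm i j v + hm i j w"
    by (rule L.cd_eqI[where A="sp i"]) (use v in \<open>auto simp: L.cd_add sc_sp i j cd_hm\<close>)
next
  fix a and v :: "'k vec" assume v: "v \<in> carrier_vec (card (L.sc (sp j)))"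
  show "hm i j (a \<cdot>\<^sub>v v) = a \<cdot>\<^sub>v hm i j v"
    by (rule L.cd_eqI[where A="sp i"]) (use v in \<open>auto simp: L.cd_smult sc_sp i j cd_hm\<close>)
qed simp

lemma lh_hm: assumes i: "i \<in> JG" and j: "j \<in> JG" and r: "RG i j" shows "lh IL (L.th (sp j)) (L.th (sp i)) (hm i j)"
proof (rule L.lh_ext[OF L.good_mods[OF L_good_sp[OF j]] L.good_mods[OF L_good_sp[OF i]]])
  show "lin (fst (L.th (sp j))) (fst (L.th (sp i))) (hm i j)" using lin_hm[OF i j] by simp
  fix x y v assume R: "L.R x y" and v: "v \<in> vs (L.th (sp j))"
  have hc: "HC i j" using RG_HC[OF i j] r by simp
  have xy: "x \<in> V" "y \<in> V" "rl x y" using R by (auto simp: L.R_def)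
  have c: "L.ac (L.th A) x y w \<in> carrier_vec (card (L.sc A))" if "w \<in> carrier_vec (card (L.sc A))" for w and A
    using wfm_act[OF L.th_wfm L.ixI[OF R], of w A] that by simp
  show "hm i j (L.ac (L.th (sp j)) x y v) = L.ac (L.th (sp i)) x y (hm i j v)"
  proof (rule L.cd_eqI[where A="sp i"])
    fix c assume cs: "c \<in> L.sc (sp i)"
    have key: "c = y \<Longrightarrow> c \<in> sp j \<and> x \<in> sp j \<longleftrightarrow> x \<in> sp i \<and> x \<in> sp j"
      using hc cs xy unfolding HC_def rl_def sc_sp[OF i] by blast
    show "L.cd (sp i) c (hm i j (L.ac (L.th (sp j)) x y v)) = L.cd (sp i) c (L.ac (L.th (sp i)) x y (hm i j v))"
      using cs key L.th_ac[OF R v, of c] L.th_ac[OF R, of "hm i j v" "sp i" c] by (auto simp: sc_sp i j cd_hm)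
  qed (auto simp: c)
qed

lemma hm_comp:
  assumes i: "i \<in> JG" and j: "j \<in> JG" and k: "k \<in> JG" and r: "RG i j" "RG j k" and v: "v \<in> vs (L.th (sp k))"
  shows "hm i j (hm j k v) = (if RG i k then hm i k v else 0\<^sub>v (card (L.sc (sp i))))"
proof (cases "RG i k")
  case True
  have "sp i \<inter> sp k \<subseteq> sp j" using RG_mid[OF i j k r True] .
  then show ?thesis using True
    by (simp, intro L.cd_eqI[where A="sp i"]) (auto simp: sc_sp i j cd_hm)
next
  case False
  have "lh IL (L.th (sp k)) (L.th (sp i)) (\<lambda>v. hm i j (hm j k v))" by (rule lh_comp[OF lh_hm[OF j k r(2)] lh_hm[OF i j r(1)]])
  then obtain a where "hm i j (hm j k v) = a \<cdot>\<^sub>v hm i k v" "a = 0" using hm_hom_scalar[OF i k] v False by metis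
  then show ?thesis using False by (simp add: zero_smult_vec[of _ "card (L.sc (sp i))"])
qed

lemma hm_self: "i \<in> JG \<Longrightarrow> v \<in> vs (L.th (sp i)) \<Longrightarrow> hm i i v = v"
  by (rule L.cd_eqI[where A="sp i"]) (auto simp: cd_hm sc_sp)

lemma RG_refl: "i \<in> JG \<Longrightarrow> RG i i" by (cases i) auto

text \<open>Images of two arrows meeting non-trivially at \<open>v\<close> give a \<open>Dv\<close>;
  failing that, a single non-zero arrow gives a \<open>Pa\<close>; if all arrows act by zero, any
  vector gives a simple summand. In the cases with arrows the functional is chosen at
  \<open>v\<close> and pulled back along the arrows.\<close>

lemma split_LM:
  assumes X: "X \<in> LM" and n: "fst X > 0" shows "\<exists>j\<in>JG. ret IL (L.th (sp j)) X"
proof -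
  have comp0: "L.al X j k (L.al X i j s) = 0\<^sub>v (fst X)" if "(i,j) \<in> Ar" "(j,k) \<in> Ar" "s \<in> vs X" for i j k s
    using L.al_comp[OF X Ar_V(1)[OF that(1)] Ar_V(1)[OF that(2)] Ar_V(2)[OF that(2)], of s] that Ar_no_short[OF that(1,2)] Ar_V(3)
    by (auto simp: rl_def) (metis less_asym)
  have fin: ?thesis if j: "j \<in> JG" and t: "\<And>i. i \<in> sp j \<Longrightarrow> t i \<in> L.Tv X i"
     and tt: "\<And>i k. i \<in> sp j \<Longrightarrow> (i,k) \<in> Ar \<Longrightarrow> L.al X i k (t i) = (if k \<in> sp j then t k else 0\<^sub>v (fst X))"
     and p: "\<And>i. i \<in> sp j \<Longrightarrow> linf (fst X) (\<phi> i)"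
     and pp: "\<And>i k s. k \<in> sp j \<Longrightarrow> (i,k) \<in> Ar \<Longrightarrow> s \<in> L.Tv X i \<Longrightarrow> \<phi> k (L.al X i k s) = (if i \<in> sp j then \<phi> i s else 0)"
     and pt: "\<And>i. i \<in> sp j \<Longrightarrow> \<phi> i (t i) = 1" for j t \<phi>
  proof (rule bexI[OF _ j])
    show "ret IL (L.th (sp j)) X"
    proof (rule L.split_family[OF sp_V[OF j] L.good_tconv[OF L_good_sp[OF j]] X t _ p _ pt])
      show "L.al X i k (t i) = (if k \<in> sp j then t k else 0\<^sub>v (fst X))" if "i \<in> sp j" "k \<in> V" "rl i k" for i k
        using tt[OF that(1)] L.al_id[OF t[OF that(1)]] that by (auto simp: rl_def)
      show "\<phi> k (L.al X i k s) = (if i \<in> sp j then \<phi> i s else 0)" if "i \<in> V" "k \<in> sp j" "rl i k" "s \<in> L.Tv X i" for i k s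
        using pp[OF that(2) _ that(4)] L.al_id[OF that(4)] that by (auto simp: rl_def)
    qed
  qed
  have lal: "lin (fst X) (fst X) (L.al X u v)" if "(u,v) \<in> Ar" for u v
    using that by (intro L.al_lin X Ar_V(1)[OF that] Ar_V(2)[OF that]) (simp add: rl_def)
  have alT: "L.al X u v x \<in> L.Tv X v" if "(u,v) \<in> Ar" "x \<in> vs X" for u v x
    using that by (intro L.al_Tv X Ar_V(1)[OF that(1)] Ar_V(2)[OF that(1)]) (simp_all add: rl_def)
  have pred2: "i = u \<or> i = u'" if "(u,v) \<in> Ar" "(u',v) \<in> Ar" "u \<noteq> u'" "(i,v) \<in> Ar" for i u u' v
    using Ar_indeg[OF that(1,2,4)] that(3) by blast
  show ?thesis
  proof (cases "\<exists>v u u' x y. u \<noteq> u' \<and> (u,v) \<in> Ar \<and> (u',v) \<in> Ar \<and> x \<in> L.Tv X u \<and> y \<in> L.Tv X u' \<and> L.al X u v x = L.al X u' v y \<and> L.al X u v x \<noteq> 0\<^sub>v (fst X)")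
    case True
    then obtain v u u' x y where h: "u \<noteq> u'" "(u,v) \<in> Ar" "(u',v) \<in> Ar" "x \<in> L.Tv X u" "y \<in> L.Tv X u'" "L.al X u v x = L.al X u' v y"
      and z: "L.al X u v x \<noteq> 0\<^sub>v (fst X)" by blast
    have xv: "x \<in> vs X" "y \<in> vs X" using h by (auto dest: L.Tv_vs)
    define w where "w = L.al X u v x"
    have w: "w \<in> L.Tv X v" unfolding w_def by (rule alT[OF h(2) xv(1)])
    obtain \<phi> where p: "linf (fst X) \<phi>" "\<phi> w = 1" using linf_separate0[OF L.Tv_vs[OF w]] z unfolding w_def by blast
    have ne: "u \<noteq> v" "u' \<noteq> v" using h Ar_irrefl by auto
    have sp: "sp (Dv v) = {v,u,u'}" using pred2[OF h(2,3,1)] h by auto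
    show ?thesis
    proof (rule fin[of "Dv v" "\<lambda>i. if i = u then x else if i = u' then y else w" "\<lambda>i s. if i = v then \<phi> s else \<phi> (L.al X i v s)"]; (unfold sp)?)
      show "Dv v \<in> JG" using h by (auto simp: fk_def)
      show "(if i = u then x else if i = u' then y else w) \<in> L.Tv X i" if "i \<in> {v,u,u'}" for i using that h w by auto
      show "L.al X i k (if i = u then x else if i = u' then y else w) = (if k \<in> {v,u,u'} then if k = u then x else if k = u' then y else w else 0\<^sub>v (fst X))"
        if "i \<in> {v,u,u'}" "(i,k) \<in> Ar" for i k
      proof (cases "i = v")
        case True
        have "k \<noteq> v" "k \<noteq> u" "k \<noteq> u'" using that True h Ar_V(3) Ar_irrefl by (metis less_asym)+
        then show ?thesis using True that ne comp0[OF h(2) _ xv(1), of k] by (simp add: w_def)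
      next
        case False
        then have "k = v" using that h Ar_fun by auto
        then show ?thesis using False that ne h by (auto simp: w_def)
      qed
      show "linf (fst X) (\<lambda>s. if i = v then \<phi> s else \<phi> (L.al X i v s))" if "i \<in> {v,u,u'}" for i
        using that p h linf_comp[OF p(1) lal] by (cases "i = v") auto
      show "(if k = v then \<phi> (L.al X i k s) else \<phi> (L.al X k v (L.al X i k s))) = (if i \<in> {v,u,u'} then if i = v then \<phi> s else \<phi> (L.al X i v s) else 0)"
        if "k \<in> {v,u,u'}" "(i,k) \<in> Ar" "s \<in> L.Tv X i" for i k s
      proof (cases "k = v")
        case True
        have "i = u \<or> i = u'" using pred2[OF h(2,3,1)] that(2) True by simp
        then show ?thesis using True ne by auto
      next
        case False
        then have kv: "(k,v) \<in> Ar" using that h by auto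
        have "i \<noteq> v" "i \<noteq> u" "i \<noteq> u'" using that(2) kv h False Ar_fun Ar_V(3) by (metis less_asym)+
        then show ?thesis using False comp0[OF that(2) kv L.Tv_vs[OF that(3)]] linf_zero[OF p(1)] by simp
      qed
      show "(if i = v then \<phi> (if i = u then x else if i = u' then y else w) else \<phi> (L.al X i v (if i = u then x else if i = u' then y else w))) = 1"
        if "i \<in> {v,u,u'}" for i
        using that ne h(6) p(2) by (auto simp: w_def)
    qed
  next
    case False
    then have no1: False if "u \<noteq> u'" "(u,v) \<in> Ar" "(u',v) \<in> Ar" "x \<in> L.Tv X u" "y \<in> L.Tv X u'"
      "L.al X u v x = L.al X u' v y" "L.al X u v x \<noteq> 0\<^sub>v (fst X)" for u u' v x y using that by blast
    show ?thesis
    proof (cases "\<exists>u v x. (u,v) \<in> Ar \<and> x \<in> L.Tv X u \<and> L.al X u v x \<noteq> 0\<^sub>v (fst X)")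
      case True
      then obtain u v x where h: "(u,v) \<in> Ar" "x \<in> L.Tv X u" and z: "L.al X u v x \<noteq> 0\<^sub>v (fst X)" by blast
      have xv: "x \<in> vs X" using h by (auto dest: L.Tv_vs)
      define w where "w = L.al X u v x"
      have w: "w \<in> L.Tv X v" unfolding w_def by (rule alT[OF h(1) xv(1)])
      \<comment> \<open>The functional has to vanish on the image of the other arrow into
        \<open>v\<close>. It exists because that image does not contain \<open>w\<close>, the
        previous case being excluded.\<close>
      obtain \<phi> where p: "linf (fst X) \<phi>" "\<phi> w = 1"
        and pk: "\<And>u' s. (u',v) \<in> Ar \<Longrightarrow> u' \<noteq> u \<Longrightarrow> s \<in> L.Tv X u' \<Longrightarrow> \<phi> (L.al X u' v s) = 0"
      proof (cases "\<exists>u'. (u',v) \<in> Ar \<and> u' \<noteq> u")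
        case True
        then obtain u' where u': "(u',v) \<in> Ar" "u' \<noteq> u" by blast
        have sW: "subsp (fst X) (L.al X u' v ` L.Tv X u')"
          by (rule subsp_image[OF lal[OF u'(1)] L.Tv_subsp[OF X Ar_V(1)[OF u'(1)]]])
        have "w \<notin> L.al X u' v ` L.Tv X u'"
        proof
          assume "w \<in> L.al X u' v ` L.Tv X u'"
          then obtain s where "s \<in> L.Tv X u'" "L.al X u v x = L.al X u' v s" unfolding w_def by blast
          then show False using no1[OF u'(2)[symmetric] h(1) u'(1) h(2)] z by blast
        qed
        then obtain \<phi> where q: "linf (fst X) \<phi>" "\<forall>s\<in>L.al X u' v ` L.Tv X u'. \<phi> s = 0" "\<phi> w = 1"
          using linf_separate[OF sW L.Tv_vs[OF w]] by blast
        show ?thesis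
        proof (rule that[OF q(1,3)])
          fix u'' s assume a: "(u'',v) \<in> Ar" "u'' \<noteq> u" "s \<in> L.Tv X u''"
          have "u'' = u'" using pred2[OF h(1) u'(1) _ a(1)] a(2) u'(2) by blast
          then show "\<phi> (L.al X u'' v s) = 0" using q(2) a by blast
        qed
      next
        case False
        obtain \<phi> where "linf (fst X) \<phi>" "\<phi> w = 1" using linf_separate0[OF L.Tv_vs[OF w]] z unfolding w_def by blast
        then show ?thesis using that False by blast
      qed
      have ne: "u \<noteq> v" using h Ar_irrefl by auto
      show ?thesis
      proof (rule fin[of "Pa u v" "\<lambda>i. if i = u then x else w" "\<lambda>i s. if i = v then \<phi> s else \<phi> (L.al X i v s)"]; (unfold sp.simps)?)
        show "Pa u v \<in> JG" using h by simp
        show "(if i = u then x else w) \<in> L.Tv X i" if "i \<in> {u,v}" for i using that h w by auto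
        show "L.al X i k (if i = u then x else w) = (if k \<in> {u,v} then if k = u then x else w else 0\<^sub>v (fst X))"
          if "i \<in> {u,v}" "(i,k) \<in> Ar" for i k
        proof (cases "i = v")
          case True
          have "k \<noteq> v" "k \<noteq> u" using that True h Ar_V(3) Ar_irrefl by (metis less_asym)+
          then show ?thesis using True that ne comp0[OF h(1) _ xv(1), of k] by (simp add: w_def)
        next
          case False
          then have "k = v" using that h Ar_fun by auto
          then show ?thesis using False that ne h by (auto simp: w_def)
        qed
        show "linf (fst X) (\<lambda>s. if i = v then \<phi> s else \<phi> (L.al X i v s))" if "i \<in> {u,v}" for i
          using that p h linf_comp[OF p(1) lal] by (cases "i = v") auto
        show "(if k = v then \<phi> (L.al X i k s) else \<phi> (L.al X k v (L.al X i k s))) = (if i \<in> {u,v} then if i = v then \<phi> s else \<phi> (L.al X i v s) else 0)"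
          if "k \<in> {u,v}" "(i,k) \<in> Ar" "s \<in> L.Tv X i" for i k s
        proof (cases "k = v")
          case True
          then have "i \<noteq> v" using that(2) Ar_irrefl by auto
          then show ?thesis using True pk[of i s] that by auto
        next
          case False
          then have kv: "(k,v) \<in> Ar" using that h by auto
          have "i \<noteq> v" "i \<noteq> u" using that(2) kv h False Ar_fun Ar_V(3) by (metis less_asym)+
          then show ?thesis using False comp0[OF that(2) kv L.Tv_vs[OF that(3)]] linf_zero[OF p(1)] by simp
        qed
        show "(if i = v then \<phi> (if i = u then x else w) else \<phi> (L.al X i v (if i = u then x else w))) = 1"
          if "i \<in> {u,v}" for i
          using that ne p(2) by (auto simp: w_def)
      qed
    next
      case False
      then have al0: "L.al X u v s = 0\<^sub>v (fst X)" if "(u,v) \<in> Ar" "s \<in> L.Tv X u" for u v s using that by blast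
      have "\<not> (\<forall>v\<in>V. \<forall>t\<in>L.Tv X v. t = 0\<^sub>v (fst X))" using L.Tv_trivial[OF X] n by auto
      then obtain v t where t: "v \<in> V" "t \<in> L.Tv X v" "t \<noteq> 0\<^sub>v (fst X)" by blast
      obtain \<phi> where p: "linf (fst X) \<phi>" "\<phi> t = 1" using linf_separate0[OF L.Tv_vs[OF t(2)] t(3)] by blast
      show ?thesis
        by (rule fin[of "Sv v" "\<lambda>_. t" "\<lambda>_. \<phi>"])
          (use t p al0 Ar_irrefl linf_zero[OF p(1)] in auto)
    qed
  qed
qed

lemma LM_decompose:
  assumes X: "X \<in> LM" obtains js where "set js \<subseteq> JG" "eqv IL X (L.dsl (map sp js))"
proof -
  have "\<exists>As. set As \<subseteq> sp ` JG \<and> eqv IL X (L.dsl As)"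
    by (rule L.decompose[where \<Phi>="\<lambda>_. True"]) (use L_good_sp split_LM X in auto)
  then obtain As where As: "set As \<subseteq> sp ` JG" "eqv IL X (L.dsl As)" by blast
  let ?js = "map (inv_into JG sp) As"
  have "map sp ?js = As" using As(1) by (simp add: comp_def) (rule map_idI, auto intro!: f_inv_into_f)
  moreover have "set ?js \<subseteq> JG" using As(1) inv_into_into[of _ sp JG] by auto
  ultimately show ?thesis using that[of ?js] As(2) by metis
qed

end

section \<open>The endomorphism algebra of an additive generator\<close>

context thincat
begin

text \<open>Inclusions and projections of a list sum in one existential statement, since the locale
  \<open>gamma\<close> takes them as parameters; the last conjunct says that the projections are
  jointly injective.\<close>

lemma dsl_coords:
  "\<exists>\<iota> \<pi>. (\<forall>c<length As. lh I (th (As!c)) (dsl As) (\<iota> c) \<and> lh I (dsl As) (th (As!c)) (\<pi> c)) \<and>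
     (\<forall>c<length As. \<forall>c'<length As. \<forall>v\<in>vs (th (As!c')). \<pi> c (\<iota> c' v) = (if c = c' then v else 0\<^sub>v (fst (th (As!c))))) \<and>
     (\<forall>v\<in>vs (dsl As). (\<forall>c<length As. \<pi> c v = 0\<^sub>v (fst (th (As!c)))) \<longrightarrow> v = 0\<^sub>v (fst (dsl As)))"
proof (induction As)
  case Nil
  have "v = 0\<^sub>v 0" if "v \<in> carrier_vec 0" for v :: "'k vec" using that by (intro vec0_eq) auto
  then show ?case by simp
next
  case (Cons A As)
  then obtain \<iota> \<pi> where hh: "(\<forall>c<length As. lh I (th (As!c)) (dsl As) (\<iota> c) \<and> lh I (dsl As) (th (As!c)) (\<pi> c)) \<and>
     (\<forall>c<length As. \<forall>c'<length As. \<forall>v\<in>vs (th (As!c')). \<pi> c (\<iota> c' v) = (if c = c' then v else 0\<^sub>v (fst (th (As!c))))) \<and>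
     (\<forall>v\<in>vs (dsl As). (\<forall>c<length As. \<pi> c v = 0\<^sub>v (fst (th (As!c)))) \<longrightarrow> v = 0\<^sub>v (fst (dsl As)))"
    by (elim exE) (rule that)
  have h: "\<And>c. c<length As \<Longrightarrow> lh I (th (As!c)) (dsl As) (\<iota> c)" "\<And>c. c<length As \<Longrightarrow> lh I (dsl As) (th (As!c)) (\<pi> c)"
    "\<And>c c' v. c<length As \<Longrightarrow> c'<length As \<Longrightarrow> v\<in>vs (th (As!c')) \<Longrightarrow> \<pi> c (\<iota> c' v) = (if c = c' then v else 0\<^sub>v (fst (th (As!c))))"
    "\<And>v. v\<in>vs (dsl As) \<Longrightarrow> (\<forall>c<length As. \<pi> c v = 0\<^sub>v (fst (th (As!c)))) \<Longrightarrow> v = 0\<^sub>v (fst (dsl As))"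
    using hh by simp_all
  let ?X = "th A" and ?Y = "dsl As"
  note w = th_wfm[of I A] dsl_wfm[of As]
  let ?i = "\<lambda>c. case c of 0 \<Rightarrow> i1 ?X ?Y | Suc c \<Rightarrow> (\<lambda>v. i2 ?X ?Y (\<iota> c v))"
  let ?p = "\<lambda>c. case c of 0 \<Rightarrow> p1 ?X ?Y | Suc c \<Rightarrow> (\<lambda>v. \<pi> c (p2 ?X ?Y v))"
  note z1 = lh_zero[OF lh_p1[OF w]] and z2 = lh_zero[OF lh_p2[OF w]]
  have A1: "lh I (th ((A # As)!c)) (dsl (A # As)) (?i c) \<and> lh I (dsl (A # As)) (th ((A # As)!c)) (?p c)" if c: "c < length (A # As)" for c
  proof (cases c)
    case 0 then show ?thesis using lh_i1[OF w] lh_p1[OF w] by simp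
  next
    case (Suc d)
    then show ?thesis using c lh_comp[OF h(1) lh_i2[OF w]] lh_comp[OF lh_p2[OF w] h(2)] by simp
  qed
  have A2: "?p c (?i c' v) = (if c = c' then v else 0\<^sub>v (fst (th ((A # As)!c))))"
    if c: "c < length (A # As)" "c' < length (A # As)" and v: "v \<in> vs (th ((A # As)!c'))" for c c' v
  proof (cases c; cases c')
    assume "c = 0" "c' = 0" then show ?thesis using v p_i(1)[of v ?X ?Y] by simp
  next
    fix d assume d: "c = 0" "c' = Suc d"
    then have "\<iota> d v \<in> vs ?Y" using lh_closed[OF h(1)] c v by simp
    then show ?thesis using d p_i(3)[of _ ?Y ?X] by simp
  next
    fix d assume d: "c = Suc d" "c' = 0"
    then show ?thesis using v c p_i(2)[of v ?X ?Y] lh_zero[OF h(2)] by simp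
  next
    fix d d' assume d: "c = Suc d" "c' = Suc d'"
    then have "\<iota> d' v \<in> vs ?Y" using lh_closed[OF h(1)] c v by simp
    then show ?thesis using d c v h(3)[of d d' v] p_i(4)[of _ ?Y ?X] by simp
  qed
  have A3: "v = 0\<^sub>v (fst (dsl (A # As)))" if v: "v \<in> vs (dsl (A # As))" and z: "\<forall>c<length (A # As). ?p c v = 0\<^sub>v (fst (th ((A # As)!c)))" for v
  proof -
    have a: "p1 ?X ?Y v = 0\<^sub>v (fst ?X)" using z[rule_format, of 0] by (simp del: dsl_simps)
    have "\<pi> c (p2 ?X ?Y v) = 0\<^sub>v (fst (th (As!c)))" if c: "c < length As" for c
      using z[rule_format, of "Suc c"] c by simp
    then have b: "p2 ?X ?Y v = 0\<^sub>v (fst ?Y)" by (intro h(4) p12_carrier(2)) blast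
    have v': "v \<in> vs (dsum ?X ?Y)" using v by (simp only: dsl_simps)
    show ?thesis unfolding dsl_simps
      by (rule dsum_eqI[OF v' zero_carrier_vec]) (simp_all only: a b z1 z2)
  qed
  show ?case
    by (rule exI[of _ ?i], rule exI[of _ ?p], intro conjI allI impI ballI)
      (erule A1[THEN conjunct1], erule A1[THEN conjunct2], erule (2) A2, erule (1) A3)
qed

end

text \<open>\<open>add_gen\<close> allows repeated summands, so \<open>js\<close> is a list in which
  every label occurs, possibly several times. Its positions become the points of the thin framework
  over \<Gamma>.\<close>

locale gamma = quiver m Ar K for m Ar and K :: "'k::field itself" +
  fixes M :: "(nat + nat \<times> nat, 'k) md" and js :: "label list" and \<iota> \<pi> :: "nat \<Rightarrow> 'k vec \<Rightarrow> 'k vec"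
  assumes M_LM: "M \<in> LM" and js: "set js = JG"
    and iota: "c < length js \<Longrightarrow> lh IL (L.th (sp (js!c))) M (\<iota> c)"
    and pi: "c < length js \<Longrightarrow> lh IL M (L.th (sp (js!c))) (\<pi> c)"
    and pi_iota: "c < length js \<Longrightarrow> c' < length js \<Longrightarrow> v \<in> vs (L.th (sp (js!c'))) \<Longrightarrow>
       \<pi> c (\<iota> c' v) = (if c = c' then v else 0\<^sub>v (card (L.sc (sp (js!c)))))"
    and pi_inj: "v \<in> vs M \<Longrightarrow> (\<And>c. c < length js \<Longrightarrow> \<pi> c v = 0\<^sub>v (card (L.sc (sp (js!c))))) \<Longrightarrow> v = 0\<^sub>v (fst M)"

context quiver
begin

lemma ret_dpow: "brick IL U \<Longrightarrow> X \<in> LM \<Longrightarrow> ret IL U (dpow X k) \<Longrightarrow> ret IL U X"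
proof (induction k)
  case 0
  then show ?case using ret_dim[of IL U zmod] by (simp add: brick_def)
next
  case (Suc k)
  have "dpow X k \<in> LM" for k by (induction k) (auto intro: L.mods_zmod L.mods_dsum Suc.prems)
  then show ?case using Suc brick_prime[of IL U X "dpow X k"] L.mods_wfm by auto
qed

text \<open>Thin representations are bricks, so a summand of a power of \<open>M\<close> is already
  a summand of \<open>M\<close>; therefore all labels occur in the decomposition of
  \<open>M\<close>.\<close>

lemma gamma_exists:
  fixes M :: "(nat + nat \<times> nat, 'k) md"
  assumes g: "add_gen m Ar M" shows "\<exists>js \<iota> \<pi>. gamma m Ar M js \<iota> \<pi>"
proof -
  have M: "M \<in> LM" using g by (simp add: add_gen_def)
  obtain js where js: "set js \<subseteq> JG" and e: "eqv IL M (L.dsl (map sp js))" using LM_decompose[OF M] .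
  have gd: "L.good A" if "A \<in> set (map sp js)" for A using that js L_good_sp by auto
  have dm: "dpow M k \<in> LM" for k by (induction k) (auto intro: L.mods_zmod L.mods_dsum M)
  have "j \<in> set js" if j: "j \<in> JG" for j
  proof -
    note U = L.good_mods[OF L_good_sp[OF j]]
    obtain k where "summand LM IL (L.th (sp j)) (dpow M k)" using g U by (auto simp: add_gen_def)
    then have "ret IL (L.th (sp j)) (dpow M k)" using L.summand_iff[OF U dm] by simp
    then have "ret IL (L.th (sp j)) M" using ret_dpow[OF L.brick_th[OF L_good_sp[OF j]] M] by blast
    then have "ret IL (L.th (sp j)) (L.dsl (map sp js))" using ret_trans eqv_ret[OF e] by blast
    then have "sp j \<in> set (map sp js)" using L.ret_dsl[OF L_good_sp[OF j] gd] by blast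
    then show ?thesis using sp_inj[OF j] js by auto
  qed
  then have js': "set js = JG" using js by auto
  from L.dsl_coords[of "map sp js"] obtain \<iota> \<pi> where hh:
    "(\<forall>c<length (map sp js). lh IL (L.th (map sp js!c)) (L.dsl (map sp js)) (\<iota> c) \<and> lh IL (L.dsl (map sp js)) (L.th (map sp js!c)) (\<pi> c)) \<and>
     (\<forall>c<length (map sp js). \<forall>c'<length (map sp js). \<forall>v\<in>vs (L.th (map sp js!c')). \<pi> c (\<iota> c' v) = (if c = c' then v else 0\<^sub>v (fst (L.th (map sp js!c))))) \<and>
     (\<forall>v\<in>vs (L.dsl (map sp js)). (\<forall>c<length (map sp js). \<pi> c v = 0\<^sub>v (fst (L.th (map sp js!c)))) \<longrightarrow> v = 0\<^sub>v (fst (L.dsl (map sp js))))"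
    by (elim exE) (rule that)
  have h: "\<And>c. c<length js \<Longrightarrow> lh IL (L.th (sp (js!c))) (L.dsl (map sp js)) (\<iota> c)" "\<And>c. c<length js \<Longrightarrow> lh IL (L.dsl (map sp js)) (L.th (sp (js!c))) (\<pi> c)"
    "\<And>c c' v. c<length js \<Longrightarrow> c'<length js \<Longrightarrow> v\<in>vs (L.th (sp (js!c'))) \<Longrightarrow> \<pi> c (\<iota> c' v) = (if c = c' then v else 0\<^sub>v (card (L.sc (sp (js!c)))))"
    "\<And>v. v\<in>vs (L.dsl (map sp js)) \<Longrightarrow> (\<forall>c<length js. \<pi> c v = 0\<^sub>v (card (L.sc (sp (js!c))))) \<Longrightarrow> v = 0\<^sub>v (fst (L.dsl (map sp js)))"
    using hh by simp_all
  obtain a b where ab: "lh IL M (L.dsl (map sp js)) a" "lh IL (L.dsl (map sp js)) M b" "\<And>v. v \<in> vs M \<Longrightarrow> b (a v) = v" "\<And>v. v \<in> vs (L.dsl (map sp js)) \<Longrightarrow> a (b v) = v"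
    using e by (rule eqvE) blast
  have "gamma m Ar M js (\<lambda>c v. b (\<iota> c v)) (\<lambda>c v. \<pi> c (a v))"
  proof
    show "lh IL (L.th (sp (js!c))) M (\<lambda>v. b (\<iota> c v))" if "c < length js" for c by (rule lh_comp[OF h(1)[OF that] ab(2)])
    show "lh IL M (L.th (sp (js!c))) (\<lambda>v. \<pi> c (a v))" if "c < length js" for c by (rule lh_comp[OF ab(1) h(2)[OF that]])
    show "\<pi> c (a (b (\<iota> c' v))) = (if c = c' then v else 0\<^sub>v (card (L.sc (sp (js!c)))))"
      if "c < length js" "c' < length js" "v \<in> vs (L.th (sp (js!c')))" for c c' v
      using h(3)[OF that] ab(4)[OF lh_closed[OF h(1)[OF that(2)] that(3)]] by simp
    show "v = 0\<^sub>v (fst M)" if "v \<in> vs M" "\<And>c. c < length js \<Longrightarrow> \<pi> c (a v) = 0\<^sub>v (card (L.sc (sp (js!c))))" for v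
    proof -
      have "a v = 0\<^sub>v (fst (L.dsl (map sp js)))" using h(4)[OF lh_closed[OF ab(1) that(1)]] that(2) by blast
      then show ?thesis using ab(3)[OF that(1)] lh_zero[OF ab(2)] by simp
    qed
  qed (use M js' in auto)
  then show ?thesis by blast
qed

end

context gamma
begin

section \<open>A multiplicative basis of the endomorphism algebra\<close>

definition N where "N = length js"
definition CG where "CG = {..<N}"
definition lb where "lb c = js ! c"
definition rpG where "rpG j = (SOME c. c < N \<and> js ! c = j)"
definition S where "S = End_alg m Ar M"
definition D where "D = fst M"
definition bG where "bG c c' = mof D D (\<lambda>v. \<iota> c (hm (lb c) (lb c') (\<pi> c' v)))"
definition x0 where "x0 i j = (SOME x. x \<in> sp i \<inter> sp j)"
text \<open>The block of \<open>s\<close> from summand \<open>c'\<close> to summand \<open>c\<close>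
  is a multiple of \<open>hm\<close>; the factor is read off at a vertex \<open>x0\<close> of the
  overlap, where \<open>hm\<close> is the identity. Where no non-zero map exists the coefficient is
  0.\<close>

definition coG where "coG s c c' = (if RG (lb c) (lb c') then
   L.cd (sp (lb c)) (x0 (lb c) (lb c')) (\<pi> c (s *\<^sub>v \<iota> c' (L.bs (sp (lb c')) (x0 (lb c) (lb c'))))) else 0)"
abbreviation XG where "XG c \<equiv> L.th (sp (lb c))"

lemma lb: assumes "c \<in> CG" shows "lb c \<in> JG"
  using nth_mem[of c js] assms unfolding CG_def N_def lb_def js by simp

lemma RG_meet: "i \<in> JG \<Longrightarrow> j \<in> JG \<Longrightarrow> RG i j \<Longrightarrow> \<exists>x. x \<in> sp i \<inter> sp j"
  using RG_HC unfolding HC_def by blast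

lemma rpG: assumes "j \<in> JG" shows "rpG j \<in> CG" "lb (rpG j) = j"
proof -
  have "\<exists>c. c < N \<and> js ! c = j" using assms js unfolding N_def by (metis in_set_conv_nth)
  then have "rpG j < N \<and> js ! rpG j = j" unfolding rpG_def by (rule someI_ex)
  then show "rpG j \<in> CG" "lb (rpG j) = j" by (auto simp: CG_def lb_def)
qed

lemma iotaG: "c \<in> CG \<Longrightarrow> lh IL (XG c) M (\<iota> c)" using iota by (simp add: CG_def N_def lb_def)
lemma piG: "c \<in> CG \<Longrightarrow> lh IL M (XG c) (\<pi> c)" using pi by (simp add: CG_def N_def lb_def)
lemma pi_iotaG: "c \<in> CG \<Longrightarrow> c' \<in> CG \<Longrightarrow> v \<in> vs (XG c') \<Longrightarrow> \<pi> c (\<iota> c' v) = (if c = c' then v else 0\<^sub>v (fst (XG c)))"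
  using pi_iota by (simp add: CG_def N_def lb_def)
lemma pi_injG: "v \<in> vs M \<Longrightarrow> (\<And>c. c \<in> CG \<Longrightarrow> \<pi> c v = 0\<^sub>v (fst (XG c))) \<Longrightarrow> v = 0\<^sub>v (fst M)"
  using pi_inj by (simp add: CG_def N_def lb_def)

lemma M_wfm: "wfm IL M" using M_LM L.mods_wfm by blast

lemma S_iff: "s \<in> S \<longleftrightarrow> s \<in> carrier_mat D D \<and> lh IL M M (\<lambda>v. s *\<^sub>v v)"
proof
  assume "s \<in> S"
  then have h: "hom IL M M s" by (simp add: S_def End_alg_def)
  then show "s \<in> carrier_mat D D \<and> lh IL M M (\<lambda>v. s *\<^sub>v v)" using hom_lh[OF M_wfm M_wfm h] by (simp add: hom_def D_def)
next
  assume s: "s \<in> carrier_mat D D \<and> lh IL M M (\<lambda>v. s *\<^sub>v v)"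
  then have "hom IL M M (mof D D (\<lambda>v. s *\<^sub>v v))" using lh_hom[OF M_wfm M_wfm] unfolding D_def by blast
  moreover have "mof D D (\<lambda>v. s *\<^sub>v v) = s" using s by (intro mof_eqI lin_mat) auto
  ultimately show "s \<in> S" by (simp add: S_def End_alg_def)
qed

lemma S_carrier: "s \<in> S \<Longrightarrow> s \<in> carrier_mat D D" by (simp add: S_iff)
lemma S_lh: "s \<in> S \<Longrightarrow> lh IL M M (\<lambda>v. s *\<^sub>v v)" by (simp add: S_iff)

lemma S_vs: "s \<in> S \<Longrightarrow> v \<in> vs M \<Longrightarrow> s *\<^sub>v v \<in> vs M" using lh_closed[OF S_lh] .

lemma S_add: assumes "s \<in> S" "t \<in> S" shows "s + t \<in> S"
proof -
  note c = S_carrier[OF assms(1)] S_carrier[OF assms(2)]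
  have "lh IL M M (\<lambda>v. (s + t) *\<^sub>v v)"
    by (rule lh_cong[OF M_wfm lh_plus[OF M_wfm S_lh[OF assms(1)] S_lh[OF assms(2)]]])
      (use add_mult_distrib_mat_vec[OF c] in \<open>simp add: D_def\<close>)
  then show ?thesis using c by (simp add: S_iff)
qed

lemma smult_mat_vec: "A \<in> carrier_mat n k \<Longrightarrow> v \<in> carrier_vec k \<Longrightarrow> (a \<cdot>\<^sub>m A) *\<^sub>v v = a \<cdot>\<^sub>v (A *\<^sub>v (v :: 'k vec))"
  by (intro eq_vecI) auto

lemma S_smult: assumes "s \<in> S" shows "a \<cdot>\<^sub>m s \<in> S"
proof -
  note c = S_carrier[OF assms(1)]
  have "lh IL M M (\<lambda>v. (a \<cdot>\<^sub>m s) *\<^sub>v v)"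
    by (rule lh_cong[OF M_wfm lh_scale[OF M_wfm S_lh[OF assms(1)]]])
      (use smult_mat_vec[OF c] in \<open>simp add: D_def\<close>)
  then show ?thesis using c by (simp add: S_iff)
qed

lemma S_mult: assumes "s \<in> S" "t \<in> S" shows "s * t \<in> S"
proof -
  note c = S_carrier[OF assms(1)] S_carrier[OF assms(2)]
  have "lh IL M M (\<lambda>v. (s * t) *\<^sub>v v)"
    by (rule lh_cong[OF M_wfm lh_comp[OF S_lh[OF assms(2)] S_lh[OF assms(1)]]])
      (use assoc_mult_mat_vec[OF c] in \<open>simp add: D_def\<close>)
  then show ?thesis using mult_carrier_mat[OF c] by (simp add: S_iff)
qed

lemma S_one: "1\<^sub>m D \<in> S"
  unfolding S_iff by (auto intro!: lh_cong[OF M_wfm lh_id] simp: D_def)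

lemma M_expand:
  assumes v: "v \<in> vs M" shows "v = vsum (fst M) (\<lambda>c. \<iota> c (\<pi> c v)) CG"
proof -
  let ?w = "vsum (fst M) (\<lambda>c. \<iota> c (\<pi> c v)) CG"
  have c: "\<iota> c (\<pi> c v) \<in> vs M" if "c \<in> CG" for c using lh_closed[OF iotaG[OF that] lh_closed[OF piG[OF that] v]] .
  have f: "finite CG" by (simp add: CG_def)
  have "v - ?w = 0\<^sub>v (fst M)"
  proof (rule pi_injG)
    fix d assume d: "d \<in> CG"
    have "\<pi> d ?w = vsum (fst (XG d)) (\<lambda>c. \<pi> d (\<iota> c (\<pi> c v))) CG"
      by (rule lin_vsum[OF lh_lin[OF piG[OF d]] f c])
    also have "\<dots> = \<pi> d v"
      by (subst vsum_single[where a=d])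
        (use d f in \<open>auto simp: pi_iotaG lh_closed[OF piG _] v lh_closed[OF piG v, simplified] \<close>)
    finally show "\<pi> d (v - ?w) = 0\<^sub>v (fst (XG d))"
      using lh_minus[OF piG[OF d] v, of ?w] minus_cancel_vec[OF lh_closed[OF piG[OF d] v]] by simp
  qed (use v in simp)
  then show ?thesis by (intro vec_diff_zero[OF v]) auto
qed

lemma coG:
  assumes s: "s \<in> S" and c: "c \<in> CG" "c' \<in> CG" and v: "v \<in> vs (XG c')"
  shows "\<pi> c (s *\<^sub>v \<iota> c' v) = coG s c c' \<cdot>\<^sub>v hm (lb c) (lb c') v"
proof -
  note l = lb[OF c(1)] lb[OF c(2)]
  have "lh IL (XG c') (XG c) (\<lambda>v. \<pi> c (s *\<^sub>v \<iota> c' v))" by (rule lh_comp[OF lh_comp[OF iotaG[OF c(2)] S_lh[OF s]] piG[OF c(1)]])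
  then obtain k where k: "\<And>v. v \<in> vs (XG c') \<Longrightarrow> \<pi> c (s *\<^sub>v \<iota> c' v) = k \<cdot>\<^sub>v hm (lb c) (lb c') v" and k0: "\<not> RG (lb c) (lb c') \<Longrightarrow> k = 0"
    using hm_hom_scalar[OF l] by blast
  have "coG s c c' = k"
  proof (cases "RG (lb c) (lb c')")
    case True
    then have "\<exists>x. x \<in> sp (lb c) \<inter> sp (lb c')" by (rule RG_meet[OF l])
    then have x: "x0 (lb c) (lb c') \<in> sp (lb c) \<inter> sp (lb c')" unfolding x0_def by (rule someI_ex)
    have b: "L.bs (sp (lb c')) (x0 (lb c) (lb c')) \<in> vs (XG c')" by simp
    show ?thesis using True x unfolding coG_def k[OF b]
      by (simp add: L.cd_smult sc_sp l cd_hm)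
  next
    case False
    then show ?thesis using k0 by (simp add: coG_def)
  qed
  then show ?thesis using k[OF v] by simp
qed

lemma coG_add: assumes "s \<in> S" "t \<in> S" "c \<in> CG" "c' \<in> CG" shows "coG (s + t) c c' = coG s c c' + coG t c c'"
proof (cases "RG (lb c) (lb c')")
  case True
  note l = lb[OF assms(3)] lb[OF assms(4)]
  have "\<exists>x. x \<in> sp (lb c) \<inter> sp (lb c')" by (rule RG_meet[OF l True])
  then have x: "x0 (lb c) (lb c') \<in> sp (lb c) \<inter> sp (lb c')" unfolding x0_def by (rule someI_ex)
  let ?b = "L.bs (sp (lb c')) (x0 (lb c) (lb c'))"
  have b: "\<iota> c' ?b \<in> vs M" using lh_closed[OF iotaG[OF assms(4)], of ?b] by simp
  note sb = S_vs[OF assms(1) b] and tb = S_vs[OF assms(2) b]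
  have "(s + t) *\<^sub>v \<iota> c' ?b = s *\<^sub>v \<iota> c' ?b + t *\<^sub>v \<iota> c' ?b"
    using add_mult_distrib_mat_vec[OF S_carrier[OF assms(1)] S_carrier[OF assms(2)]] b by (simp add: D_def)
  then have "\<pi> c ((s + t) *\<^sub>v \<iota> c' ?b) = \<pi> c (s *\<^sub>v \<iota> c' ?b) + \<pi> c (t *\<^sub>v \<iota> c' ?b)"
    using lh_add[OF piG[OF assms(3)] sb tb] by simp
  then show ?thesis using True x lh_closed[OF piG[OF assms(3)] sb] lh_closed[OF piG[OF assms(3)] tb]
    by (simp add: coG_def L.cd_add sc_sp l)
qed (simp add: coG_def)

lemma coG_smult: assumes "s \<in> S" "c \<in> CG" "c' \<in> CG" shows "coG (a \<cdot>\<^sub>m s) c c' = a * coG s c c'"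
proof (cases "RG (lb c) (lb c')")
  case True
  note l = lb[OF assms(2)] lb[OF assms(3)]
  have "\<exists>x. x \<in> sp (lb c) \<inter> sp (lb c')" by (rule RG_meet[OF l True])
  then have x: "x0 (lb c) (lb c') \<in> sp (lb c) \<inter> sp (lb c')" unfolding x0_def by (rule someI_ex)
  let ?b = "L.bs (sp (lb c')) (x0 (lb c) (lb c'))"
  have b: "\<iota> c' ?b \<in> vs M" using lh_closed[OF iotaG[OF assms(3)], of ?b] by simp
  note sb = S_vs[OF assms(1) b]
  have "(a \<cdot>\<^sub>m s) *\<^sub>v \<iota> c' ?b = a \<cdot>\<^sub>v (s *\<^sub>v \<iota> c' ?b)"
    using smult_mat_vec[OF S_carrier[OF assms(1)]] b by (simp add: D_def)
  then have "\<pi> c ((a \<cdot>\<^sub>m s) *\<^sub>v \<iota> c' ?b) = a \<cdot>\<^sub>v \<pi> c (s *\<^sub>v \<iota> c' ?b)"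
    using lh_smult[OF piG[OF assms(2)] sb] by simp
  then show ?thesis using True x lh_closed[OF piG[OF assms(2)] sb]
    by (simp add: coG_def L.cd_smult sc_sp l)
qed (simp add: coG_def)

definition rG where "rG c c' \<longleftrightarrow> c \<in> CG \<and> c' \<in> CG \<and> RG (lb c) (lb c')"

lemma bG_lh: assumes r: "rG c c'" shows "lh IL M M (\<lambda>v. \<iota> c (hm (lb c) (lb c') (\<pi> c' v)))"
proof -
  have c: "c \<in> CG" "c' \<in> CG" "RG (lb c) (lb c')" using r by (auto simp: rG_def)
  show ?thesis by (rule lh_comp[OF lh_comp[OF piG[OF c(2)] lh_hm[OF lb[OF c(1)] lb[OF c(2)] c(3)]] iotaG[OF c(1)]])
qed

lemma bG_mult: "rG c c' \<Longrightarrow> v \<in> vs M \<Longrightarrow> bG c c' *\<^sub>v v = \<iota> c (hm (lb c) (lb c') (\<pi> c' v))"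
  unfolding bG_def D_def by (rule mof_mult[OF lh_lin[OF bG_lh]])

lemma bG_S: assumes r: "rG c c'" shows "bG c c' \<in> S"
proof -
  have "lh IL M M (\<lambda>v. bG c c' *\<^sub>v v)" by (rule lh_cong[OF M_wfm bG_lh[OF r]]) (simp add: bG_mult[OF r])
  then show ?thesis by (simp add: S_iff bG_def)
qed

text \<open>\<open>\<pi> b\<close> after \<open>\<iota> c\<close> is zero unless
  \<open>b = c\<close>, and in that case \<open>hm_comp\<close> decides. The elements multiply like
  matrix units, except that some products are cut off to zero.\<close>

lemma bG_bG:
  assumes r: "rG a b" "rG c d"
  shows "bG a b * bG c d = (if b = c \<and> rG a d then bG a d else 0\<^sub>m D D)"
proof (rule mat_eq_vecI)
  have cc: "a \<in> CG" "b \<in> CG" "c \<in> CG" "d \<in> CG" using r by (auto simp: rG_def)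
  note ca = S_carrier[OF bG_S[OF r(1)]] and cb = S_carrier[OF bG_S[OF r(2)]]
  show "bG a b * bG c d \<in> carrier_mat D D" by (rule mult_carrier_mat[OF ca cb])
  show "(if b = c \<and> rG a d then bG a d else 0\<^sub>m D D) \<in> carrier_mat D D" by (simp add: bG_def)
  fix v :: "'k vec" assume "v \<in> carrier_vec D"
  then have v: "v \<in> vs M" by (simp add: D_def)
  let ?w = "hm (lb c) (lb d) (\<pi> d v)"
  have pv: "\<pi> d v \<in> vs (XG d)" by (rule lh_closed[OF piG[OF cc(4)] v])
  have w: "?w \<in> vs (XG c)" by simp
  have "(bG a b * bG c d) *\<^sub>v v = bG a b *\<^sub>v (bG c d *\<^sub>v v)"
    using assoc_mult_mat_vec[OF ca cb, of v] v by (simp add: D_def)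
  also have "\<dots> = \<iota> a (hm (lb a) (lb b) (\<pi> b (\<iota> c ?w)))"
    using bG_mult[OF r(2) v] bG_mult[OF r(1) lh_closed[OF iotaG[OF cc(3)] w]] by simp
  also have "\<dots> = (if b = c \<and> rG a d then bG a d else 0\<^sub>m D D) *\<^sub>v v"
  proof (cases "b = c")
    case False
    have "hm (lb a) (lb b) (0\<^sub>v (card (L.sc (sp (lb b))))) = 0\<^sub>v (card (L.sc (sp (lb a))))"
      using lin_zero[OF lin_hm[OF lb[OF cc(1)] lb[OF cc(2)]]] .
    then show ?thesis using False pi_iotaG[OF cc(2,3) w] lh_zero[OF iotaG[OF cc(1)]] v by (auto simp: D_def)
  next
    case True
    have "hm (lb a) (lb b) ?w = (if RG (lb a) (lb d) then hm (lb a) (lb d) (\<pi> d v) else 0\<^sub>v (card (L.sc (sp (lb a)))))"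
      using hm_comp[OF lb[OF cc(1)] lb[OF cc(2)] lb[OF cc(4)] _ _ pv] r True by (simp add: rG_def)
    then show ?thesis using True pi_iotaG[OF cc(2,3) w] lh_zero[OF iotaG[OF cc(1)]] v bG_mult[of a d v] cc
      by (auto simp: D_def rG_def)
  qed
  finally show "(bG a b * bG c d) *\<^sub>v v = (if b = c \<and> rG a d then bG a d else 0\<^sub>m D D) *\<^sub>v v" .
qed

lemma coG_unique:
  assumes s: "s \<in> S" and c: "c \<in> CG" "c' \<in> CG" and k: "\<And>v. v \<in> vs (XG c') \<Longrightarrow> \<pi> c (s *\<^sub>v \<iota> c' v) = k \<cdot>\<^sub>v hm (lb c) (lb c') v"
    and r: "RG (lb c) (lb c')"
  shows "coG s c c' = k"
proof -
  note l = lb[OF c(1)] lb[OF c(2)]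
  obtain x where x: "x \<in> sp (lb c) \<inter> sp (lb c')" using RG_meet[OF l r] by blast
  have b: "L.bs (sp (lb c')) x \<in> vs (XG c')" by simp
  have "coG s c c' \<cdot>\<^sub>v hm (lb c) (lb c') (L.bs (sp (lb c')) x) = k \<cdot>\<^sub>v hm (lb c) (lb c') (L.bs (sp (lb c')) x)"
    using coG[OF s c b] k[OF b] by simp
  then have "L.cd (sp (lb c)) x (coG s c c' \<cdot>\<^sub>v hm (lb c) (lb c') (L.bs (sp (lb c')) x)) = L.cd (sp (lb c)) x (k \<cdot>\<^sub>v hm (lb c) (lb c') (L.bs (sp (lb c')) x))" by simp
  then show ?thesis using x by (simp add: L.cd_smult sc_sp l cd_hm)
qed

lemma coG_bG: assumes r: "rG x y" and c: "c \<in> CG" "c' \<in> CG" shows "coG (bG x y) c c' = (if c = x \<and> c' = y then 1 else 0)"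
proof (cases "RG (lb c) (lb c')")
  case True
  have xy: "x \<in> CG" "y \<in> CG" using r by (auto simp: rG_def)
  show ?thesis
  proof (rule coG_unique[OF bG_S[OF r] c _ True])
    fix v assume v: "v \<in> vs (XG c')"
    have "hm (lb x) (lb y) (0\<^sub>v (card (L.sc (sp (lb y))))) = 0\<^sub>v (card (L.sc (sp (lb x))))"
      using lin_zero[OF lin_hm[OF lb[OF xy(1)] lb[OF xy(2)]]] .
    moreover have "bG x y *\<^sub>v \<iota> c' v = \<iota> x (hm (lb x) (lb y) (\<pi> y (\<iota> c' v)))" by (rule bG_mult[OF r lh_closed[OF iotaG[OF c(2)] v]])
    moreover have "\<pi> c (\<iota> x (hm (lb x) (lb y) w)) = (if c = x then hm (lb x) (lb y) w else 0\<^sub>v (fst (XG c)))" for w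
      by (rule pi_iotaG[OF c(1) xy(1)]) simp
    ultimately show "\<pi> c (bG x y *\<^sub>v \<iota> c' v) = (if c = x \<and> c' = y then 1 else 0) \<cdot>\<^sub>v hm (lb c) (lb c') v"
      using pi_iotaG[OF xy(2) c(2) v] by (auto simp: zero_smult_vec[of _ "card (L.sc (sp (lb c)))"])
  qed
next
  case False
  then show ?thesis using r by (auto simp: coG_def rG_def)
qed

lemma coG_one: assumes c: "c \<in> CG" "c' \<in> CG" shows "coG (1\<^sub>m D) c c' = (if c = c' then 1 else 0)"
proof (cases "RG (lb c) (lb c')")
  case True
  show ?thesis
  proof (rule coG_unique[OF S_one c _ True])
    fix v assume v: "v \<in> vs (XG c')"
    have "1\<^sub>m D *\<^sub>v \<iota> c' v = \<iota> c' v" using lh_closed[OF iotaG[OF c(2)] v] by (simp add: D_def)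
    then show "\<pi> c (1\<^sub>m D *\<^sub>v \<iota> c' v) = (if c = c' then 1 else 0) \<cdot>\<^sub>v hm (lb c) (lb c') v"
      using pi_iotaG[OF c v] hm_self[OF lb[OF c(2)] v] by (auto simp: zero_smult_vec[of _ "card (L.sc (sp (lb c)))"])
  qed
next
  case False
  then show ?thesis using RG_refl[OF lb[OF c(1)]] by (auto simp: coG_def)
qed

lemma coG_zero: assumes s: "s \<in> S" and z: "\<And>c c'. rG c c' \<Longrightarrow> coG s c c' = 0" shows "s = 0\<^sub>m D D"
proof (rule mat_eq_vecI[OF S_carrier[OF s] zero_carrier_mat])
  fix v :: "'k vec" assume "v \<in> carrier_vec D"
  then have v: "v \<in> vs M" by (simp add: D_def)
  have "s *\<^sub>v v = 0\<^sub>v (fst M)"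
  proof (rule pi_injG[OF S_vs[OF s v]])
    fix c assume c: "c \<in> CG"
    have f: "finite CG" by (simp add: CG_def)
    have i: "\<iota> c' (\<pi> c' v) \<in> vs M" if "c' \<in> CG" for c' using lh_closed[OF iotaG[OF that] lh_closed[OF piG[OF that] v]] .
    note l = lh_comp[OF S_lh[OF s] piG[OF c]]
    have "\<pi> c (s *\<^sub>v v) = \<pi> c (s *\<^sub>v vsum (fst M) (\<lambda>c. \<iota> c (\<pi> c v)) CG)" using M_expand[OF v] by simp
    also have "\<dots> = vsum (fst (XG c)) (\<lambda>c'. \<pi> c (s *\<^sub>v \<iota> c' (\<pi> c' v))) CG"
      by (rule lin_vsum[OF lh_lin[OF l] f i])
    also have "\<dots> = vsum (fst (XG c)) (\<lambda>c'. 0\<^sub>v (fst (XG c))) CG"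
    proof (rule vsum_cong)
      fix c' assume c': "c' \<in> CG"
      have "coG s c c' = 0" using z[of c c'] c c' by (cases "RG (lb c) (lb c')") (auto simp: rG_def coG_def)
      then show "\<pi> c (s *\<^sub>v \<iota> c' (\<pi> c' v)) = 0\<^sub>v (fst (XG c))"
        using coG[OF s c c' lh_closed[OF piG[OF c'] v]] by (simp add: zero_smult_vec[of _ "card (L.sc (sp (lb c)))"])
    qed
    also have "\<dots> = 0\<^sub>v (fst (XG c))" by (intro eq_vecI) auto
    finally show "\<pi> c (s *\<^sub>v v) = 0\<^sub>v (fst (XG c))" .
  qed
  then show "s *\<^sub>v v = 0\<^sub>m D D *\<^sub>v v" using v by (auto simp: D_def)
qed

lemma finite_rG: "finite {(c,c'). rG c c'}"
proof -
  have "{(c,c'). rG c c'} \<subseteq> CG \<times> CG" by (auto simp: rG_def)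
  then show ?thesis by (rule finite_subset) (simp add: CG_def)
qed

text \<open>The elements \<open>bG x y\<close> span \<open>S\<close>: induction on the set of
  positions at which coefficients may be non-zero, subtracting one multiple of a basis element at a
  time until \<open>coG_zero\<close> applies.\<close>

lemma S_induct:
  assumes s: "s \<in> S" and Z: "Q (0\<^sub>m D D)" and B: "\<And>x y. rG x y \<Longrightarrow> Q (bG x y)"
    and Ad: "\<And>s t. s \<in> S \<Longrightarrow> t \<in> S \<Longrightarrow> Q s \<Longrightarrow> Q t \<Longrightarrow> Q (s + t)" and Sm: "\<And>a s. s \<in> S \<Longrightarrow> Q s \<Longrightarrow> Q (a \<cdot>\<^sub>m s)"
  shows "Q s"
proof -
  have "\<And>s. s \<in> S \<Longrightarrow> (\<forall>(c,c')\<in>{(c,c'). rG c c'} - E. coG s c c' = 0) \<Longrightarrow> Q s" if "finite E" "E \<subseteq> {(c,c'). rG c c'}" for E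
    using that
  proof (induction E rule: finite_induct)
    case empty
    have "s = 0\<^sub>m D D" by (rule coG_zero[OF empty(1)]) (use empty(2) in auto)
    then show ?case using Z by simp
  next
    case (insert e E)
    obtain x y where e: "e = (x,y)" by (cases e)
    then have r: "rG x y" using insert by auto
    let ?k = "coG s x y"
    let ?t = "s + (- ?k) \<cdot>\<^sub>m bG x y"
    note bS = bG_S[OF r]
    have tS: "?t \<in> S" by (intro S_add insert.prems S_smult bS)
    have "coG ?t c c' = 0" if h: "(c,c') \<in> {(c,c'). rG c c'} - E" for c c'
    proof -
      have c: "c \<in> CG" "c' \<in> CG" using h by (auto simp: rG_def)
      have "coG ?t c c' = coG s c c' + (- ?k) * (if c = x \<and> c' = y then 1 else 0)"
        by (simp add: coG_add[OF insert.prems(1) S_smult[OF bS] c] coG_smult[OF bS c] coG_bG[OF r c])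
      then show ?thesis using insert.prems(2) h e by auto
    qed
    then have "Q ?t" using insert.IH[OF tS] insert.prems by auto
    moreover have "?t + ?k \<cdot>\<^sub>m bG x y = s"
      using S_carrier[OF insert.prems(1)] S_carrier[OF bS] by (intro eq_matI) auto
    ultimately show ?case using Ad[OF tS S_smult[OF bS] _ Sm[OF bS B[OF r]]] by metis
  qed
  from this[OF finite_rG subset_refl s] show ?thesis by simp
qed

text \<open>With \<open>coG_zero\<close> this makes the coefficients a coordinate system on
  \<open>S\<close>; the regular module is built on it.\<close>

lemma coG_surj: "\<exists>s\<in>S. \<forall>c c'. rG c c' \<longrightarrow> coG s c c' = F c c'"
proof -
  have "\<exists>s\<in>S. \<forall>c c'. rG c c' \<longrightarrow> coG s c c' = (if (c,c') \<in> E then F c c' else 0)" if "finite E" "E \<subseteq> {(c,c'). rG c c'}" for E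
    using that
  proof (induction E rule: finite_induct)
    case empty
    have "coG (0 \<cdot>\<^sub>m 1\<^sub>m D) c c' = 0" if "rG c c'" for c c' using coG_smult[OF S_one, of c c' 0] that by (simp add: rG_def)
    then show ?case using S_smult[OF S_one, of 0] by auto
  next
    case (insert e E)
    obtain x y where e: "e = (x,y)" by (cases e)
    then have r: "rG x y" using insert by auto
    note bS = bG_S[OF r]
    obtain s where s: "s \<in> S" "\<And>c c'. rG c c' \<Longrightarrow> coG s c c' = (if (c,c') \<in> E then F c c' else 0)" using insert by auto
    let ?t = "s + F x y \<cdot>\<^sub>m bG x y"
    have "coG ?t c c' = (if (c,c') \<in> insert e E then F c c' else 0)" if h: "rG c c'" for c c'
    proof -
      have c: "c \<in> CG" "c' \<in> CG" using h by (auto simp: rG_def)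
      have "coG ?t c c' = coG s c c' + F x y * (if c = x \<and> c' = y then 1 else 0)"
        by (simp add: coG_add[OF s(1) S_smult[OF bS] c] coG_smult[OF bS c] coG_bG[OF r c])
      then show ?thesis using s(2)[OF h] insert.hyps e by auto
    qed
    then show ?case using S_add[OF s(1) S_smult[OF bS]] by blast
  qed
  from this[OF finite_rG subset_refl] show ?thesis by auto
qed

sublocale G: thin0 CG lb JG RG rpG coG
proof
  show "finite CG" by (simp add: CG_def)
  show "\<And>x i j k. x \<in> JG \<Longrightarrow> i \<in> JG \<Longrightarrow> j \<in> JG \<Longrightarrow> k \<in> JG \<Longrightarrow> RG x i \<Longrightarrow> RG i j \<Longrightarrow> RG j k \<Longrightarrow> RG x k \<Longrightarrow> RG x j = RG i k"
    by (rule RG_assoc)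
qed (auto simp: lb rpG RG_refl)

section \<open>Right modules over the endomorphism algebra\<close>

abbreviation MG :: "('k mat, 'k) md set" where "MG \<equiv> rmods S D"

lemma MG_iff: "X \<in> MG \<longleftrightarrow> wfm S X \<and> (\<forall>v\<in>vs X. snd X (1\<^sub>m D) *\<^sub>v v = v) \<and>
   (\<forall>a\<in>S. \<forall>b\<in>S. \<forall>v\<in>vs X. snd X (a + b) *\<^sub>v v = snd X a *\<^sub>v v + snd X b *\<^sub>v v \<and> snd X (a * b) *\<^sub>v v = snd X b *\<^sub>v (snd X a *\<^sub>v v)) \<and>
   (\<forall>c. \<forall>a\<in>S. \<forall>v\<in>vs X. snd X (c \<cdot>\<^sub>m a) *\<^sub>v v = c \<cdot>\<^sub>v (snd X a *\<^sub>v v))"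
proof (cases "wfm S X")
  case True
  let ?n = "fst X"
  have ca: "snd X a \<in> carrier_mat ?n ?n" if "a \<in> S" for a using True that by (simp add: wfm_def)
  have eqv: "A = B \<longleftrightarrow> (\<forall>v\<in>vs X. A *\<^sub>v v = B *\<^sub>v v)" if "A \<in> carrier_mat ?n ?n" "B \<in> carrier_mat ?n ?n" for A B :: "'k mat"
    using mat_eq_vecI[OF that] by blast
  have 1: "snd X (1\<^sub>m D) = 1\<^sub>m ?n \<longleftrightarrow> (\<forall>v\<in>vs X. snd X (1\<^sub>m D) *\<^sub>v v = v)" using eqv[OF ca[OF S_one] one_carrier_mat] by simp
  have 2: "snd X (a + b) = snd X a + snd X b \<longleftrightarrow> (\<forall>v\<in>vs X. snd X (a + b) *\<^sub>v v = snd X a *\<^sub>v v + snd X b *\<^sub>v v)" if "a \<in> S" "b \<in> S" for a b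
    using eqv[OF ca[OF S_add[OF that]] add_carrier_mat[OF ca[OF that(2)]]] add_mult_distrib_mat_vec[OF ca[OF that(1)] ca[OF that(2)]] by simp
  have 3: "snd X (a * b) = snd X b * snd X a \<longleftrightarrow> (\<forall>v\<in>vs X. snd X (a * b) *\<^sub>v v = snd X b *\<^sub>v (snd X a *\<^sub>v v))" if "a \<in> S" "b \<in> S" for a b
    using eqv[OF ca[OF S_mult[OF that]] mult_carrier_mat[OF ca[OF that(2)] ca[OF that(1)]]] assoc_mult_mat_vec[OF ca[OF that(2)] ca[OF that(1)]] by simp
  have 4: "snd X (c \<cdot>\<^sub>m a) = c \<cdot>\<^sub>m snd X a \<longleftrightarrow> (\<forall>v\<in>vs X. snd X (c \<cdot>\<^sub>m a) *\<^sub>v v = c \<cdot>\<^sub>v (snd X a *\<^sub>v v))" if "a \<in> S" for c a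
    using eqv[OF ca[OF S_smult[OF that]], of "c \<cdot>\<^sub>m snd X a"] ca[OF that] smult_mat_vec[OF ca[OF that]] by simp
  show ?thesis unfolding rmods_def mem_Collect_eq 1 using True ca 2 3 4 by (simp add: ball_conj_distrib cong: ball_cong)
next
  case False
  then show ?thesis unfolding rmods_def wfm_def by auto
qed

lemma MG_D:
  assumes "X \<in> MG" "v \<in> vs X"
  shows "snd X (1\<^sub>m D) *\<^sub>v v = v" "a \<in> S \<Longrightarrow> b \<in> S \<Longrightarrow> snd X (a + b) *\<^sub>v v = snd X a *\<^sub>v v + snd X b *\<^sub>v v"
    "a \<in> S \<Longrightarrow> b \<in> S \<Longrightarrow> snd X (a * b) *\<^sub>v v = snd X b *\<^sub>v (snd X a *\<^sub>v v)" "a \<in> S \<Longrightarrow> snd X (c \<cdot>\<^sub>m a) *\<^sub>v v = c \<cdot>\<^sub>v (snd X a *\<^sub>v v)"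
  using assms unfolding MG_iff by blast+

lemma MG_wfm: "X \<in> MG \<Longrightarrow> wfm S X" by (simp add: MG_iff)

lemma MG_act: "X \<in> MG \<Longrightarrow> a \<in> S \<Longrightarrow> v \<in> vs X \<Longrightarrow> snd X a *\<^sub>v v \<in> vs X" by (rule wfm_act[OF MG_wfm])

lemma MG_zero: assumes "X \<in> MG" "v \<in> vs X" shows "snd X (0\<^sub>m D D) *\<^sub>v v = 0\<^sub>v (fst X)"
proof -
  have "0 \<cdot>\<^sub>m 1\<^sub>m D = (0\<^sub>m D D :: 'k mat)" by (intro eq_matI) auto
  then show ?thesis using MG_D(4)[OF assms S_one, of 0] zero_smult_vec[OF MG_act[OF assms(1) S_one assms(2)]] by simp
qed

lemma MG_modcat: "modcat S MG"
proof
  show "wfm S X" if "X \<in> MG" for X using that by (rule MG_wfm)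
next
  let ?Z = "zmod :: ('k mat, 'k) md"
  have e: "v = w" if "v \<in> carrier_vec 0" "w \<in> carrier_vec 0" for v w :: "'k vec" using that by (rule vec0_eq)
  have c: "snd ?Z g *\<^sub>v v \<in> carrier_vec 0" for g v by (rule carrier_vecI) (simp add: zmod_def)
  show "?Z \<in> MG" unfolding MG_iff fst_zmod
    by (intro conjI ballI allI wfm_zmod) (rule e; simp add: c)+
next
  fix X Y assume X: "X \<in> MG" and Y: "Y \<in> MG"
  note w = MG_wfm[OF X] MG_wfm[OF Y]
  note wd = wfm_dsum[OF w]
  let ?D = "dsum X Y"
  have c: "snd ?D g *\<^sub>v v \<in> vs ?D" if "g \<in> S" "v \<in> vs ?D" for g v using wfm_act[OF wd that] .
  have q1: "p1 X Y (snd ?D g *\<^sub>v v) = snd X g *\<^sub>v p1 X Y v" if "g \<in> S" "v \<in> vs ?D" for g v using lh_act[OF lh_p1[OF w] that] .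
  have q2: "p2 X Y (snd ?D g *\<^sub>v v) = snd Y g *\<^sub>v p2 X Y v" if "g \<in> S" "v \<in> vs ?D" for g v using lh_act[OF lh_p2[OF w] that] .
  note a1 = lh_add[OF lh_p1[OF w]] and a2 = lh_add[OF lh_p2[OF w]] and m1 = lh_smult[OF lh_p1[OF w]] and m2 = lh_smult[OF lh_p2[OF w]]
  note dx = MG_D[OF X p12_carrier(1)[of X Y]] and dy = MG_D[OF Y p12_carrier(2)[of X Y]]
  show "?D \<in> MG" unfolding MG_iff
  proof (intro conjI wd ballI allI)
    fix v assume v: "v \<in> vs ?D"
    show "snd ?D (1\<^sub>m D) *\<^sub>v v = v"
      by (rule dsum_eqI[OF c[OF S_one v] v]) (simp_all only: q1[OF S_one v] q2[OF S_one v] dx dy)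
    fix a assume a: "a \<in> S"
    { fix k show "snd ?D (k \<cdot>\<^sub>m a) *\<^sub>v v = k \<cdot>\<^sub>v (snd ?D a *\<^sub>v v)"
      proof (rule dsum_eqI[OF c[OF S_smult[OF a] v]])
        show "k \<cdot>\<^sub>v (snd ?D a *\<^sub>v v) \<in> vs ?D" using c[OF a v] by simp
      qed (simp_all only: q1[OF S_smult[OF a] v] q2[OF S_smult[OF a] v] m1[OF c[OF a v]] m2[OF c[OF a v]] q1[OF a v] q2[OF a v] dx(4)[OF a] dy(4)[OF a]) }
    fix b assume b: "b \<in> S"
    show "snd ?D (a + b) *\<^sub>v v = snd ?D a *\<^sub>v v + snd ?D b *\<^sub>v v"
    proof (rule dsum_eqI[OF c[OF S_add[OF a b] v]])
      show "snd ?D a *\<^sub>v v + snd ?D b *\<^sub>v v \<in> vs ?D" using c[OF a v] c[OF b v] by simp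
    qed (simp_all only: q1[OF S_add[OF a b] v] q2[OF S_add[OF a b] v] a1[OF c[OF a v] c[OF b v]] a2[OF c[OF a v] c[OF b v]] q1[OF a v] q2[OF a v] q1[OF b v] q2[OF b v] dx(2)[OF a b] dy(2)[OF a b])
    show "snd ?D (a * b) *\<^sub>v v = snd ?D b *\<^sub>v (snd ?D a *\<^sub>v v)"
      by (rule dsum_eqI[OF c[OF S_mult[OF a b] v] c[OF b c[OF a v]]])
        (simp_all only: q1[OF S_mult[OF a b] v] q2[OF S_mult[OF a b] v] q1[OF b c[OF a v]] q2[OF b c[OF a v]] q1[OF a v] q2[OF a v] dx(3)[OF a b] dy(3)[OF a b])
  qed
next
  fix X Z assume X: "X \<in> MG" and wZ: "wfm S Z" and r: "ret S Z X"
  obtain f g where f: "lh S Z X f" and g: "lh S X Z g" and gf: "\<And>v. v \<in> vs Z \<Longrightarrow> g (f v) = v" using r by (rule retE) blast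
  have c: "snd Z h *\<^sub>v v \<in> vs Z" if "h \<in> S" "v \<in> vs Z" for h v using wfm_act[OF wZ that] .
  have inj: "v = w" if "v \<in> vs Z" "w \<in> vs Z" "f v = f w" for v w using gf that by metis
  have q: "f (snd Z h *\<^sub>v v) = snd X h *\<^sub>v f v" if "h \<in> S" "v \<in> vs Z" for h v using lh_act[OF f that] .
  show "Z \<in> MG" unfolding MG_iff
  proof (intro conjI wZ ballI allI)
    fix v assume v: "v \<in> vs Z"
    note dx = MG_D[OF X lh_closed[OF f v]]
    show "snd Z (1\<^sub>m D) *\<^sub>v v = v"
      by (rule inj[OF c[OF S_one v] v]) (simp only: q[OF S_one v] dx)
    fix a assume a: "a \<in> S"
    { fix k show "snd Z (k \<cdot>\<^sub>m a) *\<^sub>v v = k \<cdot>\<^sub>v (snd Z a *\<^sub>v v)"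
      proof (rule inj[OF c[OF S_smult[OF a] v]])
        show "k \<cdot>\<^sub>v (snd Z a *\<^sub>v v) \<in> vs Z" using c[OF a v] by simp
      qed (simp only: q[OF S_smult[OF a] v] lh_smult[OF f c[OF a v]] q[OF a v] dx(4)[OF a]) }
    fix b assume b: "b \<in> S"
    show "snd Z (a + b) *\<^sub>v v = snd Z a *\<^sub>v v + snd Z b *\<^sub>v v"
    proof (rule inj[OF c[OF S_add[OF a b] v]])
      show "snd Z a *\<^sub>v v + snd Z b *\<^sub>v v \<in> vs Z" using c[OF a v] c[OF b v] by simp
    qed (simp only: q[OF S_add[OF a b] v] lh_add[OF f c[OF a v] c[OF b v]] q[OF a v] q[OF b v] dx(2)[OF a b])
    show "snd Z (a * b) *\<^sub>v v = snd Z b *\<^sub>v (snd Z a *\<^sub>v v)"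
      by (rule inj[OF c[OF S_mult[OF a b] v] c[OF b c[OF a v]]])
        (simp only: q[OF S_mult[OF a b] v] q[OF b c[OF a v]] q[OF a v] dx(3)[OF a b])
  qed
qed

lemma GR_iff: "G.R c c' \<longleftrightarrow> rG c c'" by (simp add: G.R_def rG_def)

lemma G_th_bG:
  assumes r: "rG x y" and v: "v \<in> vs (G.th A)" and c: "c \<in> G.sc A"
  shows "G.cd A c (snd (G.th A) (bG x y) *\<^sub>v v) = (if c = y \<and> x \<in> G.sc A then G.cd A x v else 0)"
proof -
  have "(\<Sum>c'\<in>G.sc A. coG (bG x y) c' c * G.cd A c' v) = (\<Sum>c'\<in>G.sc A. if c' = x then (if c = y then G.cd A x v else 0) else 0)"
    using c by (intro sum.cong) (auto simp: coG_bG[OF r] G.sc_iff)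
  then show ?thesis using v c G.cd_act[of c A v "bG x y"] by auto
qed

text \<open>Multiplicativity is linear in each factor, so applying \<open>S_induct\<close> to one
  factor at a time leaves products of basis elements. For these the claim is exactly
  \<open>tconv\<close>.\<close>

lemma G_th_MG: assumes A: "A \<subseteq> JG" "G.tconv A" shows "G.th A \<in> MG"
proof -
  let ?T = "G.th A" and ?n = "card (G.sc A)"
  have c: "snd ?T h *\<^sub>v v \<in> carrier_vec ?n" if "v \<in> carrier_vec ?n" for h v
    using wfm_act[OF G.th_wfm[of UNIV], of h v A] that by simp
  note ev = G.cd_eqI[where A=A]
  have one: "snd ?T (1\<^sub>m D) *\<^sub>v v = v" if v: "v \<in> carrier_vec ?n" for v
  proof (rule ev[OF c[OF v] v])
    fix x assume x: "x \<in> G.sc A"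
    have "(\<Sum>c'\<in>G.sc A. coG (1\<^sub>m D) c' x * G.cd A c' v) = (\<Sum>c'\<in>G.sc A. if c' = x then G.cd A x v else 0)"
      using x by (intro sum.cong) (auto simp: coG_one G.sc_iff)
    then show "G.cd A x (snd ?T (1\<^sub>m D) *\<^sub>v v) = G.cd A x v" using G.cd_act[OF x v] x by simp
  qed
  have add: "snd ?T (a + b) *\<^sub>v v = snd ?T a *\<^sub>v v + snd ?T b *\<^sub>v v" if ab: "a \<in> S" "b \<in> S" and v: "v \<in> carrier_vec ?n" for a b v
  proof (rule ev[OF c[OF v]])
    show "snd ?T a *\<^sub>v v + snd ?T b *\<^sub>v v \<in> carrier_vec ?n" using c[OF v] by simp
    fix x assume x: "x \<in> G.sc A"
    have "(\<Sum>c'\<in>G.sc A. coG (a + b) c' x * G.cd A c' v) = (\<Sum>c'\<in>G.sc A. coG a c' x * G.cd A c' v + coG b c' x * G.cd A c' v)"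
      using x by (intro sum.cong) (auto simp: coG_add[OF ab] G.sc_iff algebra_simps)
    then show "G.cd A x (snd ?T (a + b) *\<^sub>v v) = G.cd A x (snd ?T a *\<^sub>v v + snd ?T b *\<^sub>v v)"
      using G.cd_act[OF x v] G.cd_add[OF x c[OF v] c[OF v]] by (simp add: sum.distrib)
  qed
  have sm: "snd ?T (k \<cdot>\<^sub>m a) *\<^sub>v v = k \<cdot>\<^sub>v (snd ?T a *\<^sub>v v)" if a: "a \<in> S" and v: "v \<in> carrier_vec ?n" for a k v
  proof (rule ev[OF c[OF v]])
    show "k \<cdot>\<^sub>v (snd ?T a *\<^sub>v v) \<in> carrier_vec ?n" using c[OF v] by simp
    fix x assume x: "x \<in> G.sc A"
    have "(\<Sum>c'\<in>G.sc A. coG (k \<cdot>\<^sub>m a) c' x * G.cd A c' v) = (\<Sum>c'\<in>G.sc A. k * (coG a c' x * G.cd A c' v))"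
      using x by (intro sum.cong) (auto simp: coG_smult[OF a] G.sc_iff algebra_simps)
    then show "G.cd A x (snd ?T (k \<cdot>\<^sub>m a) *\<^sub>v v) = G.cd A x (k \<cdot>\<^sub>v (snd ?T a *\<^sub>v v))"
      using G.cd_act[OF x v] G.cd_smult[OF x c[OF v]] by (simp add: sum_distrib_left)
  qed
  have zero: "snd ?T (0\<^sub>m D D) *\<^sub>v v = 0\<^sub>v ?n" if v: "v \<in> carrier_vec ?n" for v
  proof -
    have "0 \<cdot>\<^sub>m 1\<^sub>m D = (0\<^sub>m D D :: 'k mat)" by (intro eq_matI) auto
    then show ?thesis using sm[OF S_one v, of 0] zero_smult_vec[OF c[OF v]] by simp
  qed
  have addz: "snd ?T b *\<^sub>v 0\<^sub>v ?n = 0\<^sub>v ?n" for b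
    using lin_zero[OF wfm_lin[OF G.th_wfm[of UNIV], of b A]] by simp
  have tl: "lin ?n ?n (\<lambda>v. snd ?T b *\<^sub>v v)" for b using wfm_lin[OF G.th_wfm[of UNIV], of b A] by simp
  have base: "snd ?T (bG x y * bG z w) *\<^sub>v v = snd ?T (bG z w) *\<^sub>v (snd ?T (bG x y) *\<^sub>v v)"
    if r: "rG x y" "rG z w" and v: "v \<in> carrier_vec ?n" for x y z w v
  proof (rule ev[OF c[OF v] c[OF c[OF v]]])
    fix p assume p: "p \<in> G.sc A"
    have vt: "v \<in> vs ?T" and vt': "snd ?T (bG x y) *\<^sub>v v \<in> vs ?T" using v c[OF v] by auto
    have rhs: "G.cd A p (snd ?T (bG z w) *\<^sub>v (snd ?T (bG x y) *\<^sub>v v)) = (if p = w \<and> z \<in> G.sc A \<and> z = y \<and> x \<in> G.sc A then G.cd A x v else 0)"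
      using G_th_bG[OF r(2) vt' p] G_th_bG[OF r(1) vt, of z] by auto
    show "G.cd A p (snd ?T (bG x y * bG z w) *\<^sub>v v) = G.cd A p (snd ?T (bG z w) *\<^sub>v (snd ?T (bG x y) *\<^sub>v v))"
    proof (cases "y = z \<and> rG x w")
      case True
      have "p = w \<Longrightarrow> x \<in> G.sc A \<Longrightarrow> y \<in> G.sc A"
      proof -
        assume pw: "p = w" "x \<in> G.sc A"
        have "lb x \<in> A" "lb w \<in> A" "lb y \<in> JG" "y \<in> CG" using pw p r lb by (auto simp: G.sc_iff rG_def)
        then show "y \<in> G.sc A" using A(2) r True unfolding G.tconv_def G.sc_iff rG_def by blast
      qed
      then show ?thesis unfolding rhs using True bG_bG[OF r] G_th_bG[of x w v A p] vt p by auto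
    next
      case False
      have "\<not> (p = w \<and> z \<in> G.sc A \<and> z = y \<and> x \<in> G.sc A)"
      proof
        assume h: "p = w \<and> z \<in> G.sc A \<and> z = y \<and> x \<in> G.sc A"
        then have "lb x \<in> A" "lb w \<in> A" "lb y \<in> A" "lb y \<in> JG" using p lb by (auto simp: G.sc_iff)
        then have "RG (lb x) (lb w)" using A(2) r h unfolding G.tconv_def rG_def by blast
        then show False using False h r by (auto simp: rG_def)
      qed
      then show ?thesis unfolding rhs using False bG_bG[OF r] zero[OF v] G.cd_zero[OF p] by auto
    qed
  qed
  have mult1: "\<forall>v\<in>carrier_vec ?n. snd ?T (bG x y * b) *\<^sub>v v = snd ?T b *\<^sub>v (snd ?T (bG x y) *\<^sub>v v)" if b: "b \<in> S" and r: "rG x y" for x y b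
    using b
  proof (rule S_induct)
    note bS = bG_S[OF r] note bc = S_carrier[OF bS]
    show "\<forall>v\<in>carrier_vec ?n. snd ?T (bG x y * 0\<^sub>m D D) *\<^sub>v v = snd ?T (0\<^sub>m D D) *\<^sub>v (snd ?T (bG x y) *\<^sub>v v)"
      using zero c bc by auto
    show "\<forall>v\<in>carrier_vec ?n. snd ?T (bG x y * bG z w) *\<^sub>v v = snd ?T (bG z w) *\<^sub>v (snd ?T (bG x y) *\<^sub>v v)" if "rG z w" for z w
      using base[OF r that] by blast
    fix s assume s: "s \<in> S" and Qs: "\<forall>v\<in>carrier_vec ?n. snd ?T (bG x y * s) *\<^sub>v v = snd ?T s *\<^sub>v (snd ?T (bG x y) *\<^sub>v v)"
    { fix t assume t: "t \<in> S" and Qt: "\<forall>v\<in>carrier_vec ?n. snd ?T (bG x y * t) *\<^sub>v v = snd ?T t *\<^sub>v (snd ?T (bG x y) *\<^sub>v v)"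
      have "bG x y * (s + t) = bG x y * s + bG x y * t" by (rule mult_add_distrib_mat[OF bc S_carrier[OF s] S_carrier[OF t]])
      then show "\<forall>v\<in>carrier_vec ?n. snd ?T (bG x y * (s + t)) *\<^sub>v v = snd ?T (s + t) *\<^sub>v (snd ?T (bG x y) *\<^sub>v v)"
        using add[OF S_mult[OF bS s] S_mult[OF bS t]] add[OF s t c] Qs Qt by simp }
    { fix a
      have "bG x y * (a \<cdot>\<^sub>m s) = a \<cdot>\<^sub>m (bG x y * s)" by (rule mult_smult_distrib[OF bc S_carrier[OF s]])
      then show "\<forall>v\<in>carrier_vec ?n. snd ?T (bG x y * (a \<cdot>\<^sub>m s)) *\<^sub>v v = snd ?T (a \<cdot>\<^sub>m s) *\<^sub>v (snd ?T (bG x y) *\<^sub>v v)"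
        using sm[OF S_mult[OF bS s]] sm[OF s c] Qs by simp }
  qed
  have mult: "\<forall>v\<in>carrier_vec ?n. snd ?T (a * b) *\<^sub>v v = snd ?T b *\<^sub>v (snd ?T a *\<^sub>v v)" if a: "a \<in> S" and b: "b \<in> S" for a b
    using a
  proof (rule S_induct)
    note bc = S_carrier[OF b]
    show "\<forall>v\<in>carrier_vec ?n. snd ?T (0\<^sub>m D D * b) *\<^sub>v v = snd ?T b *\<^sub>v (snd ?T (0\<^sub>m D D) *\<^sub>v v)"
      using zero c bc addz by auto
    show "\<forall>v\<in>carrier_vec ?n. snd ?T (bG x y * b) *\<^sub>v v = snd ?T b *\<^sub>v (snd ?T (bG x y) *\<^sub>v v)" if "rG x y" for x y
      using mult1[OF b that] by blast
    fix s assume s: "s \<in> S" and Qs: "\<forall>v\<in>carrier_vec ?n. snd ?T (s * b) *\<^sub>v v = snd ?T b *\<^sub>v (snd ?T s *\<^sub>v v)"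
    { fix t assume t: "t \<in> S" and Qt: "\<forall>v\<in>carrier_vec ?n. snd ?T (t * b) *\<^sub>v v = snd ?T b *\<^sub>v (snd ?T t *\<^sub>v v)"
      have "(s + t) * b = s * b + t * b" by (rule add_mult_distrib_mat[OF S_carrier[OF s] S_carrier[OF t] bc])
      then show "\<forall>v\<in>carrier_vec ?n. snd ?T ((s + t) * b) *\<^sub>v v = snd ?T b *\<^sub>v (snd ?T (s + t) *\<^sub>v v)"
        using add[OF S_mult[OF s b] S_mult[OF t b]] add[OF s t] Qs Qt lin_add[OF tl c c] by simp }
    { fix k
      have "(k \<cdot>\<^sub>m s) * b = k \<cdot>\<^sub>m (s * b)" by (rule mult_smult_assoc_mat[OF S_carrier[OF s] bc])
      then show "\<forall>v\<in>carrier_vec ?n. snd ?T ((k \<cdot>\<^sub>m s) * b) *\<^sub>v v = snd ?T b *\<^sub>v (snd ?T (k \<cdot>\<^sub>m s) *\<^sub>v v)"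
        using sm[OF S_mult[OF s b]] sm[OF s] Qs lin_smult[OF tl c] by simp }
  qed
  show ?thesis unfolding MG_iff G.fst_th
    using one add sm mult G.th_wfm by auto
qed

sublocale G: thincat CG lb JG RG rpG coG S MG bG
proof (intro thincat.intro G.thin0_axioms MG_modcat thincat_axioms.intro)
  show "bG c c' \<in> S" if "G.R c c'" for c c' using that bG_S by (simp add: GR_iff)
  show "coG (bG x y) c c' = (if c = x \<and> c' = y then 1 else 0)" if "G.R x y" "c \<in> CG" "c' \<in> CG" for x y c c'
    using that coG_bG by (simp add: GR_iff)
  show "snd X (bG c' c'') *\<^sub>v (snd X (bG c c') *\<^sub>v v) = (if G.R c c'' then snd X (bG c c'') *\<^sub>v v else 0\<^sub>v (fst X))"
    if "X \<in> MG" "G.R c c'" "G.R c' c''" "v \<in> vs X" for X c c' c'' v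
    using that MG_D(3)[OF that(1,4) bG_S[of c c'] bG_S[of c' c'']] MG_zero[OF that(1,4)] bG_bG[of c c' c' c''] by (auto simp: GR_iff)
  show "snd X (bG c d) *\<^sub>v (snd X (bG a b) *\<^sub>v v) = 0\<^sub>v (fst X)"
    if "X \<in> MG" "G.R a b" "G.R c d" "b \<noteq> c" "v \<in> vs X" for X a b c d v
    using that MG_D(3)[OF that(1,5) bG_S[of a b] bG_S[of c d]] MG_zero[OF that(1,5)] bG_bG[of a b c d] by (auto simp: GR_iff)
  show "v = 0\<^sub>v (fst X)" if X: "X \<in> MG" and v: "v \<in> vs X" and z: "\<And>c. c \<in> CG \<Longrightarrow> snd X (bG c c) *\<^sub>v v = 0\<^sub>v (fst X)" for X v
  proof -
    have "snd X (1\<^sub>m D) *\<^sub>v v = 0\<^sub>v (fst X)"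
    proof (rule S_induct[OF S_one])
      show "snd X (0\<^sub>m D D) *\<^sub>v v = 0\<^sub>v (fst X)" by (rule MG_zero[OF X v])
      show "snd X (bG x y) *\<^sub>v v = 0\<^sub>v (fst X)" if r: "rG x y" for x y
      proof -
        have x: "x \<in> CG" "rG x x" using r RG_refl lb by (auto simp: rG_def)
        have "snd X (bG x y) *\<^sub>v v = snd X (bG x x * bG x y) *\<^sub>v v" using bG_bG[OF x(2) r] r by simp
        also have "\<dots> = snd X (bG x y) *\<^sub>v (snd X (bG x x) *\<^sub>v v)" by (rule MG_D(3)[OF X v bG_S[OF x(2)] bG_S[OF r]])
        also have "\<dots> = 0\<^sub>v (fst X)" using z[OF x(1)] mat_zero_vec[OF wfm_carrier[OF MG_wfm[OF X] bG_S[OF r]]] by simp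
        finally show ?thesis .
      qed
    qed (simp_all add: MG_D[OF X v])
    then show ?thesis using MG_D(1)[OF X v] by simp
  qed
  show "lh S X Y f" if X: "X \<in> MG" and Y: "Y \<in> MG" and f: "lin (fst X) (fst Y) f"
    and e: "\<And>c c' v. G.R c c' \<Longrightarrow> v \<in> vs X \<Longrightarrow> f (snd X (bG c c') *\<^sub>v v) = snd Y (bG c c') *\<^sub>v f v" for X Y f
    unfolding lh_def
  proof (intro conjI ballI f)
    fix g v assume g: "g \<in> S" and v: "v \<in> vs X"
    note fv = lin_closed[OF f v]
    show "f (snd X g *\<^sub>v v) = snd Y g *\<^sub>v f v"
      using g
    proof (rule S_induct)
      show "f (snd X (0\<^sub>m D D) *\<^sub>v v) = snd Y (0\<^sub>m D D) *\<^sub>v f v" using MG_zero[OF X v] MG_zero[OF Y fv] lin_zero[OF f] by simp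
      show "f (snd X (bG x y) *\<^sub>v v) = snd Y (bG x y) *\<^sub>v f v" if "rG x y" for x y using e[OF _ v] that by (simp add: GR_iff)
      show "f (snd X (s + t) *\<^sub>v v) = snd Y (s + t) *\<^sub>v f v" if "s \<in> S" "t \<in> S" "f (snd X s *\<^sub>v v) = snd Y s *\<^sub>v f v" "f (snd X t *\<^sub>v v) = snd Y t *\<^sub>v f v" for s t
        using MG_D(2)[OF X v that(1,2)] MG_D(2)[OF Y fv that(1,2)] lin_add[OF f MG_act[OF X that(1) v] MG_act[OF X that(2) v]] that by simp
      show "f (snd X (a \<cdot>\<^sub>m s) *\<^sub>v v) = snd Y (a \<cdot>\<^sub>m s) *\<^sub>v f v" if "s \<in> S" "f (snd X s *\<^sub>v v) = snd Y s *\<^sub>v f v" for a s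
        using MG_D(4)[OF X v that(1)] MG_D(4)[OF Y fv that(1)] lin_smult[OF f MG_act[OF X that(1) v]] that by simp
    qed
  qed
  show "G.th A \<in> MG" if "A \<subseteq> JG" "G.tconv A" for A by (rule G_th_MG[OF that])
qed

end

section \<open>Modules of projective dimension at most one over the Auslander algebra\<close>

text \<open>\<open>UCs u v\<close> is the cokernel of the map from the projective module of \<open>Sv v\<close> to that of \<open>Pa u v\<close>,
  \<open>UCd u v\<close> and \<open>UKa v\<close> are the cokernels of the maps from those of \<open>Pa u v\<close> and \<open>Sv v\<close> to that of \<open>Dv v\<close>,
  and \<open>URd v\<close> is the radical of the last one.\<close>

datatype ui = UP label | UCs nat nat | UCd nat nat | UKa nat | URd nat

context quiver
begin

section \<open>Neighbours of a label, projective covers and injective hulls\<close>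

lemma RG_antisym: "i \<in> JG \<Longrightarrow> j \<in> JG \<Longrightarrow> RG i j \<Longrightarrow> RG j i \<Longrightarrow> i = j"
  by (cases i; cases j; simp) (use Ar_fun Ar_irrefl Ar_V(3) in \<open>(auto; metis less_asym)\<close>)+

lemma RG_Sv: "j \<in> JG \<Longrightarrow> RG (Sv v) j \<longleftrightarrow> j = Sv v \<or> (\<exists>w. (v,w) \<in> Ar \<and> (j = Pa v w \<or> j = Dv w))"
  by (cases j) auto

lemma RG_Pa: "(u,v) \<in> Ar \<Longrightarrow> j \<in> JG \<Longrightarrow> RG (Pa u v) j \<longleftrightarrow> j = Pa u v \<or> RG (Sv v) j"
  by (cases j) (auto dest: Ar_fun)

lemma RG_Dv: "j \<in> JG \<Longrightarrow> RG (Dv v) j \<longleftrightarrow> j = Dv v \<or> (\<exists>u. (u,v) \<in> Ar \<and> j = Pa u v) \<or> RG (Sv v) j"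
  by (cases j) auto

lemma RG_to_Sv: "i \<in> JG \<Longrightarrow> RG i (Sv v) \<longleftrightarrow> i = Sv v \<or> (\<exists>u. (u,v) \<in> Ar \<and> i = Pa u v) \<or> i = Dv v"
  by (cases i) auto

lemma RG_to_Pa: "(u,v) \<in> Ar \<Longrightarrow> i \<in> JG \<Longrightarrow> RG i (Pa u v) \<longleftrightarrow> i = Pa u v \<or> RG i (Sv u) \<or> i = Dv v"
  by (cases i) (auto dest: Ar_fun)

lemma RG_to_Dv: "i \<in> JG \<Longrightarrow> RG i (Dv v) \<longleftrightarrow> i = Dv v \<or> (\<exists>u. (u,v) \<in> Ar \<and> RG i (Sv u))"
  by (cases i) auto

text \<open>The label of the projective \<Lambda>-module with top \<open>v\<close>. The name refers
  to \<Gamma>, where the socle of a projective-injective module sits at this label.\<close>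

definition soc where "soc v = (if \<exists>w. (v,w) \<in> Ar then Pa v (THE w. (v,w) \<in> Ar) else Sv v)"

lemma soc_Pa: assumes "(v,w) \<in> Ar" shows "soc v = Pa v w"
proof -
  have "(THE w. (v,w) \<in> Ar) = w" using assms Ar_fun by blast
  then show ?thesis unfolding soc_def using assms by auto
qed

lemma soc_JG: "v \<in> V \<Longrightarrow> soc v \<in> JG"
  using soc_Pa[of v] by (cases "\<exists>w. (v,w) \<in> Ar") (fastforce, simp add: soc_def)

text \<open>A non-zero map from the projective module with top \<open>v\<close> to \<open>j\<close>
  means that \<open>v\<close> lies in the support of \<open>j\<close>; as \<open>j\<close> has Loewy
  length at most two, \<open>v\<close> is then in its socle or in its top.\<close>

lemma RG_soc: assumes "j \<in> JG" shows "RG j (soc v) \<longleftrightarrow> RG j (Sv v) \<or> RG (Sv v) j"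
proof (cases "\<exists>w. (v,w) \<in> Ar")
  case True
  then obtain w where w: "(v,w) \<in> Ar" by blast
  show ?thesis using soc_Pa[OF w] RG_to_Pa[OF w assms] RG_Sv[OF assms, of v] w Ar_fun by auto
next
  case False
  then have "soc v = Sv v" by (simp add: soc_def)
  then show ?thesis using RG_Sv[OF assms, of v] False by auto
qed

text \<open>\<open>Ij v\<close> is the injective hull of the simple module at \<open>v\<close>; the corresponding projective module over
  the Auslander algebra is injective with socle at \<open>soc v\<close>.\<close>

definition Ij where "Ij v = (if fk v then Dv v else if \<exists>u. (u,v) \<in> Ar then Pa (THE u. (u,v) \<in> Ar) v else Sv v)"

lemma Ij_Pa: assumes "\<not> fk v" "(u,v) \<in> Ar" shows "Ij v = Pa u v"
proof -
  have "(THE u. (u,v) \<in> Ar) = u" using assms unfolding fk_def by blast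
  then show ?thesis unfolding Ij_def using assms by auto
qed

lemma Ij_cases:
  assumes "v \<in> V"
  obtains "fk v" "Ij v = Dv v" | u where "\<not> fk v" "(u,v) \<in> Ar" "Ij v = Pa u v" | "\<not> fk v" "\<nexists>u. (u,v) \<in> Ar" "Ij v = Sv v"
proof (cases "fk v")
  case True then show ?thesis using that(1) by (simp add: Ij_def)
next
  case False
  show ?thesis
  proof (cases "\<exists>u. (u,v) \<in> Ar")
    case True then show ?thesis using that(2) False Ij_Pa by blast
  next
    case no: False then show ?thesis using that(3) False by (simp add: Ij_def)
  qed
qed

lemma Ij_JG: assumes "v \<in> V" shows "Ij v \<in> JG"
  using assms by (cases rule: Ij_cases) (use assms in auto)

text \<open>Both sides say that \<open>v\<close> is a composition factor of \<open>j\<close>: maps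
  into the injective hull and maps from the projective cover of the simple module at
  \<open>v\<close> detect this equally.\<close>

lemma RG_Ij: assumes v: "v \<in> V" and j: "j \<in> JG" shows "RG (Ij v) j \<longleftrightarrow> RG j (soc v)"
proof -
  have e: "RG j (soc v) \<longleftrightarrow> j = Dv v \<or> (\<exists>u. (u,v) \<in> Ar \<and> j = Pa u v) \<or> RG (Sv v) j"
    unfolding RG_soc[OF j] RG_to_Sv[OF j] by auto
  show ?thesis
    using v
  proof (cases rule: Ij_cases)
    case 1
    then show ?thesis unfolding e using RG_Dv[OF j] by simp
  next
    case (2 u)
    have "j \<noteq> Dv v" using j 2(1) by auto
    moreover have "\<And>u'. (u',v) \<in> Ar \<longleftrightarrow> u' = u" using 2(1,2) unfolding fk_def by blast
    ultimately show ?thesis unfolding e using 2(3) RG_Pa[OF 2(2) j] by simp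
  next
    case 3
    have "j \<noteq> Dv v" using j 3 by auto
    then show ?thesis unfolding e using 3 by simp
  qed
qed

lemma RG_Ij_Sv: "v \<in> V \<Longrightarrow> RG (Ij v) (Sv v)"
  by (erule Ij_cases) auto

end

context gamma
begin

fun sg :: "ui \<Rightarrow> label set" where
  "sg (UP x) = G.PP x"
| "sg (UCs u v) = G.PP (Pa u v) - G.PP (Sv v)"
| "sg (UCd u v) = G.PP (Dv v) - G.PP (Pa u v)"
| "sg (UKa v) = G.PP (Dv v) - G.PP (Sv v)"
| "sg (URd v) = G.PP (Dv v) - {Dv v}"

definition UI where "UI = UP ` JG \<union> {UCs u v | u v. (u,v) \<in> Ar} \<union> {UCd u v | u v. (u,v) \<in> Ar \<and> fk v} \<union> UKa ` {v. fk v} \<union> URd ` {v. fk v}"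

lemma UI_simps [simp]: "UP x \<in> UI \<longleftrightarrow> x \<in> JG" "UCs u v \<in> UI \<longleftrightarrow> (u,v) \<in> Ar" "UCd u v \<in> UI \<longleftrightarrow> (u,v) \<in> Ar \<and> fk v"
  "UKa v \<in> UI \<longleftrightarrow> fk v" "URd v \<in> UI \<longleftrightarrow> fk v"
  by (auto simp: UI_def)

lemma PP_iff: "j \<in> G.PP x \<longleftrightarrow> j \<in> JG \<and> RG x j" by (simp add: G.PP_def)

text \<open>A label of \<open>PP y\<close> between two labels of the difference would, by
  \<open>RG_assoc\<close>, force the later of the two into \<open>PP y\<close> as well. The centre
  is \<open>x\<close>, which antisymmetry keeps in the difference.\<close>

lemma good_coker:
  assumes x: "x \<in> JG" and y: "y \<in> JG" and r: "RG x y" "x \<noteq> y" shows "G.good (G.PP x - G.PP y)"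
proof -
  have tc: "G.tconv (G.PP x)" using G.PP_good[OF x] by (simp add: G.good_def)
  have "G.tconv (G.PP x - G.PP y)"
    unfolding G.tconv_def
  proof (intro ballI impI)
    fix i k j assume ik: "i \<in> G.PP x - G.PP y" "k \<in> G.PP x - G.PP y" and j: "j \<in> JG" and rr: "RG i j \<and> RG j k"
    have 1: "j \<in> G.PP x \<longleftrightarrow> RG i k" using tc ik j rr unfolding G.tconv_def by blast
    have "\<not> RG y j" if "RG x j"
    proof
      assume "RG y j"
      then have "RG y k" using RG_assoc[OF x y j, of k] r rr ik that by (simp add: PP_iff)
      then show False using ik by (auto simp: PP_iff)
    qed
    then show "(j \<in> G.PP x - G.PP y) = RG i k" using 1 j by (auto simp: PP_iff)
  qed
  moreover have "\<not> RG y x" using r RG_antisym[OF x y] by blast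
  then have "G.star (G.PP x - G.PP y)"
    unfolding G.star_def using x y by (intro bexI[of _ x]) (auto simp: PP_iff RG_refl)
  ultimately show ?thesis unfolding G.good_def by (auto simp: PP_iff)
qed

text \<open>The top \<open>Dv v\<close> is removed and cannot be the centre; instead every remaining
  label is related to \<open>Sv v\<close> in one direction or the other.\<close>

lemma good_rad: assumes v: "fk v" shows "G.good (G.PP (Dv v) - {Dv v})"
proof -
  have d: "Dv v \<in> JG" "Sv v \<in> JG" using v fk_V by auto
  have tc: "G.tconv (G.PP (Dv v))" using G.PP_good[OF d(1)] by (simp add: G.good_def)
  have "G.tconv (G.PP (Dv v) - {Dv v})"
    unfolding G.tconv_def
  proof (intro ballI impI)
    fix i k j assume ik: "i \<in> G.PP (Dv v) - {Dv v}" "k \<in> G.PP (Dv v) - {Dv v}" and j: "j \<in> JG" and rr: "RG i j \<and> RG j k"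
    have 1: "j \<in> G.PP (Dv v) \<longleftrightarrow> RG i k" using tc ik j rr unfolding G.tconv_def by blast
    have "j \<noteq> Dv v" using rr RG_antisym[OF d(1), of i] ik by (auto simp: PP_iff)
    then show "(j \<in> G.PP (Dv v) - {Dv v}) = RG i k" using 1 by auto
  qed
  moreover have "G.star (G.PP (Dv v) - {Dv v})"
    unfolding G.star_def
  proof (intro bexI[of _ "Sv v"] ballI)
    fix j assume "j \<in> G.PP (Dv v) - {Dv v}"
    then show "RG (Sv v) j \<or> RG j (Sv v)" using RG_Dv[of j v] by (auto simp: PP_iff)
  qed (use d in \<open>auto simp: PP_iff\<close>)
  ultimately show ?thesis unfolding G.good_def by (auto simp: PP_iff)
qed

lemma good_sg: "i \<in> UI \<Longrightarrow> G.good (sg i)"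
  using G.PP_good good_coker good_rad Ar_V fk_V by (cases i) auto

text \<open>Over \<Lambda> the maps \<open>Pa u v \<rightarrow> Sv u\<close> and
  \<open>Pa u v \<oplus> Pa u' v \<rightarrow> Dv v\<close> are surjective; the condition is that
  the contravariant functor \<open>X\<close> turns them into injective maps.\<close>

definition \<Phi> where "\<Phi> X \<longleftrightarrow> (\<forall>u v. (u,v) \<in> Ar \<longrightarrow> (\<forall>t\<in>G.Tv X (Sv u). G.al X (Sv u) (Pa u v) t = 0\<^sub>v (fst X) \<longrightarrow> t = 0\<^sub>v (fst X))) \<and>
   (\<forall>v u u'. u \<noteq> u' \<and> (u,v) \<in> Ar \<and> (u',v) \<in> Ar \<longrightarrow> (\<forall>t\<in>G.Tv X (Dv v). G.al X (Dv v) (Pa u v) t = 0\<^sub>v (fst X) \<and>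
      G.al X (Dv v) (Pa u' v) t = 0\<^sub>v (fst X) \<longrightarrow> t = 0\<^sub>v (fst X)))"

text \<open>The case of \<open>split_family\<close> in which all vectors are images of one vector at
  \<open>x\<close> and all functionals are pulled back from one functional at \<open>p\<close>, the
  labels of \<open>A\<close> lying between \<open>x\<close> and \<open>p\<close>.\<close>

lemma split_xp:
  assumes X: "X \<in> MG" and A: "A \<subseteq> JG" "G.tconv A" and x: "x \<in> JG" and p: "p \<in> JG" and t: "t \<in> G.Tv X x" and rxp: "RG x p"
    and sub: "\<And>j. j \<in> A \<Longrightarrow> RG x j \<and> RG j p"
    and tz: "\<And>j. j \<in> JG \<Longrightarrow> RG x j \<Longrightarrow> j \<notin> A \<Longrightarrow> G.al X x j t = 0\<^sub>v (fst X)"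
    and ph: "linf (fst X) \<phi>" "\<phi> (G.al X x p t) = 1"
    and pz: "\<And>i s. i \<in> JG \<Longrightarrow> RG i p \<Longrightarrow> i \<notin> A \<Longrightarrow> s \<in> G.Tv X i \<Longrightarrow> \<phi> (G.al X i p s) = 0"
  shows "ret S (G.th A) X"
proof (rule G.split_family[OF A X, where t = "\<lambda>j. G.al X x j t" and \<phi> = "\<lambda>j s. \<phi> (G.al X j p s)"])
  have tv: "t \<in> vs X" by (rule G.Tv_vs[OF t])
  show "G.al X x j t \<in> G.Tv X j" if "j \<in> A" for j using sub[OF that] that A by (intro G.al_Tv X x tv) auto
  show "G.al X i j (G.al X x i t) = (if j \<in> A then G.al X x j t else 0\<^sub>v (fst X))" if "i \<in> A" "j \<in> JG" "RG i j" for i j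
    using G.al_comp[OF X x _ that(2) _ that(3) tv] sub[OF that(1)] that A tz[OF that(2)] sub[of j] by auto
  show "linf (fst X) (\<lambda>s. \<phi> (G.al X j p s))" if "j \<in> A" for j
    using sub[OF that] that A by (intro linf_comp[OF ph(1)] G.al_lin X p) auto
  show "\<phi> (G.al X j p (G.al X i j s)) = (if i \<in> A then \<phi> (G.al X i p s) else 0)" if "i \<in> JG" "j \<in> A" "RG i j" "s \<in> G.Tv X i" for i j s
    using G.al_comp[OF X that(1) _ p that(3) _ G.Tv_vs[OF that(4)]] sub[OF that(2)] A that pz[OF that(1) _ _ that(4)] linf_zero[OF ph(1)] sub[of i] by auto
  show "\<phi> (G.al X j p (G.al X x j t)) = 1" if "j \<in> A" for j
    using G.al_comp[OF X x _ p _ _ tv] sub[OF that] that A rxp ph by auto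
qed

text \<open>If no module of the list splits off, structure maps and spaces of \<open>X\<close> turn
  out to vanish one after the other, because each failure would produce a summand, until
  \<open>X\<close> itself is zero.\<close>

lemma split_MG:
  assumes X: "X \<in> MG" and Ph: "\<Phi> X" and n: "fst X > 0"
  shows "\<exists>i\<in>UI. ret S (G.th (sg i)) X"
proof (rule ccontr)
  assume "\<not> ?thesis"
  then have no: "\<not> ret S (G.th (sg i)) X" if "i \<in> UI" for i using that by blast
  let ?z = "0\<^sub>v (fst X)"
  note gs = good_sg[unfolded G.good_def]
  have inj1: "t = ?z" if "(u,v) \<in> Ar" "t \<in> G.Tv X (Sv u)" "G.al X (Sv u) (Pa u v) t = ?z" for u v t
    using Ph that unfolding \<Phi>_def by blast
  have inj2: "t = ?z" if "u \<noteq> u'" "(u,v) \<in> Ar" "(u',v) \<in> Ar" "t \<in> G.Tv X (Dv v)" "G.al X (Dv v) (Pa u v) t = ?z" "G.al X (Dv v) (Pa u' v) t = ?z" for u u' v t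
    using Ph that unfolding \<Phi>_def by blast
  have SvJ: "Sv v \<in> JG" if "v \<in> V" for v using that by simp
  have rs: "RG (Sv v) (soc v)" "RG (Sv v) (Sv v)" if "v \<in> V" for v using RG_soc[OF SvJ[OF that]] by auto
  \<comment> \<open>By \<Phi> nothing at \<open>Sv v\<close> is lost on the way to
    \<open>soc v\<close>, so vectors at \<open>Sv v\<close> can be detected by functionals at
    \<open>soc v\<close>.\<close>
  have injs: "t = ?z" if v: "v \<in> V" and t: "t \<in> G.Tv X (Sv v)" and z: "G.al X (Sv v) (soc v) t = ?z" for v t
  proof (cases "\<exists>w. (v,w) \<in> Ar")
    case True
    then obtain w where "(v,w) \<in> Ar" by blast
    then show ?thesis using inj1 soc_Pa t z by metis
  next
    case False
    then show ?thesis using G.al_id[OF t] z by (simp add: soc_def)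
  qed
  have via: "G.al X i k s = G.al X j k (G.al X i j s)" if "i \<in> JG" "j \<in> JG" "k \<in> JG" "RG i j" "RG j k" "RG i k" "s \<in> G.Tv X i" for i j k s
    using G.al_comp[OF X that(1-5) G.Tv_vs[OF that(7)]] that(6) by simp
  have via0: "G.al X i k s = ?z" if "i \<in> JG" "j \<in> JG" "k \<in> JG" "RG i j" "RG j k" "RG i k" "s \<in> G.Tv X i" "G.al X i j s = ?z" for i j k s
    using via[OF that(1-7)] that(8) G.al_zero[OF X that(2,3,5)] by simp
  have alT: "G.al X i j s \<in> G.Tv X j" if "i \<in> JG" "j \<in> JG" "RG i j" "s \<in> G.Tv X i" for i j s
    using G.al_Tv[OF X that(1-3) G.Tv_vs[OF that(4)]] .
  have soc_RG: "RG i (soc v)" if "i \<in> JG" "RG i (Sv v)" for i v using RG_soc[OF that(1)] that by simp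
  \<comment> \<open>A vector at \<open>Ij v\<close> that survives to \<open>Sv v\<close> survives to
    \<open>soc v\<close>, where the socle of the projective-injective module at \<open>Ij v\<close>
    sits; that module would split off.\<close>
  have F1: "G.al X (Ij v) (Sv v) t = ?z" if v: "v \<in> V" and t: "t \<in> G.Tv X (Ij v)" for v t
  proof (rule ccontr)
    assume nz: "G.al X (Ij v) (Sv v) t \<noteq> ?z"
    note I = Ij_JG[OF v] and s = soc_JG[OF v]
    have ts: "G.al X (Ij v) (Sv v) t \<in> G.Tv X (Sv v)" by (rule alT[OF I SvJ[OF v] RG_Ij_Sv[OF v] t])
    have rI: "RG (Ij v) (soc v)" by (rule soc_RG[OF I RG_Ij_Sv[OF v]])
    have "G.al X (Ij v) (soc v) t \<noteq> ?z" using injs[OF v ts] nz via[OF I SvJ[OF v] s RG_Ij_Sv[OF v] rs(1)[OF v] rI t] by auto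
    then obtain \<phi> where ph: "linf (fst X) \<phi>" "\<phi> (G.al X (Ij v) (soc v) t) = 1"
      using linf_separate0 G.Tv_vs[OF alT[OF I s rI t]] by blast
    have u: "UP (Ij v) \<in> UI" using I by simp
    have "ret S (G.th (sg (UP (Ij v)))) X"
      by (rule split_xp[OF X _ _ I s t rI _ _ ph]) (use gs[OF u] RG_Ij[OF v] in \<open>auto simp: PP_iff\<close>)
    then show False using no[OF u] by blast
  qed
  have F1d: "G.al X (Dv v) (Sv v) t = ?z" if "fk v" "t \<in> G.Tv X (Dv v)" for v t
    using F1[OF fk_V[OF that(1)]] that by (simp add: Ij_def)
  \<comment> \<open>A common non-zero value \<open>w\<close> of the two maps into the space at
    \<open>Sv v\<close> glues \<open>x\<close>, \<open>y\<close> and the images of \<open>w\<close>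
    to a copy of the radical \<open>URd v\<close>. The functional meets no obstruction from
    \<open>Dv v\<close>, by \<open>F1d\<close>.\<close>
  have F2a: "w = ?z" if f: "u \<noteq> u'" "(u,v) \<in> Ar" "(u',v) \<in> Ar" and x: "x \<in> G.Tv X (Pa u v)" and y: "y \<in> G.Tv X (Pa u' v)"
    and w: "w = G.al X (Pa u v) (Sv v) x" "w = G.al X (Pa u' v) (Sv v) y" for u u' v x y w
  proof (rule ccontr)
    assume nz: "w \<noteq> ?z"
    have v: "v \<in> V" "fk v" using f Ar_V by (auto simp: fk_def)
    have J: "Pa u v \<in> JG" "Pa u' v \<in> JG" "Dv v \<in> JG" "Sv v \<in> JG" using f v by auto
    note s = soc_JG[OF v(1)]
    have wT: "w \<in> G.Tv X (Sv v)" unfolding w(1) by (rule alT[OF J(1,4) _ x]) simp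
    have pr: "i = u \<or> i = u'" if "(i,v) \<in> Ar" for i using Ar_indeg[OF f(2,3) that] f(1) by auto
    have ne: "u \<noteq> v" "u' \<noteq> v" using f Ar_irrefl by auto
    have nP: "\<not> RG (Sv v) (Pa u v)" "\<not> RG (Sv v) (Pa u' v)" using ne by auto
    obtain \<phi> where ph: "linf (fst X) \<phi>" "\<phi> (G.al X (Sv v) (soc v) w) = 1"
      using linf_separate0[OF G.Tv_vs[OF alT[OF J(4) s rs(1)[OF v(1)] wT]]] injs[OF v(1) wT] nz by blast
    let ?A = "G.PP (Dv v) - {Dv v}"
    let ?t = "\<lambda>j. if j = Pa u v then x else if j = Pa u' v then y else G.al X (Sv v) j w"
    have A: "j \<in> ?A \<longleftrightarrow> j = Pa u v \<or> j = Pa u' v \<or> (j \<in> JG \<and> RG (Sv v) j)" for j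
    proof (cases "j \<in> JG")
      case True
      have "\<not> RG (Sv v) (Dv v)" using Ar_irrefl by simp
      then show ?thesis using RG_Dv[OF True, of v] pr J True by (auto simp: PP_iff)
    qed (use J in \<open>auto simp: PP_iff\<close>)
    have Ap: "RG j (soc v)" if "j \<in> ?A" for j
      using that RG_Dv[of j v] RG_soc[of j v] RG_to_Sv[of j v] by (auto simp: PP_iff)
    have u: "URd v \<in> UI" using v by simp
    have tS: "G.al X j (soc v) (?t j) = G.al X (Sv v) (soc v) w" if j: "j \<in> ?A" for j
    proof -
      consider "j = Pa u v" | "j = Pa u' v" | "j \<noteq> Pa u v" "j \<noteq> Pa u' v" "j \<in> JG" "RG (Sv v) j" using j A by blast
      then show ?thesis
      proof cases
        case 1 then show ?thesis using via[OF J(1,4) s _ rs(1)[OF v(1)] _ x] Ap[OF j] w by simp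
      next
        case 2 then show ?thesis using via[OF J(2,4) s _ rs(1)[OF v(1)] _ y] Ap[OF j] w f(1) by simp
      next
        case 3 then show ?thesis using via[OF J(4) 3(3) s 3(4) Ap[OF j] rs(1)[OF v(1)] wT] by simp
      qed
    qed
    have "ret S (G.th (sg (URd v))) X"
    proof (rule G.split_family[where t = ?t and \<phi> = "\<lambda>j s. \<phi> (G.al X j (soc v) s)"]; (unfold sg.simps)?)
      show "?A \<subseteq> JG" "G.tconv ?A" using gs[OF u] by auto
      show "?t j \<in> G.Tv X j" if "j \<in> ?A" for j
        using that x y alT[OF J(4) _ _ wT] unfolding A by auto
      show "G.al X i j (?t i) = (if j \<in> ?A then ?t j else ?z)" if i: "i \<in> ?A" and j: "j \<in> JG" and r: "RG i j" for i j
      proof -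
        consider (a) "i = Pa u v" | (b) "i = Pa u' v" | (c) "i \<noteq> Pa u v" "i \<noteq> Pa u' v" "i \<in> JG" "RG (Sv v) i" using i A by blast
        then show ?thesis
        proof cases
          case a
          show ?thesis
          proof (cases "j = Pa u v")
            case True
            have "Pa u v \<in> ?A" using A by blast
            then show ?thesis using True a G.al_id[OF x] by simp
          next
            case False
            then have rj: "RG (Sv v) j" using r a RG_Pa[OF f(2) j] by auto
            have jA: "j \<in> ?A" unfolding A using j rj by blast
            have "j \<noteq> Pa u v" "j \<noteq> Pa u' v" using rj nP by metis+
            note this jA
            then show ?thesis using a via[OF J(1,4) j _ rj _ x] r w by auto
          qed
        next
          case b
          show ?thesis
          proof (cases "j = Pa u' v")
            case True
            have "Pa u' v \<in> ?A" using A by blast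
            then show ?thesis using True b G.al_id[OF y] f by simp
          next
            case False
            then have rj: "RG (Sv v) j" using r b RG_Pa[OF f(3) j] by auto
            have jA: "j \<in> ?A" unfolding A using j rj by blast
            have "j \<noteq> Pa u v" "j \<noteq> Pa u' v" using rj nP by metis+
            note this jA
            then show ?thesis using b via[OF J(2,4) j _ rj _ y] r w f by auto
          qed
        next
          case c
          have e: "G.al X i j (?t i) = (if RG (Sv v) j then G.al X (Sv v) j w else ?z)"
            using c G.al_comp[OF X J(4) c(3) j c(4) r G.Tv_vs[OF wT]] by simp
          have "j \<in> ?A \<longleftrightarrow> RG (Sv v) j"
          proof
            assume "j \<in> ?A"
            then have "RG (Dv v) j" by (simp add: PP_iff)
            moreover have "RG (Dv v) i" using i by (simp add: PP_iff)
            ultimately show "RG (Sv v) j" using RG_assoc[OF J(3,4) c(3) j _ c(4) r] by simp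
          next
            assume "RG (Sv v) j" then show "j \<in> ?A" using A j by blast
          qed
          then show ?thesis using e nP by auto
        qed
      qed
      show "linf (fst X) (\<lambda>s. \<phi> (G.al X j (soc v) s))" if "j \<in> ?A" for j
        using Ap[OF that] that by (intro linf_comp[OF ph(1)] G.al_lin X s) (auto simp: PP_iff)
      show "\<phi> (G.al X j (soc v) (G.al X i j q)) = (if i \<in> ?A then \<phi> (G.al X i (soc v) q) else 0)" if i: "i \<in> JG" and j: "j \<in> ?A" and r: "RG i j" and q: "q \<in> G.Tv X i" for i j q
      proof -
        have jJ: "j \<in> JG" using j by (simp add: PP_iff)
        have e: "G.al X j (soc v) (G.al X i j q) = (if RG i (soc v) then G.al X i (soc v) q else ?z)"
          using G.al_comp[OF X i jJ s r Ap[OF j] G.Tv_vs[OF q]] .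
        show ?thesis
        proof (cases "i \<in> ?A")
          case True then show ?thesis using e Ap by simp
        next
          case False
          have "i = Dv v" if "RG i (soc v)"
            using that False RG_soc[OF i] RG_to_Sv[OF i] RG_Dv[OF i, of v] i by (auto simp: PP_iff)
          moreover have "G.al X (Dv v) (soc v) q = ?z" if "i = Dv v"
            using via0[OF J(3,4) s _ rs(1)[OF v(1)]] F1d[OF v(2)] q that soc_RG[OF J(3)] by simp
          ultimately show ?thesis using e False linf_zero[OF ph(1)] by auto
        qed
      qed
      show "\<phi> (G.al X j (soc v) (?t j)) = 1" if "j \<in> ?A" for j using tS[OF that] ph by simp
    qed (rule X)
    then show False using no[OF u] by blast
  qed
  \<comment> \<open>Without a second arrow this is \<open>F1\<close>. With one, \<open>F2a\<close>
    allows a functional that vanishes on everything coming from the other arrow, and the projective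
    module at \<open>Pa u v\<close> would split off.\<close>
  have F2: "G.al X (Pa u v) (Sv v) x = ?z" if a: "(u,v) \<in> Ar" and x: "x \<in> G.Tv X (Pa u v)" for u v x
  proof (cases "fk v")
    case False
    then show ?thesis using F1[OF Ar_V(2)[OF a]] Ij_Pa[OF False a] x by simp
  next
    case fv: True
    then obtain u' where u': "u' \<noteq> u" "(u',v) \<in> Ar" unfolding fk_def by metis
    have v: "v \<in> V" by (rule Ar_V(2)[OF a])
    have J: "Pa u v \<in> JG" "Pa u' v \<in> JG" "Dv v \<in> JG" "Sv v \<in> JG" using a u' fv v by auto
    note s = soc_JG[OF v]
    have pr: "i = u \<or> i = u'" if "(i,v) \<in> Ar" for i using Ar_indeg[OF a u'(2) that] u' by auto
    have r: "RG (Pa u v) (soc v)" "RG (Pa u' v) (soc v)" "RG (Dv v) (soc v)" using soc_RG J by auto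
    show ?thesis
    proof (rule ccontr)
      assume nz: "G.al X (Pa u v) (Sv v) x \<noteq> ?z"
      let ?W = "G.al X (Pa u' v) (soc v) ` G.Tv X (Pa u' v)"
      have sW: "subsp (fst X) ?W" by (rule subsp_image[OF G.al_lin[OF X J(2) s r(2)] G.Tv_subsp[OF X J(2)]])
      have "G.al X (Pa u v) (soc v) x \<notin> ?W"
      proof
        assume "G.al X (Pa u v) (soc v) x \<in> ?W"
        then obtain y where y: "y \<in> G.Tv X (Pa u' v)" "G.al X (Pa u v) (soc v) x = G.al X (Pa u' v) (soc v) y" by blast
        let ?a = "G.al X (Pa u v) (Sv v) x" and ?b = "G.al X (Pa u' v) (Sv v) y"
        have ab: "?a \<in> G.Tv X (Sv v)" "?b \<in> G.Tv X (Sv v)" using alT[OF J(1,4) _ x] alT[OF J(2,4) _ y(1)] by auto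
        have "G.al X (Sv v) (soc v) ?a = G.al X (Sv v) (soc v) ?b"
          using via[OF J(1,4) s _ rs(1)[OF v] r(1) x] via[OF J(2,4) s _ rs(1)[OF v] r(2) y(1)] y(2) by simp
        then have "G.al X (Sv v) (soc v) (?a - ?b) = ?z"
          using lin_minus[OF G.al_lin[OF X J(4) s rs(1)[OF v]] G.Tv_vs[OF ab(1)] G.Tv_vs[OF ab(2)]]
            minus_cancel_vec[OF G.al_closed[OF X J(4) s rs(1)[OF v] G.Tv_vs[OF ab(2)]]] by simp
        moreover have "?a - ?b \<in> G.Tv X (Sv v)"
        proof -
          have "?a - ?b = ?a + (-1) \<cdot>\<^sub>v ?b" using diff_as_add[OF G.Tv_vs[OF ab(1)] G.Tv_vs[OF ab(2)]] .
          then show ?thesis using G.Tv_subsp[OF X J(4)] ab unfolding subsp_def by metis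
        qed
        ultimately have "?a - ?b = ?z" using injs[OF v] by blast
        then have "?a = ?b" using vec_diff_zero G.Tv_vs[OF ab(1)] G.Tv_vs[OF ab(2)] by blast
        then show False using F2a[OF u'(1)[symmetric] a u'(2) x y(1) refl] nz by blast
      qed
      then obtain \<phi> where ph: "linf (fst X) \<phi>" "\<forall>w\<in>?W. \<phi> w = 0" "\<phi> (G.al X (Pa u v) (soc v) x) = 1"
        using linf_separate[OF sW G.al_closed[OF X J(1) s r(1) G.Tv_vs[OF x]]] by blast
      have u: "UP (Pa u v) \<in> UI" using J by simp
      have "ret S (G.th (sg (UP (Pa u v)))) X"
      proof (rule split_xp[OF X _ _ J(1) s x r(1) _ _ ph(1,3)])
        show "sg (UP (Pa u v)) \<subseteq> JG" "G.tconv (sg (UP (Pa u v)))" using gs[OF u] by auto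
        show "RG (Pa u v) j \<and> RG j (soc v)" if "j \<in> sg (UP (Pa u v))" for j
          using that RG_Pa[OF a, of j] RG_soc[of j v] r(1) by (auto simp: PP_iff)
        show "G.al X (Pa u v) j x = ?z" if "j \<in> JG" "RG (Pa u v) j" "j \<notin> sg (UP (Pa u v))" for j using that by (simp add: PP_iff)
        show "\<phi> (G.al X i (soc v) q) = 0" if i: "i \<in> JG" "RG i (soc v)" "i \<notin> sg (UP (Pa u v))" and q: "q \<in> G.Tv X i" for i q
        proof -
          have ni: "\<not> RG (Pa u v) i" using i by (simp add: PP_iff)
          then have "i \<noteq> Pa u v" "\<not> RG (Sv v) i" using RG_Pa[OF a i(1)] by auto
          moreover have "i \<noteq> Sv v" using \<open>\<not> RG (Sv v) i\<close> by auto
          ultimately have "i = Pa u' v \<or> i = Dv v" using i(2) RG_soc[OF i(1)] RG_to_Sv[OF i(1)] pr by metis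
          then show ?thesis
          proof
            assume "i = Pa u' v" then show ?thesis using ph(2) q by auto
          next
            assume i: "i = Dv v"
            then have "G.al X (Dv v) (soc v) q = ?z" using via0[OF J(3,4) s _ rs(1)[OF v] r(3), of q] F1d[OF fv] q by simp
            then show ?thesis using i linf_zero[OF ph(1)] by simp
          qed
        qed
      qed
      then show False using no[OF u] by blast
    qed
  qed
  \<comment> \<open>All structure maps into \<open>Sv v\<close> from other labels vanish by now, so
    nothing obstructs splitting off the projective module at \<open>Sv v\<close>.\<close>
  have F3a: "t = ?z" if v: "v \<in> V" and t: "t \<in> G.Tv X (Sv v)" for v t
  proof (rule ccontr)
    assume nz: "t \<noteq> ?z"
    note s = soc_JG[OF v] and J = SvJ[OF v]
    obtain \<phi> where ph: "linf (fst X) \<phi>" "\<phi> (G.al X (Sv v) (soc v) t) = 1"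
      using linf_separate0[OF G.Tv_vs[OF alT[OF J s rs(1)[OF v] t]]] injs[OF v t] nz by blast
    have u: "UP (Sv v) \<in> UI" using J by simp
    have "ret S (G.th (sg (UP (Sv v)))) X"
    proof (rule split_xp[OF X _ _ J s t rs(1)[OF v] _ _ ph])
      show "sg (UP (Sv v)) \<subseteq> JG" "G.tconv (sg (UP (Sv v)))" using gs[OF u] by auto
      show "RG (Sv v) j \<and> RG j (soc v)" if "j \<in> sg (UP (Sv v))" for j
        using that RG_soc[of j v] by (auto simp: PP_iff)
      show "G.al X (Sv v) j t = ?z" if "j \<in> JG" "RG (Sv v) j" "j \<notin> sg (UP (Sv v))" for j using that by (simp add: PP_iff)
      show "\<phi> (G.al X i (soc v) q) = 0" if i: "i \<in> JG" "RG i (soc v)" "i \<notin> sg (UP (Sv v))" and q: "q \<in> G.Tv X i" for i q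
      proof -
        have r: "RG i (Sv v)" "i \<noteq> Sv v" using i RG_soc[OF i(1)] v by (auto simp: PP_iff)
        have "G.al X i (Sv v) q = ?z"
        proof -
          consider u where "(u,v) \<in> Ar" "i = Pa u v" | "i = Dv v" using r RG_to_Sv[OF i(1)] by auto
          then show ?thesis using F2 F1d q i(1) by cases auto
        qed
        then show ?thesis using via0[OF i(1) J s r(1) rs(1)[OF v] i(2) q] linf_zero[OF ph(1)] by simp
      qed
    qed
    then show False using no[OF u] by blast
  qed
  \<comment> \<open>Every structure map that factors through some \<open>Sv v\<close> is zero from
    here on, which settles most of the compatibility conditions below.\<close>
  have S0: "G.al X i k q = ?z" if "i \<in> JG" "k \<in> JG" "v \<in> V" "RG i (Sv v)" "RG (Sv v) k" "RG i k" "q \<in> G.Tv X i" for i k v q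
    using via0[OF that(1) SvJ[OF that(3)] that(2,4-7) F3a[OF that(3) alT[OF that(1) SvJ[OF that(3)] that(4,7)]]] .
  \<comment> \<open>A vector at \<open>Dv v\<close> that dies at \<open>Pa u v\<close> survives at
    the other \<open>Pa u' v\<close> by \<Phi>. It generates a module supported at these two labels,
    which is \<open>UCd u v\<close>.\<close>
  have F3b: "t = ?z" if a: "(u,v) \<in> Ar" "fk v" and t: "t \<in> G.Tv X (Dv v)" and z: "G.al X (Dv v) (Pa u v) t = ?z" for u v t
  proof (rule ccontr)
    assume nz: "t \<noteq> ?z"
    obtain u' where u': "u' \<noteq> u" "(u',v) \<in> Ar" using a unfolding fk_def by metis
    have v: "v \<in> V" "u' \<in> V" using Ar_V u' a by blast+
    have J: "Pa u v \<in> JG" "Pa u' v \<in> JG" "Dv v \<in> JG" "Sv v \<in> JG" using a u' v by auto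
    have pr: "i = u \<or> i = u'" if "(i,v) \<in> Ar" for i using Ar_indeg[OF a(1) u'(2) that] u' by auto
    have r: "RG (Dv v) (Pa u' v)" "RG (Dv v) (Pa u v)" by auto
    obtain \<phi> where ph: "linf (fst X) \<phi>" "\<phi> (G.al X (Dv v) (Pa u' v) t) = 1"
      using linf_separate0[OF G.Tv_vs[OF alT[OF J(3,2) r(1) t]]] inj2[OF u'(1)[symmetric] a(1) u'(2) t z] nz by blast
    have u: "UCd u v \<in> UI" using a by simp
    have ne: "u \<noteq> v" "u' \<noteq> v" using a u' Ar_irrefl by auto
    have A: "j \<in> sg (UCd u v) \<longleftrightarrow> j = Dv v \<or> j = Pa u' v" for j
    proof (cases "j \<in> JG")
      case True
      then show ?thesis using RG_Dv[OF True, of v] RG_Pa[OF a(1) True] RG_Sv[OF True, of v] pr u' a ne Ar_irrefl by (auto simp: PP_iff)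
    qed (use J in \<open>auto simp: PP_iff\<close>)
    have "ret S (G.th (sg (UCd u v))) X"
    proof (rule split_xp[OF X _ _ J(3,2) t r(1) _ _ ph])
      show "sg (UCd u v) \<subseteq> JG" "G.tconv (sg (UCd u v))" using gs[OF u] by auto
      show "RG (Dv v) j \<and> RG j (Pa u' v)" if "j \<in> sg (UCd u v)" for j using that unfolding A by auto
      show "G.al X (Dv v) j t = ?z" if "j \<in> JG" "RG (Dv v) j" "j \<notin> sg (UCd u v)" for j
        using via0[OF J(3,1) that(1) r(2) _ that(2) t z] that by (simp add: PP_iff)
      show "\<phi> (G.al X i (Pa u' v) q) = 0" if i: "i \<in> JG" "RG i (Pa u' v)" "i \<notin> sg (UCd u v)" and q: "q \<in> G.Tv X i" for i q
      proof -
        have "RG i (Sv u')" using i RG_to_Pa[OF u'(2) i(1)] unfolding A by auto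
        then show ?thesis using S0[OF i(1) J(2) v(2) _ _ i(2) q] linf_zero[OF ph(1)] by simp
      qed
    qed
    then show False using no[OF u] by blast
  qed
  \<comment> \<open>Both maps out of the space at \<open>Dv v\<close> are injective now, so a
    non-zero vector there would span a copy of \<open>UKa v\<close>, supported at
    \<open>Dv v\<close> and the labels \<open>Pa u v\<close>.\<close>
  have F3c: "t = ?z" if fv: "fk v" and t: "t \<in> G.Tv X (Dv v)" for v t
  proof (rule ccontr)
    assume nz: "t \<noteq> ?z"
    have v: "v \<in> V" by (rule fk_V[OF fv])
    have J: "Dv v \<in> JG" "Sv v \<in> JG" using fv v by auto
    have PJ: "Pa u v \<in> JG" if "(u,v) \<in> Ar" for u using that by simp
    obtain \<phi>0 where p0: "linf (fst X) \<phi>0" "\<phi>0 t = 1" using linf_separate0[OF G.Tv_vs[OF t] nz] by blast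
    \<comment> \<open>Injectivity lets the functional at \<open>Dv v\<close> be transported to
      \<open>Pa u v\<close>: a functional separating the image of \<open>t\<close> from the image of
      the kernel of \<open>\<phi>0\<close> restricts to \<open>\<phi>0\<close>, because
      \<open>\<phi>0 t = 1\<close>.\<close>
    have ext: "\<exists>\<phi>. linf (fst X) \<phi> \<and> (\<forall>s\<in>G.Tv X (Dv v). \<phi> (G.al X (Dv v) (Pa u v) s) = \<phi>0 s)" if a: "(u,v) \<in> Ar" for u
    proof -
      let ?\<beta> = "G.al X (Dv v) (Pa u v)" and ?T = "G.Tv X (Dv v)"
      have lb: "lin (fst X) (fst X) ?\<beta>" by (rule G.al_lin[OF X J(1) PJ[OF a]]) simp
      have sT: "subsp (fst X) ?T" by (rule G.Tv_subsp[OF X J(1)])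
      let ?W = "?\<beta> ` {s\<in>?T. \<phi>0 s = 0}"
      have sW: "subsp (fst X) ?W" by (rule subsp_image[OF lb subsp_kernel[OF p0(1) sT]])
      have dT: "s - s' \<in> ?T" if "s \<in> ?T" "s' \<in> ?T" for s s'
      proof -
        have "s - s' = s + (-1) \<cdot>\<^sub>v s'" using diff_as_add[OF G.Tv_vs[OF that(1)] G.Tv_vs[OF that(2)]] .
        then show ?thesis using sT that unfolding subsp_def by metis
      qed
      have dphi: "\<phi>0 (s - s') = \<phi>0 s - \<phi>0 s'" if "s \<in> ?T" "s' \<in> ?T" for s s'
        using diff_as_add[OF G.Tv_vs[OF that(1)] G.Tv_vs[OF that(2)]] linf_add[OF p0(1) G.Tv_vs[OF that(1)], of "(-1) \<cdot>\<^sub>v s'"]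
          linf_smult[OF p0(1) G.Tv_vs[OF that(2)], of "-1"] G.Tv_vs[OF that(2)] by simp
      have "?\<beta> t \<notin> ?W"
      proof
        assume "?\<beta> t \<in> ?W"
        then obtain s where s: "s \<in> ?T" "\<phi>0 s = 0" "?\<beta> t = ?\<beta> s" by blast
        have "?\<beta> (t - s) = ?z" using lin_minus[OF lb G.Tv_vs[OF t] G.Tv_vs[OF s(1)]] s(3) minus_cancel_vec[OF lin_closed[OF lb G.Tv_vs[OF s(1)]]] by simp
        then have "t - s = ?z" using F3b[OF a fv dT[OF t s(1)]] by blast
        then show False using dphi[OF t s(1)] s(2) p0 linf_zero[OF p0(1)] by simp
      qed
      then obtain \<phi> where q: "linf (fst X) \<phi>" "\<forall>w\<in>?W. \<phi> w = 0" "\<phi> (?\<beta> t) = 1"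
        using linf_separate[OF sW lin_closed[OF lb G.Tv_vs[OF t]]] by blast
      have "\<phi> (?\<beta> s) = \<phi>0 s" if s: "s \<in> ?T" for s
      proof -
        let ?k = "\<phi>0 s \<cdot>\<^sub>v t"
        have k: "?k \<in> ?T" using sT t unfolding subsp_def by blast
        have "\<phi>0 (s - ?k) = 0" using dphi[OF s k] linf_smult[OF p0(1) G.Tv_vs[OF t]] p0(2) by simp
        then have z: "\<phi> (?\<beta> (s - ?k)) = 0" using q(2) dT[OF s k] by blast
        have "s = (s - ?k) + ?k" using G.Tv_vs[OF s] G.Tv_vs[OF t] by (intro eq_vecI) auto
        then have "\<phi> (?\<beta> s) = \<phi> (?\<beta> ((s - ?k) + ?k))" by simp
        also have "\<dots> = \<phi> (?\<beta> (s - ?k)) + \<phi>0 s * \<phi> (?\<beta> t)"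
          using linf_add[OF linf_comp[OF q(1) lb] G.Tv_vs[OF dT[OF s k]] G.Tv_vs[OF k]] linf_smult[OF linf_comp[OF q(1) lb] G.Tv_vs[OF t]] by simp
        finally show ?thesis using z q(3) by simp
      qed
      then show ?thesis using q(1) by blast
    qed
    then obtain ph where ph: "\<And>u. (u,v) \<in> Ar \<Longrightarrow> linf (fst X) (ph u)" "\<And>u s. (u,v) \<in> Ar \<Longrightarrow> s \<in> G.Tv X (Dv v) \<Longrightarrow> ph u (G.al X (Dv v) (Pa u v) s) = \<phi>0 s"
      by metis
    have u: "UKa v \<in> UI" using fv by simp
    have A: "j \<in> sg (UKa v) \<longleftrightarrow> j = Dv v \<or> (\<exists>u. (u,v) \<in> Ar \<and> j = Pa u v)" for j
    proof (cases "j \<in> JG")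
      case True
      then show ?thesis using RG_Dv[OF True, of v] RG_Sv[OF True, of v] Ar_irrefl by (auto simp: PP_iff)
    qed (use J in \<open>auto simp: PP_iff\<close>)
    have rA: "RG (Dv v) j" if "j \<in> sg (UKa v)" for j using that by (simp add: PP_iff)
    have JA: "j \<in> JG" if "j \<in> sg (UKa v)" for j using that by (simp add: PP_iff)
    let ?\<phi> = "\<lambda>j. case j of Pa u w \<Rightarrow> ph u | _ \<Rightarrow> \<phi>0"
    have "ret S (G.th (sg (UKa v))) X"
    proof (rule G.split_family[where t = "\<lambda>j. G.al X (Dv v) j t" and \<phi> = ?\<phi>])
      show "sg (UKa v) \<subseteq> JG" "G.tconv (sg (UKa v))" using gs[OF u] by auto
      show "G.al X (Dv v) j t \<in> G.Tv X j" if "j \<in> sg (UKa v)" for j by (rule alT[OF J(1) JA[OF that] rA[OF that] t])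
      show "G.al X i j (G.al X (Dv v) i t) = (if j \<in> sg (UKa v) then G.al X (Dv v) j t else ?z)" if i: "i \<in> sg (UKa v)" and j: "j \<in> JG" "RG i j" for i j
      proof -
        have e: "G.al X i j (G.al X (Dv v) i t) = (if RG (Dv v) j then G.al X (Dv v) j t else ?z)"
          using G.al_comp[OF X J(1) JA[OF i] j(1) rA[OF i] j(2) G.Tv_vs[OF t]] .
        have "G.al X (Dv v) j t = ?z" if "RG (Dv v) j" "j \<notin> sg (UKa v)"
          using S0[OF J(1) j(1) v _ _ that(1) t] that j by (simp add: PP_iff)
        then show ?thesis using e rA by auto
      qed
      show "linf (fst X) (?\<phi> j)" if "j \<in> sg (UKa v)" for j using that ph(1) p0(1) unfolding A by auto
      show "?\<phi> j (G.al X i j s) = (if i \<in> sg (UKa v) then ?\<phi> i s else 0)" if i: "i \<in> JG" and j: "j \<in> sg (UKa v)" and r: "RG i j" and s: "s \<in> G.Tv X i" for i j s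
      proof -
        have zz: "G.al X i j s = ?z \<and> i \<notin> sg (UKa v)" if w: "w \<in> V" "(w,v) \<in> Ar" "RG i (Sv w)" "RG (Sv w) j" for w
        proof
          show "G.al X i j s = ?z" by (rule S0[OF i JA[OF j] w(1,3,4) r s])
          have "w < v" using Ar_V(3) w by blast
          then show "i \<notin> sg (UKa v)" unfolding A using w(3) by auto
        qed
        from j consider "j = Dv v" | u where "(u,v) \<in> Ar" "j = Pa u v" unfolding A by blast
        then show ?thesis
        proof cases
          case 1
          show ?thesis
          proof (cases "i = Dv v")
            case True then show ?thesis using 1 j G.al_id[OF s] by simp
          next
            case False
            then obtain w where w: "(w,v) \<in> Ar" "RG i (Sv w)" using r 1 RG_to_Dv[OF i] by auto
            then show ?thesis using zz[OF Ar_V(1)[OF w(1)] w] 1 w linf_zero[OF p0(1)] by (simp del: sg.simps)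
          qed
        next
          case (2 u)
          consider "i = Pa u v" | "i = Dv v" | "RG i (Sv u)" using r 2 RG_to_Pa[OF 2(1) i] by auto
          then show ?thesis
          proof cases
            case 1 then show ?thesis using 2 j s G.al_id[of s X "Pa u v"] by simp
          next
            case d: 2
            have "Dv v \<in> sg (UKa v)" using A by blast
            then show ?thesis using d 2 s ph(2)[OF 2(1)] by simp
          next
            case 3
            then show ?thesis using zz[OF Ar_V(1)[OF 2(1)] 2(1) 3] 2 linf_zero[OF ph(1)[OF 2(1)]] by (simp del: sg.simps)
          qed
        qed
      qed
      show "?\<phi> j (G.al X (Dv v) j t) = 1" if "j \<in> sg (UKa v)" for j
        using that G.al_id[OF t] p0(2) ph(2)[OF _ t] unfolding A by auto
    qed (rule X)
    then show False using no[OF u] by blast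
  qed
  \<comment> \<open>The label \<open>Pa u v\<close> is isolated by now, and \<open>UCs u v\<close>
    is the simple module there.\<close>
  have F3d: "t = ?z" if a: "(u,v) \<in> Ar" and t: "t \<in> G.Tv X (Pa u v)" for u v t
  proof (rule ccontr)
    assume nz: "t \<noteq> ?z"
    have v: "v \<in> V" "u \<in> V" using Ar_V a by blast+
    have J: "Pa u v \<in> JG" "Sv v \<in> JG" using a v by auto
    obtain \<phi> where ph: "linf (fst X) \<phi>" "\<phi> (G.al X (Pa u v) (Pa u v) t) = 1"
      using linf_separate0[OF G.Tv_vs[OF t] nz] G.al_id[OF t] by auto
    have u: "UCs u v \<in> UI" using a by simp
    have ne: "u \<noteq> v" using a Ar_irrefl by auto
    have A: "j \<in> sg (UCs u v) \<longleftrightarrow> j = Pa u v" for j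
    proof (cases "j \<in> JG")
      case True
      then show ?thesis using RG_Pa[OF a True] RG_Sv[OF True, of v] ne by (auto simp: PP_iff)
    qed (use J in \<open>auto simp: PP_iff\<close>)
    have "ret S (G.th (sg (UCs u v))) X"
    proof (rule split_xp[OF X _ _ J(1,1) t _ _ _ ph])
      show "sg (UCs u v) \<subseteq> JG" "G.tconv (sg (UCs u v))" using gs[OF u] by auto
      show "RG (Pa u v) (Pa u v)" by simp
      show "RG (Pa u v) j \<and> RG j (Pa u v)" if "j \<in> sg (UCs u v)" for j using that unfolding A by auto
      show "G.al X (Pa u v) j t = ?z" if "j \<in> JG" "RG (Pa u v) j" "j \<notin> sg (UCs u v)" for j
        using via0[OF J that(1) _ _ that(2) t F2[OF a t]] that by (simp add: PP_iff)
      show "\<phi> (G.al X i (Pa u v) q) = 0" if i: "i \<in> JG" "RG i (Pa u v)" "i \<notin> sg (UCs u v)" and q: "q \<in> G.Tv X i" for i q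
      proof -
        consider "i = Dv v" | "RG i (Sv u)" using i RG_to_Pa[OF a i(1)] unfolding A by auto
        then have "G.al X i (Pa u v) q = ?z"
        proof cases
          case 1
          then have "q = ?z" using F3c q i(1) by simp
          then show ?thesis using G.al_zero[OF X i(1) J(1) i(2)] by simp
        next
          case 2
          then show ?thesis using S0[OF i(1) J(1) v(2) _ _ i(2) q] by simp
        qed
        then show ?thesis using linf_zero[OF ph(1)] by simp
      qed
    qed
    then show False using no[OF u] by blast
  qed
  have "t = ?z" if "j \<in> JG" "t \<in> G.Tv X j" for j t
    using that F3a F3c F3d by (cases j) auto
  then show False using G.Tv_trivial[OF X] n by simp
qed

end

section \<open>Exact squares and presentations of thin modules\<close>

context thincat
begin

text \<open>Exactness of \<open>0 \<rightarrow> X z \<rightarrow> X a \<oplus> X b \<rightarrow> X x\<close> at the first two places, where \<open>X j\<close> is the space \<open>Tv X j\<close>.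
  The degenerate case \<open>a = b\<close> is to be read as \<open>0 \<rightarrow> X z \<rightarrow> X a \<rightarrow> X x\<close>.\<close>

definition sqI where "sqI z a b X \<longleftrightarrow>
  (\<forall>t\<in>Tv X z. al X z a t = 0\<^sub>v (fst X) \<and> al X z b t = 0\<^sub>v (fst X) \<longrightarrow> t = 0\<^sub>v (fst X))"

definition sqX where "sqX z a b x X \<longleftrightarrow> (\<forall>q1\<in>Tv X a. \<forall>q2\<in>Tv X b. (a = b \<longrightarrow> q1 = q2) \<and>
  al X a x q1 = (if RL z x then al X b x q2 else 0\<^sub>v (fst X)) \<longrightarrow> (\<exists>r\<in>Tv X z. al X z a r = q1 \<and> al X z b r = q2))"

definition sq where "sq z a b x X \<longleftrightarrow> sqI z a b X \<and> sqX z a b x X"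

context
  fixes z a b x
  assumes J: "z \<in> J" "a \<in> J" "b \<in> J" "x \<in> J" and r: "RL z a" "RL z b" "RL a x" "RL b x"
begin

lemma sqI_ret: assumes X: "sqI z a b X" and "ret I Z X" shows "sqI z a b Z"
  unfolding sqI_def
proof (intro ballI impI)
  obtain f g where f: "lh I Z X f" and g: "lh I X Z g" and gf: "\<And>v. v \<in> vs Z \<Longrightarrow> g (f v) = v" using assms(2) by (rule retE) blast
  fix t assume t: "t \<in> Tv Z z" and e: "al Z z a t = 0\<^sub>v (fst Z) \<and> al Z z b t = 0\<^sub>v (fst Z)"
  note tv = Tv_vs[OF t]
  have "f t = 0\<^sub>v (fst X)" using X lh_Tv[OF f J(1) t] lh_al[OF f J(1,2) r(1) tv] lh_al[OF f J(1,3) r(2) tv] e lh_zero[OF f] unfolding sqI_def by metis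
  then show "t = 0\<^sub>v (fst Z)" using gf[OF tv] lh_zero[OF g] by simp
qed

lemma sq_ret: assumes X: "sq z a b x X" and "ret I Z X" shows "sq z a b x Z"
  unfolding sq_def sqX_def
proof (intro conjI ballI impI)
  show "sqI z a b Z" using sqI_ret assms unfolding sq_def by blast
  obtain f g where f: "lh I Z X f" and g: "lh I X Z g" and gf: "\<And>v. v \<in> vs Z \<Longrightarrow> g (f v) = v" using assms(2) by (rule retE) blast
  fix q1 q2 assume q: "q1 \<in> Tv Z a" "q2 \<in> Tv Z b" and h: "(a = b \<longrightarrow> q1 = q2) \<and> al Z a x q1 = (if RL z x then al Z b x q2 else 0\<^sub>v (fst Z))"
  note qv = Tv_vs[OF q(1)] Tv_vs[OF q(2)]
  have "al X a x (f q1) = (if RL z x then al X b x (f q2) else 0\<^sub>v (fst X))"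
    using lh_al[OF f J(2,4) r(3) qv(1)] lh_al[OF f J(3,4) r(4) qv(2)] h lh_zero[OF f] by auto
  then obtain s where s: "s \<in> Tv X z" "al X z a s = f q1" "al X z b s = f q2"
    using X lh_Tv[OF f J(2) q(1)] lh_Tv[OF f J(3) q(2)] h unfolding sq_def sqX_def by metis
  have "al Z z a (g s) = q1" "al Z z b (g s) = q2"
    using lh_al[OF g J(1,2) r(1) Tv_vs[OF s(1)]] lh_al[OF g J(1,3) r(2) Tv_vs[OF s(1)]] s gf qv by auto
  then show "\<exists>r\<in>Tv Z z. al Z z a r = q1 \<and> al Z z b r = q2" using lh_Tv[OF g J(1) s(1)] by blast
qed

lemma sq_dsum: assumes X: "sq z a b x X" "X \<in> mods" and Y: "sq z a b x Y" "Y \<in> mods" shows "sq z a b x (dsum X Y)"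
proof -
  note w = mods_wfm[OF X(2)] mods_wfm[OF Y(2)] and D = mods_dsum[OF X(2) Y(2)]
  note p = lh_p1[OF w] lh_p2[OF w] and i = lh_i1[OF w] lh_i2[OF w]
  let ?D = "dsum X Y"
  have c: "v \<in> vs ?D" if "v \<in> Tv ?D j" for v j using Tv_vs[OF that] .
  have "sqI z a b ?D"
    unfolding sqI_def
  proof (intro ballI impI)
    fix t assume t: "t \<in> Tv ?D z" and e: "al ?D z a t = 0\<^sub>v (fst ?D) \<and> al ?D z b t = 0\<^sub>v (fst ?D)"
    note tv = Tv_vs[OF t]
    have 1: "p1 X Y t = 0\<^sub>v (fst X)" using X(1) lh_Tv[OF p(1) J(1) t] lh_al[OF p(1) J(1,2) r(1) tv] lh_al[OF p(1) J(1,3) r(2) tv] e lh_zero[OF p(1)] unfolding sq_def sqI_def by metis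
    have 2: "p2 X Y t = 0\<^sub>v (fst Y)" using Y(1) lh_Tv[OF p(2) J(1) t] lh_al[OF p(2) J(1,2) r(1) tv] lh_al[OF p(2) J(1,3) r(2) tv] e lh_zero[OF p(2)] unfolding sq_def sqI_def by metis
    show "t = 0\<^sub>v (fst ?D)" using dsum_eqI[OF tv, of "0\<^sub>v (fst ?D)"] 1 2 lh_zero[OF p(1)] lh_zero[OF p(2)] by simp
  qed
  moreover have "sqX z a b x ?D"
    unfolding sqX_def
  proof (intro ballI impI)
    fix q1 q2 assume q: "q1 \<in> Tv ?D a" "q2 \<in> Tv ?D b" and h: "(a = b \<longrightarrow> q1 = q2) \<and> al ?D a x q1 = (if RL z x then al ?D b x q2 else 0\<^sub>v (fst ?D))"
    note qv = Tv_vs[OF q(1)] Tv_vs[OF q(2)]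
    have "al X a x (p1 X Y q1) = (if RL z x then al X b x (p1 X Y q2) else 0\<^sub>v (fst X))"
      using lh_al[OF p(1) J(2,4) r(3) qv(1)] lh_al[OF p(1) J(3,4) r(4) qv(2)] h lh_zero[OF p(1)] by auto
    then obtain s1 where s1: "s1 \<in> Tv X z" "al X z a s1 = p1 X Y q1" "al X z b s1 = p1 X Y q2"
      using X(1) lh_Tv[OF p(1) J(2) q(1)] lh_Tv[OF p(1) J(3) q(2)] h unfolding sq_def sqX_def by metis
    have "al Y a x (p2 X Y q1) = (if RL z x then al Y b x (p2 X Y q2) else 0\<^sub>v (fst Y))"
      using lh_al[OF p(2) J(2,4) r(3) qv(1)] lh_al[OF p(2) J(3,4) r(4) qv(2)] h lh_zero[OF p(2)] by auto
    then obtain s2 where s2: "s2 \<in> Tv Y z" "al Y z a s2 = p2 X Y q1" "al Y z b s2 = p2 X Y q2"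
      using Y(1) lh_Tv[OF p(2) J(2) q(1)] lh_Tv[OF p(2) J(3) q(2)] h unfolding sq_def sqX_def by metis
    note sv = Tv_vs[OF s1(1)] Tv_vs[OF s2(1)]
    let ?s = "i1 X Y s1 + i2 X Y s2"
    have sT: "i1 X Y s1 \<in> Tv ?D z" "i2 X Y s2 \<in> Tv ?D z" using lh_Tv[OF i(1) J(1) s1(1)] lh_Tv[OF i(2) J(1) s2(1)] .
    have "?s \<in> Tv ?D z" using Tv_subsp[OF D J(1)] sT unfolding subsp_def by blast
    moreover have "al ?D z a ?s = q1"
      using lin_add[OF al_lin[OF D J(1,2) r(1)] c[OF sT(1)] c[OF sT(2)]] lh_al[OF i(1) J(1,2) r(1) sv(1)] lh_al[OF i(2) J(1,2) r(1) sv(2)] s1 s2 i_p[OF qv(1)] by simp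
    moreover have "al ?D z b ?s = q2"
      using lin_add[OF al_lin[OF D J(1,3) r(2)] c[OF sT(1)] c[OF sT(2)]] lh_al[OF i(1) J(1,3) r(2) sv(1)] lh_al[OF i(2) J(1,3) r(2) sv(2)] s1 s2 i_p[OF qv(2)] by simp
    ultimately show "\<exists>r\<in>Tv ?D z. al ?D z a r = q1 \<and> al ?D z b r = q2" by blast
  qed
  ultimately show ?thesis by (simp add: sq_def)
qed

lemma sq_zmod: "sq z a b x zmod"
proof -
  have e: "v = 0\<^sub>v 0" if "v \<in> carrier_vec 0" for v :: "'k vec" using that by (intro vec0_eq) auto
  have t: "v = 0\<^sub>v 0" if "v \<in> Tv zmod j" for v j using e Tv_vs[OF that] by simp
  have tz: "0\<^sub>v 0 \<in> Tv zmod z" using Tv_zero[OF mods_zmod J(1)] by simp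
  have az: "al zmod z a (0\<^sub>v 0) = 0\<^sub>v 0" "al zmod z b (0\<^sub>v 0) = 0\<^sub>v 0" using al_zero[OF mods_zmod J(1,2) r(1)] al_zero[OF mods_zmod J(1,3) r(2)] by simp_all
  show ?thesis unfolding sq_def sqI_def sqX_def
  proof (intro conjI ballI impI)
    fix q1 q2 assume "q1 \<in> Tv zmod a" "q2 \<in> Tv zmod b"
    then have "q1 = 0\<^sub>v 0" "q2 = 0\<^sub>v 0" using t by blast+
    then show "\<exists>r\<in>Tv zmod z. al zmod z a r = q1 \<and> al zmod z b r = q2" using tz az by blast
  qed (drule t, simp)
qed

text \<open>The spaces of a thin module are at most one-dimensional, so exactness only depends on
  which of the four labels lie in \<open>A\<close>. By \<open>h5\<close> the degenerate square is
  the one whose composite from \<open>z\<close> to \<open>x\<close> is zero.\<close>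

lemma sq_th:
  assumes A: "A \<subseteq> J" "tconv A"
    and h1: "z \<in> A \<Longrightarrow> a \<in> A \<or> b \<in> A" and h2: "a \<in> A \<Longrightarrow> z \<notin> A \<or> a \<noteq> b \<and> b \<in> A \<Longrightarrow> x \<in> A"
    and h3: "b \<in> A \<Longrightarrow> z \<notin> A \<Longrightarrow> x \<in> A" and h4: "z \<notin> A \<Longrightarrow> a \<in> A \<Longrightarrow> b \<in> A \<Longrightarrow> a = b" and h5: "a = b \<longleftrightarrow> \<not> RL z x"
  shows "sq z a b x (th A)"
  unfolding sq_def sqI_def sqX_def
proof (intro conjI ballI impI)
  let ?T = "th A"
  note m = th_mods[OF A]
  { fix t assume t: "t \<in> Tv ?T z" and e: "al ?T z a t = 0\<^sub>v (fst ?T) \<and> al ?T z b t = 0\<^sub>v (fst ?T)"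
    show "t = 0\<^sub>v (fst ?T)"
    proof (rule Tv_th_eqI[OF J(1) t Tv_zero[OF m J(1)]])
      assume z: "z \<in> A"
      have "cd A (rp z) t = 0" if "c \<in> A" "c \<in> J" "RL z c" "al ?T z c t = 0\<^sub>v (fst ?T)" for c
        using cd_al[OF J(1) that(2,3,1) Tv_vs[OF t]] z that(4) cd_zero[of "rp c" A] that(1,2) by simp
      then show "cd A (rp z) t = cd A (rp z) (0\<^sub>v (fst ?T))" using h1[OF z] J r e z cd_zero[of "rp z" A] by auto
    qed }
  fix q1 q2 assume q: "q1 \<in> Tv ?T a" "q2 \<in> Tv ?T b" and h: "(a = b \<longrightarrow> q1 = q2) \<and> al ?T a x q1 = (if RL z x then al ?T b x q2 else 0\<^sub>v (fst ?T))"
  note qv = Tv_vs[OF q(1)] Tv_vs[OF q(2)]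
  have e: "x \<in> A \<Longrightarrow> (if a \<in> A then cd A (rp a) q1 else 0) = (if RL z x \<and> b \<in> A then cd A (rp b) q2 else 0)"
    using cd_al[OF J(2,4) r(3) _ qv(1)] cd_al[OF J(3,4) r(4) _ qv(2)] h cd_zero[of "rp x" A] J by (cases "RL z x") auto
  let ?k = "if a \<in> A then cd A (rp a) q1 else cd A (rp b) q2"
  let ?s = "if z \<in> A then ?k \<cdot>\<^sub>v bs A (rp z) else 0\<^sub>v (fst ?T)"
  have s: "?s \<in> Tv ?T z" using bs_Tv[OF J(1)] Tv_zero[OF m J(1)] Tv_subsp[OF m J(1)] unfolding subsp_def by auto
  note sv = Tv_vs[OF s]
  have cs: "z \<in> A \<Longrightarrow> cd A (rp z) ?s = ?k" using cd_smult[of "rp z" A "bs A (rp z)"] J by (simp add: )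
  show "\<exists>r\<in>Tv ?T z. al ?T z a r = q1 \<and> al ?T z b r = q2"
  proof (intro bexI[OF _ s] conjI)
    show "al ?T z a ?s = q1"
    proof (rule Tv_th_eqI[OF J(2) al_Tv[OF m J(1,2) r(1) sv] q(1)])
      assume aA: "a \<in> A"
      show "cd A (rp a) (al ?T z a ?s) = cd A (rp a) q1"
        unfolding cd_al[OF J(1,2) r(1) aA sv] using cs aA e h2 h4 h5 by auto
    qed
    show "al ?T z b ?s = q2"
    proof (rule Tv_th_eqI[OF J(3) al_Tv[OF m J(1,3) r(2) sv] q(2)])
      assume bA: "b \<in> A"
      show "cd A (rp b) (al ?T z b ?s) = cd A (rp b) q2"
        unfolding cd_al[OF J(1,3) r(2) bA sv] using cs bA e h h2 h3 h4 h5 by (auto split: if_splits)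
    qed
  qed
qed

text \<open>A projective module is a retract of a sum of modules \<open>P y\<close>, and exactness
  of the square passes to sums and retracts.\<close>

lemma sq_proj:
  assumes P: "\<And>y. y \<in> J \<Longrightarrow> sq z a b x (P y)" and Q: "projective mods I Q" shows "sq z a b x Q"
proof -
  obtain js where js: "set js \<subseteq> J" "ret I Q (dsl (map PP js))" using proj_ret_free[OF Q] .
  have "sq z a b x (dsl (map PP js)) \<and> dsl (map PP js) \<in> mods" using js(1)
  proof (induction js)
    case (Cons y js) then show ?case using sq_dsum P P_mods mods_dsum by simp
  qed (simp add: sq_zmod mods_zmod)
  then show ?thesis using sq_ret js(2) by blast
qed

text \<open>The chase of the snake lemma. \<open>t\<close> lifts to \<open>p\<close> in
  \<open>P0\<close>, whose images at \<open>a\<close> and \<open>b\<close> come from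
  \<open>q1\<close> and \<open>q2\<close> in \<open>P1\<close>. Injectivity of \<open>f\<close>
  makes these compatible at \<open>x\<close>, exactness for \<open>P1\<close> lifts them to
  \<open>w\<close>, and injectivity for \<open>P0\<close> gives \<open>p = f w\<close>, hence
  \<open>t = 0\<close>.\<close>

lemma spr_sqI:
  assumes P: "\<And>y. y \<in> J \<Longrightarrow> sq z a b x (P y)" and s: "spr P0 P1 f g T" and T: "T \<in> mods" shows "sqI z a b T"
  unfolding sqI_def
proof (intro ballI impI)
  note s' = sprD[OF s]
  note m0 = proj_mods[OF s'(1)] and m1 = proj_mods[OF s'(2)]
  have q0: "sqI z a b P0" and q1: "sqX z a b x P1" using sq_proj[OF P] s' unfolding sq_def by blast+
  fix t assume t: "t \<in> Tv T z" and e: "al T z a t = 0\<^sub>v (fst T) \<and> al T z b t = 0\<^sub>v (fst T)"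
  obtain u where u: "u \<in> vs P0" "g u = t" using s'(6)[OF Tv_vs[OF t]] by blast
  obtain p where p: "p \<in> Tv P0 z" "g p = t" using Tv_lift[OF s'(4) m0 J(1) t u] by blast
  note pv = Tv_vs[OF p(1)]
  have ex: "\<exists>q\<in>Tv P1 c. f q = al P0 z c p" if c: "c \<in> J" "RL z c" "al T z c t = 0\<^sub>v (fst T)" for c
  proof -
    have "g (al P0 z c p) = 0\<^sub>v (fst T)" using lh_al[OF s'(4) J(1) c(1,2) pv] p(2) c(3) by simp
    then obtain u where "u \<in> vs P1" "f u = al P0 z c p" using s'(7)[OF al_closed[OF m0 J(1) c(1,2) pv]] by blast
    then show ?thesis using Tv_lift[OF s'(3) m1 c(1) al_Tv[OF m0 J(1) c(1,2) pv]] by blast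
  qed
  obtain q1 where q1': "q1 \<in> Tv P1 a" "f q1 = al P0 z a p" using ex[OF J(2) r(1)] e by blast
  obtain q2 where q2: "q2 \<in> Tv P1 b" "f q2 = al P0 z b p" "a = b \<Longrightarrow> q1 = q2"
    using ex[OF J(3) r(2)] e q1' by (cases "a = b") auto
  note qv = Tv_vs[OF q1'(1)] Tv_vs[OF q2(1)]
  have finj: "u = w" if "u \<in> vs P1" "w \<in> vs P1" "f u = f w" for u w
  proof -
    have "f (u - w) = 0\<^sub>v (fst P0)" using lh_minus[OF s'(3) that(1,2)] that(3) minus_cancel_vec[OF lh_closed[OF s'(3) that(2)]] by simp
    then have "u - w = 0\<^sub>v (fst P1)" using s'(5)[of "u - w"] that by simp
    then show ?thesis using vec_diff_zero that by blast
  qed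
  have A1: "f (al P1 a x q1) = (if RL z x then al P0 z x p else 0\<^sub>v (fst P0))"
    using lh_al[OF s'(3) J(2,4) r(3) qv(1)] q1'(2) al_comp[OF m0 J(1,2,4) r(1,3) pv] by simp
  have A2: "f (al P1 b x q2) = (if RL z x then al P0 z x p else 0\<^sub>v (fst P0))"
    using lh_al[OF s'(3) J(3,4) r(4) qv(2)] q2(2) al_comp[OF m0 J(1,3,4) r(2,4) pv] by simp
  have "al P1 a x q1 = (if RL z x then al P1 b x q2 else 0\<^sub>v (fst P1))"
    by (rule finj[OF al_closed[OF m1 J(2,4) r(3) qv(1)]]) (use A1 A2 al_closed[OF m1 J(3,4) r(4) qv(2)] lh_zero[OF s'(3)] in auto)
  then obtain w where w: "w \<in> Tv P1 z" "al P1 z a w = q1" "al P1 z b w = q2"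
    using q1 q1'(1) q2 unfolding sqX_def by blast
  note wv = Tv_vs[OF w(1)]
  have fw: "f w \<in> Tv P0 z" by (rule lh_Tv[OF s'(3) J(1) w(1)])
  have eq: "p - f w = p + (-1) \<cdot>\<^sub>v f w" by (rule diff_as_add[OF pv Tv_vs[OF fw]])
  have d: "p - f w \<in> Tv P0 z" unfolding eq using Tv_subsp[OF m0 J(1)] p(1) fw unfolding subsp_def by blast
  have "al P0 z a (p - f w) = 0\<^sub>v (fst P0)"
    using lin_minus[OF al_lin[OF m0 J(1,2) r(1)] pv Tv_vs[OF fw]] lh_al[OF s'(3) J(1,2) r(1) wv] w(2) q1'(2) minus_cancel_vec[OF al_closed[OF m0 J(1,2) r(1) pv]] by simp
  moreover have "al P0 z b (p - f w) = 0\<^sub>v (fst P0)"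
    using lin_minus[OF al_lin[OF m0 J(1,3) r(2)] pv Tv_vs[OF fw]] lh_al[OF s'(3) J(1,3) r(2) wv] w(3) q2(2) minus_cancel_vec[OF al_closed[OF m0 J(1,3) r(2) pv]] by simp
  ultimately have "p - f w = 0\<^sub>v (fst P0)" using q0 d unfolding sqI_def by blast
  then have "p = f w" using vec_diff_zero pv Tv_vs[OF fw] by blast
  then show "t = 0\<^sub>v (fst T)" using p(2) s'(7)[OF pv] wv by auto
qed

end

section \<open>Presentations of cokernels of inclusions\<close>

definition can where "can A B v = mk B (\<lambda>c. if lab c \<in> A then cd A c v else 0)"

lemma cd_can: "c \<in> sc B \<Longrightarrow> cd B c (can A B v) = (if lab c \<in> A then cd A c v else 0)"
  by (simp add: can_def)

lemma sc_mono: "c \<in> sc B \<Longrightarrow> lab c \<in> A \<Longrightarrow> c \<in> sc A" by (simp add: sc_iff)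

text \<open>\<open>can\<close> is the identity on common labels and zero elsewhere. By
  \<open>h\<close> a structure map from a label of \<open>A\<close> to a label of \<open>B\<close>
  is seen on both sides or on neither, which is commutation.\<close>

lemma lh_can:
  assumes A: "A \<subseteq> J" "tconv A" and B: "B \<subseteq> J" "tconv B"
    and h: "\<And>i j. i \<in> A \<Longrightarrow> j \<in> B \<Longrightarrow> RL i j \<Longrightarrow> j \<in> A \<longleftrightarrow> i \<in> B"
  shows "lh I (th A) (th B) (can A B)"
proof (rule lh_ext[OF th_mods[OF A] th_mods[OF B]])
  show l: "lin (fst (th A)) (fst (th B)) (can A B)"
  proof (rule linI)
    fix v w :: "'k vec" and k assume v: "v \<in> vs (th A)"
    show c: "can A B v \<in> vs (th B)" for v by (simp add: can_def)
    { assume w: "w \<in> vs (th A)"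
      show "can A B (v + w) = can A B v + can A B w"
        by (rule cd_eqI[where A=B]) (use c v w in \<open>auto simp: cd_can cd_add[of _ B] cd_add[of _ A] dest: sc_mono\<close>) }
    show "can A B (k \<cdot>\<^sub>v v) = k \<cdot>\<^sub>v can A B v"
      by (rule cd_eqI[where A=B]) (use c v in \<open>auto simp: cd_can cd_smult[of _ B] cd_smult[of _ A] dest: sc_mono\<close>)
  qed
  fix x y v assume r: "R x y" and v: "v \<in> vs (th A)"
  note cv = lin_closed[OF l v]
  note av = ac_closed[OF th_mods[OF A] r v]
  show "can A B (ac (th A) x y v) = ac (th B) x y (can A B v)"
  proof (rule cd_eqI[where A=B])
    show "can A B (ac (th A) x y v) \<in> carrier_vec (card (sc B))" using lin_closed[OF l av] by simp
    show "ac (th B) x y (can A B v) \<in> carrier_vec (card (sc B))" using ac_closed[OF th_mods[OF B] r cv] by simp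
    fix c assume c: "c \<in> sc B"
    have xy: "x \<in> C" "y \<in> C" "RL (lab x) (lab y)" using r by (auto simp: R_def)
    have 1: "cd B c (can A B (ac (th A) x y v)) = (if lab c \<in> A \<and> c = y \<and> x \<in> sc A then cd A x v else 0)"
      using cd_can[OF c] th_ac[OF r v, of c] c by (auto simp: sc_iff)
    have 2: "cd B c (ac (th B) x y (can A B v)) = (if c = y \<and> x \<in> sc B \<and> lab x \<in> A then cd A x v else 0)"
      using th_ac[OF r cv c] cd_can[of x B A v] by auto
    show "cd B c (can A B (ac (th A) x y v)) = cd B c (ac (th B) x y (can A B v))"
      unfolding 1 2 using h[of "lab x" "lab y"] xy c by (auto simp: sc_iff)
  qed
qed

lemma can_vs: "can A B v \<in> vs (th B)" by (simp add: can_def)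

lemma can_bs: "c \<in> sc A \<Longrightarrow> can A B (bs A c) = (if c \<in> sc B then bs B c else 0\<^sub>v (card (sc B)))"
  by (rule cd_eqI[where A=B]) (auto simp: can_vs[simplified] cd_can cd_zero sc_iff)

lemma PP_sub_lh:
  assumes x: "x \<in> J" and y: "y \<in> J" and r: "RL x y" and B: "B \<subseteq> PP x" "tconv B" and hB: "\<And>i. i \<in> PP y \<Longrightarrow> i \<in> PP x \<Longrightarrow> i \<in> B"
  shows "lh I (P y) (th B) (can (PP y) B)"
proof (rule lh_can)
  show "PP y \<subseteq> J" "tconv (PP y)" using PP_good[OF y] by (auto simp: good_def)
  show "B \<subseteq> J" "tconv B" using B by (auto simp: PP_def)
  show "j \<in> PP y \<longleftrightarrow> i \<in> B" if "i \<in> PP y" "j \<in> B" "RL i j" for i j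
    using RL_assoc[OF x y, of i j] that r B hB by (auto simp: PP_def)
qed

text \<open>For a presentation \<open>0 \<rightarrow> P y \<rightarrow> P0 \<rightarrow> U \<rightarrow> 0\<close>, this is the vanishing of the first extension group of \<open>U\<close> by \<open>T\<close>.\<close>

definition xs where "xs f P0 y T \<longleftrightarrow> (\<forall>t\<in>Tv T y. \<exists>\<psi>. lh I P0 T \<psi> \<and> \<psi> (f (bs (PP y) (rp y))) = t)"

lemma prs_xs:
  assumes s: "spr P0 (P y) f g U" and y: "y \<in> J" and x: "xs f P0 y T" shows "prs U T"
proof (rule prsI[OF s])
  note s' = sprD[OF s]
  fix \<eta> assume e: "lh I (P y) T \<eta>"
  obtain \<psi> where p: "lh I P0 T \<psi>" "\<psi> (f (bs (PP y) (rp y))) = \<eta> (bs (PP y) (rp y))"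
    using x lh_Tv[OF e y bsP_Tv[OF y]] unfolding xs_def by blast
  then show "\<exists>\<psi>. lh I P0 T \<psi> \<and> (\<forall>u\<in>vs (P y). \<eta> u = \<psi> (f u))"
    using yoneda_unique[OF y e lh_comp[OF s'(3) p(1)]] by auto
qed

lemma ext_xs:
  assumes X: "X \<in> mods" and T: "T \<in> mods" and U: "U \<in> mods" and r: "ret I U X" and ext: "ext_vanish mods I 1 X T"
    and s: "spr P0 (P y) f g U" and y: "y \<in> J" shows "xs f P0 y T"
  unfolding xs_def
proof
  note s' = sprD[OF s]
  fix t assume t: "t \<in> Tv T y"
  obtain \<eta> where e: "lh I (P y) T \<eta>" "\<eta> (bs (PP y) (rp y)) = t" using yoneda[OF T y t] .
  obtain \<psi> where p: "lh I P0 T \<psi>" "\<And>u. u \<in> vs (P y) \<Longrightarrow> \<eta> u = \<psi> (f u)"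
    by (rule ext_vanish_presentation[OF X T U r ext y s'(1,3,4,5,6,7) e(1)]) blast+
  then show "\<exists>\<psi>. lh I P0 T \<psi> \<and> \<psi> (f (bs (PP y) (rp y))) = t" using e(2) Tv_vs[OF bsP_Tv[OF y]] by metis
qed

lemma xs_ret: assumes y: "y \<in> J" and T: "xs f P0 y T" and r: "ret I Z T" shows "xs f P0 y Z"
  unfolding xs_def
proof
  obtain a b where a: "lh I Z T a" and b: "lh I T Z b" and ba: "\<And>v. v \<in> vs Z \<Longrightarrow> b (a v) = v" using r by (rule retE) blast
  fix t assume t: "t \<in> Tv Z y"
  obtain \<psi> where p: "lh I P0 T \<psi>" "\<psi> (f (bs (PP y) (rp y))) = a t" using T lh_Tv[OF a y t] unfolding xs_def by blast
  then show "\<exists>\<psi>. lh I P0 Z \<psi> \<and> \<psi> (f (bs (PP y) (rp y))) = t"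
    using lh_comp[OF p(1) b] ba[OF Tv_vs[OF t]] by auto
qed

lemma xs_dsum: assumes y: "y \<in> J" and X: "X \<in> mods" "xs f P0 y X" and Y: "Y \<in> mods" "xs f P0 y Y" shows "xs f P0 y (dsum X Y)"
  unfolding xs_def
proof
  note w = mods_wfm[OF X(1)] mods_wfm[OF Y(1)]
  let ?b = "f (bs (PP y) (rp y))"
  fix t assume t: "t \<in> Tv (dsum X Y) y"
  obtain \<psi> where p: "lh I P0 X \<psi>" "\<psi> ?b = p1 X Y t" using X(2) lh_Tv[OF lh_p1[OF w] y t] unfolding xs_def by blast
  obtain \<psi>' where p': "lh I P0 Y \<psi>'" "\<psi>' ?b = p2 X Y t" using Y(2) lh_Tv[OF lh_p2[OF w] y t] unfolding xs_def by blast
  have "prd X Y \<psi> \<psi>' ?b = t" using p(2) p'(2) i_p[OF Tv_vs[OF t]] by (simp add: prd_def)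
  then show "\<exists>\<psi>. lh I P0 (dsum X Y) \<psi> \<and> \<psi> ?b = t" using lh_prd[OF w p(1) p'(1)] by blast
qed

lemma xs_zmod: "y \<in> J \<Longrightarrow> xs f P0 y zmod"
proof -
  have e: "v = 0\<^sub>v 0" if "v \<in> carrier_vec 0" for v :: "'k vec" using that by (intro vec0_eq) auto
  show ?thesis unfolding xs_def using e Tv_vs lh_const0[OF wfm_zmod, of I P0] by fastforce
qed

lemma xs_dsl:
  assumes "y \<in> J" and "\<And>A. A \<in> set As \<Longrightarrow> good A" shows "xs f P0 y (dsl As) \<longleftrightarrow> (\<forall>A\<in>set As. xs f P0 y (th A))"
proof
  assume "xs f P0 y (dsl As)"
  then show "\<forall>A\<in>set As. xs f P0 y (th A)" using xs_ret[OF assms(1)] dsl_ret by blast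
next
  assume "\<forall>A\<in>set As. xs f P0 y (th A)"
  then show "xs f P0 y (dsl As)" using assms(2)
  proof (induction As)
    case (Cons A As) then show ?case using xs_dsum[OF assms(1) good_mods _ dsl_mods] by simp
  qed (simp add: xs_zmod assms(1))
qed

text \<open>On supports the projective module at \<open>y\<close> is a submodule of the one at
  \<open>x\<close>, and the quotient is thin on the difference; all maps are restrictions or
  extensions of coordinates.\<close>

lemma spr_coker:
  assumes x: "x \<in> J" and y: "y \<in> J" and sub: "PP y \<subseteq> PP x" and tc: "tconv (PP x - PP y)"
  shows "spr (P x) (P y) (can (PP y) (PP x)) (can (PP x) (PP x - PP y)) (th (PP x - PP y))"
proof (rule sprI[OF P_proj[OF x] P_proj[OF y]])
  let ?B = "PP x - PP y"
  have r: "RL x y" using sub PP_self[OF y] by (auto simp: PP_def)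
  have tx: "PP x \<subseteq> J" "tconv (PP x)" using PP_good[OF x] by (auto simp: good_def)
  show f: "lh I (P y) (P x) (can (PP y) (PP x))" by (rule PP_sub_lh[OF x y r]) (use tx in auto)
  show "lh I (P x) (th ?B) (can (PP x) ?B)"
  proof (rule lh_can[OF tx _ tc])
    show "j \<in> PP x \<longleftrightarrow> i \<in> ?B" if h: "i \<in> PP x" "j \<in> ?B" "RL i j" for i j
      using RL_assoc[OF x y, of i j] h r by (auto simp: PP_def)
  qed (use tx in auto)
  show "u = 0\<^sub>v (fst (P y))" if u: "u \<in> vs (P y)" and z: "can (PP y) (PP x) u = 0\<^sub>v (fst (P x))" for u
  proof (rule cd_eqI[where A="PP y"])
    fix c assume c: "c \<in> sc (PP y)"
    then have c': "c \<in> sc (PP x)" "lab c \<in> PP y" using sub by (auto simp: sc_iff)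
    show "cd (PP y) c u = cd (PP y) c (0\<^sub>v (fst (P y)))" using cd_can[OF c'(1), of "PP y" u] c' z by (simp add: cd_zero[OF c] cd_zero[OF c'(1)])
  qed (use u in auto)
  show "\<exists>u\<in>vs (P x). can (PP x) ?B u = v" if v: "v \<in> vs (th ?B)" for v
  proof (intro bexI[of _ "can ?B (PP x) v"] cd_eqI[where A="?B"])
    fix c assume c: "c \<in> sc ?B"
    then have c': "c \<in> sc (PP x)" "lab c \<in> PP x" "lab c \<in> ?B" by (auto simp: sc_iff)
    show "cd ?B c (can (PP x) ?B (can ?B (PP x) v)) = cd ?B c v" using cd_can[OF c] cd_can[OF c'(1)] c' by simp
  qed (use v can_vs in auto)
  show "can (PP x) ?B v = 0\<^sub>v (fst (th ?B)) \<longleftrightarrow> (\<exists>u\<in>vs (P y). can (PP y) (PP x) u = v)" if v: "v \<in> vs (P x)" for v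
  proof
    assume "\<exists>u\<in>vs (P y). can (PP y) (PP x) u = v"
    then obtain u where u: "v = can (PP y) (PP x) u" by blast
    show "can (PP x) ?B v = 0\<^sub>v (fst (th ?B))"
    proof (rule cd_eqI[where A="?B"])
      fix c assume c: "c \<in> sc ?B"
      then have c': "c \<in> sc (PP x)" "lab c \<notin> PP y" by (auto simp: sc_iff)
      show "cd ?B c (can (PP x) ?B v) = cd ?B c (0\<^sub>v (fst (th ?B)))" using cd_can[OF c] cd_can[OF c'(1)] c' u by (simp add: cd_zero[OF c])
    qed (use can_vs in auto)
  next
    assume e: "can (PP x) ?B v = 0\<^sub>v (fst (th ?B))"
    show "\<exists>u\<in>vs (P y). can (PP y) (PP x) u = v"
    proof (intro bexI[of _ "can (PP x) (PP y) v"] cd_eqI[where A="PP x"])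
      fix c assume c: "c \<in> sc (PP x)"
      have c0: "lab c \<in> PP x" "c \<in> C" using c by (auto simp: sc_iff)
      show "cd (PP x) c (can (PP y) (PP x) (can (PP x) (PP y) v)) = cd (PP x) c v"
      proof (cases "lab c \<in> PP y")
        case True
        then have "c \<in> sc (PP y)" using c by (auto simp: sc_iff)
        then show ?thesis using cd_can[OF c] cd_can[of c "PP y"] True c0 by simp
      next
        case False
        then have cB: "c \<in> sc ?B" using c by (auto simp: sc_iff)
        then show ?thesis using cd_can[OF c] False cd_can[OF cB, of "PP x" v] e c0 by (simp add: cd_zero[OF cB])
      qed
    qed (use v can_vs in auto)
  qed
qed

text \<open>A map from \<open>P y\<close> to \<open>th A\<close> is a vector at \<open>y\<close>,
  and it extends to \<open>P x\<close> iff this vector comes from \<open>x\<close> under the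
  structure map. In a thin module that map is the identity when both labels are present.\<close>

lemma xs_coker:
  assumes x: "x \<in> J" and y: "y \<in> J" and sub: "PP y \<subseteq> PP x" and A: "A \<subseteq> J" "tconv A"
  shows "xs (can (PP y) (PP x)) (P x) y (th A) \<longleftrightarrow> (y \<in> A \<longrightarrow> x \<in> A)"
proof -
  let ?f = "can (PP y) (PP x)" and ?b = "bs (PP x) (rp x)"
  note m = th_mods[OF A]
  have r: "RL x y" "y \<in> PP x" using sub PP_self[OF y] by (auto simp: PP_def)
  have fb: "?f (bs (PP y) (rp y)) = al (P x) x y ?b"
    using can_bs[of "rp y" "PP y" "PP x"] al_bs[OF x y r(1) PP_self[OF x]] r(2) PP_self[OF y] x y by simp
  have bv: "?b \<in> vs (P x)" by simp
  show ?thesis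
  proof
    assume xs: "xs ?f (P x) y (th A)"
    show "y \<in> A \<longrightarrow> x \<in> A"
    proof
      assume yA: "y \<in> A"
      obtain \<psi> where p: "lh I (P x) (th A) \<psi>" "\<psi> (?f (bs (PP y) (rp y))) = bs A (rp y)" using xs bs_Tv[OF y yA] unfolding xs_def by blast
      have "al (th A) x y (\<psi> ?b) = bs A (rp y)" using lh_al[OF p(1) x y r(1) bv] p(2) fb by simp
      then have "(if x \<in> A then cd A (rp x) (\<psi> ?b) else 0) = 1"
        using cd_al[OF x y r(1) yA lh_closed[OF p(1) bv]] yA y by simp
      then show "x \<in> A" by (metis zero_neq_one)
    qed
  next
    assume h: "y \<in> A \<longrightarrow> x \<in> A"
    show "xs ?f (P x) y (th A)" unfolding xs_def
    proof
      fix t assume t: "t \<in> Tv (th A) y"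
      let ?s = "if y \<in> A then cd A (rp y) t \<cdot>\<^sub>v bs A (rp x) else 0\<^sub>v (fst (th A))"
      have s: "?s \<in> Tv (th A) x" using h bs_Tv[OF x, of A] Tv_zero[OF m x] Tv_subsp[OF m x] unfolding subsp_def by auto
      obtain \<psi> where p: "lh I (P x) (th A) \<psi>" "\<psi> ?b = ?s" using yoneda[OF m x s] .
      have "\<psi> (?f (bs (PP y) (rp y))) = t"
        unfolding fb lh_al[OF p(1) x y r(1) bv] p(2)
      proof (rule Tv_th_eqI[OF y al_Tv[OF m x y r(1) Tv_vs[OF s]] t])
        assume yA: "y \<in> A"
        show "cd A (rp y) (al (th A) x y ?s) = cd A (rp y) t"
          unfolding cd_al[OF x y r(1) yA Tv_vs[OF s]] using h yA x cd_smult[of "rp x" A "bs A (rp x)"] by simp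
      qed
      then show "\<exists>\<psi>. lh I (P x) (th A) \<psi> \<and> \<psi> (?f (bs (PP y) (rp y))) = t" using p(1) by blast
    qed
  qed
qed

section \<open>Presentation of a union of two projective submodules\<close>

context
  fixes a b c d B
  assumes J: "a \<in> J" "b \<in> J" "c \<in> J" "d \<in> J" and r: "RL d b" "RL d c"
    and cap: "PP b \<inter> PP c = PP a" and B: "B = PP b \<union> PP c" and Bd: "B \<subseteq> PP d" and tB: "tconv B"
begin

text \<open>The first map of the Mayer-Vietoris sequence \<open>0 \<rightarrow> P a \<rightarrow> P
  b \<oplus> P c \<rightarrow> th B \<rightarrow> 0\<close> of two submodules with intersection
  \<open>P a\<close> and union \<open>B\<close>; the sign makes its composite with \<open>rg\<close>
  zero.\<close>

definition rf where "rf = prd (P b) (P c) (can (PP a) (PP b)) (\<lambda>u. (-1) \<cdot>\<^sub>v can (PP a) (PP c) u)"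
definition rg where "rg = cop (P b) (P c) (can (PP b) B) (can (PP c) B)"

lemma ba: "RL b a" "RL c a" "PP a \<subseteq> PP b" "PP a \<subseteq> PP c"
  using cap PP_self[OF J(1)] by (auto simp: PP_def)

lemma rf_lh: "lh I (P a) (dsum (P b) (P c)) rf"
  unfolding rf_def
proof (rule lh_prd[OF th_wfm th_wfm _ lh_scale[OF th_wfm]])
  show "lh I (P a) (P b) (can (PP a) (PP b))"
    by (rule PP_sub_lh[OF J(2,1) ba(1) subset_refl]) (use PP_good[OF J(2)] in \<open>auto simp: good_def\<close>)
  show "lh I (P a) (P c) (can (PP a) (PP c))"
    by (rule PP_sub_lh[OF J(3,1) ba(2) subset_refl]) (use PP_good[OF J(3)] in \<open>auto simp: good_def\<close>)
qed

lemma rg_lh: "lh I (dsum (P b) (P c)) (th B) rg"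
  unfolding rg_def
proof (rule lh_cop[OF th_wfm th_wfm th_wfm])
  show "lh I (P b) (th B) (can (PP b) B)" by (rule PP_sub_lh[OF J(4,2) r(1) Bd tB]) (use B in auto)
  show "lh I (P c) (th B) (can (PP c) B)" by (rule PP_sub_lh[OF J(4,3) r(2) Bd tB]) (use B in auto)
qed

lemma rf_p: "p1 (P b) (P c) (rf u) = can (PP a) (PP b) u" "p2 (P b) (P c) (rf u) = (-1) \<cdot>\<^sub>v can (PP a) (PP c) u"
  unfolding rf_def using can_vs[of "PP a"] by (subst p_prd; simp)+

lemma cd_rg: "k \<in> sc B \<Longrightarrow> cd B k (rg v) = (if lab k \<in> PP b then cd (PP b) k (p1 (P b) (P c) v) else 0) + (if lab k \<in> PP c then cd (PP c) k (p2 (P b) (P c) v) else 0)"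
  unfolding rg_def cop_def using can_vs[of _ B] by (subst cd_add) (auto simp: cd_can)

lemma spr_rad: "spr (dsum (P b) (P c)) (P a) rf rg (th B)"
proof (rule sprI[OF proj_dsum[OF P_proj[OF J(2)] P_proj[OF J(3)]] P_proj[OF J(1)] rf_lh rg_lh])
  let ?D = "dsum (P b) (P c)"
  have pz: "p1 (P b) (P c) (0\<^sub>v (fst ?D)) = 0\<^sub>v (fst (P b))" "p2 (P b) (P c) (0\<^sub>v (fst ?D)) = 0\<^sub>v (fst (P c))"
    using lh_zero[OF lh_p1[OF th_wfm th_wfm]] lh_zero[OF lh_p2[OF th_wfm th_wfm]] by auto
  show "u = 0\<^sub>v (fst (P a))" if u: "u \<in> vs (P a)" and z: "rf u = 0\<^sub>v (fst ?D)" for u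
  proof (rule cd_eqI[where A="PP a"])
    fix k assume k: "k \<in> sc (PP a)"
    then have k': "k \<in> sc (PP b)" "lab k \<in> PP a" using ba by (auto simp: sc_iff)
    have "can (PP a) (PP b) u = 0\<^sub>v (fst (P b))" using rf_p(1)[of u] z pz by simp
    then show "cd (PP a) k u = cd (PP a) k (0\<^sub>v (fst (P a)))" using cd_can[OF k'(1), of "PP a" u] k' by (simp add: cd_zero[OF k] cd_zero[OF k'(1)])
  qed (use u in auto)
  show "\<exists>u\<in>vs ?D. rg u = v" if v: "v \<in> vs (th B)" for v
  proof -
    \<comment> \<open>Coordinates shared by both submodules are lifted to \<open>P b\<close>, only
      the others to \<open>P c\<close>, so that none is counted twice.\<close>
    let ?q = "mk (PP c) (\<lambda>k. if lab k \<in> PP b then 0 else cd B k v)"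
    let ?u = "prd (P b) (P c) (\<lambda>v. can B (PP b) v) (\<lambda>v. ?q) v"
    have p: "p1 (P b) (P c) ?u = can B (PP b) v" "p2 (P b) (P c) ?u = ?q" using can_vs[of B "PP b"] by (subst p_prd; simp)+
    have "rg ?u = v"
    proof (rule cd_eqI[where A=B])
      fix k assume k: "k \<in> sc B"
      then have kB: "lab k \<in> B" "k \<in> C" by (auto simp: sc_iff)
      have s: "lab k \<in> PP b \<Longrightarrow> k \<in> sc (PP b)" "lab k \<in> PP c \<Longrightarrow> k \<in> sc (PP c)" using kB by (auto simp: sc_iff)
      show "cd B k (rg ?u) = cd B k v"
        unfolding cd_rg[OF k] p using kB s cd_can[of k "PP b" B v] cd_mk[of k "PP c"] B by auto
    qed (use v lh_closed[OF rg_lh] prd_carrier[of "\<lambda>v. can B (PP b) v" v "P b" "\<lambda>v. ?q" "P c"] can_vs[of B "PP b"] in auto)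
    then show ?thesis using prd_carrier[of "\<lambda>v. can B (PP b) v" v "P b" "\<lambda>v. ?q" "P c"] can_vs[of B "PP b"] by (intro bexI[of _ ?u]) auto
  qed
  show "rg v = 0\<^sub>v (fst (th B)) \<longleftrightarrow> (\<exists>u\<in>vs (P a). rf u = v)" if v: "v \<in> vs ?D" for v
  proof
    assume "\<exists>u\<in>vs (P a). rf u = v"
    then obtain u where u: "u \<in> vs (P a)" "rf u = v" by blast
    show "rg v = 0\<^sub>v (fst (th B))"
    proof (rule cd_eqI[where A=B])
      fix k assume k: "k \<in> sc B"
      then have kB: "lab k \<in> B" "k \<in> C" by (auto simp: sc_iff)
      have s: "lab k \<in> PP b \<Longrightarrow> k \<in> sc (PP b)" "lab k \<in> PP c \<Longrightarrow> k \<in> sc (PP c)" using kB by (auto simp: sc_iff)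
      have pp: "lab k \<in> PP a \<longleftrightarrow> lab k \<in> PP b \<and> lab k \<in> PP c" using cap by auto
      have 1: "lab k \<in> PP b \<Longrightarrow> cd (PP b) k (p1 (P b) (P c) v) = (if lab k \<in> PP a then cd (PP a) k u else 0)"
        using rf_p(1)[of u] u(2) cd_can[OF s(1)] by simp
      have 2: "lab k \<in> PP c \<Longrightarrow> cd (PP c) k (p2 (P b) (P c) v) = - (if lab k \<in> PP a then cd (PP a) k u else 0)"
        using rf_p(2)[of u] u(2) cd_can[OF s(2)] cd_smult[OF s(2), of "can (PP a) (PP c) u" "-1"] can_vs[of "PP a" "PP c" u] by simp
      show "cd B k (rg v) = cd B k (0\<^sub>v (fst (th B)))"
        unfolding cd_rg[OF k] using 1 2 pp cd_zero[OF k] by auto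
    qed (use lh_closed[OF rg_lh v] in auto)
  next
    assume z: "rg v = 0\<^sub>v (fst (th B))"
    let ?u = "can (PP b) (PP a) (p1 (P b) (P c) v)"
    have cz: "(if lab k \<in> PP b then cd (PP b) k (p1 (P b) (P c) v) else 0) + (if lab k \<in> PP c then cd (PP c) k (p2 (P b) (P c) v) else 0) = 0" if "k \<in> sc B" for k
      using cd_rg[OF that, of v] z cd_zero[OF that] by simp
    have "rf ?u = v"
    proof (rule dsum_eqI[OF lh_closed[OF rf_lh] v])
      show "?u \<in> vs (P a)" by (rule can_vs)
      show "p1 (P b) (P c) (rf ?u) = p1 (P b) (P c) v"
        unfolding rf_p
      proof (rule cd_eqI[where A="PP b"])
        fix k assume k: "k \<in> sc (PP b)"
        then have kb: "lab k \<in> PP b" "k \<in> sc B" "k \<in> C" using B by (auto simp: sc_iff)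
        show "cd (PP b) k (can (PP a) (PP b) ?u) = cd (PP b) k (p1 (P b) (P c) v)"
        proof (cases "lab k \<in> PP a")
          case True
          then have "k \<in> sc (PP a)" using kb by (auto simp: sc_iff)
          then show ?thesis using cd_can[OF k] cd_can[of k "PP a"] True kb by simp
        next
          case False
          then have "lab k \<notin> PP c" using cap kb by auto
          then show ?thesis using cd_can[OF k] False cz[OF kb(2)] kb by simp
        qed
      qed (use can_vs[of _ "PP b"] p12_carrier(1)[of "P b" "P c" v] in auto)
      show "p2 (P b) (P c) (rf ?u) = p2 (P b) (P c) v"
        unfolding rf_p
      proof (rule cd_eqI[where A="PP c"])
        fix k assume k: "k \<in> sc (PP c)"
        then have kc: "lab k \<in> PP c" "k \<in> sc B" "k \<in> C" using B by (auto simp: sc_iff)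
        have e: "cd (PP c) k ((-1) \<cdot>\<^sub>v can (PP a) (PP c) ?u) = - (if lab k \<in> PP a then cd (PP a) k ?u else 0)"
          using cd_can[OF k] cd_smult[OF k, of "can (PP a) (PP c) ?u" "-1"] can_vs[of "PP a" "PP c" ?u] by simp
        show "cd (PP c) k ((-1) \<cdot>\<^sub>v can (PP a) (PP c) ?u) = cd (PP c) k (p2 (P b) (P c) v)"
        proof (cases "lab k \<in> PP a")
          case True
          then have "k \<in> sc (PP a)" "lab k \<in> PP b" using kc cap by (auto simp: sc_iff)
          then show ?thesis unfolding e using cd_can[of k "PP a"] True kc cz[OF kc(2)] by (simp add: neg_eq_iff_add_eq_0)
        next
          case False
          then have "lab k \<notin> PP b" using cap kc by auto
          then show ?thesis unfolding e using False cz[OF kc(2)] kc by simp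
        qed
      qed (use can_vs[of _ "PP c"] p12_carrier(2)[of "P b" "P c" v] in auto)
    qed
    then show "\<exists>u\<in>vs (P a). rf u = v" using can_vs by blast
  qed
qed

text \<open>Here a vector at \<open>a\<close> has to be a difference of images from \<open>b\<close>
  and \<open>c\<close>, for which one of the two labels suffices; the construction uses
  \<open>b\<close> if it is present and \<open>c\<close> otherwise.\<close>

lemma xs_rad:
  assumes A: "A \<subseteq> J" "tconv A"
  shows "xs rf (dsum (P b) (P c)) a (th A) \<longleftrightarrow> (a \<in> A \<longrightarrow> b \<in> A \<or> c \<in> A)"
proof -
  let ?D = "dsum (P b) (P c)" and ?bb = "bs (PP b) (rp b)" and ?bc = "bs (PP c) (rp c)"
  note m = th_mods[OF A]
  note i = lh_i1[OF th_wfm th_wfm, of I "PP b" "PP c"] lh_i2[OF th_wfm th_wfm, of I "PP c" "PP b"]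
  have bv: "?bb \<in> vs (P b)" "?bc \<in> vs (P c)" by auto
  have av: "al (P b) b a ?bb \<in> vs (P b)" "al (P c) c a ?bc \<in> vs (P c)"
    using al_closed[OF P_mods[OF J(2)] J(2,1) ba(1) bv(1)] al_closed[OF P_mods[OF J(3)] J(3,1) ba(2) bv(2)] by auto
  have fb: "rf (bs (PP a) (rp a)) = i1 (P b) (P c) (al (P b) b a ?bb) + i2 (P b) (P c) ((-1) \<cdot>\<^sub>v al (P c) c a ?bc)"
    unfolding rf_def prd_def using can_bs[of "rp a" "PP a"] al_bs[OF J(2,1) ba(1) PP_self[OF J(2)]] al_bs[OF J(3,1) ba(2) PP_self[OF J(3)]] PP_self[OF J(1)] J ba(3,4) by auto
  have psi: "\<psi> (rf (bs (PP a) (rp a))) = al (th A) b a (\<psi> (i1 (P b) (P c) ?bb)) + (-1) \<cdot>\<^sub>v al (th A) c a (\<psi> (i2 (P b) (P c) ?bc))"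
    if p: "lh I ?D (th A) \<psi>" for \<psi>
  proof -
    note p1 = lh_comp[OF i(1) p] and p2 = lh_comp[OF i(2) p]
    have "\<psi> (rf (bs (PP a) (rp a))) = \<psi> (i1 (P b) (P c) (al (P b) b a ?bb)) + \<psi> (i2 (P b) (P c) ((-1) \<cdot>\<^sub>v al (P c) c a ?bc))"
      unfolding fb by (rule lh_add[OF p]) (use lh_closed[OF i(1) av(1)] lh_closed[OF i(2), of "(-1) \<cdot>\<^sub>v al (P c) c a ?bc"] av in auto)
    then show ?thesis using lh_al[OF p1 J(2,1) ba(1) bv(1)] lh_al[OF p2 J(3,1) ba(2) bv(2)] lh_smult[OF p2 av(2)] by simp
  qed
  show ?thesis
  proof
    assume xs: "xs rf ?D a (th A)"
    show "a \<in> A \<longrightarrow> b \<in> A \<or> c \<in> A"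
    proof
      assume aA: "a \<in> A"
      obtain \<psi> where p: "lh I ?D (th A) \<psi>" "\<psi> (rf (bs (PP a) (rp a))) = bs A (rp a)" using xs bs_Tv[OF J(1) aA] unfolding xs_def by blast
      note c1 = lh_closed[OF lh_comp[OF i(1) p(1)] bv(1)] and c2 = lh_closed[OF lh_comp[OF i(2) p(1)] bv(2)]
      note d1 = al_closed[OF m J(2,1) ba(1) c1] and d2 = al_closed[OF m J(3,1) ba(2) c2]
      have ra: "rp a \<in> sc A" using aA J by simp
      let ?\<alpha> = "al (th A) b a (\<psi> (i1 (P b) (P c) ?bb))" and ?\<beta> = "al (th A) c a (\<psi> (i2 (P b) (P c) ?bc))"
      have "cd A (rp a) (?\<alpha> + (-1) \<cdot>\<^sub>v ?\<beta>) = cd A (rp a) ?\<alpha> + (-1) * cd A (rp a) ?\<beta>"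
        using cd_add[OF ra, of ?\<alpha> "(-1) \<cdot>\<^sub>v ?\<beta>"] cd_smult[OF ra, of ?\<beta> "-1"] d1 d2 by simp
      moreover have "?\<alpha> + (-1) \<cdot>\<^sub>v ?\<beta> = bs A (rp a)" by (rule trans[OF psi[OF p(1), symmetric] p(2)])
      ultimately have "cd A (rp a) ?\<alpha> + (-1) * cd A (rp a) ?\<beta> = 1" using ra by simp
      then show "b \<in> A \<or> c \<in> A"
        using cd_al[OF J(2,1) ba(1) aA c1] cd_al[OF J(3,1) ba(2) aA c2] by (auto split: if_splits)
    qed
  next
    assume h: "a \<in> A \<longrightarrow> b \<in> A \<or> c \<in> A"
    have sc: "k \<cdot>\<^sub>v v \<in> Tv (th A) j" if "v \<in> Tv (th A) j" "j \<in> J" for k v j using that Tv_subsp[OF m that(2)] unfolding subsp_def by blast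
    show "xs rf ?D a (th A)" unfolding xs_def
    proof
      fix t assume t: "t \<in> Tv (th A) a"
      let ?s = "if b \<in> A then cd A (rp a) t \<cdot>\<^sub>v bs A (rp b) else 0\<^sub>v (fst (th A))"
      let ?r = "if b \<notin> A \<and> c \<in> A then (- cd A (rp a) t) \<cdot>\<^sub>v bs A (rp c) else 0\<^sub>v (fst (th A))"
      have s: "?s \<in> Tv (th A) b" using sc[OF bs_Tv[OF J(2), of A]] Tv_zero[OF m J(2)] J by auto
      have rr: "?r \<in> Tv (th A) c" using sc[OF bs_Tv[OF J(3), of A]] Tv_zero[OF m J(3)] J by auto
      obtain \<psi>1 where p1: "lh I (P b) (th A) \<psi>1" "\<psi>1 ?bb = ?s" using yoneda[OF m J(2) s] .
      obtain \<psi>2 where p2: "lh I (P c) (th A) \<psi>2" "\<psi>2 ?bc = ?r" using yoneda[OF m J(3) rr] .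
      note p = lh_cop[OF th_wfm th_wfm th_wfm p1(1) p2(1)]
      note sv = Tv_vs[OF s] and rv = Tv_vs[OF rr]
      have e: "cop (P b) (P c) \<psi>1 \<psi>2 (i1 (P b) (P c) ?bb) = ?s" "cop (P b) (P c) \<psi>1 \<psi>2 (i2 (P b) (P c) ?bc) = ?r"
        unfolding cop_def using p_i[OF bv(1)] p_i(3,4)[OF bv(2)] p1(2) p2(2) lh_zero[OF p1(1)] lh_zero[OF p2(1)] sv rv
        by (simp_all del: if_split)
      have "al (th A) b a ?s + (-1) \<cdot>\<^sub>v al (th A) c a ?r = t"
      proof (rule Tv_th_eqI[OF J(1) _ t])
        have "al (th A) b a ?s \<in> Tv (th A) a" "al (th A) c a ?r \<in> Tv (th A) a"
          using al_Tv[OF m J(2,1) ba(1) sv] al_Tv[OF m J(3,1) ba(2) rv] by auto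
        then show "al (th A) b a ?s + (-1) \<cdot>\<^sub>v al (th A) c a ?r \<in> Tv (th A) a" using sc[OF _ J(1)] Tv_subsp[OF m J(1)] unfolding subsp_def by blast
        assume aA: "a \<in> A"
        have ra: "rp a \<in> sc A" using aA J by simp
        have "cd A (rp a) (al (th A) b a ?s + (-1) \<cdot>\<^sub>v al (th A) c a ?r) = (if b \<in> A then cd A (rp b) ?s else 0) - (if c \<in> A then cd A (rp c) ?r else 0)"
          using cd_add[OF ra, of "al (th A) b a ?s" "(-1) \<cdot>\<^sub>v al (th A) c a ?r"] cd_smult[OF ra, of "al (th A) c a ?r" "-1"]
            al_closed[OF m J(2,1) ba(1) sv] al_closed[OF m J(3,1) ba(2) rv] cd_al[OF J(2,1) ba(1) aA sv] cd_al[OF J(3,1) ba(2) aA rv] by (simp del: if_split)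
        moreover have "b \<in> A \<Longrightarrow> cd A (rp b) ?s = cd A (rp a) t" using cd_smult[of "rp b" A "bs A (rp b)"] J by simp
        moreover have "c \<in> A \<Longrightarrow> cd A (rp c) ?r = (if b \<in> A then 0 else - cd A (rp a) t)" using cd_smult[of "rp c" A "bs A (rp c)"] cd_zero[of "rp c" A] J by simp
        ultimately show "cd A (rp a) (al (th A) b a ?s + (-1) \<cdot>\<^sub>v al (th A) c a ?r) = cd A (rp a) t" using h aA by (auto simp del: if_split split: if_splits)
      qed
      then have "cop (P b) (P c) \<psi>1 \<psi>2 (rf (bs (PP a) (rp a))) = t" using psi[OF p] e by (simp del: if_split)
      then show "\<exists>\<psi>. lh I ?D (th A) \<psi> \<and> \<psi> (rf (bs (PP a) (rp a))) = t" using p by blast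
    qed
  qed
qed

end

end

context gamma
begin

section \<open>Exactness of projective functors on the two families of sequences\<close>

lemma PP_Pa_Dv: "(u,v) \<in> Ar \<Longrightarrow> G.PP (Pa u v) \<subseteq> G.PP (Dv v)"
  using RG_Pa RG_Dv by (auto simp: PP_iff)

lemma PP_Sv_Pa: "(u,v) \<in> Ar \<Longrightarrow> G.PP (Sv v) \<subseteq> G.PP (Pa u v)"
  using RG_Pa by (auto simp: PP_iff)

lemma fkE: assumes "fk v" obtains u u' where "u \<noteq> u'" "(u,v) \<in> Ar" "(u',v) \<in> Ar" "\<forall>i. (i,v) \<in> Ar \<longleftrightarrow> i = u \<or> i = u'"
proof -
  obtain u u' where h: "u \<noteq> u'" "(u,v) \<in> Ar" "(u',v) \<in> Ar" using assms by (auto simp: fk_def)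
  have "(i,v) \<in> Ar \<longleftrightarrow> i = u \<or> i = u'" for i using Ar_indeg[OF h(2,3), of i] h by blast
  then show ?thesis using that h by blast
qed

text \<open>\<open>Hom(-, Y)\<close> for \<open>Y\<close> the module \<open>y\<close>, applied to
  the sequence with terms \<open>Sv v\<close>, \<open>Pa u v\<close>, \<open>Sv u\<close>. The
  middle term is a single module, so the degenerate form of the square is used.\<close>

lemma sq_arrow:
  assumes a: "(u,v) \<in> Ar" and y: "y \<in> JG" shows "G.sq (Sv u) (Pa u v) (Pa u v) (Sv v) (G.P y)"
proof -
  have J: "Sv u \<in> JG" "Pa u v \<in> JG" "Sv v \<in> JG" "u < v" using a Ar_V by auto
  have g: "G.PP y \<subseteq> JG" "G.tconv (G.PP y)" using G.PP_good[OF y] by (auto simp: G.good_def)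
  show ?thesis
  proof (rule G.sq_th[OF J(1,2,2,3) _ _ _ _ g])
    show "RG (Sv u) (Pa u v)" "RG (Sv u) (Pa u v)" "RG (Pa u v) (Sv v)" "RG (Pa u v) (Sv v)" by auto
    show "Pa u v \<in> G.PP y \<or> Pa u v \<in> G.PP y" if "Sv u \<in> G.PP y"
      using that RG_to_Pa[OF a y] J by (auto simp: PP_iff)
    have "Sv v \<in> G.PP y" if h: "Pa u v \<in> G.PP y" "Sv u \<notin> G.PP y"
      using that RG_to_Pa[OF a y] J by (auto simp: PP_iff)
    then show "Sv v \<in> G.PP y" if "Pa u v \<in> G.PP y" "Sv u \<notin> G.PP y \<or> Pa u v \<noteq> Pa u v \<and> Pa u v \<in> G.PP y" using that by blast
    then show "Sv v \<in> G.PP y" if "Pa u v \<in> G.PP y" "Sv u \<notin> G.PP y" using that by blast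
  qed (use J in auto)
qed

text \<open>\<open>Hom(-, Y)\<close> applied to the sequence ending in \<open>Dv v\<close>, whose
  middle term is the sum of the two modules given by the arrows into \<open>v\<close>.\<close>

lemma sq_fork:
  assumes a: "u \<noteq> u'" "(u,v) \<in> Ar" "(u',v) \<in> Ar" and y: "y \<in> JG" shows "G.sq (Dv v) (Pa u v) (Pa u' v) (Sv v) (G.P y)"
proof -
  have v: "fk v" using a by (auto simp: fk_def)
  have J: "Dv v \<in> JG" "Pa u v \<in> JG" "Pa u' v \<in> JG" "Sv v \<in> JG" using a v Ar_V by auto
  have g: "G.PP y \<subseteq> JG" "G.tconv (G.PP y)" using G.PP_good[OF y] by (auto simp: G.good_def)
  have pr: "(i,v) \<in> Ar \<longleftrightarrow> i = u \<or> i = u'" for i using Ar_indeg[OF a(2,3), of i] a by blast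
  have D: "Dv v \<in> G.PP y \<longleftrightarrow> y = Dv v \<or> RG y (Sv u) \<or> RG y (Sv u')" using RG_to_Dv[OF y, of v] J pr by (auto simp: PP_iff)
  have P: "Pa u v \<in> G.PP y \<longleftrightarrow> y = Pa u v \<or> RG y (Sv u) \<or> y = Dv v" "Pa u' v \<in> G.PP y \<longleftrightarrow> y = Pa u' v \<or> RG y (Sv u') \<or> y = Dv v"
    using RG_to_Pa[OF a(2) y] RG_to_Pa[OF a(3) y] J by (auto simp: PP_iff)
  have s: "Sv v \<in> G.PP y" if "y = Dv v \<or> y = Pa u v \<or> y = Pa u' v" using that J by (auto simp: PP_iff)
  \<comment> \<open>Every indecomposable \<open>y\<close> has a simple socle, so it receives
    non-zero maps from only one simple module.\<close>
  have no: "\<not> (RG y (Sv u) \<and> RG y (Sv u'))" "RG y (Sv u) \<Longrightarrow> y \<noteq> Pa u' v" "RG y (Sv u') \<Longrightarrow> y \<noteq> Pa u v" using a Ar_V(3)[OF a(2)] Ar_V(3)[OF a(3)] by (cases y; auto)+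
  show ?thesis
    by (rule G.sq_th[OF J _ _ _ _ g]) (use D P s no a in auto)
qed

lemma \<Phi>_sqI: "\<Phi> X \<longleftrightarrow> (\<forall>u v. (u,v) \<in> Ar \<longrightarrow> G.sqI (Sv u) (Pa u v) (Pa u v) X) \<and>
   (\<forall>v u u'. u \<noteq> u' \<and> (u,v) \<in> Ar \<and> (u',v) \<in> Ar \<longrightarrow> G.sqI (Dv v) (Pa u v) (Pa u' v) X)"
  by (simp add: \<Phi>_def G.sqI_def)

lemma JG_arrow: "(u,v) \<in> Ar \<Longrightarrow> Sv u \<in> JG" "(u,v) \<in> Ar \<Longrightarrow> Sv v \<in> JG" "(u,v) \<in> Ar \<Longrightarrow> Pa u v \<in> JG"
  "u \<noteq> u' \<Longrightarrow> (u,v) \<in> Ar \<Longrightarrow> (u',v) \<in> Ar \<Longrightarrow> Dv v \<in> JG"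
  using Ar_V by (auto simp: fk_def)

lemma \<Phi>_ret: assumes X: "\<Phi> X" and r: "ret S Z X" shows "\<Phi> Z"
  unfolding \<Phi>_sqI
proof (intro conjI allI impI)
  show "G.sqI (Sv u) (Pa u v) (Pa u v) Z" if "(u,v) \<in> Ar" for u v
    by (rule G.sqI_ret[of _ _ _ "Sv v" X]) (use JG_arrow(1,2,3)[OF that] X that r in \<open>auto simp: \<Phi>_sqI\<close>)
  show "G.sqI (Dv v) (Pa u v) (Pa u' v) Z" if "u \<noteq> u' \<and> (u,v) \<in> Ar \<and> (u',v) \<in> Ar" for u u' v
    by (rule G.sqI_ret[of _ _ _ "Sv v" X]) (use JG_arrow(1,2,3) JG_arrow(4)[of u u' v] X that r in \<open>auto simp: \<Phi>_sqI\<close>)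
qed

lemma pd_le1_\<Phi>: assumes T: "T \<in> MG" and p: "pd_le1 MG S T" shows "\<Phi> T"
proof -
  obtain P0 P1 f g where s: "G.spr P0 P1 f g T" using G.pd_le1_lh[OF p T] .
  show ?thesis
    unfolding \<Phi>_sqI
  proof (intro conjI allI impI)
    show "G.sqI (Sv u) (Pa u v) (Pa u v) T" if "(u,v) \<in> Ar" for u v
      by (rule G.spr_sqI[of _ _ _ "Sv v", OF _ _ _ _ _ _ _ _ sq_arrow[OF that] s T]) (use JG_arrow(1,2,3)[OF that] in auto)
    show "G.sqI (Dv v) (Pa u v) (Pa u' v) T" if h: "u \<noteq> u' \<and> (u,v) \<in> Ar \<and> (u',v) \<in> Ar" for u u' v
      by (rule G.spr_sqI[of _ _ _ "Sv v", OF _ _ _ _ _ _ _ _ sq_fork[of u u' v] s T]) (use JG_arrow(1,2,3) JG_arrow(4)[of u u' v] h in auto)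
  qed
qed

lemma \<Phi>_decompose: assumes X: "X \<in> MG" "\<Phi> X" shows "\<exists>qs. set qs \<subseteq> UI \<and> eqv S X (G.dsl (map sg qs))"
proof -
  have "\<exists>As. set As \<subseteq> sg ` UI \<and> eqv S X (G.dsl As)"
  proof (rule G.decompose[where \<Phi> = \<Phi>])
    show "\<Phi> Z" if "Y \<in> MG" "\<Phi> Y" "Z \<in> MG" "ret S Z Y" for Y Z by (rule \<Phi>_ret[OF that(2,4)])
    show "G.good A" if "A \<in> sg ` UI" for A using that good_sg by auto
    show "\<exists>A\<in>sg ` UI. ret S (G.th A) Y" if "Y \<in> MG" "\<Phi> Y" "fst Y > 0" for Y using split_MG[OF that] by blast
  qed (use X in auto)
  then obtain As where As: "set As \<subseteq> sg ` UI" "eqv S X (G.dsl As)" by blast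
  have "\<exists>qs. set qs \<subseteq> UI \<and> As = map sg qs" using As(1)
  proof (induction As)
    case (Cons A As)
    then obtain qs i where "set qs \<subseteq> UI" "As = map sg qs" "i \<in> UI" "A = sg i" by auto
    then show ?case by (intro exI[of _ "i # qs"]) auto
  qed auto
  then show ?thesis using As(2) by blast
qed

text \<open>The label in the premise belongs to the projective kernel of the presentation, the label
  or labels in the conclusion to its middle term; compare \<open>xs_coker\<close> and
  \<open>xs_rad\<close>. Projective modules impose no condition.\<close>

fun EC :: "ui \<Rightarrow> label set \<Rightarrow> bool" where
  "EC (UP x) A \<longleftrightarrow> True"
| "EC (UCs u v) A \<longleftrightarrow> (Sv v \<in> A \<longrightarrow> Pa u v \<in> A)"
| "EC (UCd u v) A \<longleftrightarrow> (Pa u v \<in> A \<longrightarrow> Dv v \<in> A)"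
| "EC (UKa v) A \<longleftrightarrow> (Sv v \<in> A \<longrightarrow> Dv v \<in> A)"
| "EC (URd v) A \<longleftrightarrow> (Sv v \<in> A \<longrightarrow> (\<exists>u. (u,v) \<in> Ar \<and> Pa u v \<in> A))"

lemma presentation:
  assumes i: "i \<in> UI" and np: "\<nexists>x. i = UP x"
  obtains P0 y f g where "G.spr P0 (G.P y) f g (G.th (sg i))" "y \<in> JG"
    "\<And>A. A \<subseteq> JG \<Longrightarrow> G.tconv A \<Longrightarrow> G.xs f P0 y (G.th A) \<longleftrightarrow> EC i A"
proof -
  note res = that
  have co: thesis if "x \<in> JG" "y \<in> JG" "G.PP y \<subseteq> G.PP x" "sg i = G.PP x - G.PP y" "\<And>A. (y \<in> A \<longrightarrow> x \<in> A) = EC i A" for x y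
  proof -
    have "G.tconv (G.PP x - G.PP y)" using good_sg[OF i] that by (simp add: G.good_def)
    then show thesis using res[OF G.spr_coker[OF that(1,2,3), folded that(4)] that(2)] G.xs_coker[OF that(1,2,3)] that(4,5) by auto
  qed
  show thesis
  proof (cases i)
    case (UP x) then show ?thesis using np by blast
  next
    case (UCs u v)
    then show ?thesis using i JG_arrow by (intro co[of "Pa u v" "Sv v"] PP_Sv_Pa) auto
  next
    case (UCd u v)
    then show ?thesis using i JG_arrow by (intro co[of "Dv v" "Pa u v"] PP_Pa_Dv) auto
  next
    case (UKa v)
    then have v: "fk v" using i by simp
    then obtain u where "(u,v) \<in> Ar" by (auto simp: fk_def)
    then have "G.PP (Sv v) \<subseteq> G.PP (Dv v)" using PP_Sv_Pa PP_Pa_Dv by blast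
    then show ?thesis using v fk_V UKa by (intro co[of "Dv v" "Sv v"]) auto
  next
    case (URd v)
    then have v: "fk v" using i by simp
    obtain u u' where u: "u \<noteq> u'" "(u,v) \<in> Ar" "(u',v) \<in> Ar" and pr: "\<forall>i. (i,v) \<in> Ar \<longleftrightarrow> i = u \<or> i = u'" using fkE[OF v] .
    have J: "Sv v \<in> JG" "Pa u v \<in> JG" "Pa u' v \<in> JG" "Dv v \<in> JG" using u v fk_V by auto
    let ?B = "G.PP (Dv v) - {Dv v}"
    have ne: "u < v" "u' < v" using Ar_V(3) u by blast+
    \<comment> \<open>Within the projective module at \<open>Dv v\<close>, the submodules given by
      the two arrows meet exactly in the projective module at \<open>Sv v\<close>, so the radical
      has a presentation of Mayer-Vietoris type.\<close>
    have cap: "G.PP (Pa u v) \<inter> G.PP (Pa u' v) = G.PP (Sv v)" using RG_Pa[OF u(2)] RG_Pa[OF u(3)] u(1) ne by (auto simp: PP_iff)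
    have B: "?B = G.PP (Pa u v) \<union> G.PP (Pa u' v)"
    proof (intro equalityI subsetI)
      fix j assume "j \<in> ?B" then show "j \<in> G.PP (Pa u v) \<union> G.PP (Pa u' v)"
        using RG_Dv[of j v] RG_Pa[OF u(2), of j] RG_Pa[OF u(3), of j] pr by (auto simp: PP_iff)
    next
      fix j assume "j \<in> G.PP (Pa u v) \<union> G.PP (Pa u' v)"
      moreover have "Dv v \<notin> G.PP (Pa u v) \<union> G.PP (Pa u' v)" using Ar_irrefl by (simp add: PP_iff)
      ultimately show "j \<in> ?B" using PP_Pa_Dv u by blast
    qed
    have tB: "G.tconv ?B" using good_rad[OF v] by (simp add: G.good_def)
    have r: "RG (Dv v) (Pa u v)" "RG (Dv v) (Pa u' v)" by auto
    have Bd: "?B \<subseteq> G.PP (Dv v)" by blast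
    have sgi: "?B = sg i" using URd by simp
    note q = G.spr_rad[OF J r cap B Bd tB] G.xs_rad[OF J r cap B Bd tB]
    show ?thesis
      by (rule that[OF q(1)[unfolded sgi] J(1)]) (use q(2)[unfolded sgi] URd pr in auto)
  qed
qed

text \<open>The projective dimension and extension conditions in the definition of tilting modules only involve
  \<open>Ext\<^sup>1\<close> between the summands, and \<open>EC i A\<close> says that \<open>Ext\<^sup>1(th (sg i), th A) = 0\<close>.\<close>

lemma pd_ext_iff:
  assumes T: "T \<in> MG" and qs: "set qs \<subseteq> UI" and e: "eqv S T (G.dsl (map sg qs))"
  shows "pd_le1 MG S T \<and> (\<forall>i\<ge>1. ext_vanish MG S i T T) \<longleftrightarrow> (\<forall>i\<in>set qs. \<forall>j\<in>set qs. EC i (sg j))"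
proof -
  have gd: "\<And>A. A \<in> set (map sg qs) \<Longrightarrow> G.good A" using qs good_sg by auto
  have dm: "G.dsl (map sg ks) \<in> MG" if "set ks \<subseteq> set qs" for ks using that qs good_sg by (intro G.dsl_mods) auto
  have xs: "G.xs f P0 y T \<longleftrightarrow> (\<forall>j\<in>set qs. G.xs f P0 y (G.th (sg j)))" if "y \<in> JG" for f P0 y
    using G.xs_dsl[OF that gd, of "map sg qs" f P0] G.xs_ret[OF that _ eqv_ret[OF e], of f P0] G.xs_ret[OF that _ eqv_ret[OF eqv_sym[OF e]], of f P0] by auto
  show ?thesis
  proof
    assume pe: "pd_le1 MG S T \<and> (\<forall>i\<ge>1. ext_vanish MG S i T T)"
    show "\<forall>i\<in>set qs. \<forall>j\<in>set qs. EC i (sg j)"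
    proof (intro ballI)
      fix i j assume i: "i \<in> set qs" and j: "j \<in> set qs"
      show "EC i (sg j)"
      proof (cases "\<exists>x. i = UP x")
        case True then show ?thesis by auto
      next
        case False
        have iU: "i \<in> UI" using i qs by blast
        obtain P0 y f g where p: "G.spr P0 (G.P y) f g (G.th (sg i))" "y \<in> JG"
          and c: "\<And>A. A \<subseteq> JG \<Longrightarrow> G.tconv A \<Longrightarrow> G.xs f P0 y (G.th A) \<longleftrightarrow> EC i A" using presentation[OF iU False] by blast
        have "ret S (G.th (sg i)) T" using i by (intro ret_trans[OF G.dsl_ret eqv_ret[OF eqv_sym[OF e]]]) auto
        then have "G.xs f P0 y T" using G.ext_xs[OF T T G.good_mods[OF good_sg[OF iU]] _ _ p] pe by simp
        then show ?thesis using xs[OF p(2)] c[of "sg j"] gd j unfolding G.good_def by auto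
      qed
    qed
  next
    assume h: "\<forall>i\<in>set qs. \<forall>j\<in>set qs. EC i (sg j)"
    have pi: "G.prs (G.th (sg i)) T" if i: "i \<in> set qs" for i
    proof (cases "\<exists>x. i = UP x")
      case True then show ?thesis using i qs G.prs_proj[OF G.P_proj T] by fastforce
    next
      case False
      have iU: "i \<in> UI" using i qs by blast
      obtain P0 y f g where p: "G.spr P0 (G.P y) f g (G.th (sg i))" "y \<in> JG"
        and c: "\<And>A. A \<subseteq> JG \<Longrightarrow> G.tconv A \<Longrightarrow> G.xs f P0 y (G.th A) \<longleftrightarrow> EC i A" using presentation[OF iU False] by blast
      have "G.xs f P0 y T" using xs[OF p(2)] c h i gd unfolding G.good_def by auto
      then show ?thesis using G.prs_xs[OF p] by blast
    qed
    have "G.prs (G.dsl (map sg ks)) T" if "set ks \<subseteq> set qs" for ks using that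
    proof (induction ks)
      case (Cons k ks)
      have "k \<in> UI" using Cons.prems qs by auto
      then show ?case using Cons G.prs_dsum[OF G.good_mods[OF good_sg] dm T pi] by simp
    qed (simp add: G.prs_zmod)
    then have "G.prs T T" using G.prs_eqv[OF eqv_sym[OF e]] by blast
    then show "pd_le1 MG S T \<and> (\<forall>i\<ge>1. ext_vanish MG S i T T)" using G.prs_pd_le1[OF _ T] G.prs_ext_vanish[OF _ T T] by blast
  qed
qed

end

section \<open>Counting isomorphism classes\<close>

context modcat
begin

text \<open>Counts isomorphism classes through a system of representatives; used both for the number
  of indecomposable summands and for the number of tilting modules.\<close>

lemma card_classes:
  assumes W: "W \<subseteq> mods" and F: "\<And>i. i \<in> B \<Longrightarrow> F i \<in> W" and s: "\<And>Y. Y \<in> W \<Longrightarrow> \<exists>i\<in>B. eqv I Y (F i)"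
    and inj: "\<And>i j. i \<in> B \<Longrightarrow> j \<in> B \<Longrightarrow> eqv I (F i) (F j) \<Longrightarrow> i = j"
  shows "card (W // isorel mods I) = card B"
proof -
  let ?c = "\<lambda>X. isorel mods I `` {X}"
  have mem: "Y \<in> ?c X \<longleftrightarrow> X \<in> mods \<and> Y \<in> mods \<and> eqv I X Y" for X Y
    using mods_iso[of X Y] by (auto simp: isorel_def)
  have eq: "?c X = ?c Y" if "X \<in> W" "Y \<in> W" "eqv I X Y" for X Y
    using that W mem eqv_trans eqv_sym by blast
  have "W // isorel mods I = (\<lambda>i. ?c (F i)) ` B"
  proof (intro equalityI subsetI)
    fix K assume "K \<in> W // isorel mods I"
    then obtain X where X: "X \<in> W" "K = ?c X" by (auto simp: quotient_def)
    then obtain i where i: "i \<in> B" "eqv I X (F i)" using s by blast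
    have "K = ?c (F i)" using eq[OF X(1) F[OF i(1)] i(2)] X(2) by simp
    then show "K \<in> (\<lambda>i. ?c (F i)) ` B" using i(1) by blast
  next
    fix K assume "K \<in> (\<lambda>i. ?c (F i)) ` B"
    then show "K \<in> W // isorel mods I" using F by (auto simp: quotient_def)
  qed
  moreover have "inj_on (\<lambda>i. ?c (F i)) B"
  proof (rule inj_onI)
    fix i j assume ij: "i \<in> B" "j \<in> B" "?c (F i) = ?c (F j)"
    have "F j \<in> ?c (F j)" using mem[of "F j" "F j"] F[OF ij(2)] W eqv_refl by blast
    then have "eqv I (F i) (F j)" using mem[of "F j" "F i"] ij(3) by blast
    then show "i = j" using inj ij by blast
  qed
  ultimately show ?thesis by (simp add: card_image)
qed

end

context gamma
begin

section \<open>Blocks and the extension relation inside a block\<close>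

definition pr where "pr v = {u. (u,v) \<in> Ar}"

fun blk :: "ui \<Rightarrow> nat" where
  "blk (UP (Sv v)) = v" | "blk (UP (Pa u v)) = v" | "blk (UP (Dv v)) = v"
| "blk (UCs u v) = v" | "blk (UCd u v) = v" | "blk (UKa v) = v" | "blk (URd v) = v"

text \<open>\<open>hS\<close>, \<open>hD\<close> and \<open>pu\<close> record which of the labels
  \<open>Sv v\<close>, \<open>Dv v\<close> and \<open>Pa u v\<close> with \<open>v = blk i\<close>
  lie in \<open>sg i\<close>. Together with \<open>blk\<close> they replace the supports in the
  count.\<close>

fun hS :: "ui \<Rightarrow> bool" where "hS (UP x) = True" | "hS (URd v) = True" | "hS _ = False"
fun hD :: "ui \<Rightarrow> bool" where "hD (UP (Dv v)) = True" | "hD (UCd u v) = True" | "hD (UKa v) = True" | "hD _ = False"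

fun pu :: "ui \<Rightarrow> nat set" where
  "pu (UP (Sv v)) = {}" | "pu (UP (Pa u v)) = {u}" | "pu (UP (Dv v)) = pr v"
| "pu (UCs u v) = {u}" | "pu (UCd u v) = pr v - {u}" | "pu (UKa v) = pr v" | "pu (URd v) = pr v"

lemma sg_Sv: "i \<in> UI \<Longrightarrow> Sv w \<in> sg i \<longleftrightarrow> hS i \<and> w = blk i"
proof (cases i)
  case (UP x)
  assume "i \<in> UI"
  then have "w = v \<Longrightarrow> v \<in> V" if "x \<in> {Sv v, Dv v} \<union> {Pa u v | u. True}" for v using that UP fk_V Ar_V by auto
  then show ?thesis using UP by (cases x) (auto simp: PP_iff)
qed (auto simp: PP_iff dest: fk_V)

lemma sg_Dv: assumes i: "i \<in> UI" shows "Dv (blk i) \<in> sg i \<longleftrightarrow> hD i"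
  using i
proof (cases i)
  case (UP x) then show ?thesis using i Ar_irrefl by (cases x) (auto simp: PP_iff)
next
  case (UCs u v) then show ?thesis using i Ar_irrefl by (auto simp: PP_iff)
next
  case (UCd u v) then show ?thesis using i Ar_irrefl by (auto simp: PP_iff)
next
  case (UKa v) then show ?thesis using i Ar_irrefl by (auto simp: PP_iff)
qed auto

lemma sg_Pa: assumes i: "i \<in> UI" and u: "(u, blk i) \<in> Ar" shows "Pa u (blk i) \<in> sg i \<longleftrightarrow> u \<in> pu i"
proof -
  have "u \<noteq> blk i" using u Ar_irrefl by auto
  then show ?thesis using i u
  proof (cases i)
    case (UP x) then show ?thesis using \<open>u \<noteq> blk i\<close> i u by (cases x) (auto simp: PP_iff pr_def)
  qed (auto simp: PP_iff pr_def)
qed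

lemma sg_blk: assumes i: "i \<in> UI" "\<not> hS i" shows "Dv w \<in> sg i \<Longrightarrow> w = blk i" "Pa u w \<in> sg i \<Longrightarrow> w = blk i"
proof -
  show "w = blk i" if "Dv w \<in> sg i" using i that by (cases i) (auto simp: PP_iff)
  show "w = blk i" if "Pa u w \<in> sg i" using i that by (cases i) (auto simp: PP_iff dest: Ar_fun)
qed

lemma pu_pr: "i \<in> UI \<Longrightarrow> pu i \<subseteq> pr (blk i)"
proof (cases i)
  case (UP x) then show "i \<in> UI \<Longrightarrow> ?thesis" by (cases x) (auto simp: pr_def)
qed (auto simp: pr_def)

lemma pr_fk1: assumes "fk v" shows "pr v \<noteq> {u}"
proof -
  obtain a b where "a \<noteq> b" "a \<in> pr v" "b \<in> pr v" using assms by (auto simp: fk_def pr_def)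
  then show ?thesis by auto
qed
lemma pr_fk2: "fk v \<Longrightarrow> pr v \<noteq> {}" unfolding fk_def pr_def by blast
lemma pr_fk3: "(u,v) \<in> Ar \<Longrightarrow> pr v - {u} = pr v - {u'} \<Longrightarrow> u = u'" unfolding pr_def by blast
lemma pr_fk4: "(u,v) \<in> Ar \<Longrightarrow> pr v - {u} \<noteq> pr v" unfolding pr_def by blast
lemmas pr_fk = pr_fk1 pr_fk1[symmetric] pr_fk2 pr_fk2[symmetric] pr_fk4 pr_fk4[symmetric]

text \<open>At a fork \<open>pr v\<close> has at least two elements, which separates
  \<open>pr v\<close> from the singletons and from the empty set; removing one element keeps
  \<open>UCd\<close> apart from \<open>UKa\<close>.\<close>

lemma ui_eqI:
  assumes ij: "i \<in> UI" "j \<in> UI" and e: "blk i = blk j" "hS i = hS j" "hD i = hD j" "pu i = pu j"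
  shows "i = j"
proof -
  have k: "(\<exists>v. k = UP (Sv v)) \<or> (\<exists>u v. k = UP (Pa u v)) \<or> (\<exists>v. k = UP (Dv v)) \<or> (\<exists>u v. k = UCs u v) \<or> (\<exists>u v. k = UCd u v) \<or> (\<exists>v. k = UKa v) \<or> (\<exists>v. k = URd v)" for k
  proof (cases k)
    case (UP x) then show ?thesis by (cases x) auto
  qed auto
  show ?thesis using k[of i] k[of j] ij e by (elim disjE exE) (auto simp: pr_fk dest: pr_fk3)
qed

lemma sg_inj: assumes ij: "i \<in> UI" "j \<in> UI" and e: "sg i = sg j" shows "i = j"
proof (rule ui_eqI[OF ij])
  have S: "hS i \<and> w = blk i \<longleftrightarrow> hS j \<and> w = blk j" for w using sg_Sv[OF ij(1), of w] sg_Sv[OF ij(2), of w] e by simp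
  show s: "hS i = hS j" using S by blast
  show b: "blk i = blk j"
  proof (cases "hS i")
    case True then show ?thesis using S by blast
  next
    case False
    then have n: "\<not> hS j" using s by simp
    obtain x where x: "x \<in> sg i" using G.good_nonempty[OF good_sg[OF ij(1)]] by blast
    show ?thesis
    proof (cases x)
      case (Sv w) then show ?thesis using x sg_Sv[OF ij(1)] False by simp
    next
      case (Pa u w) then show ?thesis using sg_blk(2)[OF ij(1) False, of u w] sg_blk(2)[OF ij(2) n, of u w] x e by simp
    next
      case (Dv w) then show ?thesis using sg_blk(1)[OF ij(1) False, of w] sg_blk(1)[OF ij(2) n, of w] x e by simp
    qed
  qed
  show "hD i = hD j" using sg_Dv[OF ij(1)] sg_Dv[OF ij(2)] b e by simp
  show "pu i = pu j"
  proof -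
    have "u \<in> pu i \<longleftrightarrow> u \<in> pu j" if "u \<in> pr (blk i)" for u
      using sg_Pa[OF ij(1), of u] sg_Pa[OF ij(2), of u] that b e by (simp add: pr_def)
    then show ?thesis using pu_pr[OF ij(1)] pu_pr[OF ij(2)] b by auto
  qed
qed

fun EC2 :: "ui \<Rightarrow> ui \<Rightarrow> bool" where
  "EC2 (UP x) j \<longleftrightarrow> True"
| "EC2 (UCs u v) j \<longleftrightarrow> (hS j \<longrightarrow> u \<in> pu j)"
| "EC2 (UCd u v) j \<longleftrightarrow> (u \<in> pu j \<longrightarrow> hD j)"
| "EC2 (UKa v) j \<longleftrightarrow> (hS j \<longrightarrow> hD j)"
| "EC2 (URd v) j \<longleftrightarrow> (hS j \<longrightarrow> pu j \<noteq> {})"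

text \<open>The premises of most clauses concern \<open>Sv v\<close>, which only occurs in supports
  of its own block. The exception is \<open>UCd\<close>, where a support from another block that
  contains \<open>Pa u v\<close> also contains \<open>Dv v\<close>.\<close>

lemma EC_sg: assumes i: "i \<in> UI" and j: "j \<in> UI" shows "EC i (sg j) \<longleftrightarrow> blk i \<noteq> blk j \<or> EC2 i j"
proof (cases "blk i = blk j")
  case True
  show ?thesis
  proof (cases i)
    case (UCs u v) then show ?thesis using True i sg_Sv[OF j] sg_Pa[OF j, of u] by auto
  next
    case (UCd u v) then show ?thesis using True i sg_Dv[OF j] sg_Pa[OF j, of u] by auto
  next
    case (UKa v) then show ?thesis using True sg_Dv[OF j] sg_Sv[OF j] by auto
  next
    case (URd v)
    have "(\<exists>u. (u,v) \<in> Ar \<and> Pa u v \<in> sg j) \<longleftrightarrow> pu j \<noteq> {}"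
      using sg_Pa[OF j] pu_pr[OF j] True URd by (auto simp: pr_def)
    then show ?thesis using True URd sg_Sv[OF j] by auto
  qed simp
next
  case False
  show ?thesis
  proof (cases i)
    case (UCd u v)
    have a: "(u,v) \<in> Ar" and f: "fk v" and ne: "blk j \<noteq> v" using UCd i False by auto
    have "Dv v \<in> sg j" if h: "Pa u v \<in> sg j"
    proof -
      have J: "Dv v \<in> JG" using f by simp
      \<comment> \<open>Outside the block, a non-zero map from \<open>Pa u v\<close> to
        \<open>x\<close> factors through the top \<open>Sv u\<close>; this is also a quotient of
        \<open>Dv v\<close>, so \<open>Dv v\<close> maps to \<open>x\<close> as well.\<close>
      have k: "Dv v \<in> G.PP x" if x: "x \<in> JG" "Pa u v \<in> G.PP x" "blk (UP x) \<noteq> v" for x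
        using x a J RG_to_Pa[OF a x(1)] RG_to_Dv[OF x(1), of v] by (auto simp: PP_iff)
      show ?thesis
      proof (cases j)
        case (UP x) then show ?thesis using h k[of x] j ne by simp
      next
        case (URd w)
        then show ?thesis using h k[of "Dv w"] j ne by simp
      qed (use h j ne Ar_fun[OF a] in \<open>auto simp: PP_iff\<close>)
    qed
    then show ?thesis using UCd False by simp
  qed (use False sg_Sv[OF j] in auto)
qed

lemma finite_UI: "finite UI"
proof -
  have fA: "finite Ar" using Ar_V finite_V by (intro finite_subset[of Ar "V \<times> V"]) auto
  have fk: "finite {v. fk v}" by (rule finite_subset[OF _ finite_V]) (auto dest: fk_V)
  have "{Pa u v | u v. (u,v) \<in> Ar} = (\<lambda>(u,v). Pa u v) ` Ar" by auto
  then have J: "finite JG" using fA fk finite_V by (simp add: JG_def)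
  have "{UCs u v | u v. (u,v) \<in> Ar} = (\<lambda>(u,v). UCs u v) ` Ar" by auto
  moreover have "{UCd u v | u v. (u,v) \<in> Ar \<and> fk v} \<subseteq> (\<lambda>(u,v). UCd u v) ` Ar" by auto
  ultimately show ?thesis using J fA fk finite_subset[of "{UCd u v | u v. (u,v) \<in> Ar \<and> fk v}"] by (simp add: UI_def)
qed

section \<open>Indecomposable summands\<close>

lemma gd_map: "set qs \<subseteq> UI \<Longrightarrow> A \<in> set (map sg qs) \<Longrightarrow> G.good A" using good_sg by auto

lemma dsl_MG: "set qs \<subseteq> UI \<Longrightarrow> G.dsl (map sg qs) \<in> MG" by (intro G.dsl_mods gd_map)

lemma ret_dsl_ui: assumes qs: "set qs \<subseteq> UI" and i: "i \<in> UI" and T: "eqv S T (G.dsl (map sg qs))"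
  shows "ret S (G.th (sg i)) T \<longleftrightarrow> i \<in> set qs"
proof
  assume "ret S (G.th (sg i)) T"
  then have "ret S (G.th (sg i)) (G.dsl (map sg qs))" using eqv_ret[OF T] ret_trans by blast
  then have "sg i \<in> set (map sg qs)" using G.ret_dsl[OF good_sg[OF i] gd_map[OF qs]] by blast
  then show "i \<in> set qs" using sg_inj[OF i] qs by auto
next
  assume "i \<in> set qs"
  then have "ret S (G.th (sg i)) (G.dsl (map sg qs))" by (intro G.dsl_ret) auto
  then show "ret S (G.th (sg i)) T" using eqv_ret[OF eqv_sym[OF T]] ret_trans by blast
qed

lemma indec_ui: assumes Y: "indec MG S Y" and Ph: "\<Phi> Y" obtains i where "i \<in> UI" "eqv S Y (G.th (sg i))"
proof -
  have Ym: "Y \<in> MG" "fst Y > 0" using Y by (auto simp: indec_def)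
  then obtain i where i: "i \<in> UI" "ret S (G.th (sg i)) Y" using split_MG[OF _ Ph] by blast
  then have "eqv S Y (G.th (sg i))" using G.indec_ret[OF Y G.good_mods _ G.fst_th_pos] good_sg by blast
  then show thesis using that i by blast
qed

lemma nind_dsl:
  assumes T: "T \<in> MG" "\<Phi> T" and qs: "set qs \<subseteq> UI" and e: "eqv S T (G.dsl (map sg qs))"
  shows "nind MG S T = card (set qs)"
  unfolding nind_def
proof (rule G.card_classes[where F = "\<lambda>i. G.th (sg i)"])
  show "{Y. indec MG S Y \<and> summand MG S Y T} \<subseteq> MG" by (auto simp: indec_def)
  show "G.th (sg i) \<in> {Y. indec MG S Y \<and> summand MG S Y T}" if "i \<in> set qs" for i
    using that qs G.indec_th[OF good_sg] G.summand_iff[OF G.good_mods[OF good_sg] T(1)] ret_dsl_ui[OF qs _ e] by auto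
  show "\<exists>i\<in>set qs. eqv S Y (G.th (sg i))" if "Y \<in> {Y. indec MG S Y \<and> summand MG S Y T}" for Y
  proof -
    have Y: "indec MG S Y" "Y \<in> MG" "summand MG S Y T" using that by (auto simp: indec_def)
    have Y3: "ret S Y T" using Y(3) G.summand_iff[OF Y(2) T(1)] by blast
    obtain i where i: "i \<in> UI" "eqv S Y (G.th (sg i))" using indec_ui[OF Y(1) \<Phi>_ret[OF T(2) Y3]] .
    have "ret S (G.th (sg i)) T" using ret_trans[OF eqv_ret[OF eqv_sym[OF i(2)]] Y3] .
    then show ?thesis using i ret_dsl_ui[OF qs i(1) e] by blast
  qed
  show "i = j" if "i \<in> set qs" "j \<in> set qs" "eqv S (G.th (sg i)) (G.th (sg j))" for i j
    using sg_inj G.ret_th_eq[OF good_sg good_sg eqv_ret[OF that(3)]] that(1,2) qs by blast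
qed

text \<open>A regular module is free on \<open>v\<close>: each \<open>w\<close> is the image of
  \<open>v\<close> under a unique \<open>a\<close>, and is sent to the image of \<open>x\<close>
  under the same \<open>a\<close>.\<close>

lemma regular_gen:
  assumes F: "F \<in> MG" and v: "v \<in> vs F" and b: "bij_betw (\<lambda>a. snd F a *\<^sub>v v) S (vs F)" and X: "X \<in> MG" and x: "x \<in> vs X"
  obtains h where "lh S F X h" "\<forall>a\<in>S. h (snd F a *\<^sub>v v) = snd X a *\<^sub>v x"
proof -
  let ?t = "\<lambda>a. snd F a *\<^sub>v v"
  define k where "k = the_inv_into S ?t"
  have inj: "inj_on ?t S" and im: "?t ` S = vs F" using b by (auto simp: bij_betw_def)
  have kt: "k (?t a) = a" if "a \<in> S" for a using the_inv_into_f_f[OF inj that] by (simp add: k_def)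
  have kS: "k w \<in> S" and tk: "?t (k w) = w" if "w \<in> vs F" for w
    using the_inv_into_into[OF inj _ subset_refl, of w] f_the_inv_into_f[OF inj, of w] that im by (auto simp: k_def)
  have keq: "k w = a" if "a \<in> S" "w = ?t a" for a w using kt that by blast
  let ?h = "\<lambda>w. snd X (k w) *\<^sub>v x"
  have "lh S F X ?h" unfolding lh_def
  proof (intro conjI linI ballI)
    fix w assume w: "w \<in> vs F"
    note kw = kS[OF w]
    show "?h w \<in> vs X" by (rule MG_act[OF X kw x])
    { fix u assume u: "u \<in> vs F"
      have "k (w + u) = k w + k u" by (rule keq[OF S_add[OF kw kS[OF u]]]) (simp add: MG_D(2)[OF F v kw kS[OF u]] tk w u)
      then show "?h (w + u) = ?h w + ?h u" using MG_D(2)[OF X x kw kS[OF u]] by simp }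
    { fix a
      have "k (a \<cdot>\<^sub>v w) = a \<cdot>\<^sub>m k w" by (rule keq[OF S_smult[OF kw]]) (simp add: MG_D(4)[OF F v kw] tk w)
      then show "?h (a \<cdot>\<^sub>v w) = a \<cdot>\<^sub>v ?h w" using MG_D(4)[OF X x kw] by simp }
    fix g assume g: "g \<in> S"
    have "k (snd F g *\<^sub>v w) = k w * g" by (rule keq[OF S_mult[OF kw g]]) (simp add: MG_D(3)[OF F v kw g] tk w)
    then show "?h (snd F g *\<^sub>v w) = snd X g *\<^sub>v ?h w" using MG_D(3)[OF X x kw g] by simp
  qed
  then show thesis using that[of ?h] kt by simp
qed

lemma regular_projective:
  assumes "regular S D F" shows "projective MG S F"
proof -
  obtain v where F: "F \<in> MG" and v: "v \<in> vs F" and b: "bij_betw (\<lambda>a. snd F a *\<^sub>v v) S (vs F)"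
    using assms by (auto simp: regular_def)
  show ?thesis
  proof (rule G.projI[OF F])
    fix X Y g f assume X: "X \<in> MG" and Y: "Y \<in> MG" and g: "lh S X Y g" and s: "\<And>v. v \<in> vs Y \<Longrightarrow> \<exists>u\<in>vs X. g u = v" and f: "lh S F Y f"
    obtain x where x: "x \<in> vs X" "g x = f v" using s[OF lh_closed[OF f v]] by blast
    obtain h where h: "lh S F X h" "\<forall>a\<in>S. h (snd F a *\<^sub>v v) = snd X a *\<^sub>v x" using regular_gen[OF F v b X x(1)] .
    have "g (h w) = f w" if "w \<in> vs F" for w
    proof -
      have "w \<in> (\<lambda>a. snd F a *\<^sub>v v) ` S" using b that by (simp add: bij_betw_def)
      then obtain a where a: "a \<in> S" "w = snd F a *\<^sub>v v" by blast
      then show ?thesis using h(2) lh_act[OF g a(1) x(1)] lh_act[OF f a(1) v] x(2) by simp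
    qed
    then show "\<exists>h. lh S F X h \<and> (\<forall>v\<in>vs F. g (h v) = f v)" using h(1) by blast
  qed
qed

text \<open>\<open>P j\<close> is generated by its basis vector at the representative of
  \<open>j\<close>, so it is a quotient of \<open>F\<close>; being projective, it is a
  retract.\<close>

lemma regular_P:
  assumes "regular S D F" and j: "j \<in> JG" shows "ret S (G.P j) F"
proof -
  obtain v where F: "F \<in> MG" and v: "v \<in> vs F" and b: "bij_betw (\<lambda>a. snd F a *\<^sub>v v) S (vs F)"
    using assms by (auto simp: regular_def)
  let ?P = "G.P j" and ?b = "G.bs (G.PP j) (rpG j)"
  note P = G.P_mods[OF j]
  have bv: "?b \<in> vs ?P" by simp
  obtain h where h: "lh S F ?P h" "\<forall>a\<in>S. h (snd F a *\<^sub>v v) = snd ?P a *\<^sub>v ?b" using regular_gen[OF F v b P bv] .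
  define W where "W = h ` vs F"
  have sb: "subsp (fst ?P) W" unfolding W_def by (rule subsp_image[OF lh_lin[OF h(1)] subsp_all])
  have s: "\<exists>u\<in>vs F. h u = w" if w: "w \<in> vs ?P" for w
  proof -
    have "G.bs (G.PP j) c \<in> W" if c: "c \<in> G.sc (G.PP j)" for c
    proof -
      have a: "bG (rpG j) c \<in> S" using G.bs_gen(2)[OF j c] G.ixI by blast
      have "G.bs (G.PP j) c = h (snd F (bG (rpG j) c) *\<^sub>v v)" using G.bs_gen(1)[OF j c] h(2) a by simp
      then show ?thesis using MG_act[OF F a v] unfolding W_def by (simp only:) (rule imageI)
    qed
    then have k: "G.cd (G.PP j) c w \<cdot>\<^sub>v G.bs (G.PP j) c \<in> W" if "c \<in> G.sc (G.PP j)" for c using sb that unfolding subsp_def by blast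
    have e: "vsum (fst ?P) (\<lambda>c. G.cd (G.PP j) c w \<cdot>\<^sub>v G.bs (G.PP j) c) (G.sc (G.PP j)) = w"
      unfolding G.fst_th by (rule G.bs_expand) (use w in simp)
    have "vsum (fst ?P) (\<lambda>c. G.cd (G.PP j) c w \<cdot>\<^sub>v G.bs (G.PP j) c) (G.sc (G.PP j)) \<in> W"
      by (rule G.vsum_subsp[OF sb G.finsc k])
    then show ?thesis unfolding e W_def by (elim imageE) (rule bexI, rule sym)
  qed
  show ?thesis
    by (rule G.proj_lift[OF G.P_proj[OF j] F P h(1) s lh_id]) (assumption | rule retI[OF _ h(1)])+
qed

lemma proj_\<Phi>: assumes "projective MG S Q" shows "\<Phi> Q"
  unfolding \<Phi>_sqI
proof (intro conjI allI impI)
  show "G.sqI (Sv u) (Pa u v) (Pa u v) Q" if "(u,v) \<in> Ar" for u v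
  proof -
    have "G.sq (Sv u) (Pa u v) (Pa u v) (Sv v) Q"
      by (rule G.sq_proj[OF _ _ _ _ _ _ _ _ sq_arrow[OF that] assms]) (use JG_arrow(1,2,3)[OF that] in auto)
    then show ?thesis by (simp add: G.sq_def)
  qed
  show "G.sqI (Dv v) (Pa u v) (Pa u' v) Q" if h: "u \<noteq> u' \<and> (u,v) \<in> Ar \<and> (u',v) \<in> Ar" for u u' v
  proof -
    have "G.sq (Dv v) (Pa u v) (Pa u' v) (Sv v) Q"
      by (rule G.sq_proj[OF _ _ _ _ _ _ _ _ sq_fork[of u u' v] assms]) (use JG_arrow(1,2,3) JG_arrow(4)[of u u' v] h in auto)
    then show ?thesis by (simp add: G.sq_def)
  qed
qed

text \<open>All projective thin modules occur by \<open>regular_P\<close>, and no others: a summand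
  of \<open>F\<close> is projective, hence a retract of a sum of projective thin modules, and
  \<open>ret_dsl\<close> identifies it with one of them.\<close>

lemma nind_regular: assumes r: "regular S D F" shows "nind MG S F = card JG"
proof -
  have F: "F \<in> MG" using r by (simp add: regular_def)
  note p = regular_projective[OF r]
  note ph = proj_\<Phi>[OF p]
  obtain qs where qs: "set qs \<subseteq> UI" "eqv S F (G.dsl (map sg qs))" using \<Phi>_decompose[OF F ph] by blast
  have "set qs = UP ` JG"
  proof (intro equalityI subsetI)
    fix i assume i: "i \<in> set qs"
    then have iU: "i \<in> UI" using qs by blast
    have "projective MG S (G.th (sg i))"
      by (rule G.proj_ret[OF p G.good_mods[OF good_sg[OF iU]]]) (use ret_dsl_ui[OF qs(1) iU qs(2)] i in blast)
    then obtain ks where ks: "set ks \<subseteq> JG" "ret S (G.th (sg i)) (G.dsl (map G.PP ks))" by (rule G.proj_ret_free)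
    have "sg i \<in> set (map G.PP ks)" by (rule G.ret_dsl[OF good_sg[OF iU] _ ks(2)]) (use ks(1) G.PP_good in auto)
    then obtain k where "k \<in> JG" "sg i = sg (UP k)" using ks(1) by auto
    then show "i \<in> UP ` JG" using sg_inj[OF iU, of "UP k"] by auto
  next
    fix i assume "i \<in> UP ` JG"
    then obtain k where k: "i = UP k" "k \<in> JG" by blast
    then show "i \<in> set qs" using regular_P[OF r k(2)] ret_dsl_ui[OF qs(1) _ qs(2), of i] by simp
  qed
  then show ?thesis using nind_dsl[OF F ph qs] by (simp add: card_image inj_on_def)
qed

text \<open>The condition on the number of summands in \<open>tilting\<close> quantifies over all
  regular modules; existence keeps it from being vacuous. The module is \<open>S\<close> itself, in
  the coordinates \<open>coG\<close>.\<close>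

lemma regular_exists: "\<exists>F. regular S D F"
proof -
  let ?E = "{(c,c'). rG c c'}"
  define n where "n = card ?E"
  obtain en where en: "bij_betw en {..<n} ?E"
    using finite_rG ex_bij_betw_nat_finite[of ?E] by (auto simp: n_def atLeast0LessThan)
  define \<theta> where "\<theta> s = vec n (\<lambda>i. coG s (fst (en i)) (snd (en i)))" for s
  have enE: "fst (en i) \<in> CG" "snd (en i) \<in> CG" if "i < n" for i
  proof -
    have "en i \<in> ?E" by (rule bspec[OF bij_betwE[OF en]]) (simp add: that)
    then show "fst (en i) \<in> CG" "snd (en i) \<in> CG" by (auto simp: rG_def)
  qed
  have c: "\<theta> s \<in> carrier_vec n" for s by (simp add: \<theta>_def)
  have add: "\<theta> (s + t) = \<theta> s + \<theta> t" if "s \<in> S" "t \<in> S" for s t by (rule eq_vecI) (auto simp: \<theta>_def coG_add[OF that enE])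
  have sm: "\<theta> (a \<cdot>\<^sub>m s) = a \<cdot>\<^sub>v \<theta> s" if "s \<in> S" for a s by (rule eq_vecI) (auto simp: \<theta>_def coG_smult[OF that enE])
  have inj: "inj_on \<theta> S"
  proof (rule inj_onI)
    fix s t assume st: "s \<in> S" "t \<in> S" "\<theta> s = \<theta> t"
    let ?d = "s + (-1) \<cdot>\<^sub>m t"
    have d: "?d \<in> S" by (intro S_add S_smult st)
    have "?d = 0\<^sub>m D D"
    proof (rule coG_zero[OF d])
      fix c c' assume r: "rG c c'"
      then obtain i where i: "i < n" "en i = (c,c')" using en unfolding bij_betw_def by force
      have "\<theta> s $ i = \<theta> t $ i" using st by simp
      then have "coG s c c' = coG t c c'" using i by (simp add: \<theta>_def)
      moreover have "c \<in> CG" "c' \<in> CG" using r by (auto simp: rG_def)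
      ultimately show "coG ?d c c' = 0" by (simp add: coG_add[OF st(1) S_smult[OF st(2)]] coG_smult[OF st(2)])
    qed
    then have "s = t + 0\<^sub>m D D" using S_carrier[OF st(1)] S_carrier[OF st(2)]
    proof -
      assume z: "?d = 0\<^sub>m D D"
      have "s = t + ?d" using S_carrier[OF st(1)] S_carrier[OF st(2)] by (intro eq_matI) auto
      then show ?thesis using z by simp
    qed
    then show "s = t" using S_carrier[OF st(2)] by simp
  qed
  have surj: "\<exists>s\<in>S. \<theta> s = w" if w: "w \<in> carrier_vec n" for w
  proof -
    define G where "G = (\<lambda>c c'. w $ (inv_into {..<n} en (c,c')))"
    obtain s where s: "s \<in> S" "\<forall>c c'. rG c c' \<longrightarrow> coG s c c' = G c c'" using coG_surj[of G] by blast
    have "\<theta> s = w"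
    proof (rule eq_vecI)
      fix i assume "i < dim_vec w"
      then have i: "i < n" using w by simp
      then have e: "en i \<in> ?E" using bij_betwE[OF en] by auto
      then have "coG s (fst (en i)) (snd (en i)) = w $ (inv_into {..<n} en (en i))" using s(2) by (auto simp: G_def split: prod.splits)
      also have "inv_into {..<n} en (en i) = i" using i en by (intro inv_into_f_f) (auto simp: bij_betw_def)
      finally show "\<theta> s $ i = w $ i" using i by (simp add: \<theta>_def)
    qed (use w in \<open>simp add: \<theta>_def\<close>)
    then show ?thesis using s(1) by blast
  qed
  define k where "k = the_inv_into S \<theta>"
  have kt: "k (\<theta> s) = s" if "s \<in> S" for s using the_inv_into_f_f[OF inj that] by (simp add: k_def)
  have im: "w \<in> \<theta> ` S" if "w \<in> carrier_vec n" for w using surj[OF that] by blast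
  have kS: "k w \<in> S" and tk: "\<theta> (k w) = w" if "w \<in> carrier_vec n" for w
    using the_inv_into_into[OF inj im[OF that] subset_refl] f_the_inv_into_f[OF inj im[OF that]] by (auto simp: k_def)
  have kadd: "k (w + u) = k w + k u" if "w \<in> carrier_vec n" "u \<in> carrier_vec n" for w u
    using kt[OF S_add[OF kS[OF that(1)] kS[OF that(2)]]] add[OF kS[OF that(1)] kS[OF that(2)]] tk that by simp
  have ksm: "k (a \<cdot>\<^sub>v w) = a \<cdot>\<^sub>m k w" if "w \<in> carrier_vec n" for w a
    using kt[OF S_smult[OF kS[OF that]]] sm[OF kS[OF that]] tk that by simp
  \<comment> \<open>Right multiplication, carried over to coordinate vectors by
    \<open>\<theta>\<close> and its inverse \<open>k\<close>.\<close>
  define F where "F = (n, \<lambda>s. mof n n (\<lambda>w. \<theta> (k w * s)))"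
  have fF: "fst F = n" by (simp add: F_def)
  have l: "lin n n (\<lambda>w. \<theta> (k w * s))" if s: "s \<in> S" for s
  proof (rule linI)
    fix w u :: "'k vec" and a assume w: "w \<in> carrier_vec n"
    show "\<theta> (k w * s) \<in> carrier_vec n" by (rule c)
    { assume u: "u \<in> carrier_vec n"
      show "\<theta> (k (w + u) * s) = \<theta> (k w * s) + \<theta> (k u * s)"
        unfolding kadd[OF w u] add_mult_distrib_mat[OF S_carrier[OF kS[OF w]] S_carrier[OF kS[OF u]] S_carrier[OF s]]
        by (rule add[OF S_mult[OF kS[OF w] s] S_mult[OF kS[OF u] s]]) }
    show "\<theta> (k (a \<cdot>\<^sub>v w) * s) = a \<cdot>\<^sub>v \<theta> (k w * s)"
      unfolding ksm[OF w] mult_smult_assoc_mat[OF S_carrier[OF kS[OF w]] S_carrier[OF s]]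
      by (rule sm[OF S_mult[OF kS[OF w] s]])
  qed
  have act: "snd F s *\<^sub>v w = \<theta> (k w * s)" if "s \<in> S" "w \<in> carrier_vec n" for s w
    using mof_mult[OF l[OF that(1)] that(2)] by (simp add: F_def)
  have F: "F \<in> MG" unfolding MG_iff fF
  proof (intro conjI ballI allI)
    show "wfm S F" by (simp add: wfm_def F_def)
    fix w :: "'k vec" assume w: "w \<in> carrier_vec n"
    note kw = kS[OF w] and kc = S_carrier[OF kS[OF w]]
    show "snd F (1\<^sub>m D) *\<^sub>v w = w" using act[OF S_one w] kc tk[OF w] by simp
    fix s assume s: "s \<in> S"
    { fix a show "snd F (a \<cdot>\<^sub>m s) *\<^sub>v w = a \<cdot>\<^sub>v (snd F s *\<^sub>v w)"
        using act[OF S_smult[OF s] w] act[OF s w] mult_smult_distrib[OF kc S_carrier[OF s], of a] sm[OF S_mult[OF kw s]] by simp }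
    fix t assume t: "t \<in> S"
    show "snd F (s + t) *\<^sub>v w = snd F s *\<^sub>v w + snd F t *\<^sub>v w"
      using act[OF S_add[OF s t] w] act[OF s w] act[OF t w] mult_add_distrib_mat[OF kc S_carrier[OF s] S_carrier[OF t]] add[OF S_mult[OF kw s] S_mult[OF kw t]] by simp
    show "snd F (s * t) *\<^sub>v w = snd F t *\<^sub>v (snd F s *\<^sub>v w)"
      using act[OF S_mult[OF s t] w] act[OF s w] act[OF t c] kt[OF S_mult[OF kw s]] assoc_mult_mat[OF kc S_carrier[OF s] S_carrier[OF t]] by simp
  qed
  have "bij_betw (\<lambda>a. snd F a *\<^sub>v \<theta> (1\<^sub>m D)) S (carrier_vec n)"
  proof -
    have "snd F a *\<^sub>v \<theta> (1\<^sub>m D) = \<theta> a" if "a \<in> S" for a using act[OF that c] kt[OF S_one] S_carrier[OF that] by simp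
    moreover have "bij_betw \<theta> S (carrier_vec n)" using inj im c by (auto simp: bij_betw_def)
    ultimately show ?thesis by (subst bij_betw_cong) auto
  qed
  then have "regular S D F" using F c by (auto simp: regular_def fF)
  then show ?thesis ..
qed

section \<open>Tilting modules as sets of thin modules\<close>

definition TB where "TB = {B. B \<subseteq> UI \<and> card B = card JG \<and> (\<forall>i\<in>B. \<forall>j\<in>B. EC i (sg j))}"

lemma tilting_dsl:
  assumes T: "T \<in> MG" and qs: "set qs \<subseteq> UI" and e: "eqv S T (G.dsl (map sg qs))"
  shows "tilting S D T \<longleftrightarrow> set qs \<in> TB"
proof -
  have "tilting S D T \<longleftrightarrow> (pd_le1 MG S T \<and> (\<forall>i\<ge>1. ext_vanish MG S i T T)) \<and> (\<forall>F. regular S D F \<longrightarrow> nind MG S T = nind MG S F)"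
    using T by (auto simp: tilting_def)
  also have "\<dots> \<longleftrightarrow> (\<forall>i\<in>set qs. \<forall>j\<in>set qs. EC i (sg j)) \<and> card (set qs) = card JG"
    using nind_dsl[OF T pd_le1_\<Phi>[OF T] qs e] nind_regular regular_exists pd_ext_iff[OF T qs e] by auto
  finally show ?thesis using qs by (auto simp: TB_def)
qed

text \<open>A repeated entry can be permuted to the front and is then a double summand. Conversely a
  double indecomposable summand is twice a thin module of the list, which
  \<open>not_distinct_ret\<close> excludes for distinct entries.\<close>

lemma basic_dsl:
  assumes T: "T \<in> MG" "\<Phi> T" and qs: "set qs \<subseteq> UI" and e: "eqv S T (G.dsl (map sg qs))"
  shows "basic MG S T \<longleftrightarrow> distinct qs"
proof
  assume b: "basic MG S T"
  show "distinct qs"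
  proof (rule ccontr)
    assume "\<not> distinct qs"
    then obtain xs ys zs y where q: "qs = xs @ [y] @ ys @ [y] @ zs" using not_distinct_decomp by blast
    let ?r = "xs @ ys @ zs"
    have "mset (map sg qs) = mset (map sg (y # y # ?r))" by (simp add: q)
    then have "eqv S (G.dsl (map sg qs)) (G.dsl (map sg (y # y # ?r)))" by (rule G.dsl_perm)
    then have "eqv S T (dsum (G.th (sg y)) (dsum (G.th (sg y)) (G.dsl (map sg ?r))))" using eqv_trans[OF e] by simp
    moreover have y: "y \<in> UI" and r: "set ?r \<subseteq> UI" using qs q by auto
    ultimately have "iso S T (dsum (G.th (sg y)) (dsum (G.th (sg y)) (G.dsl (map sg ?r))))"
      using G.mods_iso[OF T(1)] G.mods_dsum G.good_mods[OF good_sg[OF y]] dsl_MG[OF r] by blast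
    then show False using b G.indec_th[OF good_sg[OF y]] dsl_MG[OF r] unfolding basic_def by blast
  qed
next
  assume d: "distinct qs"
  show "basic MG S T" unfolding basic_def
  proof
    assume "\<exists>Y Z. indec MG S Y \<and> Z \<in> MG \<and> iso S T (dsum Y (dsum Y Z))"
    then obtain Y Z where Y: "indec MG S Y" and Z: "Z \<in> MG" and i: "iso S T (dsum Y (dsum Y Z))" by blast
    have Ym: "Y \<in> MG" using Y by (simp add: indec_def)
    note w = G.mods_wfm[OF Ym] G.mods_wfm[OF Z]
    have et: "eqv S T (dsum Y (dsum Y Z))" using i G.mods_iso[OF T(1)] G.mods_dsum Ym Z by blast
    have rT: "ret S (dsum Y Y) T"
      by (rule ret_trans[OF ret_dsum_cong[OF w(1,1,1) wfm_dsum[OF w] eqv_ret[OF eqv_refl] ret_dsum1[OF w]] eqv_ret[OF eqv_sym[OF et]]])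
    have "ret S Y T" by (rule ret_trans[OF ret_dsum1[OF w(1) w(1)] rT])
    then obtain k where k: "k \<in> UI" "eqv S Y (G.th (sg k))" using indec_ui[OF Y \<Phi>_ret[OF T(2)]] by blast
    have r: "ret S (G.th (sg k)) Y" by (rule eqv_ret[OF eqv_sym[OF k(2)]])
    have "ret S (dsum (G.th (sg k)) (G.th (sg k))) (dsum Y Y)" by (rule ret_dsum_cong[OF G.th_wfm G.th_wfm w(1) w(1) r r])
    then have "ret S (dsum (G.th (sg k)) (G.th (sg k))) (G.dsl (map sg qs))" using rT eqv_ret[OF e] ret_trans by blast
    moreover have "inj_on sg (set qs)" unfolding inj_on_def using qs sg_inj by blast
    then have "distinct (map sg qs)" using d by (simp add: distinct_map)
    ultimately show False using G.not_distinct_ret[OF good_sg[OF k(1)] gd_map[OF qs]] by blast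
  qed
qed

theorem num_tilting_TB: "num_tilting S D = card TB"
  unfolding num_tilting_def
\<comment> \<open>A set of labels has to be listed to form a direct sum; the choice of the order is
  immaterial by \<open>dsl_perm\<close>.\<close>
proof (rule G.card_classes[where F = "\<lambda>B. G.dsl (map sg (SOME qs. set qs = B \<and> distinct qs))"])
  show "{T. tilting S D T \<and> basic MG S T} \<subseteq> MG" by (auto simp: tilting_def)
  let ?l = "\<lambda>B. SOME qs. set qs = B \<and> distinct qs"
  have l: "set (?l B) = B \<and> distinct (?l B)" if "B \<in> TB" for B
  proof (rule someI_ex)
    have "finite B" using that finite_UI finite_subset by (auto simp: TB_def)
    then show "\<exists>qs. set qs = B \<and> distinct qs" by (rule finite_distinct_list)
  qed
  have lU: "set (?l B) \<subseteq> UI" if "B \<in> TB" for B using l[OF that] that by (simp add: TB_def)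
  show "G.dsl (map sg (?l B)) \<in> {T. tilting S D T \<and> basic MG S T}" if B: "B \<in> TB" for B
  proof -
    note m = dsl_MG[OF lU[OF B]]
    have t: "tilting S D (G.dsl (map sg (?l B)))" using tilting_dsl[OF m lU[OF B] eqv_refl] l[OF B] B by simp
    then have "\<Phi> (G.dsl (map sg (?l B)))" using pd_le1_\<Phi>[OF m] by (simp add: tilting_def)
    then show ?thesis using t basic_dsl[OF m _ lU[OF B] eqv_refl] l[OF B] by simp
  qed
  show "\<exists>B\<in>TB. eqv S T (G.dsl (map sg (?l B)))" if "T \<in> {T. tilting S D T \<and> basic MG S T}" for T
  proof -
    have t: "tilting S D T" and b: "basic MG S T" using that by auto
    have T: "T \<in> MG" "pd_le1 MG S T" using t by (auto simp: tilting_def)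
    note ph = pd_le1_\<Phi>[OF T]
    obtain qs where qs: "set qs \<subseteq> UI" "eqv S T (G.dsl (map sg qs))" using \<Phi>_decompose[OF T(1) ph] by blast
    have B: "set qs \<in> TB" using tilting_dsl[OF T(1) qs] t by simp
    have "distinct qs" using basic_dsl[OF T(1) ph qs] b by simp
    then have "mset qs = mset (?l (set qs))" using l[OF B] set_eq_iff_mset_eq_distinct by metis
    then have "mset (map sg qs) = mset (map sg (?l (set qs)))" by (simp only: mset_map)
    then have "eqv S T (G.dsl (map sg (?l (set qs))))" using G.dsl_perm eqv_trans qs(2) by blast
    then show ?thesis using B by blast
  qed
  show "B = B'" if B: "B \<in> TB" "B' \<in> TB" and e: "eqv S (G.dsl (map sg (?l B))) (G.dsl (map sg (?l B')))" for B B'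
  proof -
    have "i \<in> B \<longleftrightarrow> i \<in> B'" if "i \<in> UI" for i
      using ret_dsl_ui[OF lU[OF B(1)] that eqv_refl] ret_dsl_ui[OF lU[OF B(2)] that e] l[OF B(1)] l[OF B(2)] by simp
    then show ?thesis using B by (auto simp: TB_def)
  qed
qed

end

section \<open>The number of compatible sets\<close>

text \<open>Induction over the blocks: a set is determined by its part in one block and its part
  outside, and these may be chosen independently.\<close>

lemma card_blockwise:
  assumes "finite V" "\<And>v. v \<in> V \<Longrightarrow> finite (U v)" "\<And>v w. v \<in> V \<Longrightarrow> w \<in> V \<Longrightarrow> v \<noteq> w \<Longrightarrow> U v \<inter> U w = {}"
  shows "card {B. B \<subseteq> (\<Union>v\<in>V. U v) \<and> (\<forall>v\<in>V. Q v (B \<inter> U v))} = (\<Prod>v\<in>V. card {C. C \<subseteq> U v \<and> Q v C})"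
  using assms
proof (induction V)
  case empty
  have "{B. B \<subseteq> {} \<and> True} = {{}}" by auto
  then show ?case by simp
next
  case (insert w V)
  let ?X = "{C. C \<subseteq> U w \<and> Q w C}" and ?Y = "{B. B \<subseteq> (\<Union>v\<in>V. U v) \<and> (\<forall>v\<in>V. Q v (B \<inter> U v))}"
  let ?Z = "{B. B \<subseteq> (\<Union>v\<in>insert w V. U v) \<and> (\<forall>v\<in>insert w V. Q v (B \<inter> U v))}"
  have d: "U w \<inter> U v = {}" if "v \<in> V" for v using insert.prems(2)[of w v] insert.hyps(2) that by auto
  have "bij_betw (\<lambda>(C, B). C \<union> B) (?X \<times> ?Y) ?Z"
  proof (rule bij_betw_byWitness[where f' = "\<lambda>B. (B \<inter> U w, B - U w)"])
    have e: "(C \<union> B) \<inter> U w = C" "(C \<union> B) - U w = B" if "C \<subseteq> U w" "B \<subseteq> (\<Union>v\<in>V. U v)" for B C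
      using that d by blast+
    have ev: "(C \<union> B) \<inter> U v = B \<inter> U v" if "C \<subseteq> U w" "v \<in> V" for B C v
      using that d[OF that(2)] by blast
    show "\<forall>a\<in>?X \<times> ?Y. (\<lambda>B. (B \<inter> U w, B - U w)) ((\<lambda>(C, B). C \<union> B) a) = a" using e by auto
    show "\<forall>B\<in>?Z. (\<lambda>(C, B). C \<union> B) ((\<lambda>B. (B \<inter> U w, B - U w)) B) = B" by auto
    show "(\<lambda>(C, B). C \<union> B) ` (?X \<times> ?Y) \<subseteq> ?Z"
    proof clarsimp
      fix C B assume h: "C \<subseteq> U w" "Q w C" "B \<subseteq> (\<Union>v\<in>V. U v)" "\<forall>v\<in>V. Q v (B \<inter> U v)"
      show "C \<subseteq> U w \<union> \<Union> (U ` V) \<and> B \<subseteq> U w \<union> \<Union> (U ` V) \<and> Q w ((C \<union> B) \<inter> U w) \<and> (\<forall>x\<in>V. Q x ((C \<union> B) \<inter> U x))"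
        using h e(1)[OF h(1,3)] ev[OF h(1)] by auto
    qed
    show "(\<lambda>B. (B \<inter> U w, B - U w)) ` ?Z \<subseteq> ?X \<times> ?Y"
    proof clarsimp
      fix B assume h: "B \<subseteq> U w \<union> \<Union> (U ` V)" "Q w (B \<inter> U w)" "\<forall>v\<in>V. Q v (B \<inter> U v)"
      have "(B - U w) \<inter> U v = B \<inter> U v" if "v \<in> V" for v using d[OF that] by blast
      then show "B - U w \<subseteq> \<Union> (U ` V) \<and> (\<forall>v\<in>V. Q v ((B - U w) \<inter> U v))" using h by auto
    qed
  qed
  then have "card ?Z = card ?X * card ?Y" by (simp add: bij_betw_same_card[symmetric] card_cartesian_product)
  then show ?case using insert by simp
qed

text \<open>Counts the cliques of size \<open>k\<close> of the relation \<open>c\<close>, split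
  according to whether they contain the head of the list; as a recursion over lists it can be
  evaluated by rewriting.\<close>

fun cnt :: "('a \<Rightarrow> 'a \<Rightarrow> bool) \<Rightarrow> 'a list \<Rightarrow> nat \<Rightarrow> nat" where
  "cnt c xs 0 = 1"
| "cnt c [] (Suc k) = 0"
| "cnt c (x # xs) (Suc k) = cnt c xs (Suc k) + cnt c (filter (c x) xs) k"

lemma cnt_cliques:
  assumes sym: "\<And>i j. c i j \<Longrightarrow> c j i" and "distinct xs"
  shows "card {C. C \<subseteq> set xs \<and> card C = k \<and> (\<forall>i\<in>C. \<forall>j\<in>C. i \<noteq> j \<longrightarrow> c i j)} = cnt c xs k"
  using assms(2)
proof (induction "length xs" arbitrary: xs k rule: less_induct)
  case less
  define Cl where "Cl C \<longleftrightarrow> (\<forall>i\<in>C. \<forall>j\<in>C. i \<noteq> j \<longrightarrow> c i j)" for C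
  have IH: "card {C. C \<subseteq> set ys \<and> card C = l \<and> Cl C} = cnt c ys l" if "length ys < length xs" "distinct ys" for ys l
    using less.hyps[OF that] by (simp add: Cl_def)
  have "card {C. C \<subseteq> set xs \<and> card C = k \<and> Cl C} = cnt c xs k"
  proof (cases k)
    case 0
    have "{C. C \<subseteq> set xs \<and> card C = 0 \<and> Cl C} = {{}}" using finite_subset[of _ "set xs"] by (auto simp: Cl_def)
    then show ?thesis by (simp add: 0)
  next
    case (Suc l)
    show ?thesis
    proof (cases xs)
      case Nil
      have "{C. C \<subseteq> set xs \<and> card C = k \<and> Cl C} = {}" using Suc Nil by auto
      then show ?thesis by (simp add: Suc Nil)
    next
      case (Cons x ys)
      let ?F = "filter (c x) ys"
      let ?A = "{C. C \<subseteq> set ys \<and> card C = k \<and> Cl C}" and ?B = "{C. C \<subseteq> set ?F \<and> card C = l \<and> Cl C}"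
      have x: "x \<notin> set ys" "distinct ys" using less.prems Cons by auto
      have fin: "finite C" if "C \<subseteq> set zs" for C and zs :: "'a list" using that finite_subset by blast
      have "{C. C \<subseteq> set xs \<and> card C = k \<and> Cl C} = ?A \<union> insert x ` ?B"
      proof (intro equalityI subsetI)
        fix C assume "C \<in> {C. C \<subseteq> set xs \<and> card C = k \<and> Cl C}"
        then have C: "C \<subseteq> set xs" "card C = k" "Cl C" by auto
        show "C \<in> ?A \<union> insert x ` ?B"
        proof (cases "x \<in> C")
          case False then show ?thesis using C Cons by auto
        next
          case True
          have "C - {x} \<subseteq> set ?F" using C True Cons by (auto simp: Cl_def)
          moreover have "card (C - {x}) = l" using True C(2) fin[OF C(1)] Suc by simp
          moreover have "Cl (C - {x})" using C(3) by (auto simp: Cl_def)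
          ultimately have "C - {x} \<in> ?B" by blast
          moreover have "C = insert x (C - {x})" using True by auto
          ultimately show ?thesis by blast
        qed
      next
        fix C assume "C \<in> ?A \<union> insert x ` ?B"
        then show "C \<in> {C. C \<subseteq> set xs \<and> card C = k \<and> Cl C}"
        proof
          assume "C \<in> ?A" then show ?thesis using Cons by auto
        next
          assume "C \<in> insert x ` ?B"
          then obtain E where E: "C = insert x E" "E \<subseteq> set ?F" "card E = l" "Cl E" by auto
          have "x \<notin> E" using E(2) x by auto
          then have "card C = k" using E(1,3) fin[OF E(2)] Suc by simp
          moreover have "Cl C" using E(1,2,4) sym by (auto simp: Cl_def)
          ultimately show ?thesis using E Cons by auto
        qed
      qed
      moreover have "?A \<inter> insert x ` ?B = {}" using x by auto
      moreover have "finite ?A" "finite ?B" by (auto intro: finite_subset[of _ "Pow (set ys)"])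
      ultimately have "card {C. C \<subseteq> set xs \<and> card C = k \<and> Cl C} = card ?A + card (insert x ` ?B)" by (simp add: card_Un_disjoint)
      also have "card (insert x ` ?B) = card ?B"
        by (rule card_image, rule inj_onI) (use x in auto)
      finally show ?thesis using IH[of ys k] IH[of ?F l] x Cons Suc by (simp add: le_imp_less_Suc)
    qed
  qed
  then show ?case by (simp add: Cl_def)
qed

text \<open>A larger clique would contain one with exactly \<open>k + 1\<close> elements.\<close>

lemma clique_bound:
  assumes sym: "\<And>i j. c i j \<Longrightarrow> c j i" and xs: "distinct xs" and z: "cnt c xs (Suc k) = 0"
    and C: "C \<subseteq> set xs" "\<forall>i\<in>C. \<forall>j\<in>C. i \<noteq> j \<longrightarrow> c i j"
  shows "card C \<le> k"
proof (rule ccontr)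
  assume "\<not> card C \<le> k"
  then obtain E where E: "E \<subseteq> C" "card E = Suc k" using obtain_subset_with_card_n[of "Suc k" C] by auto
  let ?X = "{C. C \<subseteq> set xs \<and> card C = Suc k \<and> (\<forall>i\<in>C. \<forall>j\<in>C. i \<noteq> j \<longrightarrow> c i j)}"
  have "E \<in> ?X" using E C by blast
  moreover have "finite ?X" by (rule finite_subset[of _ "Pow (set xs)"]) auto
  ultimately have "card ?X \<noteq> 0" by auto
  then show False using cnt_cliques[OF sym xs, where k = "Suc k"] z by simp
qed

context gamma
begin

section \<open>The three kinds of blocks\<close>

definition Ub where "Ub v = {i\<in>UI. blk i = v}"
text \<open>The number of indecomposable projective modules in the block; these numbers add up to
  the size required of a tilting set.\<close>

definition cap where "cap v = card {x\<in>JG. blk (UP x) = v}"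
definition cc where "cc i j \<longleftrightarrow> EC2 i j \<and> EC2 j i"
definition compat where "compat C \<longleftrightarrow> (\<forall>i\<in>C. \<forall>j\<in>C. EC2 i j)"
definition bn :: "nat \<Rightarrow> nat" where "bn v = (if pr v = {} then 1 else if fk v then 14 else 2)"

text \<open>\<open>cnt\<close> only looks at pairs of different elements, so compatibility of each
  element with itself is a separate hypothesis. The value 0 for the next size bounds all compatible
  sets.\<close>

lemma block_count:
  assumes xs: "set xs = Ub v" "distinct xs" and r: "\<And>x. x \<in> set xs \<Longrightarrow> EC2 x x"
    and k: "cap v = k" and c: "cnt cc xs k = n" "cnt cc xs (Suc k) = 0"
  shows "(\<forall>C\<subseteq>Ub v. compat C \<longrightarrow> card C \<le> cap v) \<and> card {C. C \<subseteq> Ub v \<and> card C = cap v \<and> compat C} = n"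
proof -
  have sym: "cc i j \<Longrightarrow> cc j i" for i j by (simp add: cc_def)
  have co: "compat C \<longleftrightarrow> (\<forall>i\<in>C. \<forall>j\<in>C. i \<noteq> j \<longrightarrow> cc i j)" if "C \<subseteq> set xs" for C

  proof (intro iffI ballI impI)
    show "cc i j" if "compat C" "i \<in> C" "j \<in> C" for i j using that by (simp add: compat_def cc_def)
    assume h: "\<forall>i\<in>C. \<forall>j\<in>C. i \<noteq> j \<longrightarrow> cc i j"
    show "compat C" unfolding compat_def
    proof (intro ballI)
      fix i j assume ij: "i \<in> C" "j \<in> C"
      then show "EC2 i j" using r[of i] that h by (cases "i = j") (auto simp: cc_def)
    qed
  qed
  have "{C. C \<subseteq> Ub v \<and> card C = cap v \<and> compat C} = {C. C \<subseteq> set xs \<and> card C = k \<and> (\<forall>i\<in>C. \<forall>j\<in>C. i \<noteq> j \<longrightarrow> cc i j)}"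
    by (intro Collect_cong) (simp add: xs(1)[symmetric] k co cong: conj_cong)
  then have "card {C. C \<subseteq> Ub v \<and> card C = cap v \<and> compat C} = n" using cnt_cliques[OF sym xs(2), where k = k] c(1) by simp
  moreover have "card C \<le> cap v" if "C \<subseteq> Ub v" "compat C" for C
    unfolding k by (rule clique_bound[OF sym xs(2) c(2)]) (use that co xs(1) in auto)
  ultimately show ?thesis by blast
qed

lemma block:
  assumes v: "v \<in> V"
  shows "(\<forall>C\<subseteq>Ub v. compat C \<longrightarrow> card C \<le> cap v) \<and> card {C. C \<subseteq> Ub v \<and> card C = cap v \<and> compat C} = bn v"
proof -
  have UbI: "Ub v = set xs" if "\<And>x. x \<in> JG \<and> blk (UP x) = v \<longleftrightarrow> UP x \<in> set xs" "\<And>a b. (a,b) \<in> Ar \<and> b = v \<longleftrightarrow> UCs a b \<in> set xs"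
    "\<And>a b. (a,b) \<in> Ar \<and> fk b \<and> b = v \<longleftrightarrow> UCd a b \<in> set xs" "\<And>b. fk b \<and> b = v \<longleftrightarrow> UKa b \<in> set xs" "\<And>b. fk b \<and> b = v \<longleftrightarrow> URd b \<in> set xs" for xs
  proof -
    have "i \<in> Ub v \<longleftrightarrow> i \<in> set xs" for i
    proof (cases i)
      case (UP x) then show ?thesis using that(1)[of x] by (simp add: Ub_def)
    next
      case (UCs a b) then show ?thesis using that(2)[of a b] by (simp add: Ub_def)
    next
      case (UCd a b) then show ?thesis using that(3)[of a b] by (simp add: Ub_def)
    next
      case (UKa b) then show ?thesis using that(4)[of b] by (simp add: Ub_def)
    next
      case (URd b) then show ?thesis using that(5)[of b] by (simp add: Ub_def)
    qed
    then show ?thesis by blast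
  qed
  consider (a) "pr v = {}" | (b) u where "pr v = {u}" | (c) "fk v"
  proof (cases "pr v = {}")
    case False
    then obtain u where u: "u \<in> pr v" by blast
    show ?thesis
    proof (cases "pr v = {u}")
      case False
      then obtain u' where "u' \<in> pr v" "u' \<noteq> u" using u by blast
      then have "fk v" using u by (auto simp: fk_def pr_def)
      then show ?thesis by (rule that(3))
    qed (rule that(2))
  qed (rule that(1))
  then show ?thesis
  proof cases
    case a
    then have no: "(i,v) \<notin> Ar" for i by (auto simp: pr_def)
    then have nf: "\<not> fk v" by (auto simp: fk_def)
    have J: "x \<in> JG \<and> blk (UP x) = v \<longleftrightarrow> x = Sv v" for x using v no nf by (cases x) auto
    have cp: "cap v = 1" by (simp add: cap_def J)
    show ?thesis
    proof (rule block_count[where xs = "[UP (Sv v)]", OF _ _ _ cp])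
      show "set [UP (Sv v)] = Ub v" by (rule UbI[symmetric]) (use J no nf in auto)
    qed (use a in \<open>auto simp: bn_def\<close>)
  next
    case b
    then have ar: "(i,v) \<in> Ar \<longleftrightarrow> i = u" for i by (auto simp: pr_def)
    then have nf: "\<not> fk v" by (auto simp: fk_def)
    have J: "x \<in> JG \<and> blk (UP x) = v \<longleftrightarrow> x = Sv v \<or> x = Pa u v" for x using v ar nf by (cases x) auto
    have "{x \<in> JG. blk (UP x) = v} = {Sv v, Pa u v}" using J by blast
    then have cp: "cap v = 2" by (simp add: cap_def)
    \<comment> \<open>\<open>UP (Pa u v)\<close> is compatible with both other modules, and these
      two exclude each other, which leaves two compatible pairs.\<close>
    show ?thesis
    proof (rule block_count[where xs = "[UP (Pa u v), UP (Sv v), UCs u v]", OF _ _ _ cp])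
      show "set [UP (Pa u v), UP (Sv v), UCs u v] = Ub v"
        by (rule UbI[symmetric]) (use J ar nf in auto)
      show "cnt cc [UP (Pa u v), UP (Sv v), UCs u v] 2 = bn v" using b nf by (simp add: bn_def cc_def numeral_eq_Suc)
    qed (use b in \<open>auto simp: cc_def numeral_eq_Suc\<close>)
  next
    case c
    obtain u u' where u: "u \<noteq> u'" and ar: "\<forall>i. (i,v) \<in> Ar \<longleftrightarrow> i = u \<or> i = u'" using fkE[OF c] by metis
    have p: "pr v = {u,u'}" using ar by (auto simp: pr_def)
    have J: "x \<in> JG \<and> blk (UP x) = v \<longleftrightarrow> x = Sv v \<or> x = Pa u v \<or> x = Pa u' v \<or> x = Dv v" for x using v ar c by (cases x) auto
    have "{x \<in> JG. blk (UP x) = v} = {Sv v, Pa u v, Pa u' v, Dv v}" using J by blast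
    then have cp: "cap v = 4" using u by (simp add: cap_def)
    \<comment> \<open>The head of the list is compatible with every other entry. Among the nine
      others, \<open>UP (Sv v)\<close>, \<open>UKa v\<close> and \<open>URd v\<close> are pairwise
      incompatible, like the long diagonals of a hexagon; the remaining six correspond to its short
      diagonals, and incompatibility to crossing.\<close>
    let ?xs = "[UP (Dv v), UP (Sv v), UP (Pa u v), UP (Pa u' v), UCs u v, UCs u' v, UCd u v, UCd u' v, UKa v, URd v]"
    note s = u u[symmetric] p cc_def numeral_eq_Suc
    show ?thesis
    proof (rule block_count[where xs = ?xs, OF _ _ _ cp])
      show "set ?xs = Ub v"
        by (rule UbI[symmetric]) (use J ar c in auto)
      show "cnt cc ?xs 4 = bn v" using c by (simp add: bn_def s)
      show "cnt cc ?xs (Suc 4) = 0" by (simp add: s)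
      show "distinct ?xs" using u by auto
      show "EC2 x x" if "x \<in> set ?xs" for x using that p u by auto
    qed
  qed
qed

lemma blk_V: "i \<in> UI \<Longrightarrow> blk i \<in> V"
proof (cases i)
  case (UP x) then show "i \<in> UI \<Longrightarrow> ?thesis" using Ar_V fk_V by (cases x) auto
qed (use Ar_V fk_V in auto)

lemma card_TB: "card TB = (\<Prod>v\<in>V. bn v)"
proof -
  have "UP ` JG \<subseteq> UI" by auto
  then have "finite (UP ` JG)" using finite_UI finite_subset by blast
  then have fJ: "finite JG" by (rule finite_imageD) (simp add: inj_on_def)
  have fU: "finite (Ub v)" for v using finite_UI by (simp add: Ub_def)
  have dj: "Ub v \<inter> Ub w = {}" if "v \<noteq> w" for v w using that by (auto simp: Ub_def)
  have UU: "(\<Union>v\<in>V. Ub v) = UI" using blk_V by (auto simp: Ub_def)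
  have cJ: "card JG = (\<Sum>v\<in>V. cap v)"
  proof -
    have "(\<lambda>x. blk (UP x)) ` JG \<subseteq> V" using blk_V by auto
    from sum.group[OF fJ finite_V this, of "\<lambda>_. 1::nat"] show ?thesis by (simp add: cap_def)
  qed
  have cB: "card B = (\<Sum>v\<in>V. card (B \<inter> Ub v))" if "B \<subseteq> UI" for B
  proof -
    have fB: "finite B" using that finite_UI finite_subset by blast
    have "blk ` B \<subseteq> V" using blk_V that by auto
    moreover have "{x\<in>B. blk x = v} = B \<inter> Ub v" for v using that by (auto simp: Ub_def)
    ultimately show ?thesis using sum.group[OF fB finite_V, of blk "\<lambda>_. 1::nat"] by simp
  qed
  have "TB = {B. B \<subseteq> (\<Union>v\<in>V. Ub v) \<and> (\<forall>v\<in>V. card (B \<inter> Ub v) = cap v \<and> compat (B \<inter> Ub v))}"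
  proof (intro equalityI subsetI)
    fix B assume "B \<in> TB"
    then have B: "B \<subseteq> UI" "card B = card JG" and e: "\<forall>i\<in>B. \<forall>j\<in>B. EC i (sg j)" by (auto simp: TB_def)
    have co: "compat (B \<inter> Ub v)" for v
      unfolding compat_def
    proof (intro ballI)
      fix i j assume "i \<in> B \<inter> Ub v" "j \<in> B \<inter> Ub v"
      then show "EC2 i j" using e EC_sg[of i j] by (simp add: Ub_def)
    qed
    have "card (B \<inter> Ub v) \<le> cap v" if "v \<in> V" for v using block[OF that] co by blast
    moreover have "(\<Sum>v\<in>V. card (B \<inter> Ub v)) = (\<Sum>v\<in>V. cap v)" using cB[OF B(1)] B(2) cJ by simp
    \<comment> \<open>No block exceeds its bound while the totals agree, so every block attains its
      bound.\<close>
    ultimately have "card (B \<inter> Ub v) = cap v" if "v \<in> V" for v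
      using sum_mono_inv[OF _ _ that finite_V] by blast
    then show "B \<in> {B. B \<subseteq> (\<Union>v\<in>V. Ub v) \<and> (\<forall>v\<in>V. card (B \<inter> Ub v) = cap v \<and> compat (B \<inter> Ub v))}" using co B UU by auto
  next
    fix B assume "B \<in> {B. B \<subseteq> (\<Union>v\<in>V. Ub v) \<and> (\<forall>v\<in>V. card (B \<inter> Ub v) = cap v \<and> compat (B \<inter> Ub v))}"
    then have B: "B \<subseteq> UI" and h: "\<forall>v\<in>V. card (B \<inter> Ub v) = cap v \<and> compat (B \<inter> Ub v)" using UU by auto
    have "EC i (sg j)" if "i \<in> B" "j \<in> B" for i j
    proof -
      have ij: "i \<in> UI" "j \<in> UI" using that B by auto
      have "EC2 i j" if "blk i = blk j"
      proof -
        have "i \<in> B \<inter> Ub (blk i)" "j \<in> B \<inter> Ub (blk i)" using \<open>i \<in> B\<close> \<open>j \<in> B\<close> ij that by (auto simp: Ub_def)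
        then show ?thesis using h blk_V[OF ij(1)] unfolding compat_def by blast
      qed
      then show ?thesis using EC_sg[OF ij] by blast
    qed
    moreover have "card B = card JG" using cB[OF B] cJ h by simp
    ultimately show "B \<in> TB" using B by (auto simp: TB_def)
  qed
  then have "card TB = (\<Prod>v\<in>V. card {C. C \<subseteq> Ub v \<and> (card C = cap v \<and> compat C)})"
    using card_blockwise[OF finite_V fU dj, where Q = "\<lambda>v C. card C = cap v \<and> compat C"] by simp
  then show ?thesis using block by simp
qed

end

section \<open>The main theorem\<close>

lemma num_tilting_quiver:
  fixes M :: "(nat + nat \<times> nat, 'k::field) md"
  assumes "quiver m Ar" and "add_gen m Ar M"
  shows "num_tilting (End_alg m Ar M) (fst M) =
    (\<Prod>v\<in>{1..m}. if \<forall>u. (u,v) \<notin> Ar then 1 else if \<exists>u u'. u \<noteq> u' \<and> (u,v) \<in> Ar \<and> (u',v) \<in> Ar then 14 else 2)"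
proof -
  interpret Q: quiver m Ar "TYPE('k)" by fact
  obtain js \<iota> \<pi> where "gamma m Ar M js \<iota> \<pi>" using Q.gamma_exists[OF assms(2)] by blast
  then interpret gamma m Ar "TYPE('k)" M js \<iota> \<pi> .
  show ?thesis using num_tilting_TB card_TB unfolding S_def D_def bn_def pr_def Q.fk_def Q.V_def by simp
qed

theorem theorem1p1:
  assumes "alg_closed TYPE('k::field)"
  shows "(\<forall>m \<ge> 1. \<forall>M :: (nat + nat \<times> nat, 'k) md. add_gen m (quiver_A m) M \<longrightarrow>
             num_tilting (End_alg m (quiver_A m) M) (fst M) = 2 ^ (m - 1)) \<and>
         (\<forall>m \<ge> 4. \<forall>M :: (nat + nat \<times> nat, 'k) md. add_gen m (quiver_D m) M \<longrightarrow>
             num_tilting (End_alg m (quiver_D m) M) (fst M) = 2 ^ (m - 3) * 14) \<and>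
         (\<forall>m \<in> {6, 7, 8}. \<forall>M :: (nat + nat \<times> nat, 'k) md. add_gen m (quiver_E m) M \<longrightarrow>
             num_tilting (End_alg m (quiver_E m) M) (fst M) = 2 ^ (m - 3) * 14)"
proof (intro conjI allI impI ballI)
  fix m :: nat and M :: "(nat + nat \<times> nat, 'k) md"
  let ?n = "\<lambda>Ar v. if \<forall>u. (u::nat,v::nat) \<notin> Ar then 1 else if \<exists>u u'. u \<noteq> u' \<and> (u,v) \<in> Ar \<and> (u',v) \<in> Ar then 14 else 2 :: nat"
  { assume m: "m \<ge> 1" and g: "add_gen m (quiver_A m) M"
    have q: "quiver m (quiver_A m)" by unfold_locales (auto simp: quiver_A_def)
    have a: "(u,v) \<in> quiver_A m \<longleftrightarrow> v = Suc u \<and> 1 \<le> u \<and> v \<le> m" for u v by (auto simp: quiver_A_def)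
    define n where "n = ?n (quiver_A m)"
    have nn: "num_tilting (End_alg m (quiver_A m) M) (fst M) = prod n {1..m}"
      unfolding n_def by (rule num_tilting_quiver[OF q g])
    \<comment> \<open>Vertex 1 is the only source; each of the other \<open>m - 1\<close> vertices
      has exactly one incoming arrow.\<close>
    have n1: "n 1 = 1" by (auto simp: n_def a)
    have n2: "n v = 2" if v: "v \<in> {2..m}" for v
    proof -
      have "(v - 1, v) \<in> quiver_A m" using v by (auto simp: a)
      then show ?thesis by (auto simp: n_def a)
    qed
    have "prod n {1..m} = prod n (insert 1 {2..m})"
      by (rule prod.cong) (use m in auto)
    also have "\<dots> = (\<Prod>v\<in>{2..m}. 2)" using n1 n2 by simp
    finally show "num_tilting (End_alg m (quiver_A m) M) (fst M) = 2 ^ (m - 1)"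
      unfolding nn by simp }
  { assume m: "m \<ge> 4" and g: "add_gen m (quiver_D m) M"
    have q: "quiver m (quiver_D m)" by unfold_locales (use m in \<open>auto simp: quiver_D_def\<close>)
    have a: "(u,v) \<in> quiver_D m \<longleftrightarrow> v = 3 \<and> (u = 1 \<or> u = 2) \<or> v = Suc u \<and> 3 \<le> u \<and> v \<le> m" for u v using m by (auto simp: quiver_D_def)
    define n where "n = ?n (quiver_D m)"
    have nn: "num_tilting (End_alg m (quiver_D m) M) (fst M) = prod n {1..m}"
      unfolding n_def by (rule num_tilting_quiver[OF q g])
    have n1: "n 1 = 1" "n 2 = 1" by (auto simp: n_def a)
    have "(1,3) \<in> quiver_D m" "(2,3) \<in> quiver_D m" "(1::nat) \<noteq> 2" by (auto simp: a)
    then have n3: "n 3 = 14" unfolding n_def by meson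
    have n4: "n v = 2" if v: "v \<in> {4..m}" for v
    proof -
      have "(v - 1, v) \<in> quiver_D m" using v by (auto simp: a)
      then show ?thesis using v by (auto simp: n_def a)
    qed
    have "prod n {1..m} = prod n (insert 1 (insert 2 (insert 3 {4..m})))"
      by (rule prod.cong) (use m in auto)
    \<comment> \<open>14 belongs to vertex 3, where the two branches meet; the vertices from 4 to
      \<open>m\<close> give \<open>m - 3\<close> factors 2.\<close>
    also have "\<dots> = 14 * (\<Prod>v\<in>{4..m}. 2)" using n1 n3 n4 by simp
    finally show "num_tilting (End_alg m (quiver_D m) M) (fst M) = 2 ^ (m - 3) * 14"
      unfolding nn by simp }
  { assume m: "m \<in> {6,7,8}" and g: "add_gen m (quiver_E m) M"
    have q: "quiver m (quiver_E m)" by unfold_locales (use m in \<open>auto simp: quiver_E_def\<close>)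
    have a: "(u,v) \<in> quiver_E m \<longleftrightarrow> u = 1 \<and> v = 2 \<or> v = 4 \<and> (u = 2 \<or> u = 3) \<or> v = Suc u \<and> 4 \<le> u \<and> v \<le> m" for u v using m by (auto simp: quiver_E_def)
    define n where "n = ?n (quiver_E m)"
    have nn: "num_tilting (End_alg m (quiver_E m) M) (fst M) = prod n {1..m}"
      unfolding n_def by (rule num_tilting_quiver[OF q g])
    have n1: "n 1 = 1" "n 3 = 1" by (auto simp: n_def a)
    have n2: "n 2 = 2" by (auto simp: n_def a)
    have "(2,4) \<in> quiver_E m" "(3,4) \<in> quiver_E m" "(2::nat) \<noteq> 3" by (auto simp: a)
    then have n4: "n 4 = 14" unfolding n_def by meson
    have n5: "n v = 2" if v: "v \<in> {5..m}" for v
    proof -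
      have "(v - 1, v) \<in> quiver_E m" using v by (auto simp: a)
      then show ?thesis using v by (auto simp: n_def a)
    qed
    have "prod n {1..m} = prod n (insert 1 (insert 2 (insert 3 (insert 4 {5..m}))))"
      by (rule prod.cong) (use m in auto)
    \<comment> \<open>28 is 2 for vertex 2 times 14 for vertex 4. The vertices from 5 to
      \<open>m\<close> give \<open>m - 4\<close> factors, and the factor at vertex 2 raises the
      exponent to \<open>m - 3\<close>.\<close>
    also have "\<dots> = 28 * (\<Prod>v\<in>{5..m}. 2)" using n1 n2 n4 n5 by simp
    finally have "prod n {1..m} = 28 * 2 ^ (Suc m - 5)" by simp
    then show "num_tilting (End_alg m (quiver_E m) M) (fst M) = 2 ^ (m - 3) * 14"
      unfolding nn using m by auto }
qed

end
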